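(* Let $k$ be an algebraically closed field and let $A$ be a dg $k$-algebra such that: 1) in each degree its homology is of finite dimension; 2) its homology vanishes for large degrees (i.e. $H^pA=0$ for $p\gg 0$); 3) $A$ is homologically smooth. Then taking representatives of the isoclasses of the simple objects of the heart yields a bijection between: (i) bounded $t$-structures on $\mathcal{D}_{fd}A$ whose heart is a length category with a finite number of isoclasses of simple objects; (ii) equivalence classes of families of simple-minded objects of $\mathcal{D}_{fd}A$.
   Context: $\mathcal{D}A$ is the unbounded derived category of dg $A$-modules with shift $\Sigma$; $\mathcal{D}_{fd}A$ is the full subcategory of $\mathcal{D}A$ formed by the dg modules $M$ with $\sum_{p\in\mathbb{Z}}\dim_k H^p(M)<\infty$. $A$ is homologically smooth if $A$ is a compact object of the unbounded derived category of dg $A$-$A$-bimodules. A family of simple-minded objects is a finite family $S_1,\dots,S_r$ of objects of $\mathcal{D}_{fd}A$ such that: a) $\mathrm{Hom}_{\mathcal{D}A}(S_i,S_j)=0$ if $i\neq j$ and $\mathrm{Hom}_{\mathcal{D}A}(S_i,S_i)=k\cdot\mathbf{1}_{S_i}$ (one-dimensional); b) $\mathrm{Hom}_{\mathcal{D}A}(S_i,\Sigma^tS_j)=0$ for each $t<0$ and all $i,j$; c) $\mathcal{D}_{fd}A$ is the smallest full triangulated subcategory of $\mathcal{D}A$ containing $S_1,\dots,S_r$. Two families of simple-minded objects of $\mathcal{D}_{fd}A$ are equivalent if they have the same closure under extensions. A $t$-structure on a triangulated category $\mathcal{D}$ is a pair $(\mathcal{D}^{\leq 0},\mathcal{D}^{\geq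 0})$ of strictly full additive subcategories such that $\mathcal{D}^{\leq 0}$ is closed under $\Sigma$ and $\mathcal{D}^{\geq 0}$ under $\Sigma^{-1}$; $\mathrm{Hom}(M,\Sigma^{-1}N)=0$ for $M\in\mathcal{D}^{\leq 0}$, $N\in\mathcal{D}^{\geq 0}$; and each $M$ fits into a triangle $M^{\leq 0}\to M\to M^{\geq 1}\to\Sigma M^{\leq 0}$ with $M^{\leq 0}\in\mathcal{D}^{\leq 0}$ and $\Sigma(M^{\geq 1})\in\mathcal{D}^{\geq 0}$. Its heart is $\mathcal{D}^{\leq 0}\cap\mathcal{D}^{\geq 0}$. It is bounded if $\bigcup_{n}\Sigma^n\mathcal{D}^{\leq 0}=\mathcal{D}=\bigcup_{n}\Sigma^n\mathcal{D}^{\geq 0}$. A length category is an abelian category where each object has finite length. *)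

theory Defs
  imports "HOL-Algebra.Algebraic_Closure"
begin

no_notation var (\<open>X\<index>\<close>)

section \<open>Linear algebra over a field \<open>K\<close>\<close>

definition klinear ::
  "'k ring \<Rightarrow> ('k, 'a) module \<Rightarrow> ('k, 'b) module \<Rightarrow> ('a \<Rightarrow> 'b) \<Rightarrow> bool" where
  "klinear K V W f \<longleftrightarrow>
     f \<in> carrier V \<rightarrow> carrier W \<and>
     (\<forall>x\<in>carrier V. \<forall>y\<in>carrier V. f (x \<oplus>\<^bsub>V\<^esub> y) = f x \<oplus>\<^bsub>W\<^esub> f y) \<and>
     (\<forall>c\<in>carrier K. \<forall>x\<in>carrier V. f (c \<odot>\<^bsub>V\<^esub> x) = c \<odot>\<^bsub>W\<^esub> f x)"

definition kbilinear ::
  "'k ring \<Rightarrow> ('k, 'a) module \<Rightarrow> ('k, 'b) module \<Rightarrow> ('k, 'c) module \<Rightarrow> ('a \<Rightarrow> 'b \<Rightarrow> 'c) \<Rightarrow> bool" where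
  "kbilinear K U V W b \<longleftrightarrow>
     (\<forall>x\<in>carrier U. klinear K V W (b x)) \<and>
     (\<forall>y\<in>carrier V. klinear K U W (\<lambda>x. b x y))"

definition finite_dim :: "'k ring \<Rightarrow> ('k, 'a) module \<Rightarrow> bool" where
  "finite_dim K V \<longleftrightarrow>
     (\<exists>B. finite B \<and> B \<subseteq> carrier V \<and>
        (\<forall>v\<in>carrier V. \<exists>c\<in>B \<rightarrow> carrier K. v = finsum V (\<lambda>b. c b \<odot>\<^bsub>V\<^esub> b) B))"

definition zero_space :: "('k, 'a) module \<Rightarrow> bool" where
  "zero_space V \<longleftrightarrow> carrier V = {\<zero>\<^bsub>V\<^esub>}"

definition sign_pow :: "('k, 'a) module \<Rightarrow> int \<Rightarrow> 'a \<Rightarrow> 'a" where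
  "sign_pow V n x = (if even n then x else \<ominus>\<^bsub>V\<^esub> x)"


section \<open>Complexes and their homology\<close>

text \<open>
  The homogeneous components of a complex are separate vector spaces, whose carriers are subsets of
  a type \<open>'u\<close>. Only values on carriers matter. All complexes, dg algebras and dg modules in one
  statement share the type \<open>'u\<close>, which plays the role of the universe of sets: a dg
  algebra over \<open>'u\<close> has a derived category made of the dg modules over \<open>'u\<close>, and \<open>'u\<close> may be
  instantiated by arbitrarily large types.
\<close>

record ('k, 'u) cochain =
  gr :: "int \<Rightarrow> ('k, 'u) module"
  diff :: "int \<Rightarrow> 'u \<Rightarrow> 'u"

definition cochain_complex :: "'k ring \<Rightarrow> ('k, 'u, 'z) cochain_scheme \<Rightarrow> bool" where
  "cochain_complex K X \<longleftrightarrow>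
     (\<forall>p. module K (gr X p)) \<and>
     (\<forall>p. klinear K (gr X p) (gr X (p + 1)) (diff X p)) \<and>
     (\<forall>p. \<forall>x\<in>carrier (gr X p). diff X (p + 1) (diff X p x) = \<zero>\<^bsub>gr X (p + 2)\<^esub>)"

definition cocycles :: "('k, 'u, 'z) cochain_scheme \<Rightarrow> int \<Rightarrow> 'u set" where
  "cocycles X p = {x \<in> carrier (gr X p). diff X p x = \<zero>\<^bsub>gr X (p + 1)\<^esub>}"

definition coboundaries :: "('k, 'u, 'z) cochain_scheme \<Rightarrow> int \<Rightarrow> 'u set" where
  "coboundaries X p = diff X (p - 1) ` carrier (gr X (p - 1))"

text \<open>
  The quotient of cocycles by coboundaries, as a space of cosets. In the scalar multiplication the
  coboundaries are added in order to be correct for the scalar zero as well. The multiplicative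
  fields of the record carry no information.
\<close>
definition homology :: "('k, 'u, 'z) cochain_scheme \<Rightarrow> int \<Rightarrow> ('k, 'u set) module" where
  "homology X p =
     \<lparr>carrier = (\<lambda>z. coboundaries X p +>\<^bsub>gr X p\<^esub> z) ` cocycles X p,
      monoid.mult = undefined, one = undefined,
      zero = coboundaries X p,
      add = (\<lambda>S T. S <+>\<^bsub>gr X p\<^esub> T),
      smult = (\<lambda>c S. coboundaries X p <+>\<^bsub>gr X p\<^esub> ((\<lambda>z. c \<odot>\<^bsub>gr X p\<^esub> z) ` S))\<rparr>"

definition homology_map ::
  "('k, 'u, 'z) cochain_scheme \<Rightarrow> int \<Rightarrow> (int \<Rightarrow> 'u \<Rightarrow> 'u) \<Rightarrow> 'u set \<Rightarrow> 'u set" where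
  "homology_map Y p f S = coboundaries Y p <+>\<^bsub>gr Y p\<^esub> (f p ` S)"


section \<open>Dg algebras, dg modules, dg bimodules\<close>

record ('k, 'u) dg_alg = "('k, 'u) cochain" +
  gmult :: "int \<Rightarrow> int \<Rightarrow> 'u \<Rightarrow> 'u \<Rightarrow> 'u"
  gone :: 'u

text \<open>\<open>gmult A p q\<close> is the component of the multiplication on degrees \<open>p\<close> and \<open>q\<close>.\<close>
definition dg_algebra :: "'k ring \<Rightarrow> ('k, 'u) dg_alg \<Rightarrow> bool" where
  "dg_algebra K A \<longleftrightarrow>
     cochain_complex K A \<and>
     (\<forall>p q. kbilinear K (gr A p) (gr A q) (gr A (p + q)) (gmult A p q)) \<and>
     (\<forall>p q r. \<forall>a\<in>carrier (gr A p). \<forall>b\<in>carrier (gr A q). \<forall>c\<in>carrier (gr A r).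
        gmult A (p + q) r (gmult A p q a b) c = gmult A p (q + r) a (gmult A q r b c)) \<and>
     gone A \<in> carrier (gr A 0) \<and>
     (\<forall>p. \<forall>a\<in>carrier (gr A p). gmult A 0 p (gone A) a = a \<and> gmult A p 0 a (gone A) = a) \<and>
     (\<forall>p q. \<forall>a\<in>carrier (gr A p). \<forall>b\<in>carrier (gr A q).
        diff A (p + q) (gmult A p q a b) =
          gmult A (p + 1) q (diff A p a) b
            \<oplus>\<^bsub>gr A (p + q + 1)\<^esub> sign_pow (gr A (p + q + 1)) p (gmult A p (q + 1) a (diff A q b)))"

record ('k, 'u) dg_mod = "('k, 'u) cochain" +
  ract :: "int \<Rightarrow> int \<Rightarrow> 'u \<Rightarrow> 'u \<Rightarrow> 'u"

text \<open>Dg modules are right dg modules; \<open>ract M p q\<close> maps \<open>M\<^sup>p \<times> A\<^sup>q\<close> to \<open>M\<^sup>p\<^sup>+\<^sup>q\<close>.\<close>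
definition dg_module ::
  "'k ring \<Rightarrow> ('k, 'u) dg_alg \<Rightarrow> ('k, 'u, 'z) dg_mod_scheme \<Rightarrow> bool" where
  "dg_module K A M \<longleftrightarrow>
     cochain_complex K M \<and>
     (\<forall>p q. kbilinear K (gr M p) (gr A q) (gr M (p + q)) (ract M p q)) \<and>
     (\<forall>p q r. \<forall>m\<in>carrier (gr M p). \<forall>a\<in>carrier (gr A q). \<forall>b\<in>carrier (gr A r).
        ract M (p + q) r (ract M p q m a) b = ract M p (q + r) m (gmult A q r a b)) \<and>
     (\<forall>p. \<forall>m\<in>carrier (gr M p). ract M p 0 m (gone A) = m) \<and>
     (\<forall>p q. \<forall>m\<in>carrier (gr M p). \<forall>a\<in>carrier (gr A q).
        diff M (p + q) (ract M p q m a) =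
          ract M (p + 1) q (diff M p m) a
            \<oplus>\<^bsub>gr M (p + q + 1)\<^esub> sign_pow (gr M (p + q + 1)) p (ract M p (q + 1) m (diff A q a)))"

record ('k, 'u) dg_bimod = "('k, 'u) dg_mod" +
  lact :: "int \<Rightarrow> int \<Rightarrow> 'u \<Rightarrow> 'u \<Rightarrow> 'u"

text \<open>
  Dg \<open>A\<close>-\<open>A\<close>-bimodules. Since both actions are \<open>K\<close>-bilinear for the same vector space
  structure, \<open>K\<close> acts centrally; these are the dg modules over the enveloping algebra of \<open>A\<close>.
\<close>
definition dg_bimodule :: "'k ring \<Rightarrow> ('k, 'u) dg_alg \<Rightarrow> ('k, 'u) dg_bimod \<Rightarrow> bool" where
  "dg_bimodule K A M \<longleftrightarrow>
     dg_module K A M \<and>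
     (\<forall>p q. kbilinear K (gr A p) (gr M q) (gr M (p + q)) (lact M p q)) \<and>
     (\<forall>p q r. \<forall>a\<in>carrier (gr A p). \<forall>b\<in>carrier (gr A q). \<forall>m\<in>carrier (gr M r).
        lact M (p + q) r (gmult A p q a b) m = lact M p (q + r) a (lact M q r b m)) \<and>
     (\<forall>p. \<forall>m\<in>carrier (gr M p). lact M 0 p (gone A) m = m) \<and>
     (\<forall>p q r. \<forall>a\<in>carrier (gr A p). \<forall>m\<in>carrier (gr M q). \<forall>b\<in>carrier (gr A r).
        ract M (p + q) r (lact M p q a m) b = lact M p (q + r) a (ract M q r m b)) \<and>
     (\<forall>p q. \<forall>a\<in>carrier (gr A p). \<forall>m\<in>carrier (gr M q).
        diff M (p + q) (lact M p q a m) =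
          lact M (p + 1) q (diff A p a) m
            \<oplus>\<^bsub>gr M (p + q + 1)\<^esub> sign_pow (gr M (p + q + 1)) p (lact M p (q + 1) a (diff M q m)))"

definition diagonal_bimodule :: "('k, 'u) dg_alg \<Rightarrow> ('k, 'u) dg_bimod" where
  "diagonal_bimodule A = \<lparr>gr = gr A, diff = diff A, ract = gmult A, lact = gmult A\<rparr>"


section \<open>The dg categories of dg modules and of dg bimodules\<close>

text \<open>
  \<open>dg_hom G X Y n\<close> is the degree \<open>n\<close> part of the morphism complex from \<open>X\<close> to \<open>Y\<close>.
  A homogeneous map \<open>f\<close> of degree \<open>n\<close> has components \<open>f p : X\<^sup>p \<rightarrow> Y\<^sup>p\<^sup>+\<^sup>n\<close>.
\<close>
record ('o, 'u) dg_category =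
  dg_obj :: "'o set"
  dg_hom :: "'o \<Rightarrow> 'o \<Rightarrow> int \<Rightarrow> (int \<Rightarrow> 'u \<Rightarrow> 'u) set"

definition module_maps ::
  "'k ring \<Rightarrow> ('k, 'u) dg_alg \<Rightarrow> ('k, 'u, 'z) dg_mod_scheme \<Rightarrow> ('k, 'u, 'z) dg_mod_scheme \<Rightarrow> int
     \<Rightarrow> (int \<Rightarrow> 'u \<Rightarrow> 'u) set" where
  "module_maps K A M N n =
     {f. (\<forall>p. klinear K (gr M p) (gr N (p + n)) (f p)) \<and>
         (\<forall>p q. \<forall>m\<in>carrier (gr M p). \<forall>a\<in>carrier (gr A q).
            f (p + q) (ract M p q m a) = ract N (p + n) q (f p m) a)}"

definition bimodule_maps ::
  "'k ring \<Rightarrow> ('k, 'u) dg_alg \<Rightarrow> ('k, 'u) dg_bimod \<Rightarrow> ('k, 'u) dg_bimod \<Rightarrow> int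
     \<Rightarrow> (int \<Rightarrow> 'u \<Rightarrow> 'u) set" where
  "bimodule_maps K A M N n =
     {f \<in> module_maps K A M N n.
        \<forall>p q. \<forall>a\<in>carrier (gr A p). \<forall>m\<in>carrier (gr M q).
          f (p + q) (lact M p q a m) =
            sign_pow (gr N (p + q + n)) (n * p) (lact N p (q + n) a (f q m))}"

definition dg_modules ::
  "'k ring \<Rightarrow> ('k, 'u) dg_alg \<Rightarrow> (('k, 'u) dg_mod, 'u) dg_category" where
  "dg_modules K A = \<lparr>dg_obj = {M. dg_module K A M}, dg_hom = module_maps K A\<rparr>"

definition dg_bimodules ::
  "'k ring \<Rightarrow> ('k, 'u) dg_alg \<Rightarrow> (('k, 'u) dg_bimod, 'u) dg_category" where
  "dg_bimodules K A = \<lparr>dg_obj = {M. dg_bimodule K A M}, dg_hom = bimodule_maps K A\<rparr>"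

definition closed_maps ::
  "(('k, 'u, 'z) cochain_scheme, 'u) dg_category \<Rightarrow> ('k, 'u, 'z) cochain_scheme
     \<Rightarrow> ('k, 'u, 'z) cochain_scheme \<Rightarrow> (int \<Rightarrow> 'u \<Rightarrow> 'u) set" where
  "closed_maps G X Y =
     {f \<in> dg_hom G X Y 0. \<forall>p. \<forall>x\<in>carrier (gr X p). f (p + 1) (diff X p x) = diff Y p (f p x)}"

definition homotopic ::
  "(('k, 'u, 'z) cochain_scheme, 'u) dg_category \<Rightarrow> ('k, 'u, 'z) cochain_scheme
     \<Rightarrow> ('k, 'u, 'z) cochain_scheme \<Rightarrow> (int \<Rightarrow> 'u \<Rightarrow> 'u) \<Rightarrow> (int \<Rightarrow> 'u \<Rightarrow> 'u) \<Rightarrow> bool" where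
  "homotopic G X Y f g \<longleftrightarrow>
     (\<exists>h\<in>dg_hom G X Y (- 1). \<forall>p. \<forall>x\<in>carrier (gr X p).
        f p x \<ominus>\<^bsub>gr Y p\<^esub> g p x = diff Y (p - 1) (h p x) \<oplus>\<^bsub>gr Y p\<^esub> h (p + 1) (diff X p x))"

definition quasi_isos ::
  "(('k, 'u, 'z) cochain_scheme, 'u) dg_category \<Rightarrow> ('k, 'u, 'z) cochain_scheme
     \<Rightarrow> ('k, 'u, 'z) cochain_scheme \<Rightarrow> (int \<Rightarrow> 'u \<Rightarrow> 'u) set" where
  "quasi_isos G X Y =
     {f \<in> closed_maps G X Y.
        \<forall>p. bij_betw (homology_map Y p f) (carrier (homology X p)) (carrier (homology Y p))}"

definition gcomp :: "(int \<Rightarrow> 'u \<Rightarrow> 'u) \<Rightarrow> (int \<Rightarrow> 'u \<Rightarrow> 'u) \<Rightarrow> int \<Rightarrow> 'u \<Rightarrow> 'u" where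
  "gcomp g f = (\<lambda>p x. g p (f p x))"


section \<open>Linear categories\<close>

text \<open>
  The morphism spaces \<open>HOM C X Y\<close> are vector spaces (the multiplicative fields of the record carry no
  information). \<open>cmp C g f\<close> is \<open>g \<circ> f\<close>.
\<close>
record ('k, 'o, 'f) lin_cat =
  Obj :: "'o set"
  HOM :: "'o \<Rightarrow> 'o \<Rightarrow> ('k, 'f) module"
  cmp :: "'f \<Rightarrow> 'f \<Rightarrow> 'f"
  ident :: "'o \<Rightarrow> 'f"

abbreviation Hom :: "('k, 'o, 'f, 'z) lin_cat_scheme \<Rightarrow> 'o \<Rightarrow> 'o \<Rightarrow> 'f set" where
  "Hom C X Y \<equiv> carrier (HOM C X Y)"

abbreviation zero_mor :: "('k, 'o, 'f, 'z) lin_cat_scheme \<Rightarrow> 'o \<Rightarrow> 'o \<Rightarrow> 'f" where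
  "zero_mor C X Y \<equiv> \<zero>\<^bsub>HOM C X Y\<^esub>"

definition full_subcat ::
  "('k, 'o, 'f, 'z) lin_cat_scheme \<Rightarrow> 'o set \<Rightarrow> ('k, 'o, 'f, 'z) lin_cat_scheme" where
  "full_subcat C U = C\<lparr>Obj := U\<rparr>"

definition linear_category :: "'k ring \<Rightarrow> ('k, 'o, 'f, 'z) lin_cat_scheme \<Rightarrow> bool" where
  "linear_category K C \<longleftrightarrow>
     (\<forall>X\<in>Obj C. \<forall>Y\<in>Obj C. module K (HOM C X Y)) \<and>
     (\<forall>X\<in>Obj C. \<forall>Y\<in>Obj C. \<forall>Z\<in>Obj C. kbilinear K (HOM C Y Z) (HOM C X Y) (HOM C X Z) (cmp C)) \<and>
     (\<forall>X\<in>Obj C. ident C X \<in> Hom C X X) \<and>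
     (\<forall>X\<in>Obj C. \<forall>Y\<in>Obj C. \<forall>f\<in>Hom C X Y. cmp C f (ident C X) = f \<and> cmp C (ident C Y) f = f) \<and>
     (\<forall>W\<in>Obj C. \<forall>X\<in>Obj C. \<forall>Y\<in>Obj C. \<forall>Z\<in>Obj C.
        \<forall>f\<in>Hom C W X. \<forall>g\<in>Hom C X Y. \<forall>h\<in>Hom C Y Z. cmp C h (cmp C g f) = cmp C (cmp C h g) f)"

definition cat_iso :: "('k, 'o, 'f, 'z) lin_cat_scheme \<Rightarrow> 'o \<Rightarrow> 'o \<Rightarrow> 'f \<Rightarrow> bool" where
  "cat_iso C X Y f \<longleftrightarrow>
     X \<in> Obj C \<and> Y \<in> Obj C \<and> f \<in> Hom C X Y \<and>
     (\<exists>g\<in>Hom C Y X. cmp C g f = ident C X \<and> cmp C f g = ident C Y)"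

definition isomorphic :: "('k, 'o, 'f, 'z) lin_cat_scheme \<Rightarrow> 'o \<Rightarrow> 'o \<Rightarrow> bool" where
  "isomorphic C X Y \<longleftrightarrow> (\<exists>f. cat_iso C X Y f)"

definition zero_object :: "('k, 'o, 'f, 'z) lin_cat_scheme \<Rightarrow> 'o \<Rightarrow> bool" where
  "zero_object C X \<longleftrightarrow> X \<in> Obj C \<and> ident C X = zero_mor C X X"

definition biproduct :: "('k, 'o, 'f, 'z) lin_cat_scheme \<Rightarrow> 'o \<Rightarrow> 'o \<Rightarrow> 'o \<Rightarrow> bool" where
  "biproduct C X Y Z \<longleftrightarrow>
     X \<in> Obj C \<and> Y \<in> Obj C \<and> Z \<in> Obj C \<and>
     (\<exists>i\<in>Hom C X Z. \<exists>j\<in>Hom C Y Z. \<exists>p\<in>Hom C Z X. \<exists>q\<in>Hom C Z Y.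
        cmp C p i = ident C X \<and> cmp C q j = ident C Y \<and>
        cmp C p j = zero_mor C Y X \<and> cmp C q i = zero_mor C X Y \<and>
        cmp C i p \<oplus>\<^bsub>HOM C Z Z\<^esub> cmp C j q = ident C Z)"

definition strictly_full_additive :: "('k, 'o, 'f, 'z) lin_cat_scheme \<Rightarrow> 'o set \<Rightarrow> bool" where
  "strictly_full_additive C U \<longleftrightarrow>
     U \<subseteq> Obj C \<and>
     (\<forall>X\<in>U. \<forall>Y. isomorphic C X Y \<longrightarrow> Y \<in> U) \<and>
     (\<exists>X\<in>U. zero_object C X) \<and>
     (\<forall>X\<in>U. \<forall>Y\<in>U. \<exists>Z\<in>U. biproduct C X Y Z)"

definition cat_mono :: "('k, 'o, 'f, 'z) lin_cat_scheme \<Rightarrow> 'o \<Rightarrow> 'o \<Rightarrow> 'f \<Rightarrow> bool" where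
  "cat_mono C X Y f \<longleftrightarrow>
     X \<in> Obj C \<and> Y \<in> Obj C \<and> f \<in> Hom C X Y \<and>
     (\<forall>W\<in>Obj C. \<forall>g\<in>Hom C W X. \<forall>h\<in>Hom C W X. cmp C f g = cmp C f h \<longrightarrow> g = h)"

definition cat_epi :: "('k, 'o, 'f, 'z) lin_cat_scheme \<Rightarrow> 'o \<Rightarrow> 'o \<Rightarrow> 'f \<Rightarrow> bool" where
  "cat_epi C X Y f \<longleftrightarrow>
     X \<in> Obj C \<and> Y \<in> Obj C \<and> f \<in> Hom C X Y \<and>
     (\<forall>W\<in>Obj C. \<forall>g\<in>Hom C Y W. \<forall>h\<in>Hom C Y W. cmp C g f = cmp C h f \<longrightarrow> g = h)"

definition cat_kernel :: "('k, 'o, 'f, 'z) lin_cat_scheme \<Rightarrow> 'o \<Rightarrow> 'o \<Rightarrow> 'o \<Rightarrow> 'f \<Rightarrow> 'f \<Rightarrow> bool" where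
  "cat_kernel C X Y Z i f \<longleftrightarrow>
     X \<in> Obj C \<and> Y \<in> Obj C \<and> Z \<in> Obj C \<and> i \<in> Hom C X Y \<and> f \<in> Hom C Y Z \<and>
     cmp C f i = zero_mor C X Z \<and>
     (\<forall>W\<in>Obj C. \<forall>g\<in>Hom C W Y. cmp C f g = zero_mor C W Z \<longrightarrow> (\<exists>!h. h \<in> Hom C W X \<and> cmp C i h = g))"

definition cat_cokernel :: "('k, 'o, 'f, 'z) lin_cat_scheme \<Rightarrow> 'o \<Rightarrow> 'o \<Rightarrow> 'o \<Rightarrow> 'f \<Rightarrow> 'f \<Rightarrow> bool" where
  "cat_cokernel C X Y Z f p \<longleftrightarrow>
     X \<in> Obj C \<and> Y \<in> Obj C \<and> Z \<in> Obj C \<and> f \<in> Hom C X Y \<and> p \<in> Hom C Y Z \<and>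
     cmp C p f = zero_mor C X Z \<and>
     (\<forall>W\<in>Obj C. \<forall>g\<in>Hom C Y W. cmp C g f = zero_mor C X W \<longrightarrow> (\<exists>!h. h \<in> Hom C Z W \<and> cmp C h p = g))"

definition abelian_category :: "'k ring \<Rightarrow> ('k, 'o, 'f, 'z) lin_cat_scheme \<Rightarrow> bool" where
  "abelian_category K C \<longleftrightarrow>
     linear_category K C \<and>
     (\<exists>X. zero_object C X) \<and>
     (\<forall>X\<in>Obj C. \<forall>Y\<in>Obj C. \<exists>Z. biproduct C X Y Z) \<and>
     (\<forall>X\<in>Obj C. \<forall>Y\<in>Obj C. \<forall>f\<in>Hom C X Y. (\<exists>W i. cat_kernel C W X Y i f) \<and> (\<exists>Z p. cat_cokernel C X Y Z f p)) \<and>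
     (\<forall>X Y f. cat_mono C X Y f \<longrightarrow> (\<exists>Z g. cat_kernel C X Y Z f g)) \<and>
     (\<forall>X Y f. cat_epi C X Y f \<longrightarrow> (\<exists>W g. cat_cokernel C W X Y g f))"

definition simple_object :: "('k, 'o, 'f, 'z) lin_cat_scheme \<Rightarrow> 'o \<Rightarrow> bool" where
  "simple_object C S \<longleftrightarrow>
     S \<in> Obj C \<and> \<not> zero_object C S \<and>
     (\<forall>X f. cat_mono C X S f \<longrightarrow> zero_object C X \<or> cat_iso C X S f)"

text \<open>Objects with a finite filtration whose subquotients are simple.\<close>
inductive finite_length :: "('k, 'o, 'f, 'z) lin_cat_scheme \<Rightarrow> 'o \<Rightarrow> bool" for C where
  zero: "zero_object C X \<Longrightarrow> finite_length C X"
| step: "finite_length C X \<Longrightarrow> cat_kernel C X Y S i p \<Longrightarrow> cat_cokernel C X Y S i p \<Longrightarrow> simple_object C S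
         \<Longrightarrow> finite_length C Y"

definition length_category :: "'k ring \<Rightarrow> ('k, 'o, 'f, 'z) lin_cat_scheme \<Rightarrow> bool" where
  "length_category K C \<longleftrightarrow> abelian_category K C \<and> (\<forall>X\<in>Obj C. finite_length C X)"

definition simple_isoclasses :: "('k, 'o, 'f, 'z) lin_cat_scheme \<Rightarrow> 'o set set" where
  "simple_isoclasses C = {S. simple_object C S} // {(X, Y). isomorphic C X Y}"

definition simple_representatives :: "('k, 'o, 'f, 'z) lin_cat_scheme \<Rightarrow> 'o list \<Rightarrow> bool" where
  "simple_representatives C Ss \<longleftrightarrow>
     (\<forall>S\<in>set Ss. simple_object C S) \<and>
     (\<forall>S. simple_object C S \<longrightarrow> (\<exists>!i. i < length Ss \<and> isomorphic C S (Ss ! i)))"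

definition is_coproduct ::
  "('k, 'o, 'f, 'z) lin_cat_scheme \<Rightarrow> 'i set \<Rightarrow> ('i \<Rightarrow> 'o) \<Rightarrow> 'o \<Rightarrow> ('i \<Rightarrow> 'f) \<Rightarrow> bool" where
  "is_coproduct C I M Y \<iota> \<longleftrightarrow>
     M \<in> I \<rightarrow> Obj C \<and> Y \<in> Obj C \<and> (\<forall>i\<in>I. \<iota> i \<in> Hom C (M i) Y) \<and>
     (\<forall>Z\<in>Obj C. \<forall>g. (\<forall>i\<in>I. g i \<in> Hom C (M i) Z) \<longrightarrow>
        (\<exists>!h. h \<in> Hom C Y Z \<and> (\<forall>i\<in>I. cmp C h (\<iota> i) = g i)))"

text \<open>
  \<open>X\<close> is compact if \<open>Hom C X\<close> commutes with coproducts: the canonical map from the direct sum of the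
  spaces \<open>Hom C X (M i)\<close> to \<open>Hom C X (\<Coprod>M i)\<close> is bijective. The index sets range over the subsets
  of \<open>J\<close>.
\<close>
definition compact_object :: "('k, 'o, 'f, 'z) lin_cat_scheme \<Rightarrow> 'i set \<Rightarrow> 'o \<Rightarrow> bool" where
  "compact_object C J X \<longleftrightarrow>
     X \<in> Obj C \<and>
     (\<forall>I M Y \<iota>. I \<subseteq> J \<longrightarrow> is_coproduct C I M Y \<iota> \<longrightarrow>
        bij_betw
          (\<lambda>\<phi>. finsum (HOM C X Y) (\<lambda>i. cmp C (\<iota> i) (\<phi> i)) {i \<in> I. \<phi> i \<noteq> zero_mor C X (M i)})
          {\<phi> \<in> (\<Pi>\<^sub>E i\<in>I. Hom C X (M i)). finite {i \<in> I. \<phi> i \<noteq> zero_mor C X (M i)}}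
          (Hom C X Y))"


section \<open>The derived category\<close>

text \<open>
  The localization of the homotopy category at the quasi-isomorphisms, by calculus of fractions.
  \<open>Roof X P Y s f\<close> stands for the fraction \<open>X \<leftarrow> P \<rightarrow> Y\<close> with denominator \<open>s\<close> and numerator \<open>f\<close>.
  Morphisms are equivalence classes of roofs.
\<close>
datatype ('o, 'u) roof = Roof 'o 'o 'o "int \<Rightarrow> 'u \<Rightarrow> 'u" "int \<Rightarrow> 'u \<Rightarrow> 'u"

definition roofs ::
  "(('k, 'u, 'z) cochain_scheme, 'u) dg_category \<Rightarrow> ('k, 'u, 'z) cochain_scheme
     \<Rightarrow> ('k, 'u, 'z) cochain_scheme \<Rightarrow> (('k, 'u, 'z) cochain_scheme, 'u) roof set" where
  "roofs G X Y =
     {Roof X P Y s f | P s f. P \<in> dg_obj G \<and> s \<in> quasi_isos G P X \<and> f \<in> closed_maps G P Y}"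

definition roof_rel ::
  "(('k, 'u, 'z) cochain_scheme, 'u) dg_category \<Rightarrow> (('k, 'u, 'z) cochain_scheme, 'u) roof rel" where
  "roof_rel G =
     {(Roof X P Y s f, Roof X P' Y s' f') | X Y P s f P' s' f'.
        X \<in> dg_obj G \<and> Y \<in> dg_obj G \<and> Roof X P Y s f \<in> roofs G X Y \<and> Roof X P' Y s' f' \<in> roofs G X Y \<and>
        (\<exists>Q\<in>dg_obj G. \<exists>u\<in>closed_maps G Q P. \<exists>u'\<in>closed_maps G Q P'.
           gcomp s u \<in> quasi_isos G Q X \<and>
           homotopic G Q X (gcomp s u) (gcomp s' u') \<and>
           homotopic G Q Y (gcomp f u) (gcomp f' u'))}"

definition id_map :: "int \<Rightarrow> 'u \<Rightarrow> 'u" where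
  "id_map = (\<lambda>p x. x)"

definition strict_mor ::
  "(('k, 'u, 'z) cochain_scheme, 'u) dg_category \<Rightarrow> ('k, 'u, 'z) cochain_scheme
     \<Rightarrow> ('k, 'u, 'z) cochain_scheme \<Rightarrow> (int \<Rightarrow> 'u \<Rightarrow> 'u)
     \<Rightarrow> (('k, 'u, 'z) cochain_scheme, 'u) roof set" where
  "strict_mor G X Y f = roof_rel G `` {Roof X X Y id_map f}"

text \<open>Fractions are added, and multiplied by scalars, after passing to a common denominator.\<close>
definition derived_HOM ::
  "(('k, 'u, 'z) cochain_scheme, 'u) dg_category \<Rightarrow> ('k, 'u, 'z) cochain_scheme
     \<Rightarrow> ('k, 'u, 'z) cochain_scheme \<Rightarrow> ('k, (('k, 'u, 'z) cochain_scheme, 'u) roof set) module" where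
  "derived_HOM G X Y =
     \<lparr>carrier = roofs G X Y // roof_rel G,
      monoid.mult = undefined, one = undefined,
      zero = strict_mor G X Y (\<lambda>p x. \<zero>\<^bsub>gr Y p\<^esub>),
      add = (\<lambda>F F'. \<Union>{roof_rel G `` {Roof X P Y s (\<lambda>p x. f p x \<oplus>\<^bsub>gr Y p\<^esub> f' p x)} | P s f f'.
                        Roof X P Y s f \<in> F \<and> Roof X P Y s f' \<in> F'}),
      smult = (\<lambda>c F. \<Union>{roof_rel G `` {Roof X P Y s (\<lambda>p x. c \<odot>\<^bsub>gr Y p\<^esub> f p x)} | P s f.
                        Roof X P Y s f \<in> F})\<rparr>"

text \<open>
  The composite of \<open>X \<leftarrow> P \<rightarrow> Y\<close> and \<open>Y \<leftarrow> Q \<rightarrow> Z\<close> is the class of \<open>X \<leftarrow> R \<rightarrow> Z\<close> for any completion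
  \<open>P \<leftarrow> R \<rightarrow> Q\<close> of the middle to a homotopy commutative square.
\<close>
definition derived_cmp ::
  "(('k, 'u, 'z) cochain_scheme, 'u) dg_category \<Rightarrow> (('k, 'u, 'z) cochain_scheme, 'u) roof set
     \<Rightarrow> (('k, 'u, 'z) cochain_scheme, 'u) roof set \<Rightarrow> (('k, 'u, 'z) cochain_scheme, 'u) roof set" where
  "derived_cmp G F' F =
     \<Union>{roof_rel G `` {Roof X R Z (gcomp s u) (gcomp g v)} | X P Y Q Z s f t g R u v.
         Roof X P Y s f \<in> F \<and> Roof Y Q Z t g \<in> F' \<and>
         R \<in> dg_obj G \<and> u \<in> quasi_isos G R P \<and> v \<in> closed_maps G R Q \<and>
         homotopic G R Y (gcomp f u) (gcomp t v)}"

definition derived_category ::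
  "(('k, 'u, 'z) cochain_scheme, 'u) dg_category
     \<Rightarrow> ('k, ('k, 'u, 'z) cochain_scheme, (('k, 'u, 'z) cochain_scheme, 'u) roof set) lin_cat" where
  "derived_category G =
     \<lparr>Obj = dg_obj G, HOM = derived_HOM G, cmp = derived_cmp G,
      ident = (\<lambda>X. strict_mor G X X id_map)\<rparr>"

definition homologically_smooth :: "'k ring \<Rightarrow> ('k, 'u) dg_alg \<Rightarrow> bool" where
  "homologically_smooth K A \<longleftrightarrow>
     compact_object (derived_category (dg_bimodules K A)) (UNIV :: 'u set) (diagonal_bimodule A)"


section \<open>The triangulated structure\<close>

definition shift_obj :: "int \<Rightarrow> ('k, 'u) dg_mod \<Rightarrow> ('k, 'u) dg_mod" where
  "shift_obj n M =
     \<lparr>gr = (\<lambda>p. gr M (p + n)),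
      diff = (\<lambda>p x. sign_pow (gr M (p + n + 1)) n (diff M (p + n) x)),
      ract = (\<lambda>p q. ract M (p + n) q)\<rparr>"

definition shift_mor ::
  "'k ring \<Rightarrow> ('k, 'u) dg_alg \<Rightarrow> int \<Rightarrow> (('k, 'u) dg_mod, 'u) roof set
     \<Rightarrow> (('k, 'u) dg_mod, 'u) roof set" where
  "shift_mor K A n F =
     \<Union>{roof_rel (dg_modules K A) ``
          {Roof (shift_obj n X) (shift_obj n P) (shift_obj n Y) (\<lambda>p. s (p + n)) (\<lambda>p. f (p + n))} | X P Y s f.
          Roof X P Y s f \<in> F}"

text \<open>
  \<open>C\<close> is, via \<open>i\<close> and \<open>j\<close>, the mapping cone of \<open>\<phi> : M \<rightarrow> N\<close>: as a graded module it is
  the direct sum of \<open>N\<close> and \<open>\<Sigma>M\<close>, with differential \<open>(n, m) \<mapsto> (d n + \<phi> m, - d m)\<close>; the map \<open>\<pi>\<close> is the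
  projection onto \<open>\<Sigma>M\<close>. (The cone is not constructed on pairs since its
  elements have to be in the type \<open>'u\<close>.)
\<close>
definition mapping_cone ::
  "'k ring \<Rightarrow> ('k, 'u) dg_alg \<Rightarrow> ('k, 'u) dg_mod \<Rightarrow> ('k, 'u) dg_mod \<Rightarrow> (int \<Rightarrow> 'u \<Rightarrow> 'u)
     \<Rightarrow> ('k, 'u) dg_mod \<Rightarrow> (int \<Rightarrow> 'u \<Rightarrow> 'u) \<Rightarrow> (int \<Rightarrow> 'u \<Rightarrow> 'u) \<Rightarrow> (int \<Rightarrow> 'u \<Rightarrow> 'u) \<Rightarrow> bool" where
  "mapping_cone K A M N \<phi> C i j \<pi> \<longleftrightarrow>
     dg_module K A C \<and> i \<in> module_maps K A N C 0 \<and> j \<in> module_maps K A M C (- 1) \<and>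
     (\<forall>p. bij_betw (\<lambda>(n, m). i p n \<oplus>\<^bsub>gr C p\<^esub> j (p + 1) m)
            (carrier (gr N p) \<times> carrier (gr M (p + 1))) (carrier (gr C p))) \<and>
     (\<forall>p. \<forall>n\<in>carrier (gr N p). \<forall>m\<in>carrier (gr M (p + 1)).
        diff C p (i p n \<oplus>\<^bsub>gr C p\<^esub> j (p + 1) m) =
          i (p + 1) (diff N p n \<oplus>\<^bsub>gr N (p + 1)\<^esub> \<phi> (p + 1) m)
            \<oplus>\<^bsub>gr C (p + 1)\<^esub> j (p + 2) (\<ominus>\<^bsub>gr M (p + 2)\<^esub> diff M (p + 1) m) \<and>
        \<pi> p (i p n \<oplus>\<^bsub>gr C p\<^esub> j (p + 1) m) = m)"

text \<open>The triangles isomorphic to a triangle \<open>M \<rightarrow> N \<rightarrow> cone \<phi> \<rightarrow> \<Sigma>M\<close>.\<close>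
definition derived_triangles ::
  "'k ring \<Rightarrow> ('k, 'u) dg_alg \<Rightarrow>
     (('k, 'u) dg_mod \<times> ('k, 'u) dg_mod \<times> ('k, 'u) dg_mod \<times>
      (('k, 'u) dg_mod, 'u) roof set \<times> (('k, 'u) dg_mod, 'u) roof set \<times> (('k, 'u) dg_mod, 'u) roof set) set" where
  "derived_triangles K A =
     (let G = dg_modules K A; D = derived_category G in
      {(X, Y, Z, f, g, h).
         X \<in> Obj D \<and> Y \<in> Obj D \<and> Z \<in> Obj D \<and>
         f \<in> Hom D X Y \<and> g \<in> Hom D Y Z \<and> h \<in> Hom D Z (shift_obj 1 X) \<and>
         (\<exists>M\<in>dg_obj G. \<exists>N\<in>dg_obj G. \<exists>\<phi>\<in>closed_maps G M N. \<exists>C i j \<pi>. mapping_cone K A M N \<phi> C i j \<pi> \<and>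
            (\<exists>a b c. cat_iso D X M a \<and> cat_iso D Y N b \<and> cat_iso D Z C c \<and>
               cmp D b f = cmp D (strict_mor G M N \<phi>) a \<and>
               cmp D c g = cmp D (strict_mor G N C i) b \<and>
               cmp D (shift_mor K A 1 a) h = cmp D (strict_mor G C (shift_obj 1 M) \<pi>) c))})"

record ('k, 'o, 'f) tri_cat = "('k, 'o, 'f) lin_cat" +
  shift :: "int \<Rightarrow> 'o \<Rightarrow> 'o"
  triangles :: "('o \<times> 'o \<times> 'o \<times> 'f \<times> 'f \<times> 'f) set"

definition DA ::
  "'k ring \<Rightarrow> ('k, 'u) dg_alg
     \<Rightarrow> ('k, ('k, 'u) dg_mod, (('k, 'u) dg_mod, 'u) roof set) tri_cat" where
  "DA K A =
     lin_cat.extend (derived_category (dg_modules K A))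
       \<lparr>shift = shift_obj, triangles = derived_triangles K A\<rparr>"

text \<open>The dg modules whose homology has finite total dimension.\<close>
definition fd_objects :: "'k ring \<Rightarrow> ('k, 'u) dg_alg \<Rightarrow> ('k, 'u) dg_mod set" where
  "fd_objects K A =
     {M. dg_module K A M \<and> (\<forall>p. finite_dim K (homology M p)) \<and> finite {p. \<not> zero_space (homology M p)}}"

definition Dfd ::
  "'k ring \<Rightarrow> ('k, 'u) dg_alg
     \<Rightarrow> ('k, ('k, 'u) dg_mod, (('k, 'u) dg_mod, 'u) roof set) tri_cat" where
  "Dfd K A = full_subcat (DA K A) (fd_objects K A)"


section \<open>Subcategories of triangulated categories and t-structures\<close>

definition triangulated_subcat :: "('k, 'o, 'f) tri_cat \<Rightarrow> 'o set \<Rightarrow> bool" where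
  "triangulated_subcat C U \<longleftrightarrow>
     U \<subseteq> Obj C \<and>
     (\<forall>X. zero_object C X \<longrightarrow> X \<in> U) \<and>
     (\<forall>X\<in>U. \<forall>Y. isomorphic C X Y \<longrightarrow> Y \<in> U) \<and>
     (\<forall>X\<in>U. shift C 1 X \<in> U \<and> shift C (- 1) X \<in> U) \<and>
     (\<forall>X\<in>U. \<forall>Y\<in>U. \<forall>Z\<in>Obj C. \<forall>f g h. (X, Y, Z, f, g, h) \<in> triangles C \<longrightarrow> Z \<in> U)"

definition triangulated_hull :: "('k, 'o, 'f) tri_cat \<Rightarrow> 'o set \<Rightarrow> 'o set" where
  "triangulated_hull C S = \<Inter>{U. triangulated_subcat C U \<and> S \<subseteq> U}"

inductive_set extension_closure :: "('k, 'o, 'f) tri_cat \<Rightarrow> 'o set \<Rightarrow> 'o set" for C S where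
  base: "X \<in> S \<Longrightarrow> X \<in> extension_closure C S"
| zero: "zero_object C X \<Longrightarrow> X \<in> extension_closure C S"
| iso: "X \<in> extension_closure C S \<Longrightarrow> isomorphic C X Y \<Longrightarrow> Y \<in> extension_closure C S"
| ext: "X \<in> extension_closure C S \<Longrightarrow> Z \<in> extension_closure C S \<Longrightarrow> Y \<in> Obj C
        \<Longrightarrow> (X, Y, Z, f, g, h) \<in> triangles C \<Longrightarrow> Y \<in> extension_closure C S"

definition t_structure :: "('k, 'o, 'f) tri_cat \<Rightarrow> 'o set \<times> 'o set \<Rightarrow> bool" where
  "t_structure C = (\<lambda>(U, V).
     strictly_full_additive C U \<and> strictly_full_additive C V \<and>
     (\<forall>X\<in>U. shift C 1 X \<in> U) \<and>
     (\<forall>X\<in>V. shift C (- 1) X \<in> V) \<and>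
     (\<forall>M\<in>U. \<forall>N\<in>V. Hom C M (shift C (- 1) N) = {zero_mor C M (shift C (- 1) N)}) \<and>
     (\<forall>M\<in>Obj C. \<exists>X\<in>U. \<exists>Y\<in>Obj C. shift C 1 Y \<in> V \<and> (\<exists>f g h. (X, M, Y, f, g, h) \<in> triangles C)))"

definition heart :: "('k, 'o, 'f) tri_cat \<Rightarrow> 'o set \<times> 'o set \<Rightarrow> ('k, 'o, 'f) tri_cat" where
  "heart C = (\<lambda>(U, V). full_subcat C (U \<inter> V))"

definition shifted_subcat :: "('k, 'o, 'f) tri_cat \<Rightarrow> int \<Rightarrow> 'o set \<Rightarrow> 'o set" where
  "shifted_subcat C n U = {X. \<exists>Y\<in>U. isomorphic C X (shift C n Y)}"

definition bounded_t_structure :: "('k, 'o, 'f) tri_cat \<Rightarrow> 'o set \<times> 'o set \<Rightarrow> bool" where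
  "bounded_t_structure C = (\<lambda>(U, V).
     t_structure C (U, V) \<and>
     (\<Union>n. shifted_subcat C n U) = Obj C \<and> (\<Union>n. shifted_subcat C n V) = Obj C)"


section \<open>The two sides of the correspondence\<close>

definition length_t_structures ::
  "'k ring \<Rightarrow> ('k, 'u) dg_alg \<Rightarrow> (('k, 'u) dg_mod set \<times> ('k, 'u) dg_mod set) set" where
  "length_t_structures K A =
     {t. bounded_t_structure (Dfd K A) t \<and> length_category K (heart (Dfd K A) t) \<and>
         finite (simple_isoclasses (heart (Dfd K A) t))}"

definition simple_minded :: "'k ring \<Rightarrow> ('k, 'u) dg_alg \<Rightarrow> ('k, 'u) dg_mod list \<Rightarrow> bool" where
  "simple_minded K A Ss \<longleftrightarrow>
     set Ss \<subseteq> fd_objects K A \<and>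
     (\<forall>i<length Ss. \<forall>j<length Ss. i \<noteq> j \<longrightarrow>
        Hom (DA K A) (Ss ! i) (Ss ! j) = {zero_mor (DA K A) (Ss ! i) (Ss ! j)}) \<and>
     (\<forall>S\<in>set Ss.
        ident (DA K A) S \<noteq> zero_mor (DA K A) S S \<and>
        Hom (DA K A) S S = {c \<odot>\<^bsub>HOM (DA K A) S S\<^esub> ident (DA K A) S | c. c \<in> carrier K}) \<and>
     (\<forall>S\<in>set Ss. \<forall>T\<in>set Ss. \<forall>n<0.
        Hom (DA K A) S (shift (DA K A) n T) = {zero_mor (DA K A) S (shift (DA K A) n T)}) \<and>
     triangulated_hull (DA K A) (set Ss) = fd_objects K A"

definition simple_minded_equiv :: "'k ring \<Rightarrow> ('k, 'u) dg_alg \<Rightarrow> ('k, 'u) dg_mod list rel" where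
  "simple_minded_equiv K A =
     {(Ss, Ts). simple_minded K A Ss \<and> simple_minded K A Ts \<and>
        extension_closure (Dfd K A) (set Ss) = extension_closure (Dfd K A) (set Ts)}"

end

theory Submission
  imports Defs
begin

text \<open>
  Let \<open>S\<^sub>1, \<dots>, S\<^sub>r\<close> be simple-minded. Every object has a finite filtration whose subquotients are shifts \<open>\<Sigma>\<^sup>n S\<^sub>i\<close>.
  As there are no morphisms of negative degree, and only zero morphisms and isomorphisms in degree zero, two
  adjacent subquotients in the wrong order can be exchanged or cancel. So the filtration can be sorted by
  decreasing \<open>n\<close>, and cutting the sorted filtration gives the truncation triangles of a bounded
  t-structure. Its heart consists of the objects filtered by the \<open>S\<^sub>i\<close> themselves, i.e. it is their extension
  closure, a length category with the simple objects \<open>S\<^sub>i\<close>.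

  Conversely, the simple objects of the heart of a bounded t-structure generate by devissage, and they have no
  morphisms of negative degree. Their endomorphism algebras are division algebras, hence equal to \<open>K\<close>,
  because an endomorphism has an eigenvector on some finite-dimensional homology space. Both constructions
  are inverse to each other as a bounded t-structure is determined by its heart.

  All of this takes place in an abstract triangulated category; that the derived category is one is
  deduced from the calculus of fractions with respect to quasi-isomorphisms and from mapping cones in coordinates.
\<close>

section \<open>Linear categories\<close>

text \<open>Sorting works because the connecting morphism of a wrongly ordered pair, Sigma^n S below
  Sigma^m S' with n < m, is up to shift a morphism S' -> Sigma^(n-m+1) S with n - m + 1 <= 0, the
  range that simple-mindedness controls. On the concrete side the obstacle is that all dg modules
  live in the one type \<open>'u\<close>, so that a cone cannot be built on pairs. Pairs are coded
  by a map that is injective on carriers: for infinite \<open>'u\<close> it exists since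
  \<open>'u\<close> is equipotent with its square, and for finite \<open>'u\<close> all vector
  spaces over the infinite field K vanish. The calculus of fractions rests on two facts about cones:
  a closed map into an acyclic module becomes null-homotopic after a quasi-isomorphism, and a
  null-homotopy of a composite into the cone of phi yields a factorization through phi. A last
  obstacle is that \<open>Dfd\<close> keeps ambient triangles with vertices outside of it; the
  abstract argument runs in a copy with fewer triangles, and t-structures, extension closures and
  hulls are compared.\<close>

locale lincat =
  fixes K :: "'k ring" and C :: "('k, 'o, 'f, 'z) lin_cat_scheme"
  assumes lin: "linear_category K C"
begin

text \<open>Carrying the membership of source and target in the predicate lets the composition rules
  chain by resolution, without side conditions on objects.\<close>

definition mor where "mor X Y f \<longleftrightarrow> X \<in> Obj C \<and> Y \<in> Obj C \<and> f \<in> Hom C X Y"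
abbreviation cc (infixl \<open>\<cdot>\<close> 75) where "g \<cdot> f \<equiv> cmp C g f"
abbreviation one where "one X \<equiv> ident C X"
abbreviation zr where "zr X Y \<equiv> zero_mor C X Y"
abbreviation neg where "neg X Y f \<equiv> \<ominus>\<^bsub>HOM C X Y\<^esub> f"
abbreviation iso where "iso X Y f \<equiv> cat_iso C X Y f"

lemma morD: "mor X Y f ==> X \<in> Obj C" "mor X Y f ==> Y \<in> Obj C" "mor X Y f ==> f \<in> Hom C X Y"
  by (simp_all add: mor_def)

lemma Hom_module: "X \<in> Obj C ==> Y \<in> Obj C ==> module K (HOM C X Y)"
  using lin by (simp add: linear_category_def)

lemma Hom_ag: "X \<in> Obj C ==> Y \<in> Obj C ==> abelian_group (HOM C X Y)"
  using Hom_module by (simp add: module_def)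

lemma bilin: "X \<in> Obj C ==> Y \<in> Obj C ==> Z \<in> Obj C ==> kbilinear K (HOM C Y Z) (HOM C X Y) (HOM C X Z) (cmp C)"
  using lin by (simp add: linear_category_def)

lemma mc: "mor X Y f ==> mor Y Z g ==> mor X Z (g \<cdot> f)"
  using bilin unfolding mor_def kbilinear_def klinear_def by blast

lemma asc: "mor W X f ==> mor X Y g ==> mor Y Z h ==> h \<cdot> (g \<cdot> f) = (h \<cdot> g) \<cdot> f"
  using lin unfolding linear_category_def mor_def by blast

lemma m1: "X \<in> Obj C ==> mor X X (one X)"
  using lin by (simp add: linear_category_def mor_def)

lemma idl: "mor X Y f ==> one Y \<cdot> f = f" and idr: "mor X Y f ==> f \<cdot> one X = f"
  using lin unfolding linear_category_def mor_def by blast+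

lemma m0: "X \<in> Obj C ==> Y \<in> Obj C ==> mor X Y (zr X Y)"
  using abelian_monoid.zero_closed[OF abelian_group.axioms(1)[OF Hom_ag]] by (simp add: mor_def)

lemma ma: "mor X Y f ==> mor X Y g ==> mor X Y (f \<oplus>\<^bsub>HOM C X Y\<^esub> g)"
  using abelian_monoid.a_closed[OF abelian_group.axioms(1)[OF Hom_ag]] by (simp add: mor_def)

lemma mn: "mor X Y f ==> mor X Y (neg X Y f)"
  using abelian_group.a_inv_closed[OF Hom_ag] by (simp add: mor_def)

lemma ms: "mor X Y f ==> c \<in> carrier K ==> mor X Y (c \<odot>\<^bsub>HOM C X Y\<^esub> f)"
  using module.smult_closed[OF Hom_module] by (simp add: mor_def)

lemma klin_left: "mor Y Z g ==> X \<in> Obj C ==> klinear K (HOM C X Y) (HOM C X Z) (\<lambda>f. g \<cdot> f)"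
  and klin_right: "mor X Y f ==> Z \<in> Obj C ==> klinear K (HOM C Y Z) (HOM C X Z) (\<lambda>g. g \<cdot> f)"
  using bilin unfolding mor_def kbilinear_def by blast+

lemma klin_zero:
  assumes "klinear K V W f" "abelian_group V" "abelian_group W"
  shows "f \<zero>\<^bsub>V\<^esub> = \<zero>\<^bsub>W\<^esub>"
proof -
  interpret V: abelian_group V by fact
  interpret W: abelian_group W by fact
  have f: "!!x y. x \<in> carrier V ==> y \<in> carrier V ==> f (x \<oplus>\<^bsub>V\<^esub> y) = f x \<oplus>\<^bsub>W\<^esub> f y" "!!x. x \<in> carrier V ==> f x \<in> carrier W"
    using assms(1) by (auto simp: klinear_def)
  have "f \<zero>\<^bsub>V\<^esub> \<oplus>\<^bsub>W\<^esub> f \<zero>\<^bsub>V\<^esub> = f \<zero>\<^bsub>V\<^esub>"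
    using f(1)[of "\<zero>\<^bsub>V\<^esub>" "\<zero>\<^bsub>V\<^esub>"] by simp
  thus ?thesis
    using f(2)[OF V.zero_closed] W.add.r_cancel_one' by metis
qed

lemma klin_neg:
  assumes "klinear K V W f" "abelian_group V" "abelian_group W" "x \<in> carrier V"
  shows "f (\<ominus>\<^bsub>V\<^esub> x) = \<ominus>\<^bsub>W\<^esub> f x"
proof -
  interpret V: abelian_group V by fact
  interpret W: abelian_group W by fact
  have f: "!!x y. x \<in> carrier V ==> y \<in> carrier V ==> f (x \<oplus>\<^bsub>V\<^esub> y) = f x \<oplus>\<^bsub>W\<^esub> f y" "!!x. x \<in> carrier V ==> f x \<in> carrier W"
    using assms(1) by (auto simp: klinear_def)
  have "f (\<ominus>\<^bsub>V\<^esub> x) \<oplus>\<^bsub>W\<^esub> f x = \<zero>\<^bsub>W\<^esub>"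
    using f(1)[of "\<ominus>\<^bsub>V\<^esub> x" x] assms klin_zero[OF assms(1-3)] by (simp add: V.l_neg)
  thus ?thesis
    using W.minus_equality[of "f (\<ominus>\<^bsub>V\<^esub> x)" "f x"] assms f(2) by simp
qed

lemma cz: "mor X Y f ==> W \<in> Obj C ==> f \<cdot> zr W X = zr W Y"
  and zc: "mor X Y f ==> W \<in> Obj C ==> zr Y W \<cdot> f = zr X W"
  using klin_zero[OF klin_left Hom_ag Hom_ag] klin_zero[OF klin_right Hom_ag Hom_ag] morD by blast+

lemma cn: "mor X Y f ==> mor Y Z g ==> g \<cdot> neg X Y f = neg X Z (g \<cdot> f)"
  using klin_neg[OF klin_left Hom_ag Hom_ag, of Y Z g X f] morD by blast

lemma nc: "mor X Y f ==> mor Y Z g ==> neg Y Z g \<cdot> f = neg X Z (g \<cdot> f)"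
  using klin_neg[OF klin_right Hom_ag Hom_ag, of X Y f Z g] morD by blast

lemma ca: "mor X Y f ==> mor X Y f' ==> mor Y Z g ==> g \<cdot> (f \<oplus>\<^bsub>HOM C X Y\<^esub> f') = g \<cdot> f \<oplus>\<^bsub>HOM C X Z\<^esub> g \<cdot> f'"
  using klin_left[of Y Z g X] by (simp add: klinear_def mor_def)

lemma ac: "mor X Y f ==> mor Y Z g ==> mor Y Z g' ==> (g \<oplus>\<^bsub>HOM C Y Z\<^esub> g') \<cdot> f = g \<cdot> f \<oplus>\<^bsub>HOM C X Z\<^esub> g' \<cdot> f"
  using klin_right[of X Y f Z] by (simp add: klinear_def mor_def)

lemma cs: "mor X Y f ==> mor Y Z g ==> c \<in> carrier K ==> g \<cdot> (c \<odot>\<^bsub>HOM C X Y\<^esub> f) = c \<odot>\<^bsub>HOM C X Z\<^esub> (g \<cdot> f)"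
  using klin_left[of Y Z g X] by (simp add: klinear_def mor_def)

lemma sc: "mor X Y f ==> mor Y Z g ==> c \<in> carrier K ==> (c \<odot>\<^bsub>HOM C Y Z\<^esub> g) \<cdot> f = c \<odot>\<^bsub>HOM C X Z\<^esub> (g \<cdot> f)"
  using klin_right[of X Y f Z] by (simp add: klinear_def mor_def)

lemma nn: "mor X Y f ==> neg X Y (neg X Y f) = f"
  using abelian_group.minus_minus[OF Hom_ag] by (simp add: mor_def)

lemma n0: "X \<in> Obj C ==> Y \<in> Obj C ==> neg X Y (zr X Y) = zr X Y"
  by (metis Hom_ag abelian_group.r_neg abelian_group.axioms(1) abelian_group.a_inv_closed abelian_monoid.l_zero abelian_monoid.zero_closed)

lemma diff_zero: "mor X Y f ==> mor X Y g ==> f \<oplus>\<^bsub>HOM C X Y\<^esub> neg X Y g = zr X Y ==> f = g"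
  using abelian_group.minus_equality[OF Hom_ag, of X Y f "neg X Y g"] nn[of X Y g] mn[of X Y g] by (simp add: mor_def)

lemma diff_self: "mor X Y f ==> f \<oplus>\<^bsub>HOM C X Y\<^esub> neg X Y f = zr X Y"
  using abelian_group.r_neg[OF Hom_ag] by (simp add: mor_def)

lemma az: "mor X Y f ==> f \<oplus>\<^bsub>HOM C X Y\<^esub> zr X Y = f"
  and za: "mor X Y f ==> zr X Y \<oplus>\<^bsub>HOM C X Y\<^esub> f = f"
  using abelian_monoid.r_zero[OF abelian_group.axioms(1)[OF Hom_ag]] abelian_monoid.l_zero[OF abelian_group.axioms(1)[OF Hom_ag]]
  by (simp_all add: mor_def)

lemma isoI: "mor X Y f ==> mor Y X g ==> g \<cdot> f = one X ==> f \<cdot> g = one Y ==> iso X Y f"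
  by (auto simp: cat_iso_def mor_def)

lemma isoE:
  assumes "iso X Y f"
  obtains g where "mor X Y f" "mor Y X g" "g \<cdot> f = one X" "f \<cdot> g = one Y" "iso Y X g"
proof -
  obtain g where "mor X Y f" "mor Y X g" "g \<cdot> f = one X" "f \<cdot> g = one Y"
    using assms by (auto simp: cat_iso_def mor_def)
  thus thesis using that isoI by blast
qed

lemma iso_mor: "iso X Y f ==> mor X Y f"
  by (auto simp: cat_iso_def mor_def)

lemma iso_one: "X \<in> Obj C ==> iso X X (one X)"
  by (rule isoI[OF m1 m1]) (simp_all add: idl[OF m1])

lemma iso_comp:
  assumes "iso X Y f" "iso Y Z g"
  shows "iso X Z (g \<cdot> f)"
proof -
  obtain f' where f: "mor X Y f" "mor Y X f'" "f' \<cdot> f = one X" "f \<cdot> f' = one Y" using assms(1) by (rule isoE)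
  obtain g' where g: "mor Y Z g" "mor Z Y g'" "g' \<cdot> g = one Y" "g \<cdot> g' = one Z" using assms(2) by (rule isoE)
  show ?thesis
  proof (rule isoI[OF mc[OF f(1) g(1)] mc[OF g(2) f(2)]])
    have "(f' \<cdot> g') \<cdot> (g \<cdot> f) = f' \<cdot> ((g' \<cdot> g) \<cdot> f)"
      using asc[OF mc[OF f(1) g(1)] g(2) f(2)] asc[OF f(1) g(1,2)] by simp
    thus "(f' \<cdot> g') \<cdot> (g \<cdot> f) = one X" using f g idl by simp
    have "(g \<cdot> f) \<cdot> (f' \<cdot> g') = g \<cdot> ((f \<cdot> f') \<cdot> g')"
      using asc[OF mc[OF g(2) f(2)] f(1) g(1)] asc[OF g(2) f(2,1)] by simp
    thus "(g \<cdot> f) \<cdot> (f' \<cdot> g') = one Z" using f g idl by simp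
  qed
qed

lemma isomorphic_refl: "X \<in> Obj C ==> isomorphic C X X"
  using iso_one unfolding isomorphic_def by blast
lemma isomorphic_sym: "isomorphic C X Y ==> isomorphic C Y X"
  unfolding isomorphic_def by (meson isoE)
lemma isomorphic_trans: "isomorphic C X Y ==> isomorphic C Y Z ==> isomorphic C X Z"
  unfolding isomorphic_def using iso_comp by blast
lemma isomorphic_Obj: "isomorphic C X Y ==> X \<in> Obj C" "isomorphic C X Y ==> Y \<in> Obj C"
  by (auto simp: isomorphic_def cat_iso_def)

lemma iso_cancel_left:
  assumes "iso Y Z g" "mor X Y f" "mor X Y f'" "g \<cdot> f = g \<cdot> f'"
  shows "f = f'"
proof -
  obtain g' where g: "mor Y Z g" "mor Z Y g'" "g' \<cdot> g = one Y" using assms(1) by (rule isoE)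
  have "f = g' \<cdot> (g \<cdot> f)" using asc[OF assms(2) g(1,2)] g(3) idl[OF assms(2)] by simp
  also have "\<dots> = f'" using asc[OF assms(3) g(1,2)] g(3) idl[OF assms(3)] assms(4) by simp
  finally show ?thesis .
qed

lemma iso_cancel_right:
  assumes "iso X Y g" "mor Y Z f" "mor Y Z f'" "f \<cdot> g = f' \<cdot> g"
  shows "f = f'"
proof -
  obtain g' where g: "mor X Y g" "mor Y X g'" "g \<cdot> g' = one Y" using assms(1) by (rule isoE)
  have "f = (f \<cdot> g) \<cdot> g'" using asc[OF g(2,1) assms(2)] g(3) idr[OF assms(2)] by simp
  also have "\<dots> = f'" using asc[OF g(2,1) assms(3)] g(3) idr[OF assms(3)] assms(4) by simp
  finally show ?thesis .
qed

lemma paste: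
  assumes "mor X Y f" "mor X' Y' f'" "mor X'' Y'' f''" "mor X X' a" "mor X' X'' a'" "mor Y Y' b" "mor Y' Y'' b'"
    and e: "b \<cdot> f = f' \<cdot> a" "b' \<cdot> f' = f'' \<cdot> a'"
  shows "(b' \<cdot> b) \<cdot> f = f'' \<cdot> (a' \<cdot> a)"
  using asc[OF assms(1,6,7)] asc[OF assms(4,2,7)] asc[OF assms(4,5,3)] e by simp

text \<open>One-sided inverses suffice: f' = f' a a' = b f a', and then b' cancels b.\<close>

lemma flip:
  assumes "mor X Y f" "mor X' Y' f'" "mor X X' a" "mor X' X a'" "a \<cdot> a' = one X'" "mor Y Y' b" "mor Y' Y b'" "b' \<cdot> b = one Y"
    and e: "b \<cdot> f = f' \<cdot> a"
  shows "b' \<cdot> f' = f \<cdot> a'"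
proof -
  note fa = mc[OF assms(4,1)]
  have "f' = b \<cdot> (f \<cdot> a')" using asc[OF assms(4,3,2)] asc[OF assms(4,1,6)] e assms(5) idr[OF assms(2)] by simp
  thus ?thesis using asc[OF fa assms(6,7)] assms(8) idl[OF fa] by simp
qed

text \<open>A morphism of triangles is carried to standard cones by conjugation with isomorphisms,
  filled there, and carried back; this rule removes the two conjugations.\<close>

lemma conjugate:
  assumes f: "mor X X' f" and "mor X Y a" "mor Y X b" "b \<cdot> a = one X" "mor X' Y' a'" "mor Y' X' b'" "b' \<cdot> a' = one X'"
  shows "b' \<cdot> ((a' \<cdot> (f \<cdot> b)) \<cdot> a) = f"
proof -
  note fb = mc[OF assms(3) f]
  have "(f \<cdot> b) \<cdot> a = f" using asc[OF assms(2,3) f] assms(4) idr[OF f] by simp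
  hence "(a' \<cdot> (f \<cdot> b)) \<cdot> a = a' \<cdot> f" using asc[OF assms(2) fb assms(5)] by simp
  thus ?thesis using asc[OF f assms(5,6)] assms(7) idl[OF f] by simp
qed

lemma zero_objD:
  assumes "zero_object C X"
  shows "X \<in> Obj C" "mor X Y f ==> f = zr X Y" "mor Y X f ==> f = zr Y X"
proof -
  show X: "X \<in> Obj C" using assms by (simp add: zero_object_def)
  have e: "one X = zr X X" using assms by (simp add: zero_object_def)
  show "f = zr X Y" if "mor X Y f" using idr[OF that] cz[OF that X] e by simp
  show "f = zr Y X" if "mor Y X f" using idl[OF that] zc[OF that X] e by simp
qed

lemma zero_objI: "X \<in> Obj C ==> one X = zr X X ==> zero_object C X"
  by (simp add: zero_object_def)

lemma zero_obj_iso: "zero_object C X ==> zero_object C Y ==> iso X Y (zr X Y)"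
  by (rule isoI[of _ _ _ "zr Y X"]) (auto simp: m0 zero_objD zero_objD(2)[OF _ mc, OF _ m0 m0] zero_objD(2)[OF _ m1])

lemma zero_obj_isomorphic: "zero_object C X ==> isomorphic C X Y ==> zero_object C Y"
proof -
  assume z: "zero_object C X" and i: "isomorphic C X Y"
  obtain f g where f: "mor X Y f" "mor Y X g" "f \<cdot> g = one Y" using i by (auto simp: isomorphic_def elim: isoE)
  have "one Y = zr Y Y" using f zero_objD(2)[OF z f(1)] zc[OF f(2) morD(2)[OF f(1)]] by simp
  thus ?thesis using morD f zero_objI by blast
qed

end

section \<open>Triangulated categories\<close>

text \<open>
  The octahedral axiom is only needed as the existence of the third triangle, without the
  compatibilities. The shift is only required to be invertible up to isomorphism.
\<close>
locale tricat = lincat K C for K :: "'k ring" and C :: "('k, 'o, 'f) tri_cat" +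
  fixes sg :: "'f \<Rightarrow> 'f"
  assumes shift_Obj: "X \<in> Obj C ==> shift C n X \<in> Obj C"
    and shift_zero: "X \<in> Obj C ==> shift C 0 X = X"
    and shift_shift: "X \<in> Obj C ==> isomorphic C (shift C m (shift C n X)) (shift C (n + m) X)"
    and sg_mor: "mor X Y f ==> mor (shift C 1 X) (shift C 1 Y) (sg f)"
    and sg_cmp: "mor X Y f ==> mor Y Z g ==> sg (g \<cdot> f) = sg g \<cdot> sg f"
    and sg_one: "X \<in> Obj C ==> sg (one X) = one (shift C 1 X)"
    and sg_add: "mor X Y f ==> mor X Y g ==> sg (f \<oplus>\<^bsub>HOM C X Y\<^esub> g) = sg f \<oplus>\<^bsub>HOM C (shift C 1 X) (shift C 1 Y)\<^esub> sg g"
    and sg_inj: "mor X Y f ==> mor X Y g ==> sg f = sg g ==> f = g"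
    and sg_surj: "X \<in> Obj C ==> Y \<in> Obj C ==> mor (shift C 1 X) (shift C 1 Y) h ==> \<exists>f. mor X Y f \<and> sg f = h"
    and tri_mor: "(X, Y, Z, f, g, h) \<in> triangles C ==> mor X Y f \<and> mor Y Z g \<and> mor Z (shift C 1 X) h"
    and tri_iso: "(X, Y, Z, f, g, h) \<in> triangles C ==> iso X X' a ==> iso Y Y' b ==> iso Z Z' c ==>
      mor X' Y' f' ==> mor Y' Z' g' ==> mor Z' (shift C 1 X') h' ==>
      f' \<cdot> a = b \<cdot> f ==> g' \<cdot> b = c \<cdot> g ==> h' \<cdot> c = sg a \<cdot> h ==> (X', Y', Z', f', g', h') \<in> triangles C"
    and ex_zero: "\<exists>Z. zero_object C Z"
    and tri_cone: "mor X Y f ==> \<exists>Z g h. (X, Y, Z, f, g, h) \<in> triangles C"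
    and tri_one: "X \<in> Obj C ==> \<exists>Z g h. zero_object C Z \<and> (X, X, Z, one X, g, h) \<in> triangles C"
    and tri_rot: "(X, Y, Z, f, g, h) \<in> triangles C ==> (Y, Z, shift C 1 X, g, h, neg (shift C 1 X) (shift C 1 Y) (sg f)) \<in> triangles C"
    and tri_fill: "(X, Y, Z, f, g, h) \<in> triangles C ==> (X', Y', Z', f', g', h') \<in> triangles C ==>
      mor X X' a ==> mor Y Y' b ==> b \<cdot> f = f' \<cdot> a ==> \<exists>c. mor Z Z' c \<and> c \<cdot> g = g' \<cdot> b \<and> h' \<cdot> c = sg a \<cdot> h"
    and tri_oct: "mor X Y f ==> mor Y Z g ==> \<exists>Z' X' Y' f1 f2 g1 g2 h1 h2 k1 k2 k3.
      (X, Y, Z', f, f1, f2) \<in> triangles C \<and> (Y, Z, X', g, g1, g2) \<in> triangles C \<and>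
      (X, Z, Y', g \<cdot> f, h1, h2) \<in> triangles C \<and> (Z', Y', X', k1, k2, k3) \<in> triangles C"

context tricat
begin

abbreviation sh where "sh n X \<equiv> shift C n X"
abbreviation tri where "tri X Y Z f g h \<equiv> (X, Y, Z, f, g, h) \<in> triangles C"

lemma triD: "tri X Y Z f g h ==> mor X Y f" "tri X Y Z f g h ==> mor Y Z g" "tri X Y Z f g h ==> mor Z (sh 1 X) h"
  using tri_mor by blast+

lemma tri_obj: "tri X Y Z f g h ==> X \<in> Obj C" "tri X Y Z f g h ==> Y \<in> Obj C" "tri X Y Z f g h ==> Z \<in> Obj C"
  using tri_mor morD by blast+

section \<open>The shift on morphisms and on isomorphism classes\<close>

lemma sg_zero: "X \<in> Obj C ==> Y \<in> Obj C ==> sg (zr X Y) = zr (sh 1 X) (sh 1 Y)"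
proof -
  assume X: "X \<in> Obj C" "Y \<in> Obj C"
  note z = m0[OF X]
  have e: "sg (zr X Y) \<oplus>\<^bsub>HOM C (sh 1 X) (sh 1 Y)\<^esub> sg (zr X Y) = sg (zr X Y)"
    using sg_add[OF z z] az[OF z] by simp
  interpret A: abelian_group "HOM C (sh 1 X) (sh 1 Y)" by (intro Hom_ag shift_Obj X)
  show ?thesis using e morD(3)[OF sg_mor[OF z]] A.add.r_cancel_one' by metis
qed

lemma sg_eq_zero: "mor X Y f ==> sg f = zr (sh 1 X) (sh 1 Y) ==> f = zr X Y"
  using sg_zero[OF morD(1,2)] sg_inj[of X Y f "zr X Y"] m0[OF morD(1,2)] by auto

lemma sg_iso: "iso X Y f ==> iso (sh 1 X) (sh 1 Y) (sg f)"
proof -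
  assume "iso X Y f"
  then obtain g where g: "mor X Y f" "mor Y X g" "g \<cdot> f = one X" "f \<cdot> g = one Y" by (rule isoE)
  show ?thesis
    by (rule isoI[OF sg_mor[OF g(1)] sg_mor[OF g(2)]]) (use g sg_cmp sg_one morD in metis)+
qed

text \<open>\<open>sg\<close> is full, so the inverse of \<open>sg f\<close> has a preimage; it is
  faithful, so both inverse identities can be checked after shifting.\<close>

lemma sg_iso_refl:
  assumes "mor X Y f" "iso (sh 1 X) (sh 1 Y) (sg f)"
  shows "iso X Y f"
proof -
  note X = morD(1,2)[OF assms(1)]
  obtain h where h: "mor (sh 1 Y) (sh 1 X) h" "h \<cdot> sg f = one (sh 1 X)" "sg f \<cdot> h = one (sh 1 Y)" using assms(2) by (rule isoE)
  obtain g where g: "mor Y X g" "sg g = h" using sg_surj[OF X(2,1) h(1)] by blast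
  show ?thesis
  proof (rule isoI[OF assms(1) g(1)])
    show "g \<cdot> f = one X"
      by (rule sg_inj[OF mc[OF assms(1) g(1)] m1[OF X(1)]]) (use sg_cmp[OF assms(1) g(1)] g(2) h(2) sg_one[OF X(1)] in simp)
    show "f \<cdot> g = one Y"
      by (rule sg_inj[OF mc[OF g(1) assms(1)] m1[OF X(2)]]) (use sg_cmp[OF g(1) assms(1)] g(2) h(3) sg_one[OF X(2)] in simp)
  qed
qed

lemma isomorphic_shift1_iff: "X \<in> Obj C ==> Y \<in> Obj C ==> isomorphic C (sh 1 X) (sh 1 Y) \<longleftrightarrow> isomorphic C X Y"
proof
  assume o: "X \<in> Obj C" "Y \<in> Obj C" and "isomorphic C (sh 1 X) (sh 1 Y)"
  then obtain h where h: "iso (sh 1 X) (sh 1 Y) h" unfolding isomorphic_def by blast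
  obtain g where g: "mor X Y g" "sg g = h" using sg_surj[OF o iso_mor[OF h]] by blast
  show "isomorphic C X Y" using sg_iso_refl[OF g(1)] g(2) h unfolding isomorphic_def by blast
qed (use sg_iso in \<open>auto simp: isomorphic_def\<close>)

lemma shift_cancel: "X \<in> Obj C ==> isomorphic C (sh (- n) (sh n X)) X" "X \<in> Obj C ==> isomorphic C (sh n (sh (- n) X)) X"
  "X \<in> Obj C ==> isomorphic C (sh (- 1) (sh 1 X)) X" "X \<in> Obj C ==> isomorphic C (sh 1 (sh (- 1) X)) X"
  using shift_shift[of X "- n" n] shift_shift[of X n "- n"] shift_shift[of X "- 1" 1] shift_shift[of X 1 "- 1"] by (simp_all add: shift_zero)

lemma isomorphic_shiftm1:
  assumes "isomorphic C X Y"
  shows "isomorphic C (sh (- 1) X) (sh (- 1) Y)"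
proof -
  note o = isomorphic_Obj[OF assms]
  have "isomorphic C (sh 1 (sh (- 1) X)) (sh 1 (sh (- 1) Y))"
    using isomorphic_trans[OF isomorphic_trans[OF shift_cancel(4)[OF o(1)] assms] isomorphic_sym[OF shift_cancel(4)[OF o(2)]]] .
  thus ?thesis using isomorphic_shift1_iff shift_Obj o by blast
qed

lemma isomorphic_shift:
  assumes "isomorphic C X Y"
  shows "isomorphic C (sh n X) (sh n Y)"
proof (induction n rule: int_induct[of _ 0])
  case base
  show ?case using assms isomorphic_Obj[OF assms] by (simp add: shift_zero)
next
  case (step1 i)
  note o = isomorphic_Obj[OF assms]
  have "isomorphic C (sh 1 (sh i X)) (sh 1 (sh i Y))" using isomorphic_shift1_iff step1 shift_Obj o by blast
  from isomorphic_trans[OF isomorphic_sym[OF shift_shift[OF o(1), of 1 i]] isomorphic_trans[OF this shift_shift[OF o(2), of 1 i]]]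
  show ?case .
next
  case (step2 i)
  note o = isomorphic_Obj[OF assms]
  have "isomorphic C (sh (- 1) (sh i X)) (sh (- 1) (sh i Y))" using isomorphic_shiftm1 step2 by blast
  from isomorphic_trans[OF isomorphic_sym[OF shift_shift[OF o(1), of "- 1" i]] isomorphic_trans[OF this shift_shift[OF o(2), of "- 1" i]]]
  show ?case by simp
qed

subsection \<open>Exactness\<close>

text \<open>Filling the square from the identity triangle of X to the given triangle makes g f
  factor through the zero vertex of the former.\<close>

lemma tri_comp_zero:
  assumes t: "tri X Y Z f g h"
  shows "g \<cdot> f = zr X Z"
proof -
  note m = triD[OF t] and o = tri_obj[OF t]
  obtain Z0 g0 h0 where z: "zero_object C Z0" "tri X X Z0 (one X) g0 h0" using tri_one[OF o(1)] by blast
  obtain c where c: "mor Z0 Z c" "c \<cdot> g0 = g \<cdot> f"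
    using tri_fill[OF z(2) t m1[OF o(1)] m(1)] by auto
  have "g0 = zr X Z0" using zero_objD(3)[OF z(1) triD(2)[OF z(2)]] .
  thus ?thesis using c cz[OF c(1) o(1)] by simp
qed

lemma tri_comp_zero2: "tri X Y Z f g h ==> h \<cdot> g = zr Y (sh 1 X)"
  using tri_comp_zero[OF tri_rot] .

lemma neg_eq_zero: "mor X Y f ==> neg X Y f = zr X Y ==> f = zr X Y"
  using nn n0 morD by metis

lemma tri_comp_zero3:
  assumes t: "tri X Y Z f g h"
  shows "sg f \<cdot> h = zr Z (sh 1 Y)"
proof -
  have "neg (sh 1 X) (sh 1 Y) (sg f) \<cdot> h = zr Z (sh 1 Y)" by (rule tri_comp_zero2[OF tri_rot[OF t]])
  thus ?thesis using nc[OF triD(3)[OF t] sg_mor[OF triD(1)[OF t]]] neg_eq_zero[OF mc[OF triD(3)[OF t] sg_mor[OF triD(1)[OF t]]]] by simp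
qed

text \<open>Comparing the rotated identity triangle of W with the rotated given triangle produces a
  filler Sigma W -> Sigma X, which desuspends to the lift. The signs that rotation puts on the two
  third morphisms cancel.\<close>

lemma exact_left:
  assumes t: "tri X Y Z f g h" and u: "mor W Y u" and 0: "g \<cdot> u = zr W Z"
  obtains v where "mor W X v" "f \<cdot> v = u"
proof -
  note m = triD[OF t] and o = tri_obj[OF t] and W = morD(1)[OF u]
  obtain Z0 g0 h0 where z: "zero_object C Z0" "tri W W Z0 (one W) g0 h0" using tri_one[OF W] by blast
  note r = tri_rot[OF z(2)]
  have "zr Z0 Z \<cdot> g0 = g \<cdot> u" using 0 zc[OF triD(2)[OF z(2)] o(3)] by simp
  then obtain c where c: "mor (sh 1 W) (sh 1 X) c" "neg (sh 1 X) (sh 1 Y) (sg f) \<cdot> c = sg u \<cdot> neg (sh 1 W) (sh 1 W) (sg (one W))"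
    using tri_fill[OF r tri_rot[OF t] u m0[OF zero_objD(1)[OF z(1)] o(3)]] by auto
  obtain v where v: "mor W X v" "sg v = c" using sg_surj[OF W o(1) c(1)] by blast
  note s1 = m1[OF shift_Obj[OF W, of 1]]
  have "neg (sh 1 W) (sh 1 Y) (sg f \<cdot> c) = neg (sh 1 W) (sh 1 Y) (sg u)"
    using c nc[OF c(1) sg_mor[OF m(1)]] cn[OF s1 sg_mor[OF u]] idr[OF sg_mor[OF u]] by (simp add: sg_one W)
  hence "sg f \<cdot> c = sg u" using nn[OF mc[OF c(1) sg_mor[OF m(1)]]] nn[OF sg_mor[OF u]] by metis
  hence "sg (f \<cdot> v) = sg u" using sg_cmp[OF v(1) m(1)] v(2) by simp
  thus thesis using that[OF v(1)] sg_inj[OF mc[OF v(1) m(1)] u] by blast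
qed

lemma exact_left2: "tri X Y Z f g h ==> mor W Z u ==> h \<cdot> u = zr W (sh 1 X) ==> (!!v. mor W Y v ==> g \<cdot> v = u ==> thesis) ==> thesis"
  using exact_left[OF tri_rot] by blast

lemma exact_left3:
  assumes t: "tri X Y Z f g h" and u: "mor W (sh 1 X) u" and 0: "sg f \<cdot> u = zr W (sh 1 Y)"
  obtains v where "mor W Z v" "h \<cdot> v = u"
proof -
  have "neg (sh 1 X) (sh 1 Y) (sg f) \<cdot> u = zr W (sh 1 Y)"
    using 0 nc[OF u sg_mor[OF triD(1)[OF t]]] n0[OF morD(1)[OF u] shift_Obj[OF tri_obj(2)[OF t]]] by simp
  thus thesis using exact_left2[OF tri_rot[OF t] u] that by blast
qed

text \<open>Counterpart of the axiom \<open>tri_one\<close>; it cannot be had by rotating backwards,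
  which is established only later from the five lemma. The cone map g of 0 -> W has a section s by
  exactness, and s g - 1 is killed by g, hence factors through 0.\<close>

lemma tri_zero_id:
  assumes "W \<in> Obj C"
  obtains Z0 f g h where "zero_object C Z0" "tri Z0 W W f (one W) h"
proof -
  obtain Z0 where z: "zero_object C Z0" using ex_zero by blast
  obtain Z g h where t: "tri Z0 W Z (zr Z0 W) g h" using tri_cone[OF m0[OF zero_objD(1)[OF z] assms]] by blast
  note m = triD[OF t] and o = tri_obj[OF t]
  have sz: "zero_object C (sh 1 Z0)"
    using sg_one[OF o(1)] sg_zero[OF o(1,1)] z shift_Obj[OF o(1)] by (simp add: zero_object_def)
  have "h \<cdot> one Z = zr Z (sh 1 Z0)" using idr[OF m(3)] zero_objD(3)[OF sz m(3)] by simp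
  then obtain s where s: "mor Z W s" "g \<cdot> s = one Z" by (rule exact_left2[OF t m1[OF o(3)]])
  have "s \<cdot> g = one W"
  proof -
    let ?d = "(s \<cdot> g) \<oplus>\<^bsub>HOM C W W\<^esub> neg W W (one W)"
    have sg: "mor W W (s \<cdot> g)" by (rule mc[OF m(2) s(1)])
    have d: "mor W W ?d" by (rule ma[OF sg mn[OF m1[OF assms]]])
    have "g \<cdot> ?d = g \<cdot> (s \<cdot> g) \<oplus>\<^bsub>HOM C W Z\<^esub> neg W Z (g \<cdot> one W)"
      using ca[OF sg mn[OF m1[OF assms]] m(2)] cn[OF m1[OF assms] m(2)] by simp
    also have "\<dots> = zr W Z" using asc[OF m(2) s(1) m(2)] s(2) idl[OF m(2)] idr[OF m(2)] diff_self[OF m(2)] by simp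
    finally obtain v where "mor W Z0 v" "zr Z0 W \<cdot> v = ?d" by (rule exact_left[OF t d])
    hence "?d = zr W W" using zc[OF _ assms] by metis
    thus ?thesis using diff_zero[OF sg m1[OF assms]] by blast
  qed
  hence i: "iso Z W s" using isoI[OF s(1) m(2)] s(2) by simp
  note o1 = iso_one[OF o(1)] iso_one[OF assms]
  have "tri Z0 W W (zr Z0 W) (one W) (h \<cdot> g)"
    by (rule tri_iso[OF t o1 i m(1) m1[OF assms] mc[OF m(2,3)]])
      (use idr[OF m(1)] idl[OF m(1)] idr[OF m1[OF assms]] \<open>s \<cdot> g = one W\<close> asc[OF s(1) m(2,3)] s(2) idr[OF m(3)] sg_one[OF o(1)] idl[OF m(3)] in simp_all)
  thus thesis using that z by blast
qed

text \<open>Dual to \<open>exact_left\<close>: the filler goes into the triangle 0 -> W -> W, whose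
  first vertex receives the zero morphism from X.\<close>

lemma exact_right:
  assumes t: "tri X Y Z f g h" and u: "mor Y W u" and 0: "u \<cdot> f = zr X W"
  obtains v where "mor Z W v" "v \<cdot> g = u"
proof -
  note m = triD[OF t] and o = tri_obj[OF t] and W = morD(2)[OF u]
  obtain Z0 f0 h0 where z: "zero_object C Z0" "tri Z0 W W f0 (one W) h0" by (rule tri_zero_id[OF W])
  have "u \<cdot> f = f0 \<cdot> zr X Z0" using 0 cz[OF triD(1)[OF z(2)] o(1)] by simp
  then obtain c where "mor Z W c" "c \<cdot> g = one W \<cdot> u"
    using tri_fill[OF t z(2) m0[OF o(1) zero_objD(1)[OF z(1)]] u] by auto
  thus thesis using that idl[OF u] by simp
qed

lemma exact_right2: "tri X Y Z f g h ==> mor Z W u ==> u \<cdot> g = zr Y W ==> (!!v. mor (sh 1 X) W v ==> v \<cdot> h = u ==> thesis) ==> thesis"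
  using exact_right[OF tri_rot] by blast

text \<open>A direct chase: morphisms killed by c vanish, and a right inverse of c is built by
  correcting a first approximation. Then c (w c - 1) = 0 forces w c = 1.\<close>

lemma five_iso:
  assumes t: "tri X Y Z f g h" and t': "tri X' Y' Z' f' g' h'" and a: "iso X X' a" and b: "iso Y Y' b" and c: "mor Z Z' c"
    and e: "b \<cdot> f = f' \<cdot> a" "c \<cdot> g = g' \<cdot> b" "h' \<cdot> c = sg a \<cdot> h"
  shows "iso Z Z' c"
proof -
  note m = triD[OF t] and o = tri_obj[OF t] and m' = triD[OF t'] and o' = tri_obj[OF t']
  obtain a' where a': "mor X X' a" "mor X' X a'" "a' \<cdot> a = one X" "a \<cdot> a' = one X'" "iso X' X a'" using a by (rule isoE)
  obtain b' where b': "mor Y Y' b" "mor Y' Y b'" "b' \<cdot> b = one Y" "b \<cdot> b' = one Y'" using b by (rule isoE)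
  note sa = sg_mor[OF a'(1)] and sa' = sg_mor[OF a'(2)] and sb = sg_mor[OF b'(1)] and sf = sg_mor[OF m(1)] and sf' = sg_mor[OF m'(1)]
  have f': "f \<cdot> a' = b' \<cdot> f'"
  proof (rule iso_cancel_right[OF a mc[OF a'(2) m(1)] mc[OF m'(1) b'(2)]], rule iso_cancel_left[OF b])
    show "mor X Y ((f \<cdot> a') \<cdot> a)" "mor X Y ((b' \<cdot> f') \<cdot> a)" using mc[OF a'(1) mc[OF a'(2) m(1)]] mc[OF a'(1) mc[OF m'(1) b'(2)]] .
    have "(f \<cdot> a') \<cdot> a = f" using asc[OF a'(1,2) m(1)] a'(3) idr[OF m(1)] by simp
    moreover have "(b' \<cdot> f') \<cdot> a = b' \<cdot> (b \<cdot> f)" using asc[OF a'(1) m'(1) b'(2)] e(1) by simp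
    moreover have "\<dots> = f" using asc[OF m(1) b'(1,2)] b'(3) idl[OF m(1)] by simp
    ultimately show "b \<cdot> ((f \<cdot> a') \<cdot> a) = b \<cdot> ((b' \<cdot> f') \<cdot> a)" by simp
  qed
  have mono: "u = zr W Z" if u: "mor W Z u" "c \<cdot> u = zr W Z'" for W u
  proof -
    note W = morD(1)[OF u(1)]
    have "sg a \<cdot> (h \<cdot> u) = zr W (sh 1 X')"
      using asc[OF u(1) m(3) sa] asc[OF u(1) c m'(3)] e(3) u(2) cz[OF m'(3) W] by simp
    hence "h \<cdot> u = zr W (sh 1 X)"
      by (intro iso_cancel_left[OF sg_iso[OF a] mc[OF u(1) m(3)] m0[OF W shift_Obj[OF o(1)]]]) (simp add: cz[OF sa W])
    then obtain v where v: "mor W Y v" "g \<cdot> v = u" by (rule exact_left2[OF t u(1)])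
    note bv = mc[OF v(1) b'(1)]
    have "g' \<cdot> (b \<cdot> v) = zr W Z'" using asc[OF v(1) b'(1) m'(2)] asc[OF v(1) m(2) c] e(2) v(2) u(2) by simp
    then obtain w where w: "mor W X' w" "f' \<cdot> w = b \<cdot> v" by (rule exact_left[OF t' bv])
    have "v = b' \<cdot> (f' \<cdot> w)" using w(2) asc[OF v(1) b'(1,2)] b'(3) idl[OF v(1)] by simp
    also have "\<dots> = f \<cdot> (a' \<cdot> w)" using asc[OF w(1) m'(1) b'(2)] asc[OF w(1) a'(2) m(1)] f' by simp
    finally have "u = (g \<cdot> f) \<cdot> (a' \<cdot> w)" using v(2) asc[OF mc[OF w(1) a'(2)] m(1,2)] by simp
    thus ?thesis using tri_comp_zero[OF t] zc[OF mc[OF w(1) a'(2)] o(3)] by simp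
  qed
  have "sg f \<cdot> (sg a' \<cdot> h') = zr Z' (sh 1 Y)"
  proof -
    have "sg f \<cdot> (sg a' \<cdot> h') = sg b' \<cdot> (sg f' \<cdot> h')"
      using asc[OF m'(3) sa' sf] asc[OF m'(3) sf' sg_mor[OF b'(2)]] sg_cmp[OF a'(2) m(1)] sg_cmp[OF m'(1) b'(2)] f' by simp
    thus ?thesis using tri_comp_zero3[OF t'] cz[OF sg_mor[OF b'(2)] o'(3)] by simp
  qed
  \<comment> \<open>First approximation to the inverse: c u and the identity agree after composition
    with h'.\<close>
  then obtain u where u: "mor Z' Z u" "h \<cdot> u = sg a' \<cdot> h'" by (rule exact_left3[OF t mc[OF m'(3) sa']])
  note cu = mc[OF u(1) c] and i1 = m1[OF o'(3)]
  let ?d = "one Z' \<oplus>\<^bsub>HOM C Z' Z'\<^esub> neg Z' Z' (c \<cdot> u)"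
  have d: "mor Z' Z' ?d" by (rule ma[OF i1 mn[OF cu]])
  have "h' \<cdot> (c \<cdot> u) = h'"
    using asc[OF u(1) c m'(3)] e(3) asc[OF u(1) m(3) sa] u(2) asc[OF m'(3) sa' sa] sg_cmp[OF a'(2,1)] a'(4) sg_one[OF o'(1)] idl[OF m'(3)] by simp
  hence "h' \<cdot> ?d = zr Z' (sh 1 X')"
    using ca[OF i1 mn[OF cu] m'(3)] cn[OF cu m'(3)] idr[OF m'(3)] diff_self[OF m'(3)] by simp
  then obtain v where v: "mor Z' Y' v" "g' \<cdot> v = ?d" by (rule exact_left2[OF t' d])
  note b'v = mc[OF v(1) b'(2)]
  \<comment> \<open>The defect 1 - c u is g' v, and c carries g b' v to exactly this defect.\<close>
  let ?w = "u \<oplus>\<^bsub>HOM C Z' Z\<^esub> g \<cdot> (b' \<cdot> v)"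
  have w: "mor Z' Z ?w" by (rule ma[OF u(1) mc[OF b'v m(2)]])
  have "c \<cdot> (g \<cdot> (b' \<cdot> v)) = ?d"
    using asc[OF b'v m(2) c] e(2) asc[OF b'v b'(1) m'(2)] asc[OF v(1) b'(2,1)] b'(4) idl[OF v(1)] v(2) by simp
  hence "c \<cdot> ?w = c \<cdot> u \<oplus>\<^bsub>HOM C Z' Z'\<^esub> ?d" using ca[OF u(1) mc[OF b'v m(2)] c] by simp
  also have "\<dots> = one Z'"
    using cu i1
      abelian_monoid.a_lcomm[OF abelian_group.axioms(1)[OF Hom_ag[OF o'(3,3)]], of "c \<cdot> u" "one Z'" "neg Z' Z' (c \<cdot> u)"]
      diff_self[OF cu] az[OF i1] mn[OF cu] by (simp add: mor_def)
  finally have cw: "c \<cdot> ?w = one Z'" .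
  have "?w \<cdot> c = one Z"
  proof (rule diff_zero[OF mc[OF c w] m1[OF o(3)]], rule mono)
    note wc = mc[OF c w] and i = m1[OF o(3)]
    show "mor Z Z ((?w \<cdot> c) \<oplus>\<^bsub>HOM C Z Z\<^esub> neg Z Z (one Z))" by (rule ma[OF wc mn[OF i]])
    show "c \<cdot> ((?w \<cdot> c) \<oplus>\<^bsub>HOM C Z Z\<^esub> neg Z Z (one Z)) = zr Z Z'"
      using ca[OF wc mn[OF i] c] cn[OF i c] asc[OF c w c] cw idl[OF c] idr[OF c] diff_self[OF c] by simp
  qed
  thus ?thesis using isoI[OF c w] cw by simp
qed

subsection \<open>Triangles without their morphisms\<close>

text \<open>Filtrations only need that a triangle exists. Without its morphisms the relation is
  invariant under replacing each vertex by an isomorphic object, and all signs disappear.\<close>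

definition T where "T X Y Z \<longleftrightarrow> (\<exists>f g h. tri X Y Z f g h)"

lemma T_Obj: "T X Y Z ==> X \<in> Obj C" "T X Y Z ==> Y \<in> Obj C" "T X Y Z ==> Z \<in> Obj C"
  using tri_obj by (auto simp: T_def)

lemma cone_unique:
  assumes t: "tri X Y Z f g h" and t': "tri X Y' Z' f' g' h'" and b: "iso Y Y' b" and e: "b \<cdot> f = f'"
  shows "isomorphic C Z Z'"
proof -
  note o = tri_obj[OF t] and m = triD[OF t] and m' = triD[OF t']
  have e': "b \<cdot> f = f' \<cdot> one X" using e idr[OF m'(1)] by simp
  then obtain c where "mor Z Z' c" "c \<cdot> g = g' \<cdot> b" "h' \<cdot> c = sg (one X) \<cdot> h"
    using tri_fill[OF t t' m1[OF o(1)] iso_mor[OF b]] by auto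
  thus ?thesis using five_iso[OF t t' iso_one[OF o(1)] b _ e'] by (auto simp: isomorphic_def)
qed

lemma T_iso:
  assumes "T X Y Z" "isomorphic C X X'" "isomorphic C Y Y'" "isomorphic C Z Z'"
  shows "T X' Y' Z'"
proof -
  obtain f g h where t: "tri X Y Z f g h" using assms(1) by (auto simp: T_def)
  note m = triD[OF t]
  obtain a b c where abc: "iso X X' a" "iso Y Y' b" "iso Z Z' c" using assms(2-4) by (auto simp: isomorphic_def)
  obtain a' where a: "mor X X' a" "mor X' X a'" "a' \<cdot> a = one X" using abc(1) by (rule isoE)
  obtain b' where b: "mor Y Y' b" "mor Y' Y b'" "b' \<cdot> b = one Y" using abc(2) by (rule isoE)
  obtain c' where c: "mor Z Z' c" "mor Z' Z c'" "c' \<cdot> c = one Z" using abc(3) by (rule isoE)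
  have cancel: "(u \<cdot> v') \<cdot> v = u" if "mor V V' v" "mor V' V v'" "v' \<cdot> v = one V" "mor V W u" for u v v' V V' W
    using asc[OF that(1,2,4)] that(3) idr[OF that(4)] by simp
  show ?thesis unfolding T_def
    by (intro exI, rule tri_iso[OF t abc mc[OF a(2) mc[OF m(1) b(1)]] mc[OF b(2) mc[OF m(2) c(1)]] mc[OF c(2) mc[OF m(3) sg_mor[OF a(1)]]]])
       (use cancel[OF a mc[OF m(1) b(1)]] cancel[OF b mc[OF m(2) c(1)]] cancel[OF c mc[OF m(3) sg_mor[OF a(1)]]] in simp_all)
qed

lemma T_iso1: "T X Y Z ==> isomorphic C X X' ==> T X' Y Z"
  and T_iso2: "T X Y Z ==> isomorphic C Y Y' ==> T X Y' Z"
  and T_iso3: "T X Y Z ==> isomorphic C Z Z' ==> T X Y Z'"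
  using T_iso isomorphic_refl[OF T_Obj(1)] isomorphic_refl[OF T_Obj(2)] isomorphic_refl[OF T_Obj(3)] by blast+

lemma T_rot: "T X Y Z ==> T Y Z (sh 1 X)"
  unfolding T_def using tri_rot by blast

text \<open>As the shift is invertible only up to isomorphism, h is first composed with Sigma
  Sigma^(-1) Z -> Z and then desuspended to u. The cone of u, rotated three times, is compared with
  the given triangle rotated twice.\<close>

lemma T_rot':
  assumes "T X Y Z"
  shows "T (sh (- 1) Z) X Y"
proof -
  obtain f g h where t: "tri X Y Z f g h" using assms by (auto simp: T_def)
  note m = triD[OF t] and o = tri_obj[OF t]
  let ?Z = "sh (- 1) Z"
  have oZ: "?Z \<in> Obj C" by (rule shift_Obj[OF o(3)])
  obtain c where c: "iso (sh 1 ?Z) Z c" using shift_cancel(4)[OF o(3)] by (auto simp: isomorphic_def)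
  note cm = iso_mor[OF c]
  obtain u where u: "mor ?Z X u" "sg u = h \<cdot> c" using sg_surj[OF oZ o(1) mc[OF cm m(3)]] by blast
  obtain W v w where W: "tri ?Z X W u v w" using tri_cone[OF u(1)] by blast
  note r = tri_rot[OF tri_rot[OF tri_rot[OF W]]] and r' = tri_rot[OF tri_rot[OF t]]
  have nsu: "mor (sh 1 ?Z) (sh 1 X) (neg (sh 1 ?Z) (sh 1 X) (sg u))" by (rule mn[OF sg_mor[OF u(1)]])
  \<comment> \<open>Three rotations put a minus sign on u, so the comparison of the first vertices
    is -c instead of c.\<close>
  obtain n where n: "iso (sh 1 ?Z) Z n" "h \<cdot> n = neg (sh 1 ?Z) (sh 1 X) (sg u)"
  proof -
    let ?n = "neg (sh 1 ?Z) Z c"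
    obtain c' where c': "mor Z (sh 1 ?Z) c'" "c' \<cdot> c = one (sh 1 ?Z)" "c \<cdot> c' = one Z" using c by (rule isoE)
    let ?n' = "neg Z (sh 1 ?Z) c'"
    have "iso (sh 1 ?Z) Z ?n"
      by (rule isoI[OF mn[OF cm] mn[OF c'(1)]])
        (use c' cn[OF cm mn[OF c'(1)]] nc[OF cm c'(1)] nn[OF mc[OF cm c'(1)]] cn[OF c'(1) mn[OF cm]] nc[OF c'(1) cm] nn[OF mc[OF c'(1) cm]] in simp_all)
    thus thesis using that cn[OF cm m(3)] u(2) by simp
  qed
  have one: "iso (sh 1 X) (sh 1 X) (one (sh 1 X))" by (rule iso_one[OF shift_Obj[OF o(1)]])
  have e: "one (sh 1 X) \<cdot> neg (sh 1 ?Z) (sh 1 X) (sg u) = h \<cdot> n" using n(2) idl[OF nsu] by simp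
  obtain d where d: "mor (sh 1 W) (sh 1 Y) d"
    "d \<cdot> neg (sh 1 X) (sh 1 W) (sg v) = neg (sh 1 X) (sh 1 Y) (sg f) \<cdot> one (sh 1 X)"
    "neg (sh 1 Y) (sh 1 Z) (sg g) \<cdot> d = sg n \<cdot> neg (sh 1 W) (sh 1 (sh 1 ?Z)) (sg w)"
    using tri_fill[OF r r' iso_mor[OF n(1)] iso_mor[OF one] e] by blast
  have "isomorphic C (sh 1 W) (sh 1 Y)" using five_iso[OF r r' n(1) one d(1) e d(2,3)] by (auto simp: isomorphic_def)
  hence "isomorphic C W Y" using isomorphic_shift1_iff[OF tri_obj(3)[OF W] o(2)] by simp
  moreover have "T ?Z X W" using W by (auto simp: T_def)
  ultimately show ?thesis using T_iso3 by blast
qed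

lemma T_shift:
  assumes "T X Y Z"
  shows "T (sh n X) (sh n Y) (sh n Z)"
proof (induction n rule: int_induct[of _ 0])
  case base
  show ?case using assms T_Obj[OF assms] by (simp add: shift_zero)
next
  case (step1 i)
  \<comment> \<open>Three rotations amount to a shift by one.\<close>
  from T_rot[OF T_rot[OF T_rot[OF this(2)]]]
  have "T (sh 1 (sh i X)) (sh 1 (sh i Y)) (sh 1 (sh i Z))" .
  thus ?case by (rule T_iso) (use T_Obj[OF assms] shift_shift in blast)+
next
  case (step2 i)
  from T_rot'[OF T_rot'[OF T_rot'[OF this(2)]]]
  have "T (sh (- 1) (sh i X)) (sh (- 1) (sh i Y)) (sh (- 1) (sh i Z))" .
  thus ?case by (rule T_iso) (use T_Obj[OF assms] shift_shift[of _ "- 1" i] in auto)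
qed

lemma zero_shift1: "zero_object C X ==> zero_object C (sh 1 X)"
  using sg_one[of X] sg_zero[of X X] shift_Obj[of X 1] by (auto simp: zero_object_def)

text \<open>Comparison with X -> 0 -> Sigma X, the rotated identity triangle of X.\<close>

lemma T_zero2:
  assumes "T X Y Z" "zero_object C Y"
  shows "isomorphic C Z (sh 1 X)"
proof -
  obtain f g h where t: "tri X Y Z f g h" using assms by (auto simp: T_def)
  note o = tri_obj[OF t]
  obtain Y' g' h' where z: "zero_object C Y'" "tri X X Y' (one X) g' h'" using tri_one[OF o(1)] by blast
  show ?thesis
    by (rule cone_unique[OF t tri_rot[OF z(2)] zero_obj_iso[OF assms(2) z(1)]])
      (use zc[OF triD(1)[OF t]] zero_objD[OF z(1)] triD(2)[OF z(2)] zero_obj_iso[OF assms(2) z(1)] in auto)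
qed

lemma T_zero3: "T X Y Z ==> zero_object C Z ==> isomorphic C X Y"
  using T_zero2[OF T_rot] isomorphic_shift1_iff[OF T_Obj(1,2)] isomorphic_sym by metis

lemma T_zero1: "T X Y Z ==> zero_object C X ==> isomorphic C Y Z"
  using T_zero3[OF T_rot zero_shift1] .

lemma T_zeroI3: "isomorphic C X Y ==> zero_object C Z ==> T X Y Z"
proof -
  assume i: "isomorphic C X Y" and z: "zero_object C Z"
  obtain Z' g h where "zero_object C Z'" "tri X X Z' (one X) g h" using tri_one isomorphic_Obj[OF i] by blast
  thus ?thesis using T_iso[of X X Z' X Y Z] i z zero_obj_iso[of Z' Z] isomorphic_refl[OF isomorphic_Obj(1)[OF i]]
    by (auto simp: T_def isomorphic_def)
qed

lemma zero_shift: "zero_object C X ==> zero_object C (sh n X)"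
proof (induction n rule: int_induct[of _ 0])
  case base
  thus ?case by (simp add: shift_zero zero_objD)
next
  case (step1 i)
  thus ?case using zero_obj_isomorphic[OF zero_shift1 shift_shift[OF zero_objD(1), of X 1 i]] by simp
next
  case (step2 i)
  note o = zero_objD(1)[OF step2(3)]
  note z = step2(2)[OF step2(3)]
  have "T (sh i X) (sh i X) (sh i X)" using T_zeroI3[OF isomorphic_refl] z zero_objD(1) by blast
  hence "isomorphic C (sh (- 1) (sh i X)) (sh i X)" using T_zero3[OF T_rot'] z by blast
  hence "zero_object C (sh (- 1) (sh i X))" using zero_obj_isomorphic[OF z] isomorphic_sym by blast
  thus ?case using zero_obj_isomorphic[OF _ shift_shift[OF o, of "- 1" i]] by simp
qed

lemma T_zeroI1: "isomorphic C Y Z ==> zero_object C X ==> T X Y Z"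
proof -
  assume i: "isomorphic C Y Z" and z: "zero_object C X"
  note z1 = zero_shift[OF z]
  have "T (sh (- 1) (sh 1 X)) Y Z" using T_rot'[OF T_zeroI3[OF i z1]] .
  thus ?thesis using T_iso1 shift_cancel(3)[OF zero_objD(1)[OF z]] by blast
qed

text \<open>Read triangles as inclusions X in Y in Z: the quotient W = Z/X is an extension of N =
  Z/Y by Y' = Y/X. This is the octahedral axiom after identification of the cones.\<close>

lemma T_assoc1:
  assumes "T X Y Y'" "T Y Z N"
  obtains W where "T X Z W" "T Y' W N"
proof -
  obtain f f1 f2 where f: "tri X Y Y' f f1 f2" using assms(1) by (auto simp: T_def)
  obtain g g1 g2 where g: "tri Y Z N g g1 g2" using assms(2) by (auto simp: T_def)
  obtain Z' X' W x1 x2 y1 y2 h1 h2 k1 k2 k3 where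
    t: "tri X Y Z' f x1 x2" "tri Y Z X' g y1 y2" "tri X Z W (g \<cdot> f) h1 h2" "tri Z' W X' k1 k2 k3"
    using tri_oct[OF triD(1)[OF f] triD(1)[OF g]] by blast
  note o = tri_obj[OF g]
  have i: "isomorphic C Z' Y'" "isomorphic C X' N"
    using cone_unique[OF t(1) f iso_one[OF o(1)]] cone_unique[OF t(2) g iso_one[OF o(2)]] idl[OF triD(1)[OF f]] idl[OF triD(1)[OF g]] by simp_all
  have "T Y' W N" by (rule T_iso[OF _ i(1) isomorphic_refl[OF tri_obj(2)[OF t(4)]] i(2)]) (use t(4) in \<open>auto simp: T_def\<close>)
  moreover have "T X Z W" using t(3) by (auto simp: T_def)
  ultimately show thesis using that by blast
qed

text \<open>Here W is the preimage in Y of Y1, a subobject of Y' = Y/X. It comes from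
  \<open>T_assoc1\<close> for the rotated triangles, followed by the shift by -1.\<close>

lemma T_assoc2:
  assumes "T X Y Y'" "T Y1 Y' Z"
  obtains W where "T X W Y1" "T W Y Z"
proof -
  note o = T_Obj[OF assms(1)] T_Obj[OF assms(2)]
  obtain W where W: "T Y Z W" "T (sh 1 X) W (sh 1 Y1)" using T_assoc1[OF T_rot[OF assms(1)] T_rot[OF assms(2)]] .
  have "T (sh (- 1) (sh 1 X)) (sh (- 1) W) (sh (- 1) (sh 1 Y1))" using T_shift[OF W(2)] .
  hence "T X (sh (- 1) W) Y1"
    by (rule T_iso) (use o shift_cancel(3) isomorphic_refl[OF shift_Obj[OF T_Obj(3)[OF W(1)]]] in blast)+
  thus thesis using that T_rot'[OF W(1)] by blast
qed

subsection \<open>Split triangles\<close>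

text \<open>A zero connecting morphism gives a section s of g and makes f left-cancellable; writing
  1 - s g = f r yields a retraction r of f. The second claim identifies the cone of s with X; it is
  what allows two factors of a filtration to trade places.\<close>

lemma split_triangle:
  assumes t: "tri X Y Z f g (zr Z (sh 1 X))"
  shows "biproduct C X Z Y" "T Z Y X"
proof -
  note m = triD[OF t] and o = tri_obj[OF t]
  obtain s where s: "mor Z Y s" "g \<cdot> s = one Z"
    using exact_left2[OF t m1[OF o(3)]] idr[OF m(3)] by metis
  note sg' = mc[OF m(2) s(1)] and i = m1[OF o(2)]
  let ?e = "one Y \<oplus>\<^bsub>HOM C Y Y\<^esub> neg Y Y (s \<cdot> g)"
  have e: "mor Y Y ?e" by (rule ma[OF i mn[OF sg']])
  have gs: "g \<cdot> (s \<cdot> g) = g" using asc[OF m(2) s(1) m(2)] s(2) idl[OF m(2)] by simp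
  have "g \<cdot> ?e = zr Y Z"
    using ca[OF i mn[OF sg'] m(2)] cn[OF sg' m(2)] gs idr[OF m(2)] diff_self[OF m(2)] by simp
  then obtain r where r: "mor Y X r" "f \<cdot> r = ?e" by (rule exact_left[OF t e])
  have mono: "u = zr W X" if u: "mor W X u" "f \<cdot> u = zr W Y" for W u
  proof -
    note W = morD(1)[OF u(1)]
    have "sg f \<cdot> sg u = zr (sh 1 W) (sh 1 Y)" using sg_cmp[OF u(1) m(1)] u(2) sg_zero[OF W o(2)] by simp
    then obtain v where "mor (sh 1 W) Z v" "zr Z (sh 1 X) \<cdot> v = sg u" by (rule exact_left3[OF t sg_mor[OF u(1)]])
    hence "sg u = zr (sh 1 W) (sh 1 X)" using zc[OF _ shift_Obj[OF o(1)]] by metis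
    thus ?thesis using sg_eq_zero[OF u(1)] by simp
  qed
  have gf: "g \<cdot> f = zr X Z" by (rule tri_comp_zero[OF t])
  have rf: "r \<cdot> f = one X"
  proof (rule diff_zero[OF mc[OF m(1) r(1)] m1[OF o(1)]], rule mono)
    note rf = mc[OF m(1) r(1)]
    show "mor X X ((r \<cdot> f) \<oplus>\<^bsub>HOM C X X\<^esub> neg X X (one X))" by (rule ma[OF rf mn[OF m1[OF o(1)]]])
    have "f \<cdot> (r \<cdot> f) = ?e \<cdot> f" using asc[OF m(1) r(1) m(1)] r(2) by simp
    also have "\<dots> = f \<oplus>\<^bsub>HOM C X Y\<^esub> neg X Y ((s \<cdot> g) \<cdot> f)" using ac[OF m(1) i mn[OF sg']] nc[OF m(1) sg'] idl[OF m(1)] by simp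
    also have "\<dots> = f" using asc[OF m(1,2) s(1)] gf cz[OF s(1) o(1)] n0[OF o(1,2)] az[OF m(1)] by simp
    finally show "f \<cdot> ((r \<cdot> f) \<oplus>\<^bsub>HOM C X X\<^esub> neg X X (one X)) = zr X Y"
      using ca[OF rf mn[OF m1[OF o(1)]] m(1)] cn[OF m1[OF o(1)] m(1)] idr[OF m(1)] diff_self[OF m(1)] by simp
  qed
  have rs: "r \<cdot> s = zr Z X"
  proof (rule mono[OF mc[OF s(1) r(1)]])
    have "f \<cdot> (r \<cdot> s) = ?e \<cdot> s" using asc[OF s(1) r(1) m(1)] r(2) by simp
    also have "\<dots> = s \<oplus>\<^bsub>HOM C Z Y\<^esub> neg Z Y ((s \<cdot> g) \<cdot> s)" using ac[OF s(1) i mn[OF sg']] nc[OF s(1) sg'] idl[OF s(1)] by simp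
    also have "\<dots> = zr Z Y" using asc[OF s(1) m(2) s(1)] s(2) idr[OF s(1)] diff_self[OF s(1)] by simp
    finally show "f \<cdot> (r \<cdot> s) = zr Z Y" .
  qed
  have "f \<cdot> r \<oplus>\<^bsub>HOM C Y Y\<^esub> s \<cdot> g = one Y"
    using r(2) i sg' mn[OF sg'] abelian_group.l_neg[OF Hom_ag[OF o(2,2)], of "s \<cdot> g"]
      abelian_monoid.a_assoc[OF abelian_group.axioms(1)[OF Hom_ag[OF o(2,2)]], of "one Y" "neg Y Y (s \<cdot> g)" "s \<cdot> g"] az[OF i]
    by (simp add: mor_def)
  thus "biproduct C X Z Y" unfolding biproduct_def
    using o morD(3)[OF m(1)] morD(3)[OF s(1)] morD(3)[OF r(1)] morD(3)[OF m(2)] rf s(2) rs gf by blast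
  obtain W a b where w: "tri Z Y W s a b" using tri_cone[OF s(1)] by blast
  note wm = triD[OF w] and ow = tri_obj(3)[OF w]
  obtain v where v: "mor W X v" "v \<cdot> a = r" by (rule exact_right[OF w r(1) rs])
  \<comment> \<open>As g s = 1, the third morphism b of the triangle on s vanishes, so a morphism
    out of W is determined by its composite with a.\<close>
  have "sg g \<cdot> (sg s \<cdot> b) = zr W (sh 1 Z)" using tri_comp_zero3[OF w] cz[OF sg_mor[OF m(2)] ow] by simp
  hence b: "b = zr W (sh 1 Z)"
    using asc[OF wm(3) sg_mor[OF s(1)] sg_mor[OF m(2)]] sg_cmp[OF s(1) m(2)] s(2) sg_one[OF o(3)] idl[OF wm(3)] by simp
  note af = mc[OF m(1) wm(2)] and iW = m1[OF ow]
  note afv = mc[OF v(1) af]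
  have afva: "((a \<cdot> f) \<cdot> v) \<cdot> a = a"
  proof -
    have "((a \<cdot> f) \<cdot> v) \<cdot> a = a \<cdot> (f \<cdot> r)" using asc[OF wm(2) v(1) af] v(2) asc[OF r(1) m(1) wm(2)] by simp
    also have "\<dots> = a \<oplus>\<^bsub>HOM C Y W\<^esub> neg Y W (a \<cdot> (s \<cdot> g))"
      using r(2) ca[OF i mn[OF sg'] wm(2)] cn[OF sg' wm(2)] idr[OF wm(2)] by simp
    also have "\<dots> = a" using asc[OF m(2) s(1) wm(2)] tri_comp_zero[OF w] zc[OF m(2) ow] n0[OF o(2) ow] az[OF wm(2)] by simp
    finally show ?thesis .
  qed
  have "(a \<cdot> f) \<cdot> v = one W"
  proof (rule diff_zero[OF afv iW])
    let ?d = "((a \<cdot> f) \<cdot> v) \<oplus>\<^bsub>HOM C W W\<^esub> neg W W (one W)"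
    have "?d \<cdot> a = zr Y W" using ac[OF wm(2) afv mn[OF iW]] nc[OF wm(2) iW] idl[OF wm(2)] afva diff_self[OF wm(2)] by simp
    then obtain y where "mor (sh 1 Z) W y" "y \<cdot> b = ?d" by (rule exact_right2[OF w ma[OF afv mn[OF iW]]])
    thus "?d = zr W W" using b cz[OF _ ow] by metis
  qed
  moreover have "v \<cdot> (a \<cdot> f) = one X" using asc[OF m(1) wm(2) v(1)] v(2) rf by simp
  ultimately have "isomorphic C W X" using isoI[OF v(1) af] by (auto simp: isomorphic_def)
  moreover have "T Z Y W" using w by (auto simp: T_def)
  ultimately show "T Z Y X" using T_iso3 by blast
qed

text \<open>The triangle of the zero morphism Sigma^(-1) Z -> X, rotated once, has the required
  outer vertices.\<close>

lemma ex_split_triangle: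
  assumes "X \<in> Obj C" "Z \<in> Obj C"
  obtains Y f g where "tri X Y Z f g (zr Z (sh 1 X))"
proof -
  let ?Z = "sh (- 1) Z"
  have oZ: "?Z \<in> Obj C" using shift_Obj assms by blast
  obtain Y f h where t: "tri ?Z X Y (zr ?Z X) f h" using tri_cone[OF m0[OF oZ assms(1)]] by blast
  note r = tri_rot[OF t] and o = tri_obj[OF t]
  obtain c where c: "iso (sh 1 ?Z) Z c" using shift_cancel(4)[OF assms(2)] by (auto simp: isomorphic_def)
  have s: "sh 1 X \<in> Obj C" "sh 1 ?Z \<in> Obj C" using shift_Obj oZ assms(1) by blast+
  have "tri X Y Z f (c \<cdot> h) (zr Z (sh 1 X))"
    by (rule tri_iso[OF r iso_one[OF o(2)] iso_one[OF o(3)] c triD(1)[OF r] mc[OF triD(2)[OF r] iso_mor[OF c]] m0[OF assms(2) s(1)]])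
      (use idl[OF triD(1)[OF r]] idr[OF triD(1)[OF r]] idr[OF mc[OF triD(2)[OF r] iso_mor[OF c]]] zc[OF iso_mor[OF c] s(1)]
        sg_zero[OF oZ o(2)] n0[OF s(2,1)] sg_one[OF o(2)] idl[OF m0[OF s(2,1)]] in simp_all)
  thus thesis using that by blast
qed

subsection \<open>Vanishing of morphism spaces\<close>

definition Hz where "Hz X Y \<longleftrightarrow> X \<in> Obj C \<and> Y \<in> Obj C \<and> (\<forall>f. mor X Y f \<longrightarrow> f = zr X Y)"

lemma HzD: "Hz X Y ==> mor X Y f ==> f = zr X Y" and Hz_Obj: "Hz X Y ==> X \<in> Obj C" "Hz X Y ==> Y \<in> Obj C"
  by (auto simp: Hz_def)

lemma Hz_iff: "X \<in> Obj C ==> Y \<in> Obj C ==> Hz X Y \<longleftrightarrow> Hom C X Y = {zr X Y}"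
  using morD(3)[OF m0] unfolding Hz_def mor_def by blast

lemma Hz_iso:
  assumes "Hz X Y" "isomorphic C X X'" "isomorphic C Y Y'"
  shows "Hz X' Y'"
proof -
  note o = isomorphic_Obj[OF assms(2)] isomorphic_Obj[OF assms(3)]
  obtain a b where "iso X X' a" "iso Y Y' b" using assms(2,3) by (auto simp: isomorphic_def)
  from \<open>iso X X' a\<close> obtain a' where a: "mor X X' a" "mor X' X a'" "a \<cdot> a' = one X'" by (rule isoE)
  from \<open>iso Y Y' b\<close> obtain b' where b: "mor Y Y' b" "mor Y' Y b'" "b \<cdot> b' = one Y'" by (rule isoE)
  have "u = zr X' Y'" if u: "mor X' Y' u" for u
  proof -
    have "b' \<cdot> (u \<cdot> a) = zr X Y" using HzD[OF assms(1)] mc[OF mc[OF a(1) u] b(2)] by blast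
    hence "b \<cdot> (b' \<cdot> (u \<cdot> a)) = zr X Y'" using cz[OF b(1) o(1)] by simp
    hence "u \<cdot> a = zr X Y'" using asc[OF mc[OF a(1) u] b(2,1)] b(3) idl[OF mc[OF a(1) u]] by simp
    thus ?thesis using asc[OF a(2,1) u] a(3) idr[OF u] zc[OF a(2) o(4)] by simp
  qed
  thus ?thesis using o by (simp add: Hz_def)
qed

lemma Hz_iso2: "Hz X Y ==> isomorphic C Y Y' ==> Hz X Y'"
  using Hz_iso isomorphic_refl[OF Hz_Obj(1)] by blast

lemma Hz_shift1: "X \<in> Obj C ==> Y \<in> Obj C ==> Hz (sh 1 X) (sh 1 Y) \<longleftrightarrow> Hz X Y"
proof
  assume o: "X \<in> Obj C" "Y \<in> Obj C"
  show "Hz X Y" if "Hz (sh 1 X) (sh 1 Y)"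
    unfolding Hz_def using o HzD[OF that sg_mor] sg_eq_zero by blast
  show "Hz (sh 1 X) (sh 1 Y)" if h: "Hz X Y"
  proof -
    have "u = zr (sh 1 X) (sh 1 Y)" if u: "mor (sh 1 X) (sh 1 Y) u" for u
      using sg_surj[OF o u] HzD[OF h] sg_zero[OF o] by blast
    thus ?thesis using shift_Obj o by (simp add: Hz_def)
  qed
qed

lemma Hz_shift:
  assumes "X \<in> Obj C" "Y \<in> Obj C"
  shows "Hz (sh n X) (sh n Y) \<longleftrightarrow> Hz X Y"
proof (induction n rule: int_induct[of _ 0])
  case base
  show ?case using assms by (simp add: shift_zero)
next
  case (step1 i)
  note s = shift_shift[OF assms(1), of 1 i] shift_shift[OF assms(2), of 1 i]
  have "Hz (sh (i + 1) X) (sh (i + 1) Y) \<longleftrightarrow> Hz (sh 1 (sh i X)) (sh 1 (sh i Y))"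
    using Hz_iso[OF _ s] Hz_iso[OF _ isomorphic_sym[OF s(1)] isomorphic_sym[OF s(2)]] by blast
  thus ?case using step1 Hz_shift1 shift_Obj assms by simp
next
  case (step2 i)
  have s: "isomorphic C (sh 1 (sh (i - 1) Z)) (sh i Z)" if "Z \<in> Obj C" for Z
    using shift_shift[OF that, of 1 "i - 1"] by simp
  have "Hz (sh i X) (sh i Y) \<longleftrightarrow> Hz (sh 1 (sh (i - 1) X)) (sh 1 (sh (i - 1) Y))"
    using Hz_iso[OF _ s[OF assms(1)] s[OF assms(2)]]
      Hz_iso[OF _ isomorphic_sym[OF s[OF assms(1)]] isomorphic_sym[OF s[OF assms(2)]]] by blast
  thus ?case using step2 Hz_shift1 shift_Obj assms by simp
qed

lemma Hz_shift_iff: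
  assumes "X \<in> Obj C" "Y \<in> Obj C" "j - i = j' - i'"
  shows "Hz (sh i X) (sh j Y) \<longleftrightarrow> Hz (sh i' X) (sh j' Y)"
proof -
  let ?n = "i' - i"
  note s = shift_shift[OF assms(1), of ?n i] shift_shift[OF assms(2), of ?n j]
  have e: "i + ?n = i'" "j + ?n = j'" using assms(3) by auto
  have "Hz (sh i X) (sh j Y) \<longleftrightarrow> Hz (sh ?n (sh i X)) (sh ?n (sh j Y))" using Hz_shift shift_Obj assms by simp
  also have "\<dots> \<longleftrightarrow> Hz (sh i' X) (sh j' Y)"
    using Hz_iso[OF _ s] Hz_iso[OF _ isomorphic_sym[OF s(1)] isomorphic_sym[OF s(2)]] unfolding e by blast
  finally show ?thesis .
qed

lemma Hz_zero1: "zero_object C X ==> Y \<in> Obj C ==> Hz X Y" and Hz_zero2: "zero_object C Y ==> X \<in> Obj C ==> Hz X Y"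
  using zero_objD by (auto simp: Hz_def)

lemma Hz_self: "Hz X X ==> zero_object C X"
  using m1 by (auto simp: Hz_def zero_object_def)

lemma Hz_ext1: "T X Y Z ==> Hz X W ==> Hz Z W ==> Hz Y W"
proof -
  assume "T X Y Z" and h: "Hz X W" "Hz Z W"
  then obtain f g k where t: "tri X Y Z f g k" by (auto simp: T_def)
  have "u = zr Y W" if u: "mor Y W u" for u
  proof -
    have "u \<cdot> f = zr X W" using HzD[OF h(1) mc[OF triD(1)[OF t] u]] .
    then obtain v where v: "mor Z W v" "v \<cdot> g = u" by (rule exact_right[OF t u])
    thus ?thesis using HzD[OF h(2) v(1)] zc[OF triD(2)[OF t] Hz_Obj(2)[OF h(1)]] by simp
  qed
  thus ?thesis unfolding Hz_def using tri_obj(2)[OF t] Hz_Obj(2)[OF h(1)] by blast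
qed

lemma Hz_ext2: "T X Y Z ==> Hz W X ==> Hz W Z ==> Hz W Y"
proof -
  assume "T X Y Z" and h: "Hz W X" "Hz W Z"
  then obtain f g k where t: "tri X Y Z f g k" by (auto simp: T_def)
  have "u = zr W Y" if u: "mor W Y u" for u
  proof -
    have "g \<cdot> u = zr W Z" using HzD[OF h(2) mc[OF u triD(2)[OF t]]] .
    then obtain v where v: "mor W X v" "f \<cdot> v = u" by (rule exact_left[OF t u])
    thus ?thesis using HzD[OF h(1) v(1)] cz[OF triD(1)[OF t] Hz_Obj(1)[OF h(1)]] by simp
  qed
  thus ?thesis unfolding Hz_def using tri_obj(2)[OF t] Hz_Obj(1)[OF h(1)] by blast
qed

end

section \<open>Full subcategories\<close>

lemma full_subcat_sel [simp]:
  "Obj (full_subcat C H) = H" "HOM (full_subcat C H) = HOM C" "cmp (full_subcat C H) = cmp C" "ident (full_subcat C H) = ident C"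
  by (simp_all add: full_subcat_def)

context lincat
begin

lemma full_linear: "H \<subseteq> Obj C ==> linear_category K (full_subcat C H)"
  using lin unfolding linear_category_def full_subcat_sel by blast

lemma full_iso: "H \<subseteq> Obj C ==> cat_iso (full_subcat C H) X Y f \<longleftrightarrow> X \<in> H \<and> Y \<in> H \<and> iso X Y f"
  by (auto simp: cat_iso_def)

lemma full_isomorphic: "H \<subseteq> Obj C ==> isomorphic (full_subcat C H) X Y \<longleftrightarrow> X \<in> H \<and> Y \<in> H \<and> isomorphic C X Y"
  by (auto simp: isomorphic_def full_iso)

lemma full_zero: "H \<subseteq> Obj C ==> zero_object (full_subcat C H) X \<longleftrightarrow> X \<in> H \<and> zero_object C X"
  by (auto simp: zero_object_def)

lemma full_biproduct: "H \<subseteq> Obj C ==> biproduct (full_subcat C H) X Y Z \<longleftrightarrow> X \<in> H \<and> Y \<in> H \<and> Z \<in> H \<and> biproduct C X Y Z"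
  by (auto simp: biproduct_def)

lemma kernel_ex: "cat_kernel C X Y Z i f ==> mor W Y g ==> f \<cdot> g = zr W Z ==> \<exists>h. mor W X h \<and> i \<cdot> h = g"
  unfolding cat_kernel_def mor_def by blast

lemma kernel_inj:
  assumes "cat_kernel C X Y Z i f" "mor W X h" "mor W X h'" "i \<cdot> h = i \<cdot> h'"
  shows "h = h'"
proof -
  have m: "mor X Y i" "mor Y Z f" "f \<cdot> i = zr X Z" using assms(1) by (auto simp: cat_kernel_def mor_def)
  have "f \<cdot> (i \<cdot> h) = zr W Z" using asc[OF assms(2) m(1,2)] m(3) zc[OF assms(2) morD(2)[OF m(2)]] by simp
  hence "\<exists>!k. k \<in> Hom C W X \<and> i \<cdot> k = i \<cdot> h"
    using assms(1) mc[OF assms(2) m(1)] unfolding cat_kernel_def mor_def by blast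
  thus ?thesis using assms(2-4) by (auto simp: mor_def)
qed

lemma cokernel_ex: "cat_cokernel C X Y Z f p ==> mor Y W g ==> g \<cdot> f = zr X W ==> \<exists>h. mor Z W h \<and> h \<cdot> p = g"
  unfolding cat_cokernel_def mor_def by blast

lemma cokernel_inj:
  assumes "cat_cokernel C X Y Z f p" "mor Z W h" "mor Z W h'" "h \<cdot> p = h' \<cdot> p"
  shows "h = h'"
proof -
  have m: "mor X Y f" "mor Y Z p" "p \<cdot> f = zr X Z" using assms(1) by (auto simp: cat_cokernel_def mor_def)
  have "(h \<cdot> p) \<cdot> f = zr X W" using asc[OF m(1,2) assms(2)] m(3) cz[OF assms(2) morD(1)[OF m(1)]] by simp
  hence "\<exists>!k. k \<in> Hom C Z W \<and> k \<cdot> p = h \<cdot> p"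
    using assms(1) mc[OF m(2) assms(2)] unfolding cat_cokernel_def mor_def by blast
  thus ?thesis using assms(2-4) by (auto simp: mor_def)
qed

lemma cokernel_unique:
  assumes "cat_cokernel C X Y Z f p" "cat_cokernel C X Y Z' f p'"
  shows "isomorphic C Z Z'"
proof -
  have m: "mor X Y f" "mor Y Z p" "p \<cdot> f = zr X Z" "mor Y Z' p'" "p' \<cdot> f = zr X Z'" using assms by (auto simp: cat_cokernel_def mor_def)
  obtain a where a: "mor Z Z' a" "a \<cdot> p = p'" using cokernel_ex[OF assms(1) m(4,5)] by blast
  obtain b where b: "mor Z' Z b" "b \<cdot> p' = p" using cokernel_ex[OF assms(2) m(2,3)] by blast
  have "b \<cdot> a = one Z"
    by (rule cokernel_inj[OF assms(1) mc[OF a(1) b(1)] m1[OF morD(1)[OF a(1)]]])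
      (use asc[OF m(2) a(1) b(1)] a(2) b(2) idl[OF m(2)] in simp)
  moreover have "a \<cdot> b = one Z'"
    by (rule cokernel_inj[OF assms(2) mc[OF b(1) a(1)] m1[OF morD(1)[OF b(1)]]])
      (use asc[OF m(4) b(1) a(1)] a(2) b(2) idl[OF m(4)] in simp)
  ultimately show ?thesis using isoI[OF a(1) b(1)] by (auto simp: isomorphic_def)
qed

lemma monoD: "cat_mono C X Y f ==> mor W X g ==> mor W X h ==> f \<cdot> g = f \<cdot> h ==> g = h"
  unfolding cat_mono_def mor_def by blast

lemma kernel_mono: "cat_kernel C X Y Z i f ==> cat_mono C X Y i"
  unfolding cat_mono_def using kernel_inj[of X Y Z i f] unfolding cat_kernel_def mor_def by blast

text \<open>The kernel of f is a subobject of the simple object S and is not all of S since f is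
  nonzero. So it is zero and f is a monomorphism, which must be invertible because S' is simple and
  S is nonzero.\<close>

lemma schur:
  assumes k: "\<exists>W i. cat_kernel C W S S' i f" and s: "simple_object C S" "simple_object C S'" and f: "mor S S' f" "f \<noteq> zr S S'"
  shows "iso S S' f"
proof -
  obtain W i where W: "cat_kernel C W S S' i f" using k by blast
  have i: "mor W S i" "f \<cdot> i = zr W S'" using W by (auto simp: cat_kernel_def mor_def)
  have "\<not> iso W S i"
  proof
    assume "iso W S i"
    then obtain j where j: "mor S W j" "i \<cdot> j = one S" by (rule isoE)
    have "f = (f \<cdot> i) \<cdot> j" using asc[OF j(1) i(1) f(1)] j(2) idr[OF f(1)] by simp
    thus False using i(2) zc[OF j(1) morD(2)[OF f(1)]] f(2) by simp
  qed
  hence z: "zero_object C W" using s(1) kernel_mono[OF W] by (auto simp: simple_object_def)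
  have "g = h" if g: "mor X S g" and h: "mor X S h" and e: "f \<cdot> g = f \<cdot> h" for X g h
  proof (rule diff_zero[OF g h])
    let ?d = "g \<oplus>\<^bsub>HOM C X S\<^esub> neg X S h"
    have "f \<cdot> ?d = zr X S'" using ca[OF g mn[OF h] f(1)] cn[OF h f(1)] e diff_self[OF mc[OF h f(1)]] by simp
    then obtain k where k: "mor X W k" "i \<cdot> k = ?d" using kernel_ex[OF W ma[OF g mn[OF h]]] by blast
    thus "?d = zr X S" using zero_objD(3)[OF z k(1)] cz[OF i(1) morD(1)[OF g]] by simp
  qed
  hence "cat_mono C S S' f" using f(1) unfolding cat_mono_def mor_def by blast
  thus ?thesis using s by (auto simp: simple_object_def)
qed

end

section \<open>T-structures and their hearts\<close>

locale tstr = tricat K C sg for K :: "'k ring" and C :: "('k, 'o, 'f) tri_cat" and sg +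
  fixes U V :: "'o set"
  assumes ts: "t_structure C (U, V)"
begin

abbreviation "H \<equiv> U \<inter> V"
abbreviation "hC \<equiv> full_subcat C H"

lemma UV_iso: "X \<in> U ==> isomorphic C X Y ==> Y \<in> U" "X \<in> V ==> isomorphic C X Y ==> Y \<in> V"
  and UV_Obj: "X \<in> U ==> X \<in> Obj C" "X \<in> V ==> X \<in> Obj C"
  using ts unfolding t_structure_def strictly_full_additive_def by blast+

lemma H_Obj: "H \<subseteq> Obj C"
  using UV_Obj by blast

lemma UV_zero: "zero_object C X ==> X \<in> U" "zero_object C X ==> X \<in> V"
proof -
  obtain Y Z where "Y \<in> U" "zero_object C Y" "Z \<in> V" "zero_object C Z"
    using ts unfolding t_structure_def strictly_full_additive_def by blast
  thus "zero_object C X ==> X \<in> U" "zero_object C X ==> X \<in> V"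
    using UV_iso zero_obj_iso unfolding isomorphic_def by blast+
qed

lemma U_sh1: "X \<in> U ==> sh 1 X \<in> U" and V_shm1: "X \<in> V ==> sh (- 1) X \<in> V"
  using ts by (auto simp: t_structure_def)

lemma Hz_UV: "X \<in> U ==> Y \<in> Obj C ==> sh 1 Y \<in> V ==> Hz X Y"
proof -
  assume X: "X \<in> U" and Y: "Y \<in> Obj C" "sh 1 Y \<in> V"
  have "Hz X (sh (- 1) (sh 1 Y))"
    using ts X Y Hz_iff[OF UV_Obj(1)[OF X] shift_Obj[OF shift_Obj[OF Y(1)]]] unfolding t_structure_def by blast
  thus ?thesis using Hz_iso2 shift_cancel(3)[OF Y(1)] by blast
qed

lemma decomp:
  assumes "M \<in> Obj C"
  obtains X Y where "X \<in> U" "Y \<in> Obj C" "sh 1 Y \<in> V" "T X M Y"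
  using ts assms that unfolding t_structure_def T_def by blast

text \<open>In the truncation triangle, Y is an extension of Sigma X by M, and neither of these has
  morphisms to Y. So the identity of Y vanishes and M is isomorphic to X.\<close>

lemma U_I:
  assumes M: "M \<in> Obj C" "!!Y. Y \<in> Obj C ==> sh 1 Y \<in> V ==> Hz M Y"
  shows "M \<in> U"
proof -
  obtain X Y where X: "X \<in> U" "Y \<in> Obj C" "sh 1 Y \<in> V" "T X M Y" by (rule decomp[OF M(1)])
  have "Hz Y Y" using Hz_ext1[OF T_rot[OF X(4)] M(2)[OF X(2,3)] Hz_UV[OF U_sh1[OF X(1)] X(2,3)]] .
  thus ?thesis using T_zero3[OF X(4) Hz_self] UV_iso X(1) by blast
qed

text \<open>Dual to \<open>U_I\<close>, applied to the truncation of Sigma^(-1) Y, whose part in U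
  is shown to vanish.\<close>

lemma V_I:
  assumes Y: "Y \<in> Obj C" "!!X. X \<in> U ==> Hz (sh 1 X) Y"
  shows "Y \<in> V"
proof -
  let ?Y = "sh (- 1) Y"
  have oY: "?Y \<in> Obj C" using shift_Obj Y by blast
  obtain X Z where X: "X \<in> U" "Z \<in> Obj C" "sh 1 Z \<in> V" "T X ?Y Z" by (rule decomp[OF oY])
  note oX = UV_Obj(1)[OF X(1)]
  have shm: "Hz X (sh (- 1) N)" if "Hz (sh 1 X) N" "N \<in> Obj C" for N
    using that Hz_shift_iff[OF oX that(2), of "- 1" 0 0 1] by (simp add: shift_zero oX)
  have "Hz X X"
    using Hz_ext2[OF T_rot'[OF X(4)] shm[OF Hz_UV[OF U_sh1[OF X(1)] X(2,3)] X(2)] shm[OF Y(2)[OF X(1)] Y(1)]] .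
  hence "isomorphic C ?Y Z" using T_zero1[OF X(4) Hz_self] by blast
  hence "isomorphic C (sh 1 Z) (sh 1 ?Y)" using isomorphic_shift isomorphic_sym by blast
  thus ?thesis using UV_iso(2) X(3) shift_cancel(4)[OF Y(1)] by blast
qed

lemma Hz_UV1: "X \<in> U ==> Y \<in> V ==> Hz (sh 1 X) Y"
proof -
  assume X: "X \<in> U" and Y: "Y \<in> V"
  note o = UV_Obj(1)[OF X] UV_Obj(2)[OF Y]
  have "Hz X (sh (- 1) Y)"
    by (rule Hz_UV[OF X shift_Obj[OF o(2)]]) (use UV_iso(2)[OF Y] shift_cancel(4)[OF o(2)] isomorphic_sym in blast)
  thus ?thesis using Hz_shift_iff[OF o, of "- 1" 0 0 1] by (simp add: shift_zero o)
qed

lemma U_ext: "T X Y Z ==> X \<in> U ==> Z \<in> U ==> Y \<in> U"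
  by (rule U_I[OF T_Obj(2)]) (auto intro: Hz_ext1 Hz_UV)

lemma V_ext: "T X Y Z ==> X \<in> V ==> Z \<in> V ==> Y \<in> V"
  by (rule V_I[OF T_Obj(2)]) (auto intro: Hz_ext2 Hz_UV1)

lemma U_sh:
  assumes "X \<in> U" "n \<ge> 0"
  shows "sh n X \<in> U"
  using assms(2)
proof (induction n rule: int_ge_induct)
  case base
  thus ?case using assms(1) by (simp add: shift_zero UV_Obj)
next
  case (step i)
  have "sh 1 (sh i X) \<in> U" using U_sh1 step by blast
  thus ?case using UV_iso(1) shift_shift[OF UV_Obj(1)[OF assms(1)], of 1 i] by blast
qed

lemma V_sh:
  assumes "X \<in> V" "n \<le> 0"
  shows "sh n X \<in> V"
  using assms(2)
proof (induction n rule: int_le_induct)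
  case base
  thus ?case using assms(1) by (simp add: shift_zero UV_Obj)
next
  case (step i)
  have "sh (- 1) (sh i X) \<in> V" using V_shm1 step by blast
  thus ?case using UV_iso(2) shift_shift[OF UV_Obj(2)[OF assms(1)], of "- 1" i] by simp
qed

lemma UV_determined: "V = {Y \<in> Obj C. \<forall>X\<in>U. Hz (sh 1 X) Y}"
  using V_I Hz_UV1 UV_Obj by blast

lemma Hz_H: "X \<in> H ==> Y \<in> H ==> n < 0 ==> Hz X (sh n Y)"
proof -
  assume X: "X \<in> H" and Y: "Y \<in> H" and n: "n < 0"
  note o = H_Obj[THEN subsetD, OF Y]
  have "sh (n + 1) Y \<in> V" using V_sh Y n by auto
  hence "sh 1 (sh n Y) \<in> V" using UV_iso(2) isomorphic_sym[OF shift_shift[OF o, of 1 n]] by blast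
  thus ?thesis using Hz_UV X shift_Obj[OF o] by blast
qed

text \<open>In cohomological terms the cone Z lives in degrees -1 and 0. W and Q are its two
  cohomology objects and will turn out to be the kernel and the cokernel of f.\<close>

lemma heart_cone:
  assumes f: "mor X Y f" and H: "X \<in> H" "Y \<in> H"
  obtains Z g h W Q a b c where "tri X Y Z f g h" "W \<in> H" "Q \<in> H" "tri (sh 1 W) Z Q a b c"
proof -
  obtain Z g h where t: "tri X Y Z f g h" using tri_cone[OF f] by blast
  hence T: "T X Y Z" by (auto simp: T_def)
  have ZU: "Z \<in> U" using U_ext[OF T_rot[OF T]] H U_sh1 by blast
  have ZV: "sh (- 1) Z \<in> V" using V_ext[OF T_rot'[OF T_rot'[OF T]]] H V_shm1 by blast
  note o = UV_Obj(1)[OF ZU]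
  \<comment> \<open>Truncating Sigma^(-1) Z instead of Z cuts between the degrees -1 and 0 of
    Z.\<close>
  obtain P R where P: "P \<in> U" "R \<in> Obj C" "sh 1 R \<in> V" "T P (sh (- 1) Z) R" by (rule decomp[OF UV_Obj(2)[OF ZV]])
  have "sh (- 2) (sh 1 R) \<in> V" using V_sh[OF P(3)] by simp
  hence "sh (- 1) R \<in> V" using UV_iso(2) shift_shift[OF P(2), of "- 2" 1] by auto
  hence PV: "P \<in> V" using V_ext[OF T_rot'[OF P(4)]] ZV by blast
  have T1: "T (sh 1 P) Z (sh 1 R)" using T_iso2[OF T_shift[OF P(4)] shift_cancel(4)[OF o]] .
  hence RU: "sh 1 R \<in> U" using U_ext[OF T_rot[OF T1] ZU] U_sh1 P(1) by blast
  obtain a b c where "tri (sh 1 P) Z (sh 1 R) a b c" using T1 by (auto simp: T_def)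
  thus thesis using that t PV RU P by blast
qed

lemma sg_sur: "X \<in> H ==> Y \<in> H ==> mor (sh 1 X) (sh 1 Y) h ==> \<exists>f. mor X Y f \<and> sg f = h"
  using sg_surj H_Obj by blast

text \<open>By additivity, uniqueness of a factorization is a test on morphisms that i sends to
  zero.\<close>

lemma kernelI:
  assumes "mor X Y i" "mor Y Z f" "X \<in> H" "Y \<in> H" "Z \<in> H" "f \<cdot> i = zr X Z"
    and ex: "!!W g. W \<in> H ==> mor W Y g ==> f \<cdot> g = zr W Z ==> \<exists>h. mor W X h \<and> i \<cdot> h = g"
    and un: "!!W h. W \<in> H ==> mor W X h ==> i \<cdot> h = zr W Y ==> h = zr W X"
  shows "cat_kernel hC X Y Z i f"
proof -
  have "\<exists>!h. h \<in> Hom C W X \<and> i \<cdot> h = g" if W': "W \<in> H" "g \<in> Hom C W Y" "f \<cdot> g = zr W Z" for W g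
  proof -
    have W: "W \<in> Obj C" "mor W Y g" using that H_Obj assms(1) by (auto simp: mor_def)
    obtain h where h: "mor W X h" "i \<cdot> h = g" using ex[OF W'(1) W(2) W'(3)] by blast
    have "h' = h" if h': "h' \<in> Hom C W X" "i \<cdot> h' = g" for h'
    proof -
      have m: "mor W X h'" using h' W assms(1) by (simp add: mor_def)
      have "i \<cdot> (h' \<oplus>\<^bsub>HOM C W X\<^esub> neg W X h) = zr W Y"
        using ca[OF m mn[OF h(1)] assms(1)] cn[OF h(1) assms(1)] h h' diff_self[OF W(2)] by simp
      from un[OF \<open>W \<in> H\<close> ma[OF m mn[OF h(1)]] this] show ?thesis by (rule diff_zero[OF m h(1)])
    qed
    thus ?thesis using h morD(3) by blast
  qed
  thus ?thesis using assms(1-6) unfolding cat_kernel_def by (simp add: mor_def)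
qed

lemma cokernelI:
  assumes "mor X Y f" "mor Y Z p" "X \<in> H" "Y \<in> H" "Z \<in> H" "p \<cdot> f = zr X Z"
    and ex: "!!W g. W \<in> H ==> mor Y W g ==> g \<cdot> f = zr X W ==> \<exists>h. mor Z W h \<and> h \<cdot> p = g"
    and un: "!!W h. W \<in> H ==> mor Z W h ==> h \<cdot> p = zr Y W ==> h = zr Z W"
  shows "cat_cokernel hC X Y Z f p"
proof -
  have "\<exists>!h. h \<in> Hom C Z W \<and> h \<cdot> p = g" if W': "W \<in> H" "g \<in> Hom C Y W" "g \<cdot> f = zr X W" for W g
  proof -
    have W: "W \<in> Obj C" "mor Y W g" using that H_Obj assms(1) by (auto simp: mor_def)
    obtain h where h: "mor Z W h" "h \<cdot> p = g" using ex[OF W'(1) W(2) W'(3)] by blast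
    have "h' = h" if h': "h' \<in> Hom C Z W" "h' \<cdot> p = g" for h'
    proof -
      have m: "mor Z W h'" using h' W assms(2) by (simp add: mor_def)
      have "(h' \<oplus>\<^bsub>HOM C Z W\<^esub> neg Z W h) \<cdot> p = zr Y W"
        using ac[OF assms(2) m mn[OF h(1)]] nc[OF assms(2) h(1)] h h' diff_self[OF W(2)] by simp
      from un[OF \<open>W \<in> H\<close> ma[OF m mn[OF h(1)]] this] show ?thesis by (rule diff_zero[OF m h(1)])
    qed
    thus ?thesis using h morD(3) by blast
  qed
  thus ?thesis using assms(1-6) unfolding cat_cokernel_def by (simp add: mor_def)
qed

text \<open>Existence of factorizations is exactness of the triangle. For uniqueness, a morphism
  killed by f, or one that kills g, comes from Hom(Sigma W, Z) or Hom(Sigma X, W), and these vanish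
  for objects of the heart.\<close>

lemma heart_ses:
  assumes t: "tri X Y Z f g h" and H: "X \<in> H" "Y \<in> H" "Z \<in> H"
  shows "cat_kernel hC X Y Z f g" "cat_cokernel hC X Y Z f g"
proof -
  note m = triD[OF t] and o = tri_obj[OF t]
  show "cat_kernel hC X Y Z f g"
  proof (rule kernelI[OF m(1,2) H tri_comp_zero[OF t]])
    show "\<exists>v. mor W X v \<and> f \<cdot> v = u" if "mor W Y u" "g \<cdot> u = zr W Z" for W u
      using exact_left[OF t that] by blast
    show "u = zr W X" if W: "W \<in> H" and u: "mor W X u" "f \<cdot> u = zr W Y" for W u
    proof -
      have "sg f \<cdot> sg u = zr (sh 1 W) (sh 1 Y)" using sg_cmp[OF u(1) m(1)] u(2) sg_zero[OF morD(1)[OF u(1)] o(2)] by simp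
      then obtain v where v: "mor (sh 1 W) Z v" "h \<cdot> v = sg u" by (rule exact_left3[OF t sg_mor[OF u(1)]])
      have "v = zr (sh 1 W) Z" using HzD[OF Hz_UV1 v(1)] W H by blast
      thus ?thesis using v cz[OF m(3) morD(1)[OF v(1)]] sg_eq_zero[OF u(1)] by simp
    qed
  qed
  show "cat_cokernel hC X Y Z f g"
  proof (rule cokernelI[OF m(1,2) H tri_comp_zero[OF t]])
    show "\<exists>v. mor Z W v \<and> v \<cdot> g = u" if "mor Y W u" "u \<cdot> f = zr X W" for W u
      using exact_right[OF t that] by blast
    show "u = zr Z W" if W: "W \<in> H" and u: "mor Z W u" "u \<cdot> g = zr Y W" for W u
    proof -
      obtain v where v: "mor (sh 1 X) W v" "v \<cdot> h = u" by (rule exact_right2[OF t u])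
      have "v = zr (sh 1 X) W" using HzD[OF Hz_UV1 v(1)] W H by blast
      thus ?thesis using v zc[OF m(3) morD(2)[OF v(1)]] by simp
    qed
  qed
qed

text \<open>The kernel is the desuspension of Sigma W -> Z -> Sigma X. Its universal property
  follows from exactness of both triangles for P in the heart, since the obstructions Hom(Sigma P,
  Q), Hom(Sigma P, Y) and Hom(Sigma^2 P, Q) vanish.\<close>

lemma heart_kernel:
  assumes t: "tri X Y Z f g h" and t': "tri (sh 1 W) Z Q a b c" and H: "X \<in> H" "Y \<in> H" "W \<in> H" "Q \<in> H"
  obtains i where "cat_kernel hC W X Y i f" "mor W X i" "sg i = h \<cdot> a"
proof -
  note m = triD[OF t] and o = tri_obj[OF t] and m' = triD[OF t']
  obtain i where i: "mor W X i" "sg i = h \<cdot> a" using sg_sur[OF H(3,1) mc[OF m'(1) m(3)]] by blast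
  have "cat_kernel hC W X Y i f"
  proof (rule kernelI[OF i(1) m(1) H(3,1,2)])
    have "sg f \<cdot> sg i = zr (sh 1 W) (sh 1 Y)"
      using asc[OF m'(1) m(3) sg_mor[OF m(1)]] tri_comp_zero3[OF t] zc[OF m'(1) shift_Obj[OF o(2)]] i(2) by simp
    thus "f \<cdot> i = zr W Y" using sg_eq_zero[OF mc[OF i(1) m(1)]] sg_cmp[OF i(1) m(1)] by simp
    show "\<exists>v. mor P W v \<and> i \<cdot> v = u" if P: "P \<in> H" and u: "mor P X u" "f \<cdot> u = zr P Y" for P u
    proof -
      have "sg f \<cdot> sg u = zr (sh 1 P) (sh 1 Y)" using sg_cmp[OF u(1) m(1)] u(2) sg_zero[OF morD(1)[OF u(1)] o(2)] by simp
      then obtain w where w: "mor (sh 1 P) Z w" "h \<cdot> w = sg u" by (rule exact_left3[OF t sg_mor[OF u(1)]])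
      have "b \<cdot> w = zr (sh 1 P) Q" using HzD[OF Hz_UV1 mc[OF w(1) m'(2)]] P H by blast
      then obtain v' where v': "mor (sh 1 P) (sh 1 W) v'" "a \<cdot> v' = w" by (rule exact_left[OF t' w(1)])
      obtain v where v: "mor P W v" "sg v = v'" using sg_sur[OF P H(3) v'(1)] by blast
      have "sg (i \<cdot> v) = sg u" using sg_cmp[OF v(1) i(1)] i(2) v(2) asc[OF v'(1) m'(1) m(3)] v'(2) w(2) by simp
      thus ?thesis using sg_inj[OF mc[OF v(1) i(1)] u(1)] v(1) by blast
    qed
    show "v = zr P W" if P: "P \<in> H" and v: "mor P W v" "i \<cdot> v = zr P X" for P v
    proof -
      note sv = sg_mor[OF v(1)] note av = mc[OF sv m'(1)]
      have oP: "P \<in> Obj C" "sh 1 P \<in> Obj C" "sh 1 (sh 1 P) \<in> Obj C" using morD(1)[OF v(1)] shift_Obj by blast+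
      have "h \<cdot> (a \<cdot> sg v) = zr (sh 1 P) (sh 1 X)"
        using asc[OF sv m'(1) m(3)] i(2) sg_cmp[OF v(1) i(1)] v(2) sg_zero[OF oP(1) o(1)] by simp
      then obtain y where y: "mor (sh 1 P) Y y" "g \<cdot> y = a \<cdot> sg v" by (rule exact_left2[OF t av])
      have "y = zr (sh 1 P) Y" using HzD[OF Hz_UV1 y(1)] P H by blast
      hence "a \<cdot> sg v = zr (sh 1 P) Z" using y(2) cz[OF m(2) oP(2)] by simp
      hence "sg a \<cdot> sg (sg v) = zr (sh 1 (sh 1 P)) (sh 1 Z)" using sg_cmp[OF sv m'(1)] sg_zero[OF oP(2) o(3)] by simp
      then obtain x where x: "mor (sh 1 (sh 1 P)) Q x" "c \<cdot> x = sg (sg v)" by (rule exact_left3[OF t' sg_mor[OF sv]])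
      have "x = zr (sh 1 (sh 1 P)) Q" using HzD[OF Hz_UV1 x(1)] U_sh1 P H by blast
      thus ?thesis using x(2) cz[OF m'(3) oP(3)] sg_eq_zero[OF sv] sg_eq_zero[OF v(1)] by simp
    qed
  qed
  thus thesis using that i by blast
qed

text \<open>Dual to \<open>heart_kernel\<close>; the obstructions are Hom(Sigma W, P), Hom(Sigma X,
  P) and Hom(Sigma^2 W, P).\<close>

lemma heart_cokernel:
  assumes t: "tri X Y Z f g h" and t': "tri (sh 1 W) Z Q a b c" and H: "X \<in> H" "Y \<in> H" "W \<in> H" "Q \<in> H"
  shows "cat_cokernel hC X Y Q f (b \<cdot> g)"
proof -
  note m = triD[OF t] and o = tri_obj[OF t] and m' = triD[OF t']
  note bg = mc[OF m(2) m'(2)]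
  show ?thesis
  proof (rule cokernelI[OF m(1) bg H(1,2,4)])
    show "(b \<cdot> g) \<cdot> f = zr X Q" using asc[OF m(1,2) m'(2)] tri_comp_zero[OF t] cz[OF m'(2) o(1)] by simp
    show "\<exists>v. mor Q P v \<and> v \<cdot> (b \<cdot> g) = u" if P: "P \<in> H" and u: "mor Y P u" "u \<cdot> f = zr X P" for P u
    proof -
      obtain w where w: "mor Z P w" "w \<cdot> g = u" by (rule exact_right[OF t u])
      have "w \<cdot> a = zr (sh 1 W) P" using HzD[OF Hz_UV1 mc[OF m'(1) w(1)]] P H by blast
      then obtain v where v: "mor Q P v" "v \<cdot> b = w" by (rule exact_right[OF t' w(1)])
      thus ?thesis using w asc[OF m(2) m'(2) v(1)] by auto
    qed
    show "v = zr Q P" if P: "P \<in> H" and v: "mor Q P v" "v \<cdot> (b \<cdot> g) = zr Y P" for P v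
    proof -
      note vb = mc[OF m'(2) v(1)]
      have "(v \<cdot> b) \<cdot> g = zr Y P" using asc[OF m(2) m'(2) v(1)] v(2) by simp
      then obtain y where y: "mor (sh 1 X) P y" "y \<cdot> h = v \<cdot> b" by (rule exact_right2[OF t vb])
      have "y = zr (sh 1 X) P" using HzD[OF Hz_UV1 y(1)] P H by blast
      hence "v \<cdot> b = zr Z P" using y(2) zc[OF m(3) morD(2)[OF v(1)]] by simp
      then obtain x where x: "mor (sh 1 (sh 1 W)) P x" "x \<cdot> c = v" by (rule exact_right2[OF t' v(1)])
      have "x = zr (sh 1 (sh 1 W)) P" using HzD[OF Hz_UV1 x(1)] U_sh1 P H by blast
      thus ?thesis using x(2) zc[OF m'(3) morD(2)[OF v(1)]] by simp
    qed
  qed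
qed

sublocale h: lincat K "hC"
  by unfold_locales (rule full_linear[OF H_Obj])

lemma h_mor: "h.mor X Y f \<longleftrightarrow> X \<in> H \<and> Y \<in> H \<and> mor X Y f"
  using H_Obj by (auto simp: h.mor_def mor_def)

lemma kernel_zero:
  assumes k: "cat_kernel hC W X Y i f" and i: "i = zr W X"
  shows "zero_object C W"
proof -
  have W: "W \<in> H" "X \<in> H" using k by (auto simp: cat_kernel_def)
  hence o: "W \<in> Obj C" "X \<in> Obj C" using H_Obj by auto
  have "one W = zr W W"
    by (rule h.kernel_inj[OF k]) (use W o m1 m0 i idr[OF m0[OF o]] cz[OF m0[OF o] o(1)] in \<open>auto simp: h_mor\<close>)
  thus ?thesis using o by (simp add: zero_objI)
qed

text \<open>The kernel W of a monomorphism is zero, so the cone reduces to its degree zero part Q.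
  With \<open>heart_ses\<close> it follows that monomorphisms are kernels.\<close>

lemma mono_cone:
  assumes m: "cat_mono hC X Y f" and t: "tri X Y Z f g h"
  shows "Z \<in> H"
proof -
  have H: "X \<in> H" "Y \<in> H" using m by (auto simp: cat_mono_def)
  obtain Z' g' h' W Q a b c where t': "tri X Y Z' f g' h'" "W \<in> H" "Q \<in> H" "tri (sh 1 W) Z' Q a b c"
    by (rule heart_cone[OF triD(1)[OF t] H])
  obtain i where i: "cat_kernel hC W X Y i f" "mor W X i"
    by (rule heart_kernel[OF t'(1,4) H t'(2,3)])
  have o: "W \<in> Obj C" "X \<in> Obj C" using morD i(2) by blast+
  have "f \<cdot> i = f \<cdot> zr W X" using i(1) cz[OF triD(1)[OF t] o(1)] by (simp add: cat_kernel_def)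
  hence "i = zr W X" using h.monoD[OF m, of W i "zr W X"] i(2) m0[OF o] H t'(2) by (simp add: h_mor)
  hence "zero_object C (sh 1 W)" using zero_shift1 kernel_zero[OF i(1)] by blast
  hence "isomorphic C Z' Q" using T_zero1 t'(4) unfolding T_def by blast
  moreover have "isomorphic C Z' Z" using cone_unique[OF t'(1) t iso_one[OF tri_obj(2)[OF t]]] idl[OF triD(1)[OF t]] by simp
  ultimately have "isomorphic C Q Z" using isomorphic_trans isomorphic_sym by blast
  thus ?thesis using UV_iso t'(3) by blast
qed

text \<open>For an epimorphism Q vanishes. A morphism u that kills the kernel W then kills the whole
  cone after shifting, and exactness extends u along f.\<close>

lemma epi_cokernel:
  assumes e: "cat_epi hC X Y f"
  shows "\<exists>W i. cat_cokernel hC W X Y i f"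
proof -
  have H: "X \<in> H" "Y \<in> H" using e by (auto simp: cat_epi_def)
  hence f: "mor X Y f" using e H_Obj by (auto simp: cat_epi_def mor_def)
  obtain Z g h W Q a b c where t: "tri X Y Z f g h" "W \<in> H" "Q \<in> H" "tri (sh 1 W) Z Q a b c"
    by (rule heart_cone[OF f H])
  note m = triD[OF t(1)] and m' = triD[OF t(4)] and o = tri_obj[OF t(1)]
  obtain i where i: "cat_kernel hC W X Y i f" "mor W X i" "sg i = h \<cdot> a"
    by (rule heart_kernel[OF t(1,4) H t(2,3)])
  note ck = heart_cokernel[OF t(1,4) H t(2,3)]
  have oQ: "Q \<in> Obj C" using H_Obj t(3) by blast
  have "(b \<cdot> g) \<cdot> f = zr Y Q \<cdot> f" using ck zc[OF f oQ] by (simp add: cat_cokernel_def)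
  hence bg: "b \<cdot> g = zr Y Q"
    using e t(3) morD(3)[OF mc[OF m(2) m'(2)]] morD(3)[OF m0[OF o(2) oQ]] unfolding cat_epi_def full_subcat_sel by blast
  have "one Q = zr Q Q"
    by (rule h.cokernel_inj[OF ck]) (use t(3) m1[OF oQ] m0[OF oQ oQ] bg idl[OF m0[OF o(2) oQ]] zc[OF m0[OF o(2) oQ] oQ] in \<open>auto simp: h_mor\<close>)
  hence z: "zero_object C Q" using oQ zero_objI by blast
  have "cat_cokernel hC W X Y i f"
  proof (rule cokernelI[OF i(2) f t(2) H])
    show "f \<cdot> i = zr W Y" using i(1) by (simp add: cat_kernel_def)
    show "\<exists>v. mor Y P v \<and> v \<cdot> f = u" if P: "P \<in> H" and u: "mor X P u" "u \<cdot> i = zr W P" for P u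
    proof -
      have oP: "P \<in> Obj C" using morD(2)[OF u(1)] .
      note su = sg_mor[OF u(1)] note suh = mc[OF m(3) su]
      have "(sg u \<cdot> h) \<cdot> a = zr (sh 1 W) (sh 1 P)"
        using asc[OF m'(1) m(3) su] i(3) sg_cmp[OF i(2) u(1)] u(2) sg_zero[OF morD(1)[OF i(2)] oP] by simp
      then obtain y where y: "mor Q (sh 1 P) y" "y \<cdot> b = sg u \<cdot> h" by (rule exact_right[OF t(4) suh])
      have "sg u \<cdot> h = zr Z (sh 1 P)" using y zero_objD(2)[OF z y(1)] zc[OF m'(2) shift_Obj[OF oP]] by simp
      then obtain v' where v': "mor (sh 1 Y) (sh 1 P) v'" "v' \<cdot> neg (sh 1 X) (sh 1 Y) (sg f) = sg u"
        by (rule exact_right2[OF tri_rot[OF t(1)] su])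
      \<comment> \<open>The sign compensates the one that the rotated triangle puts on
        \<open>sg f\<close>.\<close>
      obtain v where v: "mor Y P v" "sg v = neg (sh 1 Y) (sh 1 P) v'" using sg_sur[OF H(2) P mn[OF v'(1)]] by blast
      have "sg (v \<cdot> f) = sg u" using sg_cmp[OF f v(1)] v(2) nc[OF sg_mor[OF f] v'(1)] cn[OF sg_mor[OF f] v'(1)] v'(2) by simp
      thus ?thesis using sg_inj[OF mc[OF f v(1)] u(1)] v(1) by blast
    qed
    show "v = zr Y P" if P: "P \<in> H" and v: "mor Y P v" "v \<cdot> f = zr X P" for P v
      using e P v morD(3)[OF v(1)] morD(3)[OF m0[OF morD(1,2)[OF v(1)]]] zc[OF f morD(2)[OF v(1)]]
      unfolding cat_epi_def full_subcat_sel by metis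
  qed
  thus ?thesis by blast
qed

text \<open>The cone of the monomorphism i is a cokernel of i in the heart, hence isomorphic to
  S.\<close>

lemma ses_triangle:
  assumes k: "cat_kernel hC X Y S i p" "cat_cokernel hC X Y S i p"
  shows "T X Y S"
proof -
  have H: "X \<in> H" "Y \<in> H" "S \<in> H" "mor X Y i" using k H_Obj by (auto simp: cat_kernel_def mor_def)
  obtain Z g h where t: "tri X Y Z i g h" using tri_cone[OF H(4)] by blast
  have Z: "Z \<in> H" using mono_cone[OF h.kernel_mono[OF k(1)] t] .
  have "isomorphic C Z S" using h.cokernel_unique[OF heart_ses(2)[OF t H(1,2) Z] k(2)] full_isomorphic[OF H_Obj] by blast
  thus ?thesis using T_iso3 t unfolding T_def by blast
qed

lemma heart_abelian: "abelian_category K hC"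
  unfolding abelian_category_def
proof (intro conjI ballI allI impI)
  show "linear_category K hC" by (rule full_linear[OF H_Obj])
  show "\<exists>X. zero_object hC X" using ex_zero UV_zero full_zero[OF H_Obj] by blast
  show "\<exists>Z. biproduct hC X Y Z" if "X \<in> Obj hC" "Y \<in> Obj hC" for X Y
  proof -
    have XY: "X \<in> H" "Y \<in> H" "X \<in> Obj C" "Y \<in> Obj C" using that H_Obj by auto
    obtain Z f g where t: "tri X Z Y f g (zr Y (sh 1 X))" by (rule ex_split_triangle[OF XY(3,4)])
    hence "T X Z Y" by (auto simp: T_def)
    hence "Z \<in> H" using U_ext V_ext XY by blast
    thus ?thesis using split_triangle(1)[OF t] full_biproduct[OF H_Obj] XY by blast
  qed
  show "\<exists>W i. cat_kernel hC W X Y i f" "\<exists>Z p. cat_cokernel hC X Y Z f p"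
    if "X \<in> Obj hC" "Y \<in> Obj hC" "f \<in> Hom hC X Y" for X Y f
  proof -
    have H: "X \<in> H" "Y \<in> H" "mor X Y f" using that H_Obj by (auto simp: mor_def)
    obtain Z g h W Q a b c where t: "tri X Y Z f g h" "W \<in> H" "Q \<in> H" "tri (sh 1 W) Z Q a b c"
      by (rule heart_cone[OF H(3,1,2)])
    show "\<exists>W i. cat_kernel hC W X Y i f" using heart_kernel[OF t(1,4) H(1,2) t(2,3)] by blast
    show "\<exists>Z p. cat_cokernel hC X Y Z f p" using heart_cokernel[OF t(1,4) H(1,2) t(2,3)] by blast
  qed
  show "\<exists>Z g. cat_kernel hC X Y Z f g" if f: "cat_mono hC X Y f" for X Y f
  proof -
    have H: "X \<in> H" "Y \<in> H" "mor X Y f" using f H_Obj by (auto simp: cat_mono_def mor_def)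
    obtain Z g h where t: "tri X Y Z f g h" using tri_cone[OF H(3)] by blast
    show ?thesis using heart_ses(1)[OF t H(1,2) mono_cone[OF f t]] by blast
  qed
qed (rule epi_cokernel)

end

section \<open>Triangulated subcategories and devissage along a bounded t-structure\<close>

context tricat
begin

lemma T_subcat_cone:
  assumes "triangulated_subcat C W" "T X Y Z" "X \<in> W" "Y \<in> W"
  shows "Z \<in> W"
  using assms T_Obj(3)[OF assms(2)] unfolding triangulated_subcat_def T_def by blast

lemma T_subcat_iso: "triangulated_subcat C W ==> X \<in> W ==> isomorphic C X Y ==> Y \<in> W"
  and T_subcat_shift1: "triangulated_subcat C W ==> X \<in> W ==> sh 1 X \<in> W"
  and T_subcat_shiftm1: "triangulated_subcat C W ==> X \<in> W ==> sh (- 1) X \<in> W"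
  and T_subcat_Obj: "triangulated_subcat C W ==> X \<in> W ==> X \<in> Obj C"
  unfolding triangulated_subcat_def by blast+

lemma T_subcat_ext:
  assumes "triangulated_subcat C W" "T X Y Z" "X \<in> W" "Z \<in> W"
  shows "Y \<in> W"
  using T_subcat_cone[OF assms(1) T_rot'[OF assms(2)] T_subcat_shiftm1[OF assms(1,4)] assms(3)] .

lemma T_subcat_shift:
  assumes "triangulated_subcat C W" "X \<in> W"
  shows "sh n X \<in> W"
proof (induction n rule: int_induct[of _ 0])
  case base
  thus ?case using assms T_subcat_Obj by (simp add: shift_zero)
next
  case (step1 i)
  show ?case using T_subcat_iso[OF assms(1) T_subcat_shift1[OF assms(1) step1(2)] shift_shift[OF T_subcat_Obj[OF assms], of 1 i]] .
next
  case (step2 i)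
  show ?case using T_subcat_iso[OF assms(1) T_subcat_shiftm1[OF assms(1) step2(2)] shift_shift[OF T_subcat_Obj[OF assms], of "- 1" i]] by simp
qed

lemma extension_closure_T: "X \<in> extension_closure C S ==> Z \<in> extension_closure C S ==> T X Y Z ==> Y \<in> extension_closure C S"
  using extension_closure.ext T_Obj(2) unfolding T_def by metis

lemma extension_closure_Obj: "S \<subseteq> Obj C ==> X \<in> extension_closure C S ==> X \<in> Obj C"
  by (erule extension_closure.cases) (auto simp: zero_objD isomorphic_Obj)

end

context tstr
begin

text \<open>M has cohomology in the degrees -n to 0 only; the induction splits off the lowest
  cohomology object. W is an arbitrary class closed under isomorphisms and extensions, because it
  will be a triangulated subcategory in one use and the aisle of another t-structure in the
  other.\<close>

lemma devissage:
  assumes W: "!!X Y. X \<in> W ==> isomorphic C X Y ==> Y \<in> W" "!!X Y Z. T X Y Z ==> X \<in> W ==> Z \<in> W ==> Y \<in> W"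
    and H: "!!X m. X \<in> H ==> m \<ge> 0 ==> sh m X \<in> W"
  shows "M \<in> U ==> sh (- int n) M \<in> V ==> M \<in> W"
proof (induction n arbitrary: M)
  case 0
  thus ?case using H[of M 0] UV_Obj by (simp add: shift_zero)
next
  case (Suc n)
  let ?N = "sh (- int (Suc n)) M" and ?m = "int (Suc n)"
  note oM = UV_Obj(1)[OF Suc(2)] and oN = UV_Obj(2)[OF Suc(3)]
  \<comment> \<open>X is the lowest cohomology of M, moved to degree zero; its membership in V is
    checked next.\<close>
  obtain X Y where X: "X \<in> U" "Y \<in> Obj C" "sh 1 Y \<in> V" "T X ?N Y" by (rule decomp[OF oN])
  have "sh (- 2) (sh 1 Y) \<in> V" using V_sh X(3) by simp
  hence "sh (- 1) Y \<in> V" using UV_iso(2) shift_shift[OF X(2), of "- 2" 1] by auto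
  hence XH: "X \<in> H" using V_ext[OF T_rot'[OF X(4)]] Suc(3) X(1) by blast
  let ?Y = "sh ?m Y"
  have t: "T (sh ?m X) M ?Y" using T_iso2[OF T_shift[OF X(4)] shift_cancel(2)[OF oM]] .
  have YU: "?Y \<in> U" using U_ext[OF T_rot[OF t] Suc(2)] U_sh1 U_sh[OF X(1)] by simp
  have "isomorphic C (sh 1 Y) (sh (- int n) ?Y)"
    using isomorphic_sym[OF shift_shift[OF X(2), of "- int n" ?m]] by simp
  hence "?Y \<in> W" using Suc(1)[OF YU] UV_iso(2) X(3) by blast
  thus ?case using W(2)[OF t] H[OF XH] by simp
qed

text \<open>The exponent is natural because \<open>devissage\<close> counts with it. Taking
  \<open>nat a\<close> also covers negative a, as V is stable under negative shifts.\<close>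

lemma V_large:
  assumes b: "bounded_t_structure C (U, V)" and M: "M \<in> Obj C"
  obtains n where "sh (- int n) M \<in> V"
proof -
  obtain a Y where Y: "Y \<in> V" "isomorphic C M (sh a Y)"
    using b M unfolding bounded_t_structure_def shifted_subcat_def by blast
  note o = UV_Obj(2)[OF Y(1)]
  have "isomorphic C (sh (- int (nat a)) (sh a Y)) (sh (a - int (nat a)) Y)" using shift_shift[OF o, of "- int (nat a)" a] by simp
  hence "isomorphic C (sh (a - int (nat a)) Y) (sh (- int (nat a)) M)"
    using isomorphic_shift[OF Y(2), of "- int (nat a)"] isomorphic_sym isomorphic_trans by blast
  moreover have "sh (a - int (nat a)) Y \<in> V" by (rule V_sh[OF Y(1)]) simp
  ultimately show thesis using that UV_iso(2) by blast
qed

lemma U_large: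
  assumes b: "bounded_t_structure C (U, V)" and M: "M \<in> Obj C"
  obtains n where "sh n M \<in> U"
proof -
  obtain a Y where Y: "Y \<in> U" "isomorphic C M (sh a Y)"
    using b M unfolding bounded_t_structure_def shifted_subcat_def by blast
  have "isomorphic C (sh (- a) M) Y"
    using isomorphic_trans[OF isomorphic_shift[OF Y(2)] shift_cancel(1)[OF UV_Obj(1)[OF Y(1)]]] .
  thus thesis using that UV_iso(1)[OF Y(1)] isomorphic_sym by blast
qed

lemma subcat_heart:
  assumes b: "bounded_t_structure C (U, V)" and W: "triangulated_subcat C W" and HW: "H \<subseteq> W" and M: "M \<in> Obj C"
  shows "M \<in> W"
proof -
  obtain a where a: "sh a M \<in> U" by (rule U_large[OF b M])
  obtain n where n: "sh (- int n) (sh a M) \<in> V" by (rule V_large[OF b shift_Obj[OF M]])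
  have "sh a M \<in> W"
    by (rule devissage[OF _ _ _ a n]) (use T_subcat_iso[OF W] T_subcat_ext[OF W] T_subcat_shift[OF W] HW in blast)+
  thus ?thesis using T_subcat_iso[OF W T_subcat_shift[OF W] shift_cancel(1)[OF M]] by blast
qed

text \<open>Schur's lemma governs degree zero and orthogonality of the t-structure the negative
  degrees. Composition series in the heart become iterated extensions by
  \<open>ses_triangle\<close>, and the heart generates everything by devissage.\<close>

lemma simples:
  assumes b: "bounded_t_structure C (U, V)" and l: "length_category K hC"
    and r: "simple_representatives hC Ss"
  shows "set Ss \<subseteq> Obj C"
    and "i < length Ss ==> j < length Ss ==> i \<noteq> j ==> Hz (Ss ! i) (Ss ! j)"
    and "S \<in> set Ss ==> \<not> zero_object C S"
    and "S \<in> set Ss ==> mor S S f ==> f \<noteq> zr S S ==> iso S S f"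
    and "S \<in> set Ss ==> S' \<in> set Ss ==> n < 0 ==> Hz S (sh n S')"
    and "triangulated_hull C (set Ss) = Obj C"
    and "extension_closure C (set Ss) = H"
proof -
  have s: "simple_object hC S" if "S \<in> set Ss" for S using r that by (simp add: simple_representatives_def)
  have SH: "set Ss \<subseteq> H" using s by (auto simp: simple_object_def)
  thus So: "set Ss \<subseteq> Obj C" using H_Obj by blast
  show "Hz S (sh n S')" if "S \<in> set Ss" "S' \<in> set Ss" "n < 0" using Hz_H SH that by blast
  have sch: "iso S S' f" if S: "S \<in> set Ss" "S' \<in> set Ss" and f: "mor S S' f" "f \<noteq> zr S S'" for S S' f
  proof -
    have "cat_iso hC S S' f"
    proof (rule h.schur[OF _ s[OF S(1)] s[OF S(2)]])
      show "\<exists>W i. cat_kernel hC W S S' i f"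
        using heart_abelian S SH morD(3)[OF f(1)] unfolding abelian_category_def full_subcat_sel by blast
    qed (use S f SH in \<open>auto simp: h_mor\<close>)
    thus ?thesis by (simp add: full_iso[OF H_Obj])
  qed
  thus "iso S S f" if "S \<in> set Ss" "mor S S f" "f \<noteq> zr S S" using that by blast
  show "\<not> zero_object C S" if "S \<in> set Ss" using s[OF that] SH that full_zero[OF H_Obj] by (auto simp: simple_object_def)
  show "Hz (Ss ! i) (Ss ! j)" if ij: "i < length Ss" "j < length Ss" "i \<noteq> j"
  proof -
    have m: "Ss ! i \<in> set Ss" "Ss ! j \<in> set Ss" using ij by simp_all
    hence o: "Ss ! i \<in> Obj C" "Ss ! j \<in> Obj C" using So by blast+
    have "\<not> isomorphic C (Ss ! i) (Ss ! j)"
    proof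
      assume "isomorphic C (Ss ! i) (Ss ! j)"
      hence "isomorphic hC (Ss ! i) (Ss ! i)" "isomorphic hC (Ss ! i) (Ss ! j)"
        using m SH full_isomorphic[OF H_Obj] isomorphic_refl[OF o(1)] by blast+
      thus False using r s[OF m(1)] ij unfolding simple_representatives_def by blast
    qed
    thus ?thesis using sch[OF m] o unfolding Hz_def isomorphic_def by blast
  qed
  show e: "extension_closure C (set Ss) = H"
  proof (intro equalityI subsetI)
    fix X assume "X \<in> extension_closure C (set Ss)"
    thus "X \<in> H"
    proof induction
      case (base X)
      thus ?case using SH by blast
    next
      case (zero X)
      thus ?case using UV_zero by blast
    next
      case (iso X Y)
      thus ?case using UV_iso by blast
    next
      case (ext X Z Y f g h)
      have "T X Y Z" using ext by (auto simp: T_def)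
      thus ?case using U_ext V_ext ext by blast
    qed
  next
    fix X assume "X \<in> H"
    hence "finite_length hC X" using l by (simp add: length_category_def)
    thus "X \<in> extension_closure C (set Ss)"
    proof induction
      case (zero X)
      thus ?case by (intro extension_closure.zero) (simp add: full_zero[OF H_Obj])
    next
      case (step X Y S i p)
      obtain j where "j < length Ss" "isomorphic hC S (Ss ! j)"
        using r step(4) unfolding simple_representatives_def by blast
      hence "Ss ! j \<in> set Ss" "isomorphic C (Ss ! j) S" using full_isomorphic[OF H_Obj] isomorphic_sym by auto
      from extension_closure_T[OF step(5) extension_closure.iso[OF extension_closure.base[OF this(1)] this(2)] ses_triangle[OF step(2,3)]]
      show ?case .
    qed
  qed
  show "triangulated_hull C (set Ss) = Obj C"
  proof
    have "triangulated_subcat C (Obj C)"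
      unfolding triangulated_subcat_def by (auto simp: shift_Obj isomorphic_Obj zero_objD)
    thus "triangulated_hull C (set Ss) \<subseteq> Obj C" unfolding triangulated_hull_def using So by blast
    have "Obj C \<subseteq> W" if W: "triangulated_subcat C W" "set Ss \<subseteq> W" for W
    proof -
      have "X \<in> W" if "X \<in> extension_closure C (set Ss)" for X
        using that
      proof induction
        case (base X)
        thus ?case using W by blast
      next
        case (zero X)
        thus ?case using W(1) by (simp add: triangulated_subcat_def)
      next
        case (iso X Y)
        thus ?case using T_subcat_iso[OF W(1)] by blast
      next
        case (ext X Z Y f g h)
        have "T X Y Z" using ext by (auto simp: T_def)
        thus ?case using T_subcat_ext[OF W(1)] ext by blast
      qed
      thus ?thesis using subcat_heart[OF b W(1)] e by blast
    qed
    thus "Obj C \<subseteq> triangulated_hull C (set Ss)" unfolding triangulated_hull_def by blast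
  qed
qed

end

text \<open>By devissage, U consists of iterated extensions of nonnegative shifts of the heart and
  therefore lies in U'. By symmetry U = U', and V is the orthogonal of the shifted U.\<close>

lemma (in tricat) heart_determines:
  assumes "bounded_t_structure C (U, V)" "bounded_t_structure C (U', V')" "U \<inter> V = U' \<inter> V'"
  shows "(U, V) = (U', V')"
proof -
  have *: "U \<subseteq> U'" if b: "bounded_t_structure C (U, V)" and b': "bounded_t_structure C (U', V')" and e: "U \<inter> V = U' \<inter> V'" for U V U' V'
  proof
    interpret t: tstr K C sg U V by unfold_locales (use b in \<open>simp add: bounded_t_structure_def\<close>)
    interpret t': tstr K C sg U' V' by unfold_locales (use b' in \<open>simp add: bounded_t_structure_def\<close>)
    fix M assume M: "M \<in> U"
    obtain n where n: "sh (- int n) M \<in> V" using t.V_large[OF b t.UV_Obj(1)[OF M]] .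
    show "M \<in> U'"
    proof (rule t.devissage[OF _ _ _ M n])
      show "sh m X \<in> U'" if "X \<in> U \<inter> V" "m \<ge> 0" for X m using t'.U_sh that e by blast
    qed (fact t'.UV_iso(1) t'.U_ext)+
  qed
  have "U = U'" using *[OF assms] *[OF assms(2,1) assms(3)[symmetric]] by blast
  moreover have "V = {Y \<in> Obj C. \<forall>X\<in>U. Hz (sh 1 X) Y}" if "bounded_t_structure C (U, V)" for U V
  proof -
    interpret t: tstr K C sg U V by unfold_locales (use that in \<open>simp add: bounded_t_structure_def\<close>)
    show ?thesis by (rule t.UV_determined)
  qed
  from this[OF assms(1)] this[OF assms(2)] calculation show ?thesis by simp
qed

section \<open>Simple-minded families\<close>

text \<open>Endomorphism algebras are only asked to be division algebras here. That they reduce to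
  scalars is a matter of the derived category and is treated there.\<close>

locale smf = tricat K C sg for K :: "'k ring" and C :: "('k, 'o, 'f) tri_cat" and sg +
  fixes Ss :: "'o list"
  assumes Ss_Obj: "set Ss \<subseteq> Obj C"
    and Ss_Hz: "!!i j. i < length Ss ==> j < length Ss ==> i \<noteq> j ==> Hz (Ss ! i) (Ss ! j)"
    and Ss_nz: "!!S. S \<in> set Ss ==> \<not> zero_object C S"
    and Ss_end: "!!S f. S \<in> set Ss ==> mor S S f ==> f \<noteq> zr S S ==> iso S S f"
    and Ss_neg: "!!S S' n. S \<in> set Ss ==> S' \<in> set Ss ==> n < 0 ==> Hz S (sh n S')"
    and Ss_hull: "triangulated_hull C (set Ss) = Obj C"
begin

lemma Ss_mor:
  assumes "S \<in> set Ss" "S' \<in> set Ss" "mor S S' f" "f \<noteq> zr S S'"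
  shows "iso S S' f"
proof -
  obtain i j where ij: "i < length Ss" "j < length Ss" "S = Ss ! i" "S' = Ss ! j"
    using assms(1,2) by (metis in_set_conv_nth)
  show ?thesis
  proof (cases "i = j")
    case True
    thus ?thesis using Ss_end assms ij by simp
  next
    case False
    thus ?thesis using HzD[OF Ss_Hz[OF ij(1,2)]] assms ij by blast
  qed
qed

text \<open>\<open>flt L M\<close>: there is a filtration of \<open>M\<close> whose subquotients are, starting from the bottom, the objects \<open>\<Sigma>\<^sup>n S\<close> for the pairs \<open>(n, S)\<close> in the list \<open>L\<close>.\<close>
inductive flt :: "(int \<times> 'o) list \<Rightarrow> 'o \<Rightarrow> bool" where
  nil: "zero_object C M ==> flt [] M"
| cons: "S \<in> set Ss ==> T (sh n S) M M' ==> flt L M' ==> flt ((n, S) # L) M"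

inductive_cases flt_nil: "flt [] M"
inductive_cases flt_cons: "flt ((n, S) # L) M"

lemma flt_Obj: "flt L M ==> M \<in> Obj C"
  by (erule flt.cases) (auto simp: zero_objD T_Obj)

lemma flt_iso: "flt L M ==> isomorphic C M N ==> flt L N"
  by (erule flt.cases) (auto intro: flt.nil flt.cons dest: zero_obj_isomorphic T_iso2)

text \<open>Each step of the first filtration is moved past the extension by
  \<open>T_assoc1\<close>.\<close>

lemma flt_append: "flt L1 X ==> T X Y Z ==> flt L2 Z ==> flt (L1 @ L2) Y"
proof (induction arbitrary: Y Z rule: flt.induct)
  case (nil M)
  have "isomorphic C Z Y" using T_zero1[OF nil(2,1)] by (rule isomorphic_sym)
  from flt_iso[OF nil(3) this] show ?case by simp
next
  case (cons S n M M' L)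
  obtain W where W: "T (sh n S) Y W" "T M' W Z" using T_assoc1[OF cons(2) cons(5)] .
  show ?case using flt.cons[OF cons(1) W(1) cons(4)[OF W(2) cons(6)]] by simp
qed

text \<open>Converse of \<open>flt_append\<close>: the preimage of a filtered subobject under the
  quotient by the bottom factor is supplied by \<open>T_assoc2\<close>.\<close>

lemma flt_split: "flt (L1 @ L2) M ==> \<exists>X Z. flt L1 X \<and> flt L2 Z \<and> T X M Z"
proof (induction L1 arbitrary: M)
  case Nil
  obtain X where X: "zero_object C X" using ex_zero by blast
  hence "T X M M" using T_zeroI1 isomorphic_refl flt_Obj[OF Nil] by blast
  thus ?case using X Nil flt.nil by auto
next
  case (Cons a L1)
  obtain n S where a: "a = (n, S)" by (cases a)
  have "flt ((n, S) # (L1 @ L2)) M" using Cons(2) a by simp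
  then obtain M' where M: "S \<in> set Ss" "T (sh n S) M M'" "flt (L1 @ L2) M'" by (rule flt_cons)
  obtain X Z where X: "flt L1 X" "flt L2 Z" "T X M' Z" using Cons(1)[OF M(3)] by blast
  obtain W where W: "T (sh n S) W X" "T W M Z" using T_assoc2[OF M(2) X(3)] .
  show ?case using flt.cons[OF M(1) W(1) X(1)] X(2) W(2) a by blast
qed

lemma flt_shift: "flt L M ==> flt (map (apfst (\<lambda>m. m + n)) L) (sh n M)"
proof (induction rule: flt.induct)
  case (nil M)
  thus ?case using zero_shift flt.nil by auto
next
  case (cons S m M M' L)
  have "T (sh (m + n) S) (sh n M) (sh n M')"
    using T_iso1[OF T_shift[OF cons(2)] shift_shift] Ss_Obj cons(1) by blast
  thus ?case using flt.cons[OF cons(1)] cons(4) by simp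
qed

lemma flt_single: "S \<in> set Ss ==> isomorphic C (sh n S) M ==> flt [(n, S)] M"
  using ex_zero flt.nil flt.cons[OF _ T_zeroI3] by blast

lemma flt_singleD: "flt [(n, S)] M ==> S \<in> set Ss \<and> isomorphic C (sh n S) M"
  by (metis flt_cons flt_nil T_zero3)

text \<open>A third vertex Z of a triangle on X -> Y is an extension of Sigma X by Y, so closure
  under cones follows from concatenation and shifting of filtrations.\<close>

lemma flt_subcat: "triangulated_subcat C {M. \<exists>L. flt L M}"
  unfolding triangulated_subcat_def
proof (intro conjI subsetI allI impI ballI)
  fix X assume "X \<in> {M. \<exists>L. flt L M}"
  then obtain L where L: "flt L X" by blast
  show "X \<in> Obj C" using flt_Obj[OF L] .
  show "sh 1 X \<in> {M. \<exists>L. flt L M}" "sh (- 1) X \<in> {M. \<exists>L. flt L M}" using flt_shift[OF L] by blast+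
  show "Y \<in> {M. \<exists>L. flt L M}" if "isomorphic C X Y" for Y using flt_iso[OF L that] by blast
  fix Y Z f g h assume "Y \<in> {M. \<exists>L. flt L M}" and "tri X Y Z f g h"
  then obtain L' where "flt L' Y" "T Y Z (sh 1 X)" using T_rot unfolding T_def by blast
  thus "Z \<in> {M. \<exists>L. flt L M}" using flt_append flt_shift[OF L] by blast
next
  fix X assume "zero_object C X"
  thus "X \<in> {M. \<exists>L. flt L M}" using flt.nil by blast
qed

lemma flt_all: "M \<in> Obj C ==> \<exists>L. flt L M"
proof -
  assume M: "M \<in> Obj C"
  have "S \<in> {M. \<exists>L. flt L M}" if "S \<in> set Ss" for S
    using flt_single[OF that, of 0 S] that isomorphic_refl Ss_Obj by (auto simp: shift_zero subset_iff)
  hence "triangulated_hull C (set Ss) \<subseteq> {M. \<exists>L. flt L M}"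
    unfolding triangulated_hull_def using flt_subcat by blast
  thus ?thesis using Ss_hull M by blast
qed

text \<open>If the first morphism vanishes, so does the connecting morphism of the rotated triangle,
  and a split triangle can be read in the opposite order.\<close>

lemma split_T:
  assumes "tri X Y Z (zr X Y) g h"
  shows "T (sh 1 X) Z Y"
proof (rule split_triangle(2))
  note o = tri_obj[OF assms]
  show "tri Y Z (sh 1 X) g h (zr (sh 1 X) (sh 1 Y))"
    using tri_rot[OF assms] sg_zero[OF o(1,2)] n0[OF shift_Obj[OF o(1)] shift_Obj[OF o(2)]] by simp
qed

text \<open>The connecting morphism \<open>\<Sigma>\<^sup>m S' \<rightarrow> \<Sigma>\<^sup>n\<^sup>+\<^sup>1 S\<close> is zero, and the triangle splits, or it is invertible, and \<open>W\<close> vanishes.\<close>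
lemma Ss_swap:
  assumes S: "S \<in> set Ss" "S' \<in> set Ss" and W: "T (sh n S) W (sh m S')" and nm: "n < m"
  shows "zero_object C W \<or> T (sh m S') W (sh n S)"
proof -
  have o: "S \<in> Obj C" "S' \<in> Obj C" "W \<in> Obj C" using S Ss_Obj T_Obj[OF W] by auto
  \<comment> \<open>After a shift by -n the morphism in question goes from Sigma^k S' to S, with k =
    m - 1 - n >= 0.\<close>
  let ?k = "m - 1 - n" and ?W = "sh (- n) W"
  have "T (sh (m - 1) S') (sh n S) W" using T_iso1[OF T_rot'[OF W] shift_shift[OF o(2), of "- 1" m]] by simp
  from T_shift[OF this, of "- n"] have "T (sh ?k S') S ?W"
    by (rule T_iso) (use shift_shift[OF o(2), of "- n" "m - 1"] shift_cancel(1)[OF o(1)] isomorphic_refl[OF shift_Obj[OF o(3)]] in simp_all)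
  then obtain f g h where t: "tri (sh ?k S') S ?W f g h" by (auto simp: T_def)
  show ?thesis
  proof (cases "f = zr (sh ?k S') S")
    case True
    hence "T (sh 1 (sh ?k S')) ?W S" using split_T t by simp
    from T_shift[OF this, of n] have "T (sh m S') W (sh n S)"
    proof (rule T_iso)
      show "isomorphic C (sh n (sh 1 (sh ?k S'))) (sh m S')"
        using isomorphic_trans[OF isomorphic_shift[OF shift_shift[OF o(2), of 1 ?k]] shift_shift[OF o(2), of n "?k + 1"]] by simp
    qed (use shift_cancel(2)[OF o(3)] isomorphic_refl[OF shift_Obj[OF o(1)]] in blast)+
    thus ?thesis ..
  next
    case False
    have "\<not> Hz (sh ?k S') S" using False HzD triD(1)[OF t] by blast
    moreover have "Hz (sh ?k S') S" if "?k > 0"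
      using Ss_neg[OF S(2,1), of "- ?k"] that Hz_shift_iff[OF o(2,1), of "- ?k" 0 0 ?k] by (simp add: shift_zero o)
    \<comment> \<open>For k > 0 the morphism would have negative degree; so a nonzero one occurs
      only for k = 0, where it is invertible.\<close>
    ultimately have "?k = 0" using nm by force
    hence t: "tri S' S ?W f g h" and "f \<noteq> zr S' S" using t False by (simp_all add: shift_zero o)
    hence i: "iso S' S f" using Ss_mor S triD(1) by blast
    obtain Z g' h' where z: "zero_object C Z" "tri S' S' Z (one S') g' h'" using tri_one[OF o(2)] by blast
    have "isomorphic C Z ?W" using cone_unique[OF z(2) t i] idr[OF iso_mor[OF i]] by simp
    hence "zero_object C (sh n ?W)" using zero_obj_isomorphic zero_shift z(1) by blast
    thus ?thesis using zero_obj_isomorphic shift_cancel(2)[OF o(3)] by blast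
  qed
qed

text \<open>The two lowest factors form a subobject W to which \<open>Ss_swap\<close> applies. If W
  vanishes, both entries are dropped from the list.\<close>

lemma flt_swap:
  assumes "flt ((n, S) # (m, S') # L) M" "n < m"
  shows "flt ((m, S') # (n, S) # L) M \<or> flt L M"
proof -
  obtain M' where M: "S \<in> set Ss" "T (sh n S) M M'" "flt ((m, S') # L) M'" using assms(1) by (rule flt_cons)
  obtain N where N: "S' \<in> set Ss" "T (sh m S') M' N" "flt L N" using M(3) by (rule flt_cons)
  obtain W where W: "T (sh n S) W (sh m S')" "T W M N" using T_assoc2[OF M(2) N(2)] .
  from Ss_swap[OF M(1) N(1) W(1) assms(2)] show ?thesis
  proof
    assume "zero_object C W"
    thus ?thesis using flt_iso[OF N(3)] T_zero1[OF W(2)] isomorphic_sym by blast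
  next
    assume "T (sh m S') W (sh n S)"
    then obtain P where P: "T (sh m S') M P" "T (sh n S) P N" using T_assoc1 W(2) by blast
    show ?thesis using flt.cons[OF N(1) P(1) flt.cons[OF M(1) P(2) N(3)]] ..
  qed
qed

abbreviation desc :: "(int \<times> 'o) list \<Rightarrow> bool" where "desc \<equiv> sorted_wrt (\<lambda>a b. fst a \<ge> fst b)"

text \<open>One step of insertion sort. A cancellation deletes two entries, hence the mere inclusion
  between the sets of entries; the tail that remains is already sorted.\<close>

lemma flt_insert:
  "flt (a # L) M ==> desc L ==> \<exists>L'. flt L' M \<and> desc L' \<and> set L' \<subseteq> set (a # L)"
proof (induction L arbitrary: M)
  case Nil
  thus ?case by (intro exI[of _ "[a]"]) simp
next
  case (Cons b L)
  show ?case
  proof (cases "fst a \<ge> fst b")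
    case True
    thus ?thesis using Cons(2,3) by (intro exI[of _ "a # b # L"]) fastforce
  next
    case False
    then consider "flt (b # a # L) M" | "flt L M" using flt_swap[of "fst a" "snd a" "fst b" "snd b" L M] Cons(2) by auto
    thus ?thesis
    proof cases
      case 1
      then obtain M' where M: "snd b \<in> set Ss" "T (sh (fst b) (snd b)) M M'" "flt (a # L) M'"
        using flt_cons[of "fst b" "snd b" "a # L" M] by auto
      obtain L' where L: "flt L' M'" "desc L'" "set L' \<subseteq> set (a # L)" using Cons(1)[OF M(3)] Cons(3) by auto
      have "flt (b # L') M" using flt.cons[OF M(1,2) L(1)] by simp
      moreover have "desc (b # L')" using L(2,3) False Cons(3) by auto
      ultimately show ?thesis using L(3) by (intro exI[of _ "b # L'"]) auto
    next
      case 2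
      thus ?thesis using Cons(3) by (intro exI[of _ L]) auto
    qed
  qed
qed

lemma flt_sort: "flt L M ==> \<exists>L'. flt L' M \<and> desc L' \<and> set L' \<subseteq> set L"
proof (induction rule: flt.induct)
  case (nil M)
  thus ?case using flt.nil by (intro exI[of _ "[]"]) simp
next
  case (cons S n M M' L)
  then obtain L' where L: "flt L' M'" "desc L'" "set L' \<subseteq> set L" by blast
  obtain L'' where "flt L'' M" "desc L''" "set L'' \<subseteq> set ((n, S) # L')" using flt_insert[OF flt.cons[OF cons(1,2) L(1)] L(2)] by blast
  thus ?case using L(3) by (intro exI[of _ L'']) auto
qed

text \<open>In the sorted filtration the factors with shift at least n form an initial segment, that
  is, a subobject X.\<close>

lemma flt_cut:
  assumes "flt L M"
  obtains X Z L1 L2 where "flt L1 X" "flt L2 Z" "T X M Z" "\<forall>a\<in>set L1. fst a \<ge> n" "\<forall>a\<in>set L2. fst a < n" "set L1 \<union> set L2 \<subseteq> set L"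
proof -
  obtain L' where L: "flt L' M" "desc L'" "set L' \<subseteq> set L" using flt_sort[OF assms] by blast
  let ?P = "\<lambda>a::int \<times> 'o. fst a \<ge> n"
  obtain X Z where "flt (takeWhile ?P L') X" "flt (dropWhile ?P L') Z" "T X M Z"
    using flt_split[of "takeWhile ?P L'" "dropWhile ?P L'" M] L(1) by auto
  moreover have "\<forall>a\<in>set (dropWhile ?P L'). fst a < n" using L(2)
  proof (induction L')
    case (Cons a L')
    thus ?case by (cases "n \<le> fst a") force+
  qed simp
  moreover have "\<forall>a\<in>set (takeWhile ?P L'). ?P a" using set_takeWhileD by metis
  moreover have "set (takeWhile ?P L') \<union> set (dropWhile ?P L') \<subseteq> set L" using L(3) set_takeWhileD set_dropWhileD by fastforce
  ultimately show thesis using that by blast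
qed

text \<open>For two single factors this is vanishing in negative degrees. Two nested inductions, one
  over each filtration, pass it on to M and N.\<close>

lemma Hz_flt:
  assumes "flt L M" "flt L' N" "!!a b. a \<in> set L ==> b \<in> set L' ==> fst b < fst a"
  shows "Hz M N"
  using assms(1,3)
proof (induction rule: flt.induct)
  case (nil M)
  thus ?case using Hz_zero1 flt_Obj[OF assms(2)] by blast
next
  case (cons S n M M' L)
  have oS: "S \<in> Obj C" using cons(1) Ss_Obj by blast
  have "!!b. b \<in> set L' ==> fst b < n" using cons(5)[of "(n, S)"] by simp
  with assms(2) have "Hz (sh n S) N"
  proof (induction rule: flt.induct)
    case (nil N)
    thus ?case using Hz_zero2 shift_Obj[OF oS] by blast
  next
    case (cons S' m N N' L')
    have oS': "S' \<in> Obj C" using cons(1) Ss_Obj by blast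
    have "Hz S (sh (m - n) S')" using Ss_neg[OF \<open>S \<in> set Ss\<close> cons(1)] cons(5)[of "(m, S')"] by simp
    hence "Hz (sh n S) (sh m S')" using Hz_shift_iff[OF oS oS', of "m - n" 0 m n] by (simp add: shift_zero oS)
    thus ?case using Hz_ext2[OF cons(2)] cons(4,5) by simp
  qed
  thus ?case using Hz_ext1[OF cons(2)] cons(4,5) by simp
qed

section \<open>The t-structure attached to a simple-minded family\<close>

definition U where "U = {M. \<exists>L. flt L M \<and> (\<forall>a\<in>set L. fst a \<ge> 0)}"
definition V where "V = {M. \<exists>L. flt L M \<and> (\<forall>a\<in>set L. fst a \<le> 0)}"

text \<open>One argument serves both halves: a biproduct is the middle of a split triangle and is
  filtered by the concatenated lists.\<close>

lemma UV_additive: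
  assumes "P = (\<lambda>n::int. n \<ge> 0) \<or> P = (\<lambda>n. n \<le> 0)"
  shows "strictly_full_additive C {M. \<exists>L. flt L M \<and> (\<forall>a\<in>set L. P (fst a))}" (is "strictly_full_additive C ?A")
  unfolding strictly_full_additive_def
proof (intro conjI subsetI ballI allI impI)
  show "X \<in> Obj C" if "X \<in> ?A" for X using that flt_Obj by blast
  show "Y \<in> ?A" if "X \<in> ?A" "isomorphic C X Y" for X Y using that flt_iso by blast
  obtain Z where "zero_object C Z" using ex_zero by blast
  moreover hence "Z \<in> ?A" using flt.nil by (intro CollectI exI[of _ "[]"]) simp
  ultimately show "\<exists>X\<in>?A. zero_object C X" by blast
  show "\<exists>Z\<in>?A. biproduct C X Y Z" if "X \<in> ?A" "Y \<in> ?A" for X Y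
  proof -
    obtain L L' where L: "flt L X" "\<forall>a\<in>set L. P (fst a)" "flt L' Y" "\<forall>a\<in>set L'. P (fst a)" using \<open>X \<in> ?A\<close> \<open>Y \<in> ?A\<close> by blast
    obtain Z f g where Z: "tri X Z Y f g (zr Y (sh 1 X))" by (rule ex_split_triangle[OF flt_Obj[OF L(1)] flt_Obj[OF L(3)]])
    have "flt (L @ L') Z" using flt_append[OF L(1) _ L(3)] Z by (auto simp: T_def)
    hence "Z \<in> ?A" using L(2,4) by (intro CollectI exI[of _ "L @ L'"]) auto
    thus ?thesis using split_triangle(1)[OF Z] by blast
  qed
qed

lemma UV_bounded: "bounded_t_structure C (U, V)"
  unfolding bounded_t_structure_def t_structure_def prod.case
proof (intro conjI ballI)
  show "strictly_full_additive C U" "strictly_full_additive C V" unfolding U_def V_def by (rule UV_additive, simp)+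
  show "sh 1 X \<in> U" if "X \<in> U" for X
  proof -
    obtain L where "flt L X" "\<forall>a\<in>set L. fst a \<ge> 0" using \<open>X \<in> U\<close> unfolding U_def by blast
    thus ?thesis using flt_shift[of L X 1] unfolding U_def by (intro CollectI exI[of _ "map (apfst (\<lambda>m. m + 1)) L"]) auto
  qed
  have Vm: "\<exists>L. flt L (sh (- 1) X) \<and> (\<forall>a\<in>set L. fst a < 0)" if "X \<in> V" for X
  proof -
    obtain L where "flt L X" "\<forall>a\<in>set L. fst a \<le> 0" using \<open>X \<in> V\<close> unfolding V_def by blast
    thus ?thesis using flt_shift[of L X "- 1"] by (intro exI[of _ "map (apfst (\<lambda>m. m + - 1)) L"]) auto
  qed
  show "sh (- 1) X \<in> V" if "X \<in> V" for X
  proof -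
    obtain L where "flt L (sh (- 1) X)" "\<forall>a\<in>set L. fst a < 0" using Vm[OF \<open>X \<in> V\<close>] by blast
    thus ?thesis unfolding V_def by force
  qed
  show "Hom C M (sh (- 1) N) = {zr M (sh (- 1) N)}" if M: "M \<in> U" and N: "N \<in> V" for M N
  proof -
    obtain L where L: "flt L M" "\<forall>a\<in>set L. fst a \<ge> 0" using M unfolding U_def by blast
    obtain L' where L': "flt L' (sh (- 1) N)" "\<forall>a\<in>set L'. fst a < 0" using Vm[OF N] by blast
    have "Hz M (sh (- 1) N)" by (rule Hz_flt[OF L(1) L'(1)]) (use L(2) L'(2) in force)
    thus ?thesis using Hz_iff Hz_Obj by blast
  qed
  show "\<exists>X\<in>U. \<exists>Y\<in>Obj C. sh 1 Y \<in> V \<and> (\<exists>f g h. tri X M Y f g h)" if M: "M \<in> Obj C" for M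
  proof -
    obtain L where L: "flt L M" using flt_all[OF M] by blast
    obtain X Y L1 L2 where X: "flt L1 X" "flt L2 Y" "T X M Y" "\<forall>a\<in>set L1. fst a \<ge> 0" "\<forall>a\<in>set L2. fst a < 0"
      using flt_cut[OF L, of 0] .
    have "sh 1 Y \<in> V" unfolding V_def using flt_shift[OF X(2), of 1] X(5)
      by (intro CollectI exI[of _ "map (apfst (\<lambda>m. m + 1)) L2"]) auto
    moreover have "X \<in> U" using X(1,4) unfolding U_def by blast
    ultimately show ?thesis using X(3) flt_Obj[OF X(2)] unfolding T_def by blast
  qed
  \<comment> \<open>Only finitely many shifts occur in a filtration, so a translation brings all of
    them into the half-line described by P.\<close>
  have b: "\<exists>n Y L. flt L Y \<and> isomorphic C M (sh n Y) \<and> (\<forall>a\<in>set L. P (fst a))"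
    if M: "M \<in> Obj C" and P: "!!A. finite A ==> \<exists>n::int. \<forall>a\<in>A. P (a + n)" for M P
  proof -
    obtain L where L: "flt L M" using flt_all[OF M] by blast
    obtain n where n: "\<forall>a\<in>fst ` set L. P (a + n)" using P[of "fst ` set L"] by blast
    show ?thesis
      by (intro exI conjI, rule flt_shift[OF L, of n], rule isomorphic_sym[OF shift_cancel(1)[OF M]]) (use n in auto)
  qed
  have fin: "\<exists>n::int. \<forall>a\<in>A. a + n \<ge> 0" "\<exists>n::int. \<forall>a\<in>A. a + n \<le> 0" if A: "finite A" for A
  proof -
    obtain l u where "!!a. a \<in> A ==> l \<le> a \<and> a \<le> u"
      using bdd_below_finite[OF A] bdd_above_finite[OF A] unfolding bdd_below_def bdd_above_def by blast
    thus "\<exists>n::int. \<forall>a\<in>A. a + n \<ge> 0" "\<exists>n::int. \<forall>a\<in>A. a + n \<le> 0"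
      by (intro exI[of _ "- l"] exI[of _ "- u"], simp)+
  qed
  have sub: "(\<Union>n. shifted_subcat C n W) \<subseteq> Obj C" for W
    by (auto simp: shifted_subcat_def dest: isomorphic_Obj)
  show "(\<Union>n. shifted_subcat C n U) = Obj C"
  proof (intro equalityI subsetI)
    fix M assume "M \<in> Obj C"
    from b[OF this fin(1)] obtain n Y where "Y \<in> U" "isomorphic C M (sh n Y)" unfolding U_def by blast
    thus "M \<in> (\<Union>n. shifted_subcat C n U)" unfolding shifted_subcat_def by blast
  qed (use sub in blast)
  show "(\<Union>n. shifted_subcat C n V) = Obj C"
  proof (intro equalityI subsetI)
    fix M assume "M \<in> Obj C"
    from b[OF this fin(2)] obtain n Y where "Y \<in> V" "isomorphic C M (sh n Y)" unfolding V_def by blast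
    thus "M \<in> (\<Union>n. shifted_subcat C n V)" unfolding shifted_subcat_def by blast
  qed (use sub in blast)
qed

sublocale t: tstr K C sg U V
  by unfold_locales (use UV_bounded in \<open>simp add: bounded_t_structure_def\<close>)

text \<open>M has one filtration by nonnegative shifts and another one by nonpositive shifts. The
  strictly positive part X of the first has no morphisms to M, by the second, nor to Sigma^(-1) Z,
  whose factors have shift -1. As X is an extension of these, it is zero.\<close>

lemma heart_flt: "M \<in> U \<inter> V \<longleftrightarrow> (\<exists>L. flt L M \<and> (\<forall>a\<in>set L. fst a = 0))"
proof
  assume M: "M \<in> U \<inter> V"
  obtain L where L: "flt L M" "\<forall>a\<in>set L. fst a \<ge> 0" using M unfolding U_def by blast
  obtain L' where L': "flt L' M" "\<forall>a\<in>set L'. fst a \<le> 0" using M unfolding V_def by blast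
  obtain X Z L1 L2 where X: "flt L1 X" "flt L2 Z" "T X M Z" "\<forall>a\<in>set L1. fst a \<ge> 1" "\<forall>a\<in>set L2. fst a < 1" "set L1 \<union> set L2 \<subseteq> set L"
    using flt_cut[OF L(1), of 1] .
  have L2: "\<forall>a\<in>set L2. fst a = 0" using X(5,6) L(2) by force
  have "Hz X M" by (rule Hz_flt[OF X(1) L'(1)]) (use X(4) L'(2) in force)
  moreover have "Hz X (sh (- 1) Z)"
    by (rule Hz_flt[OF X(1) flt_shift[OF X(2)]]) (use X(4) L2 in force)
  ultimately have "zero_object C X" using Hz_self[OF Hz_ext2[OF T_rot'[OF X(3)]]] by blast
  hence "flt L2 M" using flt_iso[OF X(2)] T_zero1[OF X(3)] isomorphic_sym by blast
  thus "\<exists>L. flt L M \<and> (\<forall>a\<in>set L. fst a = 0)" using L2 by blast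
qed (force simp: U_def V_def)

lemma heart_closure: "extension_closure C (set Ss) = U \<inter> V"
proof (intro equalityI subsetI)
  have S: "S \<in> U \<inter> V" if "S \<in> set Ss" for S
    unfolding heart_flt using flt_single[OF that, of 0 S] that isomorphic_refl Ss_Obj
    by (intro exI[of _ "[(0, S)]"]) (auto simp: shift_zero subset_iff)
  fix X assume "X \<in> extension_closure C (set Ss)"
  thus "X \<in> U \<inter> V"
  proof induction
    case (base X)
    thus ?case by (rule S)
  next
    case (zero X)
    thus ?case using t.UV_zero by blast
  next
    case (iso X Y)
    thus ?case using t.UV_iso by blast
  next
    case (ext X Z Y f g h)
    have "T X Y Z" using ext by (auto simp: T_def)
    thus ?case using t.U_ext t.V_ext ext by blast
  qed
next
  fix X assume "X \<in> U \<inter> V"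
  then obtain L where "flt L X" "\<forall>a\<in>set L. fst a = 0" unfolding heart_flt by blast
  thus "X \<in> extension_closure C (set Ss)"
  proof induction
    case (nil M)
    show ?case by (rule extension_closure.zero[OF nil(1)])
  next
    case (cons S n M M' L)
    hence "T S M M'" using Ss_Obj by (auto simp: shift_zero subset_iff)
    thus ?case using extension_closure_T[OF extension_closure.base[OF cons(1)]] cons by simp
  qed
qed

lemma Ss_heart: "S \<in> set Ss ==> S \<in> U \<inter> V"
  using extension_closure.base[of S "set Ss" C] unfolding heart_closure .

text \<open>The bottom factor of a filtration of X is the kernel of the projection to the rest of
  the filtration.\<close>

lemma heart_sub:
  assumes X: "X \<in> U \<inter> V" "\<not> zero_object C X"
  obtains S u where "S \<in> set Ss" "cat_mono (full_subcat C (U \<inter> V)) S X u" "mor S X u" "u \<noteq> zr S X"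
proof -
  obtain L where L: "flt L X" "\<forall>a\<in>set L. fst a = 0" using X(1) unfolding heart_flt by blast
  obtain S L' where SL: "L = (0, S) # L'"
  proof (cases L)
    case Nil
    thus ?thesis using L(1) X(2) flt_nil by blast
  next
    case (Cons a L')
    thus ?thesis using that L(2) by (cases a) auto
  qed
  have "flt ((0, S) # L') X" using L(1) SL by simp
  then obtain X' where X': "S \<in> set Ss" "T (sh 0 S) X X'" "flt L' X'" by (rule flt_cons)
  then obtain u g h where u: "tri S X X' u g h" using Ss_Obj by (auto simp: T_def shift_zero subset_iff)
  have "X' \<in> U \<inter> V" unfolding heart_flt using X'(3) L(2) SL by auto
  note k = t.heart_ses(1)[OF u Ss_heart[OF X'(1)] X(1) this]
  have "u \<noteq> zr S X" using t.kernel_zero[OF k] Ss_nz[OF X'(1)] by blast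
  thus thesis using that X'(1) t.h.kernel_mono[OF k] triD(1)[OF u] by blast
qed

text \<open>A nonzero subobject f : X -> S contains some S', and the composite S' -> S is nonzero,
  hence invertible. So f has a section, and a monomorphism with a section is invertible.\<close>

lemma Ss_simple:
  assumes S: "S \<in> set Ss"
  shows "simple_object (full_subcat C (U \<inter> V)) S"
  unfolding simple_object_def full_subcat_sel full_zero[OF t.H_Obj]
proof (intro conjI allI impI)
  show "S \<in> U \<inter> V" by (rule Ss_heart[OF S])
  show "\<not> (S \<in> U \<inter> V \<and> zero_object C S)" using Ss_nz[OF S] by blast
  fix X f assume f: "cat_mono (full_subcat C (U \<inter> V)) X S f"
  hence X: "X \<in> U \<inter> V" "mor X S f" using t.H_Obj by (auto simp: cat_mono_def mor_def)
  note mono = t.h.monoD[OF f, unfolded t.h_mor full_subcat_sel]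
  show "X \<in> U \<inter> V \<and> zero_object C X \<or> cat_iso (full_subcat C (U \<inter> V)) X S f"
  proof (cases "zero_object C X")
    case False
    then obtain S' u where u: "S' \<in> set Ss" "mor S' X u" "u \<noteq> zr S' X" using heart_sub[OF X(1)] by blast
    note fu = mc[OF u(2) X(2)] and o = morD[OF X(2)]
    have "f \<cdot> u \<noteq> zr S' S"
      using mono[of S' u "zr S' X"] u X Ss_heart[OF u(1)] cz[OF X(2) morD(1)[OF u(2)]] m0[OF morD(1,2)[OF u(2)]] by auto
    hence "iso S' S (f \<cdot> u)" using Ss_mor[OF u(1) S fu] by blast
    then obtain w where w: "mor S S' w" "(f \<cdot> u) \<cdot> w = one S" by (rule isoE)
    note uw = mc[OF w(1) u(2)] and uwf = mc[OF X(2) mc[OF w(1) u(2)]]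
    have fuw: "f \<cdot> (u \<cdot> w) = one S" using w asc[OF w(1) u(2) X(2)] by simp
    have "(u \<cdot> w) \<cdot> f = one X"
      by (rule mono[of X]) (use X uwf m1[OF o(1)] asc[OF X(2) uw X(2)] fuw idl[OF X(2)] idr[OF X(2)] in simp_all)
    hence "iso X S f" using isoI[OF X(2) uw] fuw by blast
    thus ?thesis using X Ss_heart[OF S] full_iso[OF t.H_Obj] by blast
  qed (use X in blast)
qed

text \<open>A simple X contains some member of the family and so is isomorphic to it. The index is
  unique since there are no nonzero morphisms between members at different indices.\<close>

lemma Ss_representatives: "simple_representatives (full_subcat C (U \<inter> V)) Ss"
  unfolding simple_representatives_def
proof (intro conjI ballI allI impI)
  fix X assume s: "simple_object (full_subcat C (U \<inter> V)) X"
  hence X: "X \<in> U \<inter> V" "\<not> zero_object C X" using full_zero[OF t.H_Obj] by (auto simp: simple_object_def)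
  obtain S u where S: "S \<in> set Ss" "cat_mono (full_subcat C (U \<inter> V)) S X u" by (rule heart_sub[OF X])
  hence "cat_iso (full_subcat C (U \<inter> V)) S X u"
    using s Ss_nz full_zero[OF t.H_Obj] unfolding simple_object_def by blast
  hence i: "isomorphic (full_subcat C (U \<inter> V)) X S" using t.h.isomorphic_sym unfolding isomorphic_def by blast
  obtain i where i: "i < length Ss" "isomorphic (full_subcat C (U \<inter> V)) X (Ss ! i)" using S(1) i by (metis in_set_conv_nth)
  have "j = i" if j: "j < length Ss" "isomorphic (full_subcat C (U \<inter> V)) X (Ss ! j)" for j
  proof (rule ccontr)
    assume "j \<noteq> i"
    hence h: "Hz (Ss ! j) (Ss ! i)" using Ss_Hz j(1) i(1) by blast
    have "isomorphic C (Ss ! i) (Ss ! j)"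
      using isomorphic_trans[OF isomorphic_sym] i(2) j(2) full_isomorphic[OF t.H_Obj] by blast
    hence "zero_object C (Ss ! j)" using Hz_self[OF Hz_iso2[OF h]] by blast
    thus False using Ss_nz j(1) by simp
  qed
  thus "\<exists>!i. i < length Ss \<and> isomorphic (full_subcat C (U \<inter> V)) X (Ss ! i)" using i by blast
qed (rule Ss_simple)

text \<open>The list is consumed from its end because \<open>finite_length\<close> adds a simple
  quotient on top, while \<open>flt\<close> adds a factor at the bottom.\<close>

lemma heart_length: "length_category K (full_subcat C (U \<inter> V))"
  unfolding length_category_def
proof (intro conjI ballI)
  show "abelian_category K (full_subcat C (U \<inter> V))" by (rule t.heart_abelian)
  have "flt L X ==> \<forall>a\<in>set L. fst a = 0 ==> finite_length (full_subcat C (U \<inter> V)) X" for L X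
  proof (induction L arbitrary: X rule: rev_induct)
    case Nil
    hence "zero_object C X" using flt_nil by blast
    thus ?case using t.UV_zero full_zero[OF t.H_Obj] by (intro finite_length.zero) blast
  next
    case (snoc a L)
    obtain S where a: "a = (0, S)" using snoc(3) by (cases a) auto
    obtain Y Z where Y: "flt L Y" "flt [(0, S)] Z" "T Y X Z" using flt_split[of L "[(0, S)]" X] snoc(2) a by blast
    hence S: "S \<in> set Ss" "isomorphic C Z S" using flt_singleD[OF Y(2)] isomorphic_sym Ss_Obj by (auto simp: shift_zero subset_iff)
    obtain f g h where t: "tri Y X S f g h" using T_iso3[OF Y(3) S(2)] by (auto simp: T_def)
    have "\<forall>a\<in>set L. fst a = 0" using snoc(3) by simp
    hence "Y \<in> U \<inter> V" "X \<in> U \<inter> V" using Y(1) snoc(2,3) heart_flt by blast+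
    note s = t.heart_ses[OF t this Ss_heart[OF S(1)]]
    show ?case by (rule finite_length.step[OF snoc(1)[OF Y(1)] s Ss_simple[OF S(1)]]) (use snoc(3) in simp)
  qed
  thus "finite_length (full_subcat C (U \<inter> V)) X" if "X \<in> Obj (full_subcat C (U \<inter> V))" for X
    using that heart_flt unfolding full_subcat_sel by blast
qed

end

section \<open>Triangulated subcategories\<close>

text \<open>The same category occurs as several records that differ in their triangles or extra
  fields. These notions see only the four linear fields, so they can be carried over.\<close>

lemma lin_cong:
  assumes "Obj A = Obj B" "HOM A = HOM B" "cmp A = cmp B" "ident A = ident B"
  shows "cat_iso A = cat_iso B" "isomorphic A = isomorphic B" "zero_object A = zero_object B" "biproduct A = biproduct B"
    and "simple_object A = simple_object B" "length_category K A = length_category K B"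
    and "simple_isoclasses A = simple_isoclasses B" "simple_representatives A = simple_representatives B"
proof -
  have c: "cat_iso A = cat_iso B" "isomorphic A = isomorphic B" "zero_object A = zero_object B" "biproduct A = biproduct B"
    "cat_mono A = cat_mono B" "cat_epi A = cat_epi B" "cat_kernel A = cat_kernel B" "cat_cokernel A = cat_cokernel B"
    "linear_category K A = linear_category K B"
    by (unfold fun_eq_iff, simp_all add: assms cat_iso_def isomorphic_def zero_object_def biproduct_def cat_mono_def cat_epi_def cat_kernel_def cat_cokernel_def linear_category_def)
  show i: "cat_iso A = cat_iso B" "isomorphic A = isomorphic B" "zero_object A = zero_object B" "biproduct A = biproduct B" by (fact c)+
  show s: "simple_object A = simple_object B" by (unfold fun_eq_iff, simp add: simple_object_def c assms)
  have "finite_length A X ==> finite_length B X" for X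
    by (induction rule: finite_length.induct) (auto intro: finite_length.intros simp: c s)
  moreover have "finite_length B X ==> finite_length A X" for X
    by (induction rule: finite_length.induct) (auto intro: finite_length.intros simp: c s)
  ultimately show "length_category K A = length_category K B"
    using c assms by (auto simp: length_category_def abelian_category_def)
  show "simple_isoclasses A = simple_isoclasses B" "simple_representatives A = simple_representatives B"
    by (unfold fun_eq_iff, simp_all add: simple_isoclasses_def simple_representatives_def i s)
qed

text \<open>Links the finiteness condition on t-structures with lists of representatives; such a
  list is obtained by a choice in each member of a distinct enumeration of the classes.\<close>

lemma (in lincat) finite_isoclasses_iff:
  "finite (simple_isoclasses C) \<longleftrightarrow> (\<exists>Ss. simple_representatives C Ss)"
proof
  let ?R = "{(X, Y). isomorphic C X Y}"
  have cls: "?R `` {X} = ?R `` {Y} \<longleftrightarrow> isomorphic C X Y" if "X \<in> Obj C" "Y \<in> Obj C" for X Y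
  proof
    assume "?R `` {X} = ?R `` {Y}"
    thus "isomorphic C X Y" using isomorphic_refl[OF that(2)] by auto
  qed (auto intro: isomorphic_trans isomorphic_sym)
  have so: "S \<in> Obj C" if "simple_object C S" for S using that by (simp add: simple_object_def)
  show "\<exists>Ss. simple_representatives C Ss" if fin: "finite (simple_isoclasses C)"
  proof -
    obtain cs where cs: "set cs = simple_isoclasses C" "distinct cs" using finite_distinct_list[OF fin] by blast
    define r where "r = (\<lambda>c. SOME S. simple_object C S \<and> c = ?R `` {S})"
    have r: "simple_object C (r c) \<and> c = ?R `` {r c}" if c: "c \<in> set cs" for c
    proof -
      have "\<exists>S. simple_object C S \<and> c = ?R `` {S}" using c cs unfolding simple_isoclasses_def quotient_def by blast
      thus ?thesis unfolding r_def by (rule someI_ex)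
    qed
    have "\<exists>!i. i < length (map r cs) \<and> isomorphic C S (map r cs ! i)" if S: "simple_object C S" for S
    proof -
      have "?R `` {S} \<in> set cs" using S cs unfolding simple_isoclasses_def quotient_def by blast
      then obtain i where i: "i < length cs" "cs ! i = ?R `` {S}" by (metis in_set_conv_nth)
      have e: "isomorphic C S (r (cs ! j)) \<longleftrightarrow> cs ! j = ?R `` {S}" if "j < length cs" for j
        using r[of "cs ! j"] that cls[OF so[OF S], of "r (cs ! j)"] so by auto
      show ?thesis
      proof (rule ex1I[of _ i])
        show "i < length (map r cs) \<and> isomorphic C S (map r cs ! i)"
          using iffD2[OF e[OF i(1)] i(2)] i(1) by simp
        show "j = i" if "j < length (map r cs) \<and> isomorphic C S (map r cs ! j)" for j
        proof -
          have j: "j < length cs" "isomorphic C S (r (cs ! j))" using that by auto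
          have "cs ! j = cs ! i" using iffD1[OF e[OF j(1)] j(2)] i(2) by (rule trans[OF _ sym])
          thus ?thesis using nth_eq_iff_index_eq[OF cs(2) j(1) i(1)] by blast
        qed
      qed
    qed
    hence "simple_representatives C (map r cs)" using r unfolding simple_representatives_def by auto
    thus ?thesis by blast
  qed
  show "finite (simple_isoclasses C)" if ex: "\<exists>Ss. simple_representatives C Ss"
  proof -
    obtain Ss where r: "simple_representatives C Ss" using ex by blast
    have "simple_isoclasses C \<subseteq> (\<lambda>S. ?R `` {S}) ` set Ss"
    proof
      fix c assume "c \<in> simple_isoclasses C"
      then obtain S where S: "simple_object C S" "c = ?R `` {S}" unfolding simple_isoclasses_def quotient_def by blast
      then obtain i where i: "i < length Ss" "isomorphic C S (Ss ! i)" using r unfolding simple_representatives_def by blast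
      hence "c = ?R `` {Ss ! i}" using cls[OF so[OF S(1)] isomorphic_Obj(2)[OF i(2)]] S(2) by simp
      thus "c \<in> (\<lambda>S. ?R `` {S}) ` set Ss" using i(1) by simp
    qed
    thus ?thesis using finite_surj by blast
  qed
qed

text \<open>A full subcategory keeps all triangles of the ambient category; those outside of the subcategory are removed here.\<close>
definition restrict_tri where
  "restrict_tri C E = (full_subcat C E)\<lparr>triangles := {(X, Y, Z, t). (X, Y, Z, t) \<in> triangles C \<and> X \<in> E \<and> Y \<in> E \<and> Z \<in> E}\<rparr>"

lemma restrict_tri_sel [simp]:
  "Obj (restrict_tri C E) = E" "HOM (restrict_tri C E) = HOM C" "cmp (restrict_tri C E) = cmp C" "ident (restrict_tri C E) = ident C"
  "shift (restrict_tri C E) = shift C"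
  "(X, Y, Z, f, g, h) \<in> triangles (restrict_tri C E) \<longleftrightarrow> (X, Y, Z, f, g, h) \<in> triangles C \<and> X \<in> E \<and> Y \<in> E \<and> Z \<in> E"
  by (simp_all add: restrict_tri_def full_subcat_def)

lemma full_subcat_tri_sel [simp]: "shift (full_subcat C E) = shift C" "triangles (full_subcat C E) = triangles C"
  by (simp_all add: full_subcat_def)

lemma restrict_full: "cat_iso (restrict_tri C E) = cat_iso (full_subcat C E)" "isomorphic (restrict_tri C E) = isomorphic (full_subcat C E)"
  "zero_object (restrict_tri C E) = zero_object (full_subcat C E)" "biproduct (restrict_tri C E) = biproduct (full_subcat C E)"
  by (rule lin_cong; simp)+

locale tri_sub = tricat K C sg for K :: "'k ring" and C :: "('k, 'o, 'f) tri_cat" and sg +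
  fixes E assumes E: "triangulated_subcat C E"
begin

abbreviation R where "R \<equiv> restrict_tri C E"

lemma E_Obj: "E \<subseteq> Obj C"
  using E by (simp add: triangulated_subcat_def)

lemmas r_iso = restrict_full(1)[of C E] full_iso[OF E_Obj]
lemmas r_isomorphic = restrict_full(2)[of C E] full_isomorphic[OF E_Obj]
lemmas r_zero = restrict_full(3)[of C E] full_zero[OF E_Obj]

sublocale r: lincat K "R"
  by unfold_locales (use full_linear[OF E_Obj] in \<open>simp add: linear_category_def\<close>)

lemma r_mor: "r.mor X Y f \<longleftrightarrow> X \<in> E \<and> Y \<in> E \<and> mor X Y f"
  using E_Obj by (auto simp: r.mor_def mor_def)

lemma zero_E: "zero_object C X ==> X \<in> E"
  using E by (simp add: triangulated_subcat_def)

lemma tri_E: "tri X Y Z f g h ==> X \<in> E ==> Y \<in> E ==> Z \<in> E"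
  using T_subcat_cone[OF E] unfolding T_def by blast

text \<open>The axioms restrict because E contains the zero objects, is stable under shifts, and
  contains every cone of a morphism between its objects.\<close>

sublocale r: tricat K "R" sg
proof unfold_locales
  note sE = T_subcat_shift[OF E]
  show "shift R n X \<in> Obj R" if "X \<in> Obj R" for n X
    using sE that by simp
  show "shift R 0 X = X" if "X \<in> Obj R" for X
    using that shift_zero E_Obj by auto
  show "isomorphic R (shift R m (shift R n X)) (shift R (n + m) X)"
    if "X \<in> Obj R" for m n X
    using that shift_shift E_Obj sE by (simp add: r_isomorphic subset_iff)
  show "r.mor (shift R 1 X) (shift R 1 Y) (sg f)" if "r.mor X Y f" for X Y f
    using that sE sg_mor by (simp add: r_mor)
  show "sg (cmp R g f) = cmp R (sg g) (sg f)" if "r.mor X Y f" "r.mor Y Z g" for X Y Z f g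
    using that sg_cmp[of X Y f Z g] by (simp add: r_mor)
  show "sg (ident R X) = ident R (shift R 1 X)" if "X \<in> Obj R" for X
    using that E_Obj sg_one by auto
  show "sg (f \<oplus>\<^bsub>HOM R X Y\<^esub> g) = sg f \<oplus>\<^bsub>HOM R (shift R 1 X) (shift R 1 Y)\<^esub> sg g"
    if "r.mor X Y f" "r.mor X Y g" for X Y f g
    using that sg_add by (simp add: r_mor)
  show "f = g" if "r.mor X Y f" "r.mor X Y g" "sg f = sg g" for X Y f g
    using that sg_inj r_mor by blast
  show "\<exists>f. r.mor X Y f \<and> sg f = h"
    if "X \<in> Obj R" "Y \<in> Obj R" "r.mor (shift R 1 X) (shift R 1 Y) h" for X Y h
    using that sg_surj[of X Y h] E_Obj by (auto simp: r_mor)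
  show "r.mor X Y f \<and> r.mor Y Z g \<and> r.mor Z (shift R 1 X) h" if "(X, Y, Z, f, g, h) \<in> triangles R" for X Y Z f g h
    using that tri_mor[of X Y Z f g h] sE by (simp add: r_mor)
  show "(X', Y', Z', f', g', h') \<in> triangles R"
    if "(X, Y, Z, f, g, h) \<in> triangles R" "cat_iso R X X' a" "cat_iso R Y Y' b"
      "cat_iso R Z Z' c" "r.mor X' Y' f'" "r.mor Y' Z' g'" "r.mor Z' (shift R 1 X') h'"
      "cmp R f' a = cmp R b f" "cmp R g' b = cmp R c g"
      "cmp R h' c = cmp R (sg a) h" for X Y Z f g h X' a Y' b Z' c f' g' h'
    using that tri_iso[of X Y Z f g h X' a Y' b Z' c f' g' h'] by (simp add: r_mor r_iso)
  show "\<exists>Z. zero_object R Z" using ex_zero zero_E by (auto simp: r_zero)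
  show "\<exists>Z g h. (X, Y, Z, f, g, h) \<in> triangles R" if "r.mor X Y f" for X Y f
  proof -
    have f: "X \<in> E" "Y \<in> E" "mor X Y f" using that by (simp_all add: r_mor)
    obtain Z g h where t: "tri X Y Z f g h" using tri_cone[OF f(3)] by blast
    thus ?thesis using f tri_E[OF t] unfolding restrict_tri_sel by blast
  qed
  show "\<exists>Z g h. zero_object R Z \<and> (X, X, Z, ident R X, g, h) \<in> triangles R"
    if "X \<in> Obj R" for X
  proof -
    have X: "X \<in> E" "X \<in> Obj C" using that E_Obj by auto
    obtain Z g h where Z: "zero_object C Z" "tri X X Z (one X) g h" using tri_one[OF X(2)] by blast
    thus ?thesis using X zero_E[OF Z(1)] unfolding restrict_tri_sel r_zero by blast
  qed
  show "(Y, Z, shift R 1 X, g, h, \<ominus>\<^bsub>HOM R (shift R 1 X) (shift R 1 Y)\<^esub> sg f) \<in> triangles R"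
    if "(X, Y, Z, f, g, h) \<in> triangles R" for X Y Z f g h
    using that tri_rot sE by simp
  show "\<exists>c. r.mor Z Z' c \<and> cmp R c g = cmp R g' b \<and> cmp R h' c = cmp R (sg a) h"
    if "(X, Y, Z, f, g, h) \<in> triangles R" "(X', Y', Z', f', g', h') \<in> triangles R"
      "r.mor X X' a" "r.mor Y Y' b" "cmp R b f = cmp R f' a" for X Y Z f g h X' Y' Z' f' g' h' a b
    using that tri_fill[of X Y Z f g h X' Y' Z' f' g' h' a b] by (simp add: r_mor)
  show "\<exists>Z' X' Y' f1 f2 g1 g2 h1 h2 k1 k2 k3.
      (X, Y, Z', f, f1, f2) \<in> triangles R \<and> (Y, Z, X', g, g1, g2) \<in> triangles R \<and>
      (X, Z, Y', cmp R g f, h1, h2) \<in> triangles R \<and> (Z', Y', X', k1, k2, k3) \<in> triangles R"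
    if "r.mor X Y f" "r.mor Y Z g" for X Y Z f g
  proof -
    have m: "mor X Y f" "mor Y Z g" "X \<in> E" "Y \<in> E" "Z \<in> E" using that by (simp_all add: r_mor)
    obtain Z' X' Y' f1 f2 g1 g2 h1 h2 k1 k2 k3 where
      t: "tri X Y Z' f f1 f2" "tri Y Z X' g g1 g2" "tri X Z Y' (g \<cdot> f) h1 h2" "tri Z' Y' X' k1 k2 k3"
      using tri_oct[OF m(1,2)] by blast
    thus ?thesis using m(3-5) tri_E[OF t(1)] tri_E[OF t(2)] tri_E[OF t(3)] unfolding restrict_tri_sel by blast
  qed
qed

abbreviation S where "S \<equiv> full_subcat C E"

lemma restrict_t: "t_structure S t \<longleftrightarrow> t_structure R t"
proof -
  have "strictly_full_additive R W \<longleftrightarrow> strictly_full_additive S W" for W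
    by (simp add: strictly_full_additive_def restrict_full)
  thus ?thesis
    by (cases t) (simp add: t_structure_def, auto simp: strictly_full_additive_def subset_iff)
qed

lemma restrict_bounded: "bounded_t_structure S t \<longleftrightarrow> bounded_t_structure R t"
  by (cases t) (simp add: bounded_t_structure_def restrict_t shifted_subcat_def restrict_full)

lemma heart_cong:
  "simple_object (heart S (U, V)) = simple_object (full_subcat R (U \<inter> V))"
  "length_category K (heart S (U, V)) = length_category K (full_subcat R (U \<inter> V))"
  "simple_isoclasses (heart S (U, V)) = simple_isoclasses (full_subcat R (U \<inter> V))"
  "simple_representatives (heart S (U, V)) = simple_representatives (full_subcat R (U \<inter> V))"
  by (rule lin_cong; simp add: heart_def)+

text \<open>The generators and all middle terms lie in E, so every triangle used in forming the
  closure has its vertices in E.\<close>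

lemma restrict_closure:
  assumes "B \<subseteq> E"
  shows "extension_closure S B = extension_closure R B"
proof (intro equalityI subsetI)
  fix X assume "X \<in> extension_closure S B"
  thus "X \<in> extension_closure R B"
  proof induction
    case (ext X Z Y f g h)
    thus ?case using assms r.extension_closure_Obj[of B]
      by (intro extension_closure.ext[of X _ _ Z Y f g h]) auto
  qed (auto intro: extension_closure.intros(1-3) simp: restrict_full)
next
  fix X assume "X \<in> extension_closure R B"
  thus "X \<in> extension_closure S B"
  proof induction
    case (ext X Z Y f g h)
    thus ?case by (intro extension_closure.ext[of X _ _ Z Y f g h]) auto
  qed (auto intro: extension_closure.intros(1-3) simp: restrict_full)
qed

text \<open>A triangulated subcategory W of the ambient category gives W intersected with E.
  Conversely, one inside E remains triangulated in the ambient category, since E absorbs zero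
  objects, isomorphic objects and cones.\<close>

lemma restrict_hull:
  assumes "B \<subseteq> E"
  shows "triangulated_hull C B = triangulated_hull R B"
proof -
  have 1: "triangulated_subcat R (W \<inter> E)" if W: "triangulated_subcat C W" for W
    unfolding triangulated_subcat_def restrict_tri_sel r_isomorphic r_zero
  proof (intro conjI allI ballI impI)
    show "Z \<in> W \<inter> E" if "X \<in> W \<inter> E" "Y \<in> W \<inter> E" "tri X Y Z f g h \<and> X \<in> E \<and> Y \<in> E \<and> Z \<in> E" for X Y Z f g h
      using T_subcat_cone[OF W, of X Y Z] that unfolding T_def by blast
    show "sh 1 X \<in> W \<inter> E" "sh (- 1) X \<in> W \<inter> E" if "X \<in> W \<inter> E" for X
      using T_subcat_shift[OF W] T_subcat_shift[OF E] that by blast+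
    show "Y \<in> W \<inter> E" if "X \<in> W \<inter> E" "X \<in> E \<and> Y \<in> E \<and> isomorphic C X Y" for X Y
      using T_subcat_iso[OF W, of X Y] that by blast
    show "X \<in> W \<inter> E" if "X \<in> E \<and> zero_object C X" for X
      using W that by (simp add: triangulated_subcat_def)
  qed simp
  have 2: "triangulated_subcat C W" if W: "triangulated_subcat R W" for W
  proof -
    have WE: "W \<subseteq> E" using W by (simp add: triangulated_subcat_def)
    show ?thesis unfolding triangulated_subcat_def
    proof (intro conjI allI ballI impI)
      show "Y \<in> W" if "X \<in> W" "isomorphic C X Y" for X Y
        using r.T_subcat_iso[OF W that(1), of Y] that WE T_subcat_iso[OF E, of X Y] by (auto simp: r_isomorphic)
      show "Z \<in> W" if t: "X \<in> W" "Y \<in> W" "tri X Y Z f g h" for X Y Z f g h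
        using r.T_subcat_cone[OF W _ t(1,2), of Z] t WE tri_E[OF t(3)] unfolding r.T_def by auto
      show "sh 1 X \<in> W" "sh (- 1) X \<in> W" if "X \<in> W" for X
        using r.T_subcat_shift[OF W that] by simp_all
      show "X \<in> W" if "zero_object C X" for X
        using W that zero_E[OF that] unfolding triangulated_subcat_def r_zero by blast
    qed (use WE E_Obj in blast)
  qed
  show ?thesis
  proof (intro equalityI subsetI)
    show "X \<in> triangulated_hull R B" if "X \<in> triangulated_hull C B" for X
      using that 2 unfolding triangulated_hull_def by blast
    show "X \<in> triangulated_hull C B" if "X \<in> triangulated_hull R B" for X
      using that 1 assms unfolding triangulated_hull_def by blast
  qed
qed

lemma r_Hz: "r.Hz X Y \<longleftrightarrow> X \<in> E \<and> Y \<in> E \<and> Hz X Y"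
  using E_Obj by (auto simp: r.Hz_def Hz_def r_mor)

lemma heart_bounded_determines:
  "bounded_t_structure S (U, V) ==> bounded_t_structure S (U', V') ==> U \<inter> V = U' \<inter> V' ==> (U, V) = (U', V')"
  using r.heart_determines unfolding restrict_bounded by blast

lemma simples_of_t_structure:
  assumes b: "bounded_t_structure S (U, V)" and l: "length_category K (heart S (U, V))"
    and r: "simple_representatives (heart S (U, V)) Ss"
  shows "set Ss \<subseteq> E"
    and "i < length Ss ==> j < length Ss ==> i \<noteq> j ==> Hz (Ss ! i) (Ss ! j)"
    and "s \<in> set Ss ==> \<not> zero_object C s"
    and "s \<in> set Ss ==> mor s s f ==> f \<noteq> zr s s ==> iso s s f"
    and "s \<in> set Ss ==> s' \<in> set Ss ==> n < 0 ==> Hz s (sh n s')"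
    and "triangulated_hull C (set Ss) = E"
    and "extension_closure S (set Ss) = U \<inter> V"
proof -
  interpret t: tstr K "R" sg U V
    by unfold_locales (use b in \<open>simp add: restrict_t bounded_t_structure_def\<close>)
  note s = t.simples[OF b[unfolded restrict_bounded] l[unfolded heart_cong] r[unfolded heart_cong]]
  show SE: "set Ss \<subseteq> E" using s(1) by simp
  show "Hz (Ss ! i) (Ss ! j)" if "i < length Ss" "j < length Ss" "i \<noteq> j" using s(2)[OF that] by (simp add: r_Hz)
  show "\<not> zero_object C s" if "s \<in> set Ss" using s(3)[OF that] SE that by (auto simp: r_zero)
  show "iso s s f" if "s \<in> set Ss" "mor s s f" "f \<noteq> zr s s" using s(4)[OF that(1), of f] that SE by (auto simp: r_iso r_mor)
  show "Hz s (sh n s')" if "s \<in> set Ss" "s' \<in> set Ss" "n < 0" using s(5)[OF that] by (simp add: r_Hz)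
  show "triangulated_hull C (set Ss) = E" using s(6) restrict_hull[OF SE] by simp
  show "extension_closure S (set Ss) = U \<inter> V" using s(7) restrict_closure[OF SE] by simp
qed

lemma t_structure_of_simples:
  assumes "set Ss \<subseteq> E"
    and "!!i j. i < length Ss ==> j < length Ss ==> i \<noteq> j ==> Hz (Ss ! i) (Ss ! j)"
    and "!!s. s \<in> set Ss ==> \<not> zero_object C s"
    and "!!s f. s \<in> set Ss ==> mor s s f ==> f \<noteq> zr s s ==> iso s s f"
    and "!!s s' n. s \<in> set Ss ==> s' \<in> set Ss ==> n < 0 ==> Hz s (sh n s')"
    and "triangulated_hull C (set Ss) = E"
  obtains U V where "bounded_t_structure S (U, V)" "length_category K (heart S (U, V))" "simple_representatives (heart S (U, V)) Ss"
proof -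
  interpret m: smf K "R" sg Ss
  proof unfold_locales
    show "r.Hz (Ss ! i) (Ss ! j)" if "i < length Ss" "j < length Ss" "i \<noteq> j" for i j
      using assms(1,2) that by (auto simp: r_Hz subset_iff)
    show "r.Hz s (shift R n s')" if "s \<in> set Ss" "s' \<in> set Ss" "n < 0" for s s' n
      using assms(1,5) that T_subcat_shift[OF E] by (auto simp: r_Hz)
    show "triangulated_hull R (set Ss) = Obj R" using assms(6) restrict_hull[OF assms(1)] by simp
  qed (use assms in \<open>auto simp: r_zero r_mor r_iso\<close>)
  show thesis
    by (rule that[of m.U m.V]; unfold restrict_bounded heart_cong) (rule m.UV_bounded m.heart_length m.Ss_representatives)+
qed

end

section \<open>Finite-dimensional vector spaces\<close>

locale vspace = module K V + field K for K :: "'k ring" (structure) and V :: "('k, 'a) module"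
begin

abbreviation vadd (infixl \<open>+\<^sub>v\<close> 65) where "x +\<^sub>v y \<equiv> x \<oplus>\<^bsub>V\<^esub> y"
abbreviation vsm (infixr \<open>*\<^sub>v\<close> 70) where "c *\<^sub>v x \<equiv> c \<odot>\<^bsub>V\<^esub> x"
abbreviation vz (\<open>0\<^sub>v\<close>) where "0\<^sub>v \<equiv> \<zero>\<^bsub>V\<^esub>"

text \<open>An inductive span turns linear algebra into inductions without coefficient functions;
  \<open>finite_dim_iff\<close> connects it with the sums in \<open>finite_dim\<close>.\<close>

inductive_set lspan for B where
  zero: "0\<^sub>v \<in> lspan B"
| step: "b \<in> B ==> c \<in> carrier K ==> v \<in> lspan B ==> c *\<^sub>v b +\<^sub>v v \<in> lspan B"

definition subsp where "subsp W \<longleftrightarrow> W \<subseteq> carrier V \<and> 0\<^sub>v \<in> W \<and> (\<forall>x\<in>W. \<forall>y\<in>W. x +\<^sub>v y \<in> W) \<and> (\<forall>c\<in>carrier K. \<forall>x\<in>W. c *\<^sub>v x \<in> W)"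

lemma lspan_sub: "subsp W ==> B \<subseteq> W ==> lspan B \<subseteq> W"
proof
  fix v assume "v \<in> lspan B" "subsp W" "B \<subseteq> W"
  thus "v \<in> W" by induction (auto simp: subsp_def)
qed

lemma subsp_carrier: "subsp (carrier V)"
  by (auto simp: subsp_def)

lemma lspan_carrier: "B \<subseteq> carrier V ==> v \<in> lspan B ==> v \<in> carrier V"
  using lspan_sub[OF subsp_carrier] by blast

lemma lspan_base: "b \<in> B ==> B \<subseteq> carrier V ==> b \<in> lspan B"
  using lspan.step[OF _ _ lspan.zero, of b B \<one>] by (auto simp: smult_one subset_iff)

lemma lspan_subsp:
  assumes "B \<subseteq> carrier V"
  shows "subsp (lspan B)"
  unfolding subsp_def
proof (intro conjI ballI)
  show "lspan B \<subseteq> carrier V" using lspan_carrier[OF assms] by blast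
  show "x +\<^sub>v y \<in> lspan B" if "x \<in> lspan B" "y \<in> lspan B" for x y
    using that(1)
  proof induction
    case zero
    thus ?case using that(2) lspan_carrier[OF assms] by simp
  next
    case (step b c v)
    have "c *\<^sub>v b +\<^sub>v v +\<^sub>v y = c *\<^sub>v b +\<^sub>v (v +\<^sub>v y)"
      using step lspan_carrier[OF assms] that(2) assms by (intro M.a_assoc) auto
    thus ?case using lspan.step step by auto
  qed
  show "a *\<^sub>v x \<in> lspan B" if "a \<in> carrier K" "x \<in> lspan B" for a x
    using that(2)
  proof induction
    case zero
    thus ?case using lspan.zero that(1) by (simp add: smult_r_null)
  next
    case (step b c v)
    have "a *\<^sub>v (c *\<^sub>v b +\<^sub>v v) = (a \<otimes> c) *\<^sub>v b +\<^sub>v a *\<^sub>v v"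
      using step lspan_carrier[OF assms] that(1) assms by (subst smult_r_distr) (auto simp: smult_assoc1 subset_iff)
    thus ?case using lspan.step step that(1) by auto
  qed
qed (rule lspan.zero)

lemma lspan_mono: "B \<subseteq> lspan B' ==> B' \<subseteq> carrier V ==> lspan B \<subseteq> lspan B'"
  using lspan_sub[OF lspan_subsp] by blast

lemma lspan_mono': "B \<subseteq> B' ==> B' \<subseteq> carrier V ==> lspan B \<subseteq> lspan B'"
  by (rule lspan_mono) (auto intro: lspan_base)

lemma subsp_diff: "subsp W ==> x \<in> W ==> y \<in> W ==> x \<ominus>\<^bsub>V\<^esub> y \<in> W"
proof -
  assume W: "subsp W" "x \<in> W" "y \<in> W"
  hence "y \<in> carrier V" "\<ominus> \<one> *\<^sub>v y \<in> W" by (auto simp: subsp_def)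
  moreover from this have "\<ominus>\<^bsub>V\<^esub> y = \<ominus> \<one> *\<^sub>v y" using smult_l_minus[of \<one> y] by (simp add: smult_one)
  ultimately show ?thesis using W unfolding a_minus_def by (auto simp: subsp_def)
qed

lemma finite_dim_iff: "finite_dim K V \<longleftrightarrow> (\<exists>B. finite B \<and> B \<subseteq> carrier V \<and> carrier V \<subseteq> lspan B)"
proof -
  have key: "v \<in> lspan B \<longleftrightarrow> (\<exists>c\<in>B \<rightarrow> carrier K. v = finsum V (\<lambda>b. c b *\<^sub>v b) B)" if B: "finite B" "B \<subseteq> carrier V" for B v
  proof
    assume "v \<in> lspan B"
    thus "\<exists>c\<in>B \<rightarrow> carrier K. v = finsum V (\<lambda>b. c b *\<^sub>v b) B"
    proof induction
      case zero
      have "finsum V (\<lambda>b. \<zero> *\<^sub>v b) B = finsum V (\<lambda>b. 0\<^sub>v) B" by (rule M.finsum_cong') (use B in \<open>auto simp: smult_l_null\<close>)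
      thus ?case using M.finsum_zero[of B] by (intro bexI[of _ "\<lambda>b. \<zero>"]) auto
    next
      case (step b a v)
      then obtain c where c: "c \<in> B \<rightarrow> carrier K" "v = finsum V (\<lambda>b. c b *\<^sub>v b) B" by blast
      have b: "b \<in> carrier V" using step B by blast
      \<comment> \<open>Adding a b to the sum changes only the coefficient at b.\<close>
      have "finsum V (\<lambda>x. (c(b := a \<oplus> c b)) x *\<^sub>v x) B = finsum V (\<lambda>x. (if b = x then a *\<^sub>v x else 0\<^sub>v) +\<^sub>v c x *\<^sub>v x) B"
        by (rule M.finsum_cong') (use B c step in \<open>auto simp: Pi_iff subset_iff smult_l_distr\<close>)
      also have "\<dots> = finsum V (\<lambda>x. if b = x then a *\<^sub>v x else 0\<^sub>v) B +\<^sub>v finsum V (\<lambda>x. c x *\<^sub>v x) B"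
        by (rule M.finsum_addf) (use B c step in \<open>auto simp: Pi_iff subset_iff\<close>)
      also have "finsum V (\<lambda>x. if b = x then a *\<^sub>v x else 0\<^sub>v) B = a *\<^sub>v b"
        by (rule M.add.finprod_singleton) (use B step in auto)
      finally show ?case using c step by (intro bexI[of _ "c(b := a \<oplus> c b)"]) (auto simp: Pi_iff)
    qed
  next
    assume "\<exists>c\<in>B \<rightarrow> carrier K. v = finsum V (\<lambda>b. c b *\<^sub>v b) B"
    then obtain c where c: "c \<in> B \<rightarrow> carrier K" "v = finsum V (\<lambda>b. c b *\<^sub>v b) B" by blast
    have "finsum V (\<lambda>b. c b *\<^sub>v b) B' \<in> lspan B'" if "B' \<subseteq> B" "finite B'" for B'
      using that(2,1)
    proof (induction B')
      case (insert b B')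
      have "lspan B' \<subseteq> lspan (insert b B')" using lspan_mono'[of B' "insert b B'"] insert B by auto
      moreover have "finsum V (\<lambda>b. c b *\<^sub>v b) (insert b B') = c b *\<^sub>v b +\<^sub>v finsum V (\<lambda>b. c b *\<^sub>v b) B'"
        by (rule M.finsum_insert) (use insert c B in \<open>auto simp: Pi_iff subset_iff\<close>)
      ultimately show ?case using lspan.step[of b "insert b B'" "c b"] insert c by (auto simp: Pi_iff subset_iff)
    qed (simp add: lspan.zero)
    thus "v \<in> lspan B" using c(2) B by blast
  qed
  have "(\<forall>v\<in>carrier V. \<exists>c\<in>B \<rightarrow> carrier K. v = finsum V (\<lambda>b. c b *\<^sub>v b) B) \<longleftrightarrow> carrier V \<subseteq> lspan B"
    if "finite B" "B \<subseteq> carrier V" for B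
    unfolding subset_eq key[OF that] ..
  thus ?thesis unfolding finite_dim_def by (simp cong: conj_cong)
qed

lemma lspan_insert:
  assumes "w \<in> lspan (insert b B)" "insert b B \<subseteq> carrier V"
  obtains c u where "c \<in> carrier K" "u \<in> lspan B" "w = c *\<^sub>v b +\<^sub>v u"
proof -
  have "\<exists>c\<in>carrier K. \<exists>u\<in>lspan B. w = c *\<^sub>v b +\<^sub>v u"
    using assms(1)
  proof induction
    case zero
    show ?case using lspan.zero assms(2) by (intro bexI[of _ \<zero>] bexI[of _ "0\<^sub>v"]) (auto simp: smult_l_null)
  next
    case (step x a v)
    then obtain c u where c: "c \<in> carrier K" "u \<in> lspan B" "v = c *\<^sub>v b +\<^sub>v u" by blast
    have u: "u \<in> carrier V" "b \<in> carrier V" "x \<in> carrier V" using lspan_carrier c(2) assms(2) step(1) by auto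
    show ?case
    proof (cases "x = b")
      case True
      have "a *\<^sub>v x +\<^sub>v v = (a \<oplus> c) *\<^sub>v b +\<^sub>v u" using True c u step by (simp add: smult_l_distr M.a_assoc)
      thus ?thesis using c step by (intro bexI[of _ "a \<oplus> c"] bexI[of _ u]) auto
    next
      case False
      have "a *\<^sub>v x +\<^sub>v v = c *\<^sub>v b +\<^sub>v (a *\<^sub>v x +\<^sub>v u)" using c u step by (simp add: M.a_lcomm)
      thus ?thesis using c lspan.step[of x B a u] False step by (intro bexI[of _ c] bexI[of _ "a *\<^sub>v x +\<^sub>v u"]) auto
    qed
  qed
  thus thesis using that by blast
qed

text \<open>Induction on the generators. If W is not inside the span of B, some w in W has a nonzero
  coefficient at b, and W is spanned by w together with its intersection with the span of B.\<close>

lemma subsp_fg: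
  assumes "finite B" "B \<subseteq> carrier V" "subsp W" "W \<subseteq> lspan B"
  shows "\<exists>B'. finite B' \<and> B' \<subseteq> W \<and> W \<subseteq> lspan B'"
  using assms
proof (induction B arbitrary: W)
  case empty
  have "w = 0\<^sub>v" if "w \<in> lspan {}" for w using that by cases auto
  hence "W \<subseteq> lspan {}" using empty lspan.zero by blast
  thus ?case by (intro exI[of _ "{}"]) auto
next
  case (insert b B W)
  have Bc: "B \<subseteq> carrier V" "b \<in> carrier V" using insert by auto
  have Wc: "W \<subseteq> carrier V" using insert by (simp add: subsp_def)
  have "subsp (W \<inter> lspan B)" using insert(5) lspan_subsp[OF Bc(1)] by (auto simp: subsp_def)
  from insert(3)[OF Bc(1) this Int_lower2] obtain B' where B': "finite B'" "B' \<subseteq> W \<inter> lspan B" "W \<inter> lspan B \<subseteq> lspan B'" by (elim exE conjE)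
  show ?case
  proof (cases "W \<subseteq> lspan B")
    case True
    thus ?thesis using B' by blast
  next
    case False
    then obtain w where w: "w \<in> W" "w \<notin> lspan B" by blast
    obtain c u where c: "c \<in> carrier K" "u \<in> lspan B" "w = c *\<^sub>v b +\<^sub>v u" using lspan_insert[of w b B] w(1) insert by blast
    have uc: "u \<in> carrier V" using lspan_carrier[OF Bc(1) c(2)] .
    have c0: "c \<noteq> \<zero>" using w(2) c Bc uc by (auto simp: smult_l_null)
    have "x \<in> lspan (insert w B')" if x: "x \<in> W" for x
    proof -
      obtain a y where a: "a \<in> carrier K" "y \<in> lspan B" "x = a *\<^sub>v b +\<^sub>v y" using lspan_insert[of x b B] x insert by blast
      have yc: "y \<in> carrier V" using lspan_carrier[OF Bc(1) a(2)] .
      \<comment> \<open>With this factor, e w has the same coefficient at b as x, so the difference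
        lies in the span of B.\<close>
      define e where "e = a \<otimes> inv c"
      have ec: "inv c \<in> carrier K" "e \<in> carrier K" "e \<otimes> c = a" using c0 c(1) a(1) by (auto simp: e_def m_assoc field_Units)
      have wc: "w \<in> carrier V" using w Wc by blast
      have "e *\<^sub>v w = a *\<^sub>v b +\<^sub>v e *\<^sub>v u" using c ec uc Bc by (simp add: smult_r_distr smult_assoc1[symmetric])
      hence "x \<ominus>\<^bsub>V\<^esub> e *\<^sub>v w = y \<ominus>\<^bsub>V\<^esub> e *\<^sub>v u"
        using a uc yc ec Bc by (simp add: a_minus_def M.minus_add M.a_assoc M.a_lcomm[of y] M.r_neg1 M.r_neg2 M.a_comm[of y])
      moreover have "y \<ominus>\<^bsub>V\<^esub> e *\<^sub>v u \<in> lspan B" using subsp_diff[OF lspan_subsp[OF Bc(1)] a(2)] lspan_subsp[OF Bc(1)] c(2) ec(2) by (auto simp: subsp_def)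
      moreover have "x \<ominus>\<^bsub>V\<^esub> e *\<^sub>v w \<in> W" using subsp_diff[OF insert(5) x] insert(5) w(1) ec(2) by (auto simp: subsp_def)
      ultimately have z: "x \<ominus>\<^bsub>V\<^esub> e *\<^sub>v w \<in> lspan B'" using B'(3) by auto
      have "lspan B' \<subseteq> lspan (insert w B')" using lspan_mono'[of B' "insert w B'"] B'(2) Wc wc by blast
      hence "e *\<^sub>v w +\<^sub>v (x \<ominus>\<^bsub>V\<^esub> e *\<^sub>v w) \<in> lspan (insert w B')" using lspan.step[of w "insert w B'" e] z ec(2) by blast
      moreover have "e *\<^sub>v w +\<^sub>v (x \<ominus>\<^bsub>V\<^esub> e *\<^sub>v w) = x"
        using x Wc wc ec by (simp add: a_minus_def M.a_lcomm[of _ x] subset_iff M.r_neg)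
      ultimately show ?thesis by simp
    qed
    thus ?thesis using B' w(1) by (intro exI[of _ "insert w B'"]) auto
  qed
qed

end

lemma vspaceI: "field K ==> module K V ==> vspace K V"
  by (simp add: vspace_def)

text \<open>A spanning set of V consists of the images of generators of V' and of preimages D of
  generators of the image of g; the image is finitely generated as a subspace of V''.\<close>

lemma exact_finite_dim:
  assumes K: "field K" and V: "module K V'" "module K V" "module K V''" and f: "klinear K V' V f" and g: "klinear K V V'' g"
    and ex: "!!v. v \<in> carrier V ==> g v = \<zero>\<^bsub>V''\<^esub> ==> \<exists>u\<in>carrier V'. f u = v"
    and fd: "finite_dim K V'" "finite_dim K V''"
  shows "finite_dim K V"
proof -
  interpret V': vspace K V' by (rule vspaceI[OF K V(1)])
  interpret V: vspace K V by (rule vspaceI[OF K V(2)])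
  interpret V'': vspace K V'' by (rule vspaceI[OF K V(3)])
  note fl = f[unfolded klinear_def] and gl = g[unfolded klinear_def]
  have lin0: "h \<zero>\<^bsub>W\<^esub> = \<zero>\<^bsub>W'\<^esub>" if "klinear K W W' h" "module K W" "module K W'" for h and W :: "('a, 'z) module" and W' :: "('a, 'y) module"
  proof -
    interpret W: module K W by fact
    interpret W': module K W' by fact
    have "h (\<zero>\<^bsub>K\<^esub> \<odot>\<^bsub>W\<^esub> \<zero>\<^bsub>W\<^esub>) = \<zero>\<^bsub>K\<^esub> \<odot>\<^bsub>W'\<^esub> h \<zero>\<^bsub>W\<^esub>" "h \<zero>\<^bsub>W\<^esub> \<in> carrier W'"
      using that(1) V.zero_closed W.M.zero_closed unfolding klinear_def by blast+
    thus ?thesis by (simp add: W.smult_l_null W'.smult_l_null)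
  qed
  have klin: "v \<in> carrier V ==> g v \<in> carrier V''" for v using gl by auto
  note f0 = lin0[OF f V(1,2)] and g0 = lin0[OF g V(2,3)]
  obtain B' where B': "finite B'" "B' \<subseteq> carrier V'" "carrier V' \<subseteq> V'.lspan B'" using fd(1) V'.finite_dim_iff by blast
  obtain B0 where B0: "finite B0" "B0 \<subseteq> carrier V''" "carrier V'' \<subseteq> V''.lspan B0" using fd(2) V''.finite_dim_iff by blast
  have "V''.subsp (g ` carrier V)"
    unfolding V''.subsp_def
  proof (intro conjI ballI)
    show "\<zero>\<^bsub>V''\<^esub> \<in> g ` carrier V" using imageI[OF V.M.zero_closed, of g] g0 by simp
    show "x \<oplus>\<^bsub>V''\<^esub> y \<in> g ` carrier V" if xy: "x \<in> g ` carrier V" "y \<in> g ` carrier V" for x y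
    proof -
      obtain v w where "v \<in> carrier V" "w \<in> carrier V" "x = g v" "y = g w" using xy by blast
      thus ?thesis using gl by (intro image_eqI[of _ _ "v \<oplus>\<^bsub>V\<^esub> w"]) auto
    qed
    show "c \<odot>\<^bsub>V''\<^esub> x \<in> g ` carrier V" if c: "c \<in> carrier K" "x \<in> g ` carrier V" for c x
    proof -
      obtain v where "v \<in> carrier V" "x = g v" using c by blast
      thus ?thesis using gl c(1) by (intro image_eqI[of _ _ "c \<odot>\<^bsub>V\<^esub> v"]) auto
    qed
  qed (use gl in auto)
  moreover have "g ` carrier V \<subseteq> V''.lspan B0" using B0(3) gl by auto
  ultimately obtain C where C: "finite C" "C \<subseteq> g ` carrier V" "g ` carrier V \<subseteq> V''.lspan C"
    using V''.subsp_fg[OF B0(1,2), of "g ` carrier V"] by blast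
  then obtain D where D: "finite D" "D \<subseteq> carrier V" "C = g ` D" by (metis finite_subset_image)
  let ?B = "f ` B' \<union> D"
  have Bc: "?B \<subseteq> carrier V" using fl B' D by auto
  note sub = V.lspan_subsp[OF Bc]
  have 1: "f u \<in> V.lspan ?B" if "u \<in> V'.lspan B'" for u
    using that
  proof induction
    case zero
    thus ?case using f0 V.lspan.zero by simp
  next
    case (step b c v)
    have "b \<in> carrier V'" "v \<in> carrier V'" using step B' V'.lspan_carrier by auto
    hence "f (c \<odot>\<^bsub>V'\<^esub> b \<oplus>\<^bsub>V'\<^esub> v) = c \<odot>\<^bsub>V\<^esub> f b \<oplus>\<^bsub>V\<^esub> f v" using fl step(2) by simp
    thus ?case using V.lspan.step[of "f b" ?B] step by simp
  qed
  have 2: "\<exists>d\<in>V.lspan ?B. g d = w" if "w \<in> V''.lspan C" for w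
    using that
  proof induction
    case zero
    thus ?case using g0 V.lspan.zero by blast
  next
    case (step b c w)
    then obtain d x where d: "d \<in> V.lspan ?B" "g d = w" "x \<in> D" "b = g x" using D by blast
    have c: "d \<in> carrier V" "x \<in> carrier V" using V.lspan_carrier[OF Bc] d D by auto
    hence "g (c \<odot>\<^bsub>V\<^esub> x \<oplus>\<^bsub>V\<^esub> d) = c \<odot>\<^bsub>V''\<^esub> b \<oplus>\<^bsub>V''\<^esub> w" using gl step(2) d by simp
    thus ?case using V.lspan.step[of x ?B c d] d step(2) by blast
  qed
  have "carrier V \<subseteq> V.lspan ?B"
  proof
    fix v assume v: "v \<in> carrier V"
    then obtain d where d: "d \<in> V.lspan ?B" "g d = g v" using 2 C by blast
    have dc: "d \<in> carrier V" using V.lspan_carrier[OF Bc d(1)] .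
    let ?m = "\<ominus>\<^bsub>K\<^esub> \<one>\<^bsub>K\<^esub> \<odot>\<^bsub>V\<^esub> d"
    have m: "?m = \<ominus>\<^bsub>V\<^esub> d" using V.smult_l_minus[of "\<one>\<^bsub>K\<^esub>" d] dc by (simp add: V.smult_one)
    have "g (v \<oplus>\<^bsub>V\<^esub> ?m) = g v \<oplus>\<^bsub>V''\<^esub> (\<ominus>\<^bsub>K\<^esub> \<one>\<^bsub>K\<^esub>) \<odot>\<^bsub>V''\<^esub> g v" using gl v dc d(2) by simp
    also have "\<dots> = \<zero>\<^bsub>V''\<^esub>" using V''.smult_l_minus[of "\<one>\<^bsub>K\<^esub>" "g v"] klin v by (simp add: V''.smult_one V''.M.r_neg)
    finally obtain u where u: "u \<in> carrier V'" "f u = v \<oplus>\<^bsub>V\<^esub> ?m" using ex[of "v \<oplus>\<^bsub>V\<^esub> ?m"] v dc by auto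
    hence "v \<oplus>\<^bsub>V\<^esub> ?m \<in> V.lspan ?B" using 1[OF subsetD[OF B'(3) u(1)]] by simp
    hence "(v \<oplus>\<^bsub>V\<^esub> ?m) \<oplus>\<^bsub>V\<^esub> d \<in> V.lspan ?B" using sub d(1) by (simp add: V.subsp_def)
    thus "v \<in> V.lspan ?B" using v dc m by (simp add: V.M.a_assoc V.M.l_neg)
  qed
  moreover have "finite ?B" using B'(1) D(1) by simp
  ultimately show ?thesis unfolding V.finite_dim_iff using Bc by (intro exI[of _ ?B] conjI)
qed

section \<open>Eigenvectors\<close>

text \<open>Coefficient lists start with the constant term.\<close>
primrec (in ring) peval where
  "peval [] x = \<zero>"
| "peval (a # p) x = a \<oplus> x \<otimes> peval p x"

text \<open>The quotient of a polynomial by \<open>X - x\<close>.\<close>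
fun (in ring) pquot where
  "pquot [] x = []"
| "pquot [a] x = []"
| "pquot (a # b # p) x = peval (b # p) x # pquot (b # p) x"

lemma (in ring) peval_closed: "set p \<subseteq> carrier R ==> x \<in> carrier R ==> peval p x \<in> carrier R"
  by (induction p) auto

lemma (in ring) pquot_closed: "set p \<subseteq> carrier R ==> x \<in> carrier R ==> set (pquot p x) \<subseteq> carrier R"
  by (induction p x rule: pquot.induct) (auto simp: peval_closed)

text \<open>Division by X - x preserves the leading coefficient, so the quotient remains a
  legitimate nonzero polynomial in the induction of \<open>ex_eigenvector\<close>.\<close>

lemma (in ring) pquot_last: "length p \<ge> 2 ==> set p \<subseteq> carrier R ==> x \<in> carrier R ==> last (pquot p x) = last p"
proof (induction p x rule: pquot.induct)
  case (3 a b p x)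
  thus ?case by (cases p) auto
qed auto

lemma (in ring) pquot_length: "length (pquot p x) = length p - 1"
  by (induction p x rule: pquot.induct) auto

text \<open>\<open>eval\<close> reads coefficient lists with the leading coefficient first.\<close>

lemma (in cring) eval_rev: "set p \<subseteq> carrier R ==> x \<in> carrier R ==> eval (rev p) x = peval p x"
proof (induction p)
  case (Cons a p)
  hence "eval (rev p @ [a]) x = eval (rev p) x \<otimes> x \<oplus> a" by (intro eval_append_aux) auto
  thus ?case using Cons by (simp add: a_comm m_comm peval_closed)
qed simp

lemma (in algebraically_closed) ex_root:
  assumes "set p \<subseteq> carrier L" "length p \<ge> 2" "last p \<noteq> \<zero>"
  obtains x where "x \<in> carrier L" "peval p x = \<zero>"
proof -
  have "rev p \<noteq> []" "hd (rev p) \<noteq> \<zero>" using assms by (auto simp: hd_rev)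
  hence P: "rev p \<in> carrier (poly_ring L)" using assms(1) by (auto simp: univ_poly_carrier[symmetric] polynomial_def)
  have "size (roots (rev p)) = degree (rev p)" using roots_over_carrier[OF P] by (simp add: splitted_def)
  then obtain x where "x \<in># roots (rev p)" using assms(2) by (metis length_rev multiset_nonemptyE size_empty diff_is_0_eq not_less_eq_eq numeral_2_eq_2 One_nat_def)
  hence "is_root (rev p) x" using roots_mem_iff_is_root[OF P] by simp
  thus thesis using that eval_rev[OF assms(1)] by (auto simp: is_root_def)
qed

text \<open>If the field had q elements, X^q - X + 1 would take the value 1 everywhere, although it
  must have a root.\<close>

lemma (in algebraically_closed) infinite_carrier: "infinite (carrier L)"
proof
  assume fin: "finite (carrier L)"
  let ?q = "card (carrier L)"
  have "card {\<zero>, \<one>} \<le> ?q" by (rule card_mono[OF fin]) auto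
  hence q: "?q \<ge> 2" by simp
  have U: "card (Units L) = ?q - 1" using fin by (simp add: field_Units)
  have pow: "x \<otimes> x [^] (?q - 1) = x" if "x \<in> carrier L" for x
    using that units_power_order_eq_one[of x] fin by (cases "x = \<zero>") (auto simp: field_Units U[symmetric])
  have ev: "peval (replicate n \<zero> @ [\<one>]) x = x [^] n" if "x \<in> carrier L" for x n
    using that by (induction n) (simp_all add: m_comm)
  \<comment> \<open>This is 1 - X + X^q; the q - 2 zeros fill the degrees from 2 to q - 1.\<close>
  let ?p = "\<one> # \<ominus> \<one> # replicate (?q - 2) \<zero> @ [\<one>]"
  obtain x where x: "x \<in> carrier L" "peval ?p x = \<zero>" by (rule ex_root[of ?p]) auto
  have "x \<otimes> x [^] (?q - 2) = x [^] (?q - 1)" using x(1) q nat_pow_Suc2[OF x(1), of "?q - 2"] by (simp add: Suc_diff_Suc numeral_2_eq_2)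
  moreover have "peval ?p x = \<one> \<oplus> x \<otimes> (\<ominus> \<one> \<oplus> x \<otimes> x [^] (?q - 2))" using ev[OF x(1)] by simp
  ultimately have "peval ?p x = \<one> \<oplus> (\<ominus> x \<oplus> x \<otimes> x [^] (?q - 1))" using x(1) by (simp add: r_distr r_minus)
  hence "peval ?p x = \<one>" using pow[OF x(1)] x(1) by (simp add: l_neg)
  thus False using x(2) by simp
qed

context vspace
begin

text \<open>The vector p(T) v, evaluated by Horner's scheme.\<close>

primrec vpeval where
  "vpeval T [] v = 0\<^sub>v"
| "vpeval T (a # p) v = a *\<^sub>v v +\<^sub>v T (vpeval T p v)"

context
  fixes T assumes T: "klinear K V V T"
begin

lemma T_simps: "x \<in> carrier V ==> T x \<in> carrier V" "x \<in> carrier V ==> y \<in> carrier V ==> T (x +\<^sub>v y) = T x +\<^sub>v T y"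
  "c \<in> carrier K ==> x \<in> carrier V ==> T (c *\<^sub>v x) = c *\<^sub>v T x"
  using T by (auto simp: klinear_def)

lemma vneg_zero: "\<ominus>\<^bsub>V\<^esub> 0\<^sub>v = 0\<^sub>v"
  using M.minus_equality[of "0\<^sub>v" "0\<^sub>v"] by simp

lemma T_zero: "T 0\<^sub>v = 0\<^sub>v"
  using T_simps(3)[of \<zero> "0\<^sub>v"] T_simps(1)[of "0\<^sub>v"] by (simp add: smult_l_null)

lemma vpeval_closed: "set p \<subseteq> carrier K ==> v \<in> carrier V ==> vpeval T p v \<in> carrier V"
  by (induction p) (auto simp: T_simps)

lemma funpow_closed: "v \<in> carrier V ==> (T ^^ i) v \<in> carrier V"
  by (induction i) (auto simp: T_simps)

lemma vpeval_update:
  assumes "set p \<subseteq> carrier K" "v \<in> carrier V" "c \<in> carrier K" "i < length p"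
  shows "vpeval T (p[i := p ! i \<oplus> c]) v = c *\<^sub>v (T ^^ i) v +\<^sub>v vpeval T p v"
  using assms
proof (induction p arbitrary: i)
  case (Cons a p)
  have m: "vpeval T p v \<in> carrier V" "a \<in> carrier K" using Cons vpeval_closed by auto
  show ?case
  proof (cases i)
    case 0
    thus ?thesis using Cons m by (simp add: smult_l_distr M.a_ac T_simps)
  next
    case (Suc j)
    hence "T (vpeval T (p[j := p ! j \<oplus> c]) v) = c *\<^sub>v (T ^^ i) v +\<^sub>v T (vpeval T p v)"
      using Cons m funpow_closed[of v j] by (simp add: T_simps)
    thus ?thesis using Suc Cons m funpow_closed[of v j] by (simp add: M.a_lcomm T_simps)
  qed
qed simp

text \<open>Combinations of v, T v, ..., T^(n-1) v are the vectors p(T) v; fixing the length of p to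
  n lets a coefficient be updated in place.\<close>

lemma vpeval_lspan:
  assumes "u \<in> lspan ((\<lambda>i. (T ^^ i) v) ` {..<n})" "v \<in> carrier V"
  shows "\<exists>p. set p \<subseteq> carrier K \<and> length p = n \<and> vpeval T p v = u"
  using assms(1)
proof induction
  case zero
  have "vpeval T (replicate n \<zero>) v = 0\<^sub>v" using assms(2) by (induction n) (auto simp: smult_l_null T_zero)
  thus ?case by (intro exI[of _ "replicate n \<zero>"]) auto
next
  case (step b c u)
  then obtain p i where p: "set p \<subseteq> carrier K" "length p = n" "vpeval T p v = u" "i < n" "b = (T ^^ i) v" by auto
  have "p ! i \<oplus> c \<in> carrier K" using p step(2) by (auto simp: subset_iff)
  thus ?case using vpeval_update[OF p(1) assms(2) step(2), of i] p set_update_subset_insert[of p i "p ! i \<oplus> c"]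
    by (intro exI[of _ "p[i := p ! i \<oplus> c]"]) auto
qed

text \<open>Division with remainder, p = (X - x) q + p(x), evaluated at T and applied to v.\<close>

lemma vpeval_quot:
  assumes "set p \<subseteq> carrier K" "v \<in> carrier V" "x \<in> carrier K"
  shows "vpeval T p v = (T (vpeval T (pquot p x) v) \<ominus>\<^bsub>V\<^esub> x *\<^sub>v vpeval T (pquot p x) v) +\<^sub>v peval p x *\<^sub>v v"
  using assms
proof (induction p x rule: pquot.induct)
  case (1 x)
  thus ?case by (simp add: T_zero smult_r_null smult_l_null a_minus_def vneg_zero)
next
  case (2 a x)
  thus ?case by (simp add: T_zero smult_r_null smult_l_null a_minus_def vneg_zero)
next
  case (3 a b p x)
  let ?p = "b # p" let ?q = "pquot ?p x"
  define e y where "e = peval ?p x" and "y = vpeval T ?q v"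
  have m: "a \<in> carrier K" "e \<in> carrier K" "y \<in> carrier V" "T y \<in> carrier V" "T v \<in> carrier V" "T (T y) \<in> carrier V"
    "x \<in> carrier K" "v \<in> carrier V"
    using 3 peval_closed pquot_closed vpeval_closed unfolding e_def y_def by (auto simp del: peval.simps vpeval.simps simp: T_simps)
  have n: "T (\<ominus>\<^bsub>V\<^esub> w) = \<ominus>\<^bsub>V\<^esub> T w" if "w \<in> carrier V" for w
    using T_simps(3)[of "\<ominus> \<one>" w] smult_l_minus[of \<one>] that T_simps(1)[OF that] by (simp add: smult_one)
  have canc: "u +\<^sub>v (w +\<^sub>v \<ominus>\<^bsub>V\<^esub> u) = w" if "u \<in> carrier V" "w \<in> carrier V" for u w
    using that M.a_lcomm[of u w "\<ominus>\<^bsub>V\<^esub> u"] by (simp add: M.r_neg)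
  have IH: "vpeval T ?p v = (T y \<ominus>\<^bsub>V\<^esub> x *\<^sub>v y) +\<^sub>v e *\<^sub>v v" using 3 unfolding e_def y_def by simp
  have "vpeval T (a # ?p) v = a *\<^sub>v v +\<^sub>v (T (T y) +\<^sub>v \<ominus>\<^bsub>V\<^esub> (x *\<^sub>v T y) +\<^sub>v e *\<^sub>v T v)"
    unfolding vpeval.simps(2)[of T a ?p] IH using m by (simp add: a_minus_def T_simps n)
  moreover have "vpeval T (pquot (a # ?p) x) v = e *\<^sub>v v +\<^sub>v T y" by (simp add: e_def y_def)
  moreover have "T (e *\<^sub>v v +\<^sub>v T y) \<ominus>\<^bsub>V\<^esub> x *\<^sub>v (e *\<^sub>v v +\<^sub>v T y) +\<^sub>v (a \<oplus> x \<otimes> e) *\<^sub>v v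
     = a *\<^sub>v v +\<^sub>v (T (T y) +\<^sub>v \<ominus>\<^bsub>V\<^esub> (x *\<^sub>v T y) +\<^sub>v e *\<^sub>v T v)"
    using m by (simp add: a_minus_def T_simps smult_r_distr smult_l_distr smult_assoc1 M.minus_add M.a_ac M.r_neg1 M.r_neg2 canc)
  ultimately show ?case by (simp add: e_def)
qed

end

text \<open>Some nonzero polynomial p satisfies p(T) v = 0. Split off a root x with quotient q:
  either q(T) v is an eigenvector for x, or it vanishes and the shorter q takes the place of
  p.\<close>

lemma ex_eigenvector:
  assumes ac: "algebraically_closed K" and T: "klinear K V V T" and fd: "finite_dim K V" and v: "v \<in> carrier V" "v \<noteq> 0\<^sub>v"
  obtains c w where "c \<in> carrier K" "w \<in> carrier V" "w \<noteq> 0\<^sub>v" "T w = c *\<^sub>v w"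
proof -
  interpret K: algebraically_closed K by (rule ac)
  have eig: "\<exists>c\<in>carrier K. \<exists>w\<in>carrier V. w \<noteq> 0\<^sub>v \<and> T w = c *\<^sub>v w"
    if "set p \<subseteq> carrier K" "p \<noteq> []" "last p \<noteq> \<zero>" "vpeval T p v = 0\<^sub>v" for p
    using that
  proof (induction "length p" arbitrary: p rule: less_induct)
    case less
    show ?case
    proof (cases "length p \<ge> 2")
      case False
      then obtain a where a: "p = [a]" using less(3) by (cases p) (auto simp: Suc_le_eq)
      hence "a *\<^sub>v v = 0\<^sub>v" "a \<in> carrier K" "a \<noteq> \<zero>" using less T_zero[OF T] v by auto
      moreover have "inv a \<in> carrier K" "inv a \<otimes> a = \<one>" using \<open>a \<in> carrier K\<close> \<open>a \<noteq> \<zero>\<close> field_Units by auto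
      ultimately have "(inv a \<otimes> a) *\<^sub>v v = 0\<^sub>v" using v smult_assoc1[of "inv a" a v] by (simp add: smult_r_null)
      thus ?thesis using v \<open>inv a \<otimes> a = \<one>\<close> by (simp add: smult_one)
    next
      case True
      obtain x where x: "x \<in> carrier K" "peval p x = \<zero>" using K.ex_root[OF less(2) True less(4)] .
      let ?q = "pquot p x" let ?w = "vpeval T ?q v"
      have q: "set ?q \<subseteq> carrier K" "length ?q < length p" "?q \<noteq> []" "last ?q \<noteq> \<zero>"
        using pquot_closed[OF less(2) x(1)] pquot_length[of p x] pquot_last[OF True less(2) x(1)] True less(4) by (auto simp flip: length_greater_0_conv)
      have w: "?w \<in> carrier V" "T ?w \<in> carrier V" using vpeval_closed[OF T q(1) v(1)] T_simps(1)[OF T] by auto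
      have "T ?w \<ominus>\<^bsub>V\<^esub> x *\<^sub>v ?w = 0\<^sub>v" using vpeval_quot[OF T less(2) v(1) x(1)] x w v less(5) by (simp add: smult_l_null)
      hence "T ?w = x *\<^sub>v ?w" using w x(1) M.minus_equality[of "T ?w" "\<ominus>\<^bsub>V\<^esub> (x *\<^sub>v ?w)"] by (simp add: a_minus_def)
      thus ?thesis using less(1)[OF q(2,1,3,4)] w x(1) by (cases "?w = 0\<^sub>v") auto
    qed
  qed
  let ?P = "\<lambda>i. (T ^^ i) v"
  have Pc: "?P ` I \<subseteq> carrier V" for I using funpow_closed[OF T v(1)] by blast
  obtain B0 where B0: "finite B0" "B0 \<subseteq> carrier V" "carrier V \<subseteq> lspan B0" using fd finite_dim_iff by blast
  have "lspan (range ?P) \<subseteq> lspan B0" using lspan_carrier[OF Pc] B0(3) by blast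
  \<comment> \<open>The span of all powers T^i v is finitely generated, so boundedly many powers
    already span it.\<close>
  from subsp_fg[OF B0(1,2) lspan_subsp[OF Pc] this]
  obtain B where B: "finite B" "B \<subseteq> lspan (range ?P)" "lspan (range ?P) \<subseteq> lspan B" by (elim exE conjE)
  have "\<exists>n. u \<in> lspan (?P ` {..<n})" if "u \<in> lspan (range ?P)" for u
    using that
  proof induction
    case zero
    thus ?case using lspan.zero by blast
  next
    case (step b c u)
    then obtain n i where n: "u \<in> lspan (?P ` {..<n})" "b = ?P i" by blast
    have "lspan (?P ` {..<n}) \<subseteq> lspan (?P ` {..<max n (Suc i)})" by (rule lspan_mono'[OF image_mono Pc]) auto
    hence "u \<in> lspan (?P ` {..<max n (Suc i)})" using n(1) by blast
    moreover have "b \<in> ?P ` {..<max n (Suc i)}" using n(2) by auto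
    ultimately have "c *\<^sub>v b +\<^sub>v u \<in> lspan (?P ` {..<max n (Suc i)})" using lspan.step[OF _ step(2)] by simp
    thus ?case ..
  qed
  hence "\<forall>b\<in>B. \<exists>n. b \<in> lspan (?P ` {..<n})" using B(2) by blast
  then obtain N where N: "!!b. b \<in> B ==> b \<in> lspan (?P ` {..<N b})" by metis
  obtain n where n: "!!b. b \<in> B ==> N b \<le> n" using finite_nat_set_iff_bounded_le[of "N ` B"] B(1) by auto
  have "b \<in> lspan (?P ` {..<n})" if "b \<in> B" for b
    using N[OF that] subsetD[OF lspan_mono'[OF image_mono[of "{..<N b}" "{..<n}"] Pc]] n[OF that] by simp
  hence "lspan B \<subseteq> lspan (?P ` {..<n})" using lspan_mono[OF _ Pc] by blast
  hence "?P n \<in> lspan (?P ` {..<n})" using B(3) lspan_base[of "?P n" "range ?P"] Pc by blast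
  \<comment> \<open>With the coefficient -1, appending 1 to p gives a monic polynomial that
    annihilates v.\<close>
  hence "\<ominus> \<one> *\<^sub>v ?P n \<in> lspan (?P ` {..<n})" using lspan_subsp[OF Pc] by (simp add: subsp_def)
  then obtain p where p: "set p \<subseteq> carrier K" "length p = n" "vpeval T p v = \<ominus> \<one> *\<^sub>v ?P n" using vpeval_lspan[OF T _ v(1)] by blast
  have ap: "vpeval T (p @ [\<one>]) v = vpeval T p v +\<^sub>v ?P (length p)" using p(1)
  proof (induction p)
    case Nil
    thus ?case using v by (simp add: smult_one T_zero[OF T])
  next
    case (Cons a p)
    thus ?case using v vpeval_closed[OF T, of p v] funpow_closed[OF T v(1), of "length p"]
      by (simp add: T_simps[OF T] M.a_assoc)
  qed
  have "vpeval T (p @ [\<one>]) v = 0\<^sub>v"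
    unfolding ap using p funpow_closed[OF T v(1), of n] by (simp add: smult_l_minus smult_one M.l_neg)
  then obtain c w where "c \<in> carrier K" "w \<in> carrier V" "w \<noteq> 0\<^sub>v" "T w = c *\<^sub>v w" using eig[of "p @ [\<one>]"] p(1) by auto
  thus thesis by (rule that)
qed

end

section \<open>Abelian groups and linear maps\<close>

context abelian_group
begin

text \<open>Associative-commutative normalization may leave a summand and its negative separated by
  up to three others; each distance gets a rule. From \<open>cancel2\<close> on, the primed rules
  allow further summands after the negative.\<close>

lemma cancel1: "[|x \<in> carrier G; z \<in> carrier G|] ==> x \<oplus> (\<ominus> x \<oplus> z) = z"
  by (simp add: r_neg2 r_neg1)
lemma cancel1': "[|x \<in> carrier G; z \<in> carrier G|] ==> \<ominus> x \<oplus> (x \<oplus> z) = z"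
  by (simp add: r_neg2 r_neg1)
lemma cancel2: "[|x \<in> carrier G; a \<in> carrier G|] ==> x \<oplus> (a \<oplus> \<ominus> x) = a"
  by (metis a_inv_closed a_lcomm r_neg r_zero)
lemma cancel2': "[|x \<in> carrier G; a \<in> carrier G; z \<in> carrier G|] ==> x \<oplus> (a \<oplus> (\<ominus> x \<oplus> z)) = a \<oplus> z"
  by (metis a_closed a_inv_closed a_lcomm cancel1)
lemma cancel3: "[|x \<in> carrier G; a \<in> carrier G; b \<in> carrier G|] ==> x \<oplus> (a \<oplus> (b \<oplus> \<ominus> x)) = a \<oplus> b"
  by (metis a_closed a_inv_closed a_lcomm cancel2)
lemma cancel3': "[|x \<in> carrier G; a \<in> carrier G; b \<in> carrier G; z \<in> carrier G|]
  ==> x \<oplus> (a \<oplus> (b \<oplus> (\<ominus> x \<oplus> z))) = a \<oplus> (b \<oplus> z)"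
  by (metis a_closed a_inv_closed a_lcomm cancel2')
lemma cancel4: "[|x \<in> carrier G; a \<in> carrier G; b \<in> carrier G; c \<in> carrier G|]
  ==> x \<oplus> (a \<oplus> (b \<oplus> (c \<oplus> \<ominus> x))) = a \<oplus> (b \<oplus> c)"
  by (metis a_closed a_inv_closed a_lcomm cancel3)
lemma cancel4': "[|x \<in> carrier G; a \<in> carrier G; b \<in> carrier G; c \<in> carrier G; z \<in> carrier G|]
  ==> x \<oplus> (a \<oplus> (b \<oplus> (c \<oplus> (\<ominus> x \<oplus> z)))) = a \<oplus> (b \<oplus> (c \<oplus> z))"
  by (metis a_closed a_inv_closed a_lcomm cancel3')
lemma minus_def': "x \<ominus> y = x \<oplus> \<ominus> y"
  by (simp add: minus_eq)
lemma minus_eqD: "[|x \<ominus> y = z; x \<in> carrier G; y \<in> carrier G|] ==> x = z \<oplus> y"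
  by (metis a_assoc a_inv_closed l_neg minus_eq r_zero)
lemma minus_self: "x \<in> carrier G ==> x \<ominus> x = \<zero>"
  by (simp add: minus_eq r_neg)

lemma neg_zero: "\<ominus> \<zero> = \<zero>"
  by (metis a_inv_closed l_zero r_neg zero_closed)
lemma ag_group: "abelian_group G" ..

end

abbreviation elt where "elt X p \<equiv> carrier (gr X p)"
abbreviation Sh where "Sh \<equiv> shift_obj"
abbreviation hmap where "hmap \<equiv> homology_map"
abbreviation hel where "hel X p \<equiv> carrier (homology X p)"
abbreviation gadd (\<open>(_/ \<oplus>[_ _] _)\<close> [65, 1000, 1000, 66] 65) where "x \<oplus>[X p] y \<equiv> x \<oplus>\<^bsub>gr X p\<^esub> y"
abbreviation gminus (\<open>(_/ \<ominus>[_ _] _)\<close> [65, 1000, 1000, 66] 65) where "x \<ominus>[X p] y \<equiv> x \<ominus>\<^bsub>gr X p\<^esub> y"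
abbreviation gneg (\<open>\<ominus>[_ _] _\<close> [1000, 1000, 81] 80) where "\<ominus>[X p] x \<equiv> \<ominus>\<^bsub>gr X p\<^esub> x"
abbreviation gscal (\<open>(_/ \<odot>[_ _] _)\<close> [71, 1000, 1000, 70] 70) where "c \<odot>[X p] x \<equiv> c \<odot>\<^bsub>gr X p\<^esub> x"
abbreviation gzero (\<open>\<zero>[_ _]\<close>) where "\<zero>[X p] \<equiv> \<zero>\<^bsub>gr X p\<^esub>"

lemma abelian_group_monoid: "abelian_group G ==> abelian_monoid G"
  by (rule abelian_group.axioms)

lemmas ag_facts [OF abelian_group_monoid] =
  abelian_monoid.a_closed abelian_monoid.zero_closed
  abelian_monoid.a_assoc abelian_monoid.a_comm abelian_monoid.a_lcomm
  abelian_monoid.l_zero abelian_monoid.r_zero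

lemmas ag_simps =
  ag_facts
  abelian_group.a_inv_closed abelian_group.minus_closed abelian_group.minus_minus
  abelian_group.neg_zero
  abelian_group.minus_add abelian_group.l_neg abelian_group.r_neg
  abelian_group.cancel1 abelian_group.cancel1' abelian_group.cancel2
  abelian_group.cancel2' abelian_group.cancel3 abelian_group.cancel3' abelian_group.cancel4
  abelian_group.cancel4' abelian_group.minus_def'

lemma klinear_comp: "klinear K U V f ==> klinear K V W g ==> klinear K U W (\<lambda>x. g (f x))"
  unfolding klinear_def Pi_def by simp

lemma klinearI:
  assumes "!!x. x \<in> carrier V ==> f x \<in> carrier W"
    and "!!x y. x \<in> carrier V ==> y \<in> carrier V ==> f (x \<oplus>\<^bsub>V\<^esub> y) = f x \<oplus>\<^bsub>W\<^esub> f y"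
    and "!!c x. c \<in> carrier K ==> x \<in> carrier V ==> f (c \<odot>\<^bsub>V\<^esub> x) = c \<odot>\<^bsub>W\<^esub> f x"
  shows "klinear K V W f"
  using assms unfolding klinear_def by auto

lemma klinear_closed: "klinear K V W f ==> x \<in> carrier V ==> f x \<in> carrier W"
  and klinear_add: "klinear K V W f ==> x \<in> carrier V ==> y \<in> carrier V ==> f (x \<oplus>\<^bsub>V\<^esub> y) = f x \<oplus>\<^bsub>W\<^esub> f y"
  and klinear_smult: "klinear K V W f ==> c \<in> carrier K ==> x \<in> carrier V ==> f (c \<odot>\<^bsub>V\<^esub> x) = c \<odot>\<^bsub>W\<^esub> f x"
  unfolding klinear_def by auto

lemma module_ag: "module K V ==> abelian_group V"
  by (simp add: module_def)

lemma klinear_zero: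
  assumes "klinear K V W f" "abelian_group V" "abelian_group W"
  shows "f \<zero>\<^bsub>V\<^esub> = \<zero>\<^bsub>W\<^esub>"
proof -
  interpret V: abelian_group V by fact
  interpret W: abelian_group W by fact
  have "f \<zero>\<^bsub>V\<^esub> \<oplus>\<^bsub>W\<^esub> f \<zero>\<^bsub>V\<^esub> = f \<zero>\<^bsub>V\<^esub>"
    using klinear_add[OF assms(1), of "\<zero>\<^bsub>V\<^esub>" "\<zero>\<^bsub>V\<^esub>"] by simp
  thus ?thesis
    using klinear_closed[OF assms(1) V.zero_closed] W.add.r_cancel_one' by metis
qed

lemma klinear_neg:
  assumes "klinear K V W f" "abelian_group V" "abelian_group W" "x \<in> carrier V"
  shows "f (\<ominus>\<^bsub>V\<^esub> x) = \<ominus>\<^bsub>W\<^esub> f x"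
proof -
  interpret V: abelian_group V by fact
  interpret W: abelian_group W by fact
  have "f (\<ominus>\<^bsub>V\<^esub> x) \<oplus>\<^bsub>W\<^esub> f x = \<zero>\<^bsub>W\<^esub>"
    using klinear_add[OF assms(1), of "\<ominus>\<^bsub>V\<^esub> x" x] assms by (simp add: V.l_neg klinear_zero)
  thus ?thesis
    using W.minus_equality[of "f (\<ominus>\<^bsub>V\<^esub> x)" "f x"] assms klinear_closed[OF assms(1)] by simp
qed

lemma module_smult_simps:
  assumes "module K V"
  shows "!!a x. [|a \<in> carrier K; x \<in> carrier V|] ==> a \<odot>\<^bsub>V\<^esub> x \<in> carrier V"
   "!!a x y. [|a \<in> carrier K; x \<in> carrier V; y \<in> carrier V|] ==> a \<odot>\<^bsub>V\<^esub> (x \<oplus>\<^bsub>V\<^esub> y) = a \<odot>\<^bsub>V\<^esub> x \<oplus>\<^bsub>V\<^esub> a \<odot>\<^bsub>V\<^esub> y"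
   "!!a x. [|a \<in> carrier K; x \<in> carrier V|] ==> a \<odot>\<^bsub>V\<^esub> (\<ominus>\<^bsub>V\<^esub> x) = \<ominus>\<^bsub>V\<^esub> (a \<odot>\<^bsub>V\<^esub> x)"
   "!!a. a \<in> carrier K ==> a \<odot>\<^bsub>V\<^esub> \<zero>\<^bsub>V\<^esub> = \<zero>\<^bsub>V\<^esub>"
  using assms by (auto simp: module.smult_closed module.smult_r_distr module.smult_r_minus module.smult_r_null)

section \<open>Dg modules and homogeneous maps\<close>

text \<open>An infinite field is what makes direct sums available inside \<open>'u\<close>;
  algebraic closedness enters separately, with eigenvectors.\<close>

locale dga =
  fixes K :: "'k ring" and A :: "('k, 'u) dg_alg"
  assumes field_K: "field K" and infinite_K: "infinite (carrier K)" and dg_A: "dg_algebra K A"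
begin

abbreviation G where "G \<equiv> dg_modules K A"
abbreviation ob where "ob X \<equiv> dg_module K A X"
abbreviation hm where "hm \<equiv> module_maps K A"
abbreviation cl where "cl \<equiv> closed_maps G"
abbreviation qi where "qi \<equiv> quasi_isos G"
abbreviation hty where "hty \<equiv> homotopic G"

lemma G_simps [simp]: "dg_obj G = Collect ob" "dg_hom G = hm"
  by (simp_all add: dg_modules_def)

lemma cring_K: "cring K"
  using field_K by (simp add: field_def domain_def)

lemma A_module: "module K (gr A p)"
  and A_diff: "a \<in> elt A p ==> diff A p a \<in> elt A (p + 1)"
  using dg_A unfolding dg_algebra_def cochain_complex_def klinear_def by auto

lemma A_ag [simp]: "abelian_group (gr A p)"
  using A_module module_ag by blast

lemma ob_module: "ob X ==> module K (gr X p)"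
  unfolding dg_module_def cochain_complex_def by auto

lemma ob_ag [simp]: "ob X ==> abelian_group (gr X p)"
  using ob_module module_ag by blast

lemma ob_diff: "ob X ==> klinear K (gr X p) (gr X (p + 1)) (diff X p)"
  unfolding dg_module_def cochain_complex_def by auto

lemma ob_dd: "ob X ==> x \<in> elt X p ==> diff X (p + 1) (diff X p x) = \<zero>[X (p + 2)]"
  unfolding dg_module_def cochain_complex_def by auto

text \<open>The target degree q comes with an equation as a premise, so that simp can prove it by
  arithmetic instead of having to match the degree syntactically.\<close>

lemma d_simps:
  assumes "ob X"
  shows "!!x p q. x \<in> elt X p ==> q = p + 1 ==> diff X p x \<in> elt X q"
   "!!x y p. x \<in> elt X p ==> y \<in> elt X p ==>
     diff X p (x \<oplus>[X p] y) = diff X p x \<oplus>[X (p + 1)] diff X p y"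
   "!!x p. x \<in> elt X p ==> diff X p (\<ominus>[X p] x) = \<ominus>[X (p + 1)] diff X p x"
   "!!p. diff X p \<zero>[X p] = \<zero>[X (p + 1)]"
   "!!x p q. x \<in> elt X p ==> q = p + 1 ==> diff X q (diff X p x) = \<zero>[X (p + 2)]"
   "!!c x p. c \<in> carrier K ==> x \<in> elt X p ==> diff X p (c \<odot>[X p] x) = c \<odot>[X (p + 1)] diff X p x"
  using klinear_closed[OF ob_diff[OF assms]] klinear_add[OF ob_diff[OF assms]]
    klinear_neg[OF ob_diff[OF assms] ob_ag[OF assms] ob_ag[OF assms]]
    klinear_zero[OF ob_diff[OF assms] ob_ag[OF assms] ob_ag[OF assms]]
    klinear_smult[OF ob_diff[OF assms]] ob_dd[OF assms] by auto

lemma act_klinear: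
  assumes "ob X"
  shows "m \<in> elt X p ==> klinear K (gr A q) (gr X (p + q)) (ract X p q m)"
   "a \<in> elt A q ==> klinear K (gr X p) (gr X (p + q)) (\<lambda>m. ract X p q m a)"
  using assms unfolding dg_module_def kbilinear_def by auto

lemma act_simps:
  assumes "ob X"
  shows "!!x a p q r. x \<in> elt X p ==> a \<in> elt A q ==> r = p + q ==> ract X p q x a \<in> elt X r"
   "!!x y a p q. x \<in> elt X p ==> y \<in> elt X p ==> a \<in> elt A q ==>
     ract X p q (x \<oplus>[X p] y) a = ract X p q x a \<oplus>[X (p + q)] ract X p q y a"
   "!!x a p q. x \<in> elt X p ==> a \<in> elt A q ==>
     ract X p q (\<ominus>[X p] x) a = \<ominus>[X (p + q)] ract X p q x a"
   "!!a p q. a \<in> elt A q ==> ract X p q \<zero>[X p] a = \<zero>[X (p + q)]"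
   "!!c x a p q. c \<in> carrier K ==> x \<in> elt X p ==> a \<in> elt A q ==>
     ract X p q (c \<odot>[X p] x) a = c \<odot>[X (p + q)] ract X p q x a"
   "!!x a b p q. x \<in> elt X p ==> a \<in> elt A q ==> b \<in> elt A q ==>
     ract X p q x (a \<oplus>[A q] b) = ract X p q x a \<oplus>[X (p + q)] ract X p q x b"
   "!!c x a p q. c \<in> carrier K ==> x \<in> elt X p ==> a \<in> elt A q ==>
     ract X p q x (c \<odot>[A q] a) = c \<odot>[X (p + q)] ract X p q x a"
   "!!x a b p q r. x \<in> elt X p ==> a \<in> elt A q ==> b \<in> elt A r ==>
     ract X (p + q) r (ract X p q x a) b = ract X p (q + r) x (gmult A q r a b)"
   "!!x p. x \<in> elt X p ==> ract X p 0 x (gone A) = x"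
   "!!x a p q. x \<in> elt X p ==> a \<in> elt A q ==> diff X (p + q) (ract X p q x a) =
          ract X (p + 1) q (diff X p x) a
            \<oplus>[X (p + q + 1)] sign_pow (gr X (p + q + 1)) p (ract X p (q + 1) x (diff A q a))"
proof -
  note 1 = act_klinear(1)[OF assms] and 2 = act_klinear(2)[OF assms]
  note ob_ag[OF assms, simp]
  show "!!x a p q r. x \<in> elt X p ==> a \<in> elt A q ==> r = p + q ==> ract X p q x a \<in> elt X r"
    using klinear_closed[OF 1] by auto
  show "!!x y a p q. x \<in> elt X p ==> y \<in> elt X p ==> a \<in> elt A q ==>
     ract X p q (x \<oplus>[X p] y) a = ract X p q x a \<oplus>[X (p + q)] ract X p q y a"
    using klinear_add[OF 2] by auto
  show "!!x a p q. x \<in> elt X p ==> a \<in> elt A q ==>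
     ract X p q (\<ominus>[X p] x) a = \<ominus>[X (p + q)] ract X p q x a"
    using klinear_neg[OF 2] by auto
  show "!!a p q. a \<in> elt A q ==> ract X p q \<zero>[X p] a = \<zero>[X (p + q)]"
    using klinear_zero[OF 2] by auto
  show "!!c x a p q. c \<in> carrier K ==> x \<in> elt X p ==> a \<in> elt A q ==>
     ract X p q (c \<odot>[X p] x) a = c \<odot>[X (p + q)] ract X p q x a"
    using klinear_smult[OF 2] by auto
  show "!!x a b p q. x \<in> elt X p ==> a \<in> elt A q ==> b \<in> elt A q ==>
     ract X p q x (a \<oplus>[A q] b) = ract X p q x a \<oplus>[X (p + q)] ract X p q x b"
    using klinear_add[OF 1] by auto
  show "!!c x a p q. c \<in> carrier K ==> x \<in> elt X p ==> a \<in> elt A q ==>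
     ract X p q x (c \<odot>[A q] a) = c \<odot>[X (p + q)] ract X p q x a"
    using klinear_smult[OF 1] by auto
qed (use assms in \<open>auto simp: dg_module_def\<close>)

lemma hm_klinear: "f \<in> hm X Y n ==> klinear K (gr X p) (gr Y (p + n)) (f p)"
  by (simp add: module_maps_def)

lemma hm_simps:
  assumes "f \<in> hm X Y n" "ob X" "ob Y"
  shows "!!x p q. x \<in> elt X p ==> q = p + n ==> f p x \<in> elt Y q"
   "!!x y p. x \<in> elt X p ==> y \<in> elt X p ==>
     f p (x \<oplus>[X p] y) = f p x \<oplus>[Y (p + n)] f p y"
   "!!x p. x \<in> elt X p ==> f p (\<ominus>[X p] x) = \<ominus>[Y (p + n)] f p x"
   "!!p. f p \<zero>[X p] = \<zero>[Y (p + n)]"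
   "!!c x p. c \<in> carrier K ==> x \<in> elt X p ==> f p (c \<odot>[X p] x) = c \<odot>[Y (p + n)] f p x"
   "!!x a p q. x \<in> elt X p ==> a \<in> elt A q ==>
     f (p + q) (ract X p q x a) = ract Y (p + n) q (f p x) a"
  using klinear_closed[OF hm_klinear[OF assms(1)]] klinear_add[OF hm_klinear[OF assms(1)]]
    klinear_neg[OF hm_klinear[OF assms(1)] ob_ag[OF assms(2)] ob_ag[OF assms(3)]]
    klinear_zero[OF hm_klinear[OF assms(1)] ob_ag[OF assms(2)] ob_ag[OF assms(3)]]
    klinear_smult[OF hm_klinear[OF assms(1)]] assms(1)
  by (auto simp: module_maps_def)

lemma hmI:
  assumes "!!x p. x \<in> elt X p ==> f p x \<in> elt Y (p + n)"
   "!!x y p. x \<in> elt X p ==> y \<in> elt X p ==>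
     f p (x \<oplus>[X p] y) = f p x \<oplus>[Y (p + n)] f p y"
   "!!c x p. c \<in> carrier K ==> x \<in> elt X p ==> f p (c \<odot>[X p] x) = c \<odot>[Y (p + n)] f p x"
   "!!x a p q. x \<in> elt X p ==> a \<in> elt A q ==>
     f (p + q) (ract X p q x a) = ract Y (p + n) q (f p x) a"
  shows "f \<in> hm X Y n"
  using assms unfolding module_maps_def by (auto intro!: klinearI)

lemma hm_comp:
  assumes "f \<in> hm X Y n" "g \<in> hm Y Z m" "ob X" "ob Y" "ob Z" "k = n + m"
  shows "(\<lambda>p x. g (p + n) (f p x)) \<in> hm X Z k"
proof -
  note [simp] = hm_simps[OF assms(1,3,4)] hm_simps[OF assms(2,4,5)]
  have [simp]: "(p + q + n) = p + n + q" for p q :: int by simp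
  show ?thesis
    unfolding assms(6) add.assoc[symmetric] by (rule hmI) (simp_all add: add.assoc[symmetric])
qed

lemma hm_add:
  assumes "f \<in> hm X Y n" "g \<in> hm X Y n" "ob X" "ob Y" "!!p. q p = p + n"
  shows "(\<lambda>p x. f p x \<oplus>[Y (q p)] g p x) \<in> hm X Y n"
proof -
  note [simp] = hm_simps[OF assms(1,3,4)] hm_simps[OF assms(2,3,4)] module_smult_simps[OF ob_module[OF assms(4)]]
    act_simps[OF assms(4)]
  have [simp]: "(p + q + n) = p + n + q" for p q :: int by simp
  show ?thesis
    unfolding assms(5) by (rule hmI) (simp_all add: ag_simps assms)
qed

lemma hm_neg:
  assumes "f \<in> hm X Y n" "ob X" "ob Y" "!!p. q p = p + n"
  shows "(\<lambda>p x. \<ominus>[Y (q p)] f p x) \<in> hm X Y n"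
proof -
  note [simp] = hm_simps[OF assms(1,2,3)] module_smult_simps[OF ob_module[OF assms(3)]]
    act_simps[OF assms(3)]
  have [simp]: "(p + q + n) = p + n + q" for p q :: int by simp
  show ?thesis
    unfolding assms(4) by (rule hmI) (simp_all add: ag_simps assms)
qed

lemma hm_zero:
  assumes "ob X" "ob Y" "!!p. q p = p + n"
  shows "(\<lambda>p x. \<zero>[Y (q p)]) \<in> hm X Y n"
proof -
  note [simp] = module_smult_simps[OF ob_module[OF assms(2)]]
    act_simps[OF assms(2)]
  have [simp]: "(p + q + n) = p + n + q" for p q :: int by simp
  show ?thesis
    unfolding assms(3) by (rule hmI) (simp_all add: ag_simps assms)
qed

lemma hm_smult:
  assumes "f \<in> hm X Y n" "ob X" "ob Y" "c \<in> carrier K" "!!p. q p = p + n"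
  shows "(\<lambda>p x. c \<odot>[Y (q p)] f p x) \<in> hm X Y n"
proof -
  note [simp] = hm_simps[OF assms(1,2,3)] module_smult_simps[OF ob_module[OF assms(3)]]
    act_simps[OF assms(3)]
  have [simp]: "(p + q + n) = p + n + q" for p q :: int by simp
  have [simp]: "c \<odot>[Y p] (d \<odot>[Y p] x) = d \<odot>[Y p] (c \<odot>[Y p] x)"
    if "x \<in> elt Y p" "d \<in> carrier K" for d p x
    using module.smult_assoc1[OF ob_module[OF assms(3)]] that assms(4)
      cring.cring_simprules(14)[OF cring_K] by metis
  show ?thesis
    unfolding assms(5) by (rule hmI) (simp_all add: ag_simps assms)
qed

subsection \<open>Closed maps and homotopies\<close>

lemma clI:
  assumes "f \<in> hm X Y 0" "!!p x. x \<in> elt X p ==> f (p + 1) (diff X p x) = diff Y p (f p x)"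
  shows "f \<in> cl X Y"
  using assms by (simp add: closed_maps_def)

lemma cl_hm: "f \<in> cl X Y ==> f \<in> hm X Y 0"
  by (simp add: closed_maps_def)

lemma cl_d: "f \<in> cl X Y ==> x \<in> elt X p ==> q = p + 1 ==> f q (diff X p x) = diff Y p (f p x)"
  by (simp add: closed_maps_def)

lemma cl_d': "f \<in> cl X Y ==> ob X ==> ob Y ==> x \<in> elt X p ==> q = p + 1 ==> f q (diff X p x) = diff Y p (f p x)"
  by (simp add: closed_maps_def)

lemmas cl_simps = hm_simps[OF cl_hm, simplified] cl_d'

lemma id_cl [simp]: "ob X ==> id_map \<in> cl X X"
  by (rule clI, rule hmI) (simp_all add: id_map_def)

lemma cl_comp:
  assumes "f \<in> cl X Y" "g \<in> cl Y Z" "ob X" "ob Y" "ob Z"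
  shows "gcomp g f \<in> cl X Z"
proof -
  note [simp] = cl_simps[OF assms(1,3,4)] cl_simps[OF assms(2,4,5)] cl_d[OF assms(1)] cl_d[OF assms(2)]
  have "gcomp g f \<in> hm X Z 0"
    using hm_comp[OF cl_hm[OF assms(1)] cl_hm[OF assms(2)]] assms(3-) unfolding gcomp_def by auto
  thus ?thesis by (rule clI) (simp add: gcomp_def)
qed

lemma cl_add:
  assumes "f \<in> cl X Y" "g \<in> cl X Y" "ob X" "ob Y"
  shows "(\<lambda>p x. f p x \<oplus>[Y p] g p x) \<in> cl X Y"
proof -
  note [simp] = cl_simps[OF assms(1,3,4)] cl_simps[OF assms(2,3,4)] cl_d[OF assms(1)] cl_d[OF assms(2)]
   d_simps[OF assms(4)]
  show ?thesis
    by (rule clI, rule hm_add) (simp_all add: cl_hm assms)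
qed

lemma cl_neg:
  assumes "f \<in> cl X Y" "ob X" "ob Y"
  shows "(\<lambda>p x. \<ominus>[Y p] f p x) \<in> cl X Y"
proof -
  note [simp] = cl_simps[OF assms(1,2,3)] cl_d[OF assms(1)] d_simps[OF assms(3)]
  show ?thesis
    by (rule clI, rule hm_neg) (simp_all add: cl_hm assms)
qed

lemma cl_smult:
  assumes "f \<in> cl X Y" "ob X" "ob Y" "c \<in> carrier K"
  shows "(\<lambda>p x. c \<odot>[Y p] f p x) \<in> cl X Y"
proof -
  note [simp] = cl_simps[OF assms(1,2,3)] cl_d[OF assms(1)] d_simps[OF assms(3)]
  show ?thesis
    by (rule clI, rule hm_smult) (simp_all add: cl_hm assms)
qed

lemma cl_zero:
  assumes "ob X" "ob Y"
  shows "(\<lambda>p x. \<zero>[Y p]) \<in> cl X Y"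
proof -
  note [simp] = d_simps[OF assms(2)]
  show ?thesis
    by (rule clI, rule hm_zero) (simp_all add: assms)
qed

text \<open>The homotopy relation is solved for f so that it can be used as a rewrite rule on
  elements.\<close>

lemma htyI:
  assumes "h \<in> hm X Y (- 1)" "f \<in> cl X Y" "g \<in> cl X Y" "ob X" "ob Y"
    "!!p x. x \<in> elt X p ==>
      f p x = g p x \<oplus>[Y p] (diff Y (p - 1) (h p x) \<oplus>[Y p] h (p + 1) (diff X p x))"
  shows "hty X Y f g"
proof -
  note [simp] = hm_simps[OF assms(1,4,5)] cl_simps[OF assms(2,4,5)] cl_simps[OF assms(3,4,5)] d_simps[OF assms(4)]
    d_simps[OF assms(5)]
  show ?thesis unfolding homotopic_def
    by (rule bexI[of _ h]) (use assms in \<open>auto simp: assms(6) ag_simps\<close>)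
qed

lemma htyE:
  assumes "hty X Y f g" "f \<in> cl X Y" "g \<in> cl X Y" "ob X" "ob Y"
  obtains h where "h \<in> hm X Y (- 1)"
    "!!p x. x \<in> elt X p ==>
      f p x = g p x \<oplus>[Y p] (diff Y (p - 1) (h p x) \<oplus>[Y p] h (p + 1) (diff X p x))"
proof -
  obtain h where h: "h \<in> hm X Y (- 1)" and e: "!!p x. x \<in> elt X p ==>
      f p x \<ominus>[Y p] g p x = (diff Y (p - 1) (h p x) \<oplus>[Y p] h (p + 1) (diff X p x))"
    using assms unfolding homotopic_def by auto
  note [simp] = hm_simps[OF h assms(4,5)] cl_simps[OF assms(2,4,5)] cl_simps[OF assms(3,4,5)] d_simps[OF assms(4)]
    d_simps[OF assms(5)]
  show ?thesis
  proof (rule that[OF h])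
    fix p x assume x: "x \<in> elt X p"
    show "f p x = g p x \<oplus>[Y p] (diff Y (p - 1) (h p x) \<oplus>[Y p] h (p + 1) (diff X p x))"
      using abelian_group.minus_eqD[OF _ e] x assms by (simp add: ag_simps)
  qed
qed

lemma hty_eq:
  assumes "!!p x. x \<in> elt X p ==> f p x = g p x" "f \<in> cl X Y" "g \<in> cl X Y" "ob X" "ob Y"
  shows "hty X Y f g"
proof -
  note [simp] = cl_simps[OF assms(2,4,5)] cl_simps[OF assms(3,4,5)] d_simps[OF assms(5)] d_simps(4)[OF assms(5), of "p - 1" for p, simplified]
  show ?thesis
    by (rule htyI[OF hm_zero]) (use assms in \<open>auto simp: ag_simps\<close>)
qed

lemma hty_refl: "f \<in> cl X Y ==> ob X ==> ob Y ==> hty X Y f f"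
  by (rule hty_eq) auto

text \<open>The rules \<open>d_simps\<close> for the differential that ends in degree p, whose
  target degree p - 1 + 1 would not be recognized.\<close>

lemma d_m1:
  assumes "ob X"
  shows "!!x p q. x \<in> elt X (p - 1) ==> diff X (p - 1) x \<in> elt X p"
   "!!x y p. x \<in> elt X (p - 1) ==> y \<in> elt X (p - 1) ==>
     diff X (p - 1) (x \<oplus>[X (p - 1)] y) = diff X (p - 1) x \<oplus>[X p] diff X (p - 1) y"
   "!!x p. x \<in> elt X (p - 1) ==> diff X (p - 1) (\<ominus>[X (p - 1)] x) = \<ominus>[X p] diff X (p - 1) x"
   "!!p. diff X (p - 1) \<zero>[X (p - 1)] = \<zero>[X p]"
   "!!x p. x \<in> elt X (p - 1) ==> diff X p (diff X (p - 1) x) = \<zero>[X (p + 1)]"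
  using d_simps(1)[OF assms, of _ "p - 1" for p] d_simps(2)[OF assms, of _ "p - 1" for p]
    d_simps(3)[OF assms, of _ "p - 1" for p] d_simps(4)[OF assms, of "p - 1" for p]
    d_simps(5)[OF assms, of _ "p - 1" for p] by (auto simp: add.commute[of 1])

lemma hty_sym:
  assumes "hty X Y f g" "f \<in> cl X Y" "g \<in> cl X Y" "ob X" "ob Y"
  shows "hty X Y g f"
proof (rule htyE[OF assms])
  fix h assume h: "h \<in> hm X Y (- 1)"
    "!!p x. x \<in> elt X p ==>
      f p x = g p x \<oplus>[Y p] (diff Y (p - 1) (h p x) \<oplus>[Y p] h (p + 1) (diff X p x))"
  note [simp] = hm_simps[OF h(1) assms(4,5)] cl_simps[OF assms(2,4,5)] cl_simps[OF assms(3,4,5)] d_simps[OF assms(4)]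
    d_simps[OF assms(5)] d_m1[OF assms(5)]
  show ?thesis
    by (rule htyI[OF hm_neg[OF h(1), of "\<lambda>p. p - 1"]]) (use assms in \<open>auto simp: h(2) ag_simps\<close>)
qed

lemma hty_trans:
  assumes "hty X Y f g" "hty X Y g k" "f \<in> cl X Y" "g \<in> cl X Y" "k \<in> cl X Y" "ob X" "ob Y"
  shows "hty X Y f k"
proof (rule htyE[OF assms(1,3,4,6,7)], goal_cases)
  case (1 h)
  show ?thesis
  proof (rule htyE[OF assms(2,4,5,6,7)], goal_cases)
    case (1 h')
    note h = \<open>h \<in> _\<close> and h' = \<open>h' \<in> _\<close>
    note [simp] = hm_simps[OF h assms(6,7)] hm_simps[OF h' assms(6,7)] cl_simps[OF assms(3,6,7)] cl_simps[OF assms(4,6,7)]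
     cl_simps[OF assms(5,6,7)] d_simps[OF assms(6)] d_simps[OF assms(7)] d_m1[OF assms(7)]
    show ?case
      by (rule htyI[OF hm_add[OF h h', of "\<lambda>p. p - 1"]])
        (use assms 1(2) \<open>!!x p. _ ==> f p x = _\<close> in \<open>auto simp: ag_simps\<close>)
  qed
qed

lemma hty_comp_left:
  assumes "hty X Y f g" "f \<in> cl X Y" "g \<in> cl X Y" "k \<in> cl Y Z" "ob X" "ob Y" "ob Z"
  shows "hty X Z (gcomp k f) (gcomp k g)"
proof (rule htyE[OF assms(1,2,3,5,6)], goal_cases)
  case (1 h)
  note h = \<open>h \<in> _\<close>
  note [simp] = hm_simps[OF h assms(5,6)] cl_simps[OF assms(2,5,6)] cl_simps[OF assms(3,5,6)]
    cl_simps[OF assms(4,6,7)] cl_d[OF assms(4)] d_simps[OF assms(5)] d_simps[OF assms(6)] d_m1[OF assms(6)]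
  show ?case
    by (rule htyI[OF hm_comp[OF h cl_hm[OF assms(4)]]]) (use assms 1 in \<open>auto simp: ag_simps gcomp_def cl_comp[unfolded gcomp_def]\<close>)
qed

lemma hty_comp_right:
  assumes "hty X Y f g" "f \<in> cl X Y" "g \<in> cl X Y" "k \<in> cl W X" "ob X" "ob Y" "ob W"
  shows "hty W Y (gcomp f k) (gcomp g k)"
proof (rule htyE[OF assms(1,2,3,5,6)], goal_cases)
  case (1 h)
  note h = \<open>h \<in> _\<close>
  note [simp] = hm_simps[OF h assms(5,6)] cl_simps[OF assms(2,5,6)] cl_simps[OF assms(3,5,6)]
    cl_simps[OF assms(4,7,5)] cl_d[OF assms(4)] d_simps[OF assms(7)] d_simps[OF assms(5)] d_simps[OF assms(6)] d_m1[OF assms(6)]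
  show ?case
    by (rule htyI[OF hm_comp[OF cl_hm[OF assms(4)] h]]) (use assms 1 in \<open>auto simp: ag_simps gcomp_def cl_comp[unfolded gcomp_def]\<close>)
qed

lemma hty_add:
  assumes "hty X Y f g" "hty X Y f' g'" "f \<in> cl X Y" "g \<in> cl X Y" "f' \<in> cl X Y" "g' \<in> cl X Y" "ob X" "ob Y"
  shows "hty X Y (\<lambda>p x. f p x \<oplus>[Y p] f' p x) (\<lambda>p x. g p x \<oplus>[Y p] g' p x)"
proof (rule htyE[OF assms(1,3,4,7,8)], goal_cases)
  case (1 h)
  show ?thesis
  proof (rule htyE[OF assms(2,5,6,7,8)], goal_cases)
    case (1 h')
    note h = \<open>h \<in> _\<close> and h' = \<open>h' \<in> _\<close>
    note [simp] = hm_simps[OF h assms(7,8)] hm_simps[OF h' assms(7,8)] cl_simps[OF assms(3,7,8)] cl_simps[OF assms(4,7,8)]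
     cl_simps[OF assms(5,7,8)] cl_simps[OF assms(6,7,8)] d_simps[OF assms(7)] d_simps[OF assms(8)] d_m1[OF assms(8)]
    show ?case
      by (rule htyI[OF hm_add[OF h h', of "\<lambda>p. p - 1"]])
        (use assms 1(2) \<open>!!x p. _ ==> f p x = _\<close> in \<open>auto simp: ag_simps cl_add\<close>)
  qed
qed

lemma hty_smult:
  assumes "hty X Y f g" "f \<in> cl X Y" "g \<in> cl X Y" "ob X" "ob Y" "c \<in> carrier K"
  shows "hty X Y (\<lambda>p x. c \<odot>[Y p] f p x) (\<lambda>p x. c \<odot>[Y p] g p x)"
proof (rule htyE[OF assms(1,2,3,4,5)], goal_cases)
  case (1 h)
  note h = \<open>h \<in> _\<close>
  note [simp] = hm_simps[OF h assms(4,5)] cl_simps[OF assms(2,4,5)] cl_simps[OF assms(3,4,5)]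
    d_simps[OF assms(4)] d_simps[OF assms(5)] d_m1[OF assms(5)]
    d_simps(6)[OF assms(5), of _ _ "p - 1" for p, simplified]
    module_smult_simps[OF ob_module[OF assms(5)]]
  show ?case
    by (rule htyI[OF hm_smult[OF h, of _ "\<lambda>p. p - 1"]]) (use assms 1 in \<open>auto simp: ag_simps cl_smult\<close>)
qed

end

subsection \<open>Direct sums inside the universe\<close>

text \<open>The elements of a sum have to be in \<open>'u\<close> again, so pairs are coded by e. As
  e is injective only on the carriers, decoding uses the inverse on them.\<close>

definition dsum :: "('u \<times> 'u \<Rightarrow> 'u) \<Rightarrow> ('k, 'u) module \<Rightarrow> ('k, 'u) module \<Rightarrow> ('k, 'u) module" where
  "dsum e V W = \<lparr>carrier = e ` (carrier V \<times> carrier W), monoid.mult = undefined, one = undefined,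
     zero = e (\<zero>\<^bsub>V\<^esub>, \<zero>\<^bsub>W\<^esub>),
     add = (\<lambda>x y. case (inv_into (carrier V \<times> carrier W) e x, inv_into (carrier V \<times> carrier W) e y) of
              ((a, b), (c, d)) \<Rightarrow> e (a \<oplus>\<^bsub>V\<^esub> c, b \<oplus>\<^bsub>W\<^esub> d)),
     smult = (\<lambda>c x. case inv_into (carrier V \<times> carrier W) e x of (a, b) \<Rightarrow> e (c \<odot>\<^bsub>V\<^esub> a, c \<odot>\<^bsub>W\<^esub> b))\<rparr>"

lemma dsum_simps:
  assumes "inj_on e (carrier V \<times> carrier W)"
  shows "carrier (dsum e V W) = e ` (carrier V \<times> carrier W)"
    "\<zero>\<^bsub>dsum e V W\<^esub> = e (\<zero>\<^bsub>V\<^esub>, \<zero>\<^bsub>W\<^esub>)"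
    "!!a b c d. a \<in> carrier V ==> b \<in> carrier W ==> c \<in> carrier V ==> d \<in> carrier W ==>
       e (a, b) \<oplus>\<^bsub>dsum e V W\<^esub> e (c, d) = e (a \<oplus>\<^bsub>V\<^esub> c, b \<oplus>\<^bsub>W\<^esub> d)"
    "!!a b c. a \<in> carrier V ==> b \<in> carrier W ==> c \<odot>\<^bsub>dsum e V W\<^esub> e (a, b) = e (c \<odot>\<^bsub>V\<^esub> a, c \<odot>\<^bsub>W\<^esub> b)"
  using assms by (auto simp: dsum_def)

lemma dsum_module:
  assumes "inj_on e (carrier V \<times> carrier W)" "module K V" "module K W"
  shows "module K (dsum e V W)"
proof -
  note [simp] = dsum_simps[OF assms(1)]
  interpret V: module K V by fact
  interpret W: module K W by fact
  show ?thesis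
  proof (rule moduleI)
    show "cring K" using assms by (simp add: module_def)
    show "abelian_group (dsum e V W)"
    proof (rule abelian_groupI)
      fix x assume "x \<in> carrier (dsum e V W)"
      then obtain a b where ab: "x = e (a, b)" "a \<in> carrier V" "b \<in> carrier W" by auto
      thus "\<exists>y\<in>carrier (dsum e V W). y \<oplus>\<^bsub>dsum e V W\<^esub> x = \<zero>\<^bsub>dsum e V W\<^esub>"
        by (intro bexI[of _ "e (\<ominus>\<^bsub>V\<^esub> a, \<ominus>\<^bsub>W\<^esub> b)"])
          (auto simp: V.l_neg W.l_neg intro!: imageI)
    qed (auto simp: ag_simps V.ag_group W.ag_group)
  qed (auto simp: V.smult_l_distr V.smult_r_distr V.smult_assoc1 W.smult_l_distr W.smult_r_distr W.smult_assoc1)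
qed

lemma deg_simps: "(1 :: int) + p = p + 1" "(2 :: int) + p = p + 2" "(3 :: int) + p = p + 3"
  by simp_all

context dga
begin

text \<open>One coding serves all pairs of spaces. For finite \<open>'u\<close> every space is zero,
  since the multiples of a nonzero vector by the infinitely many scalars would be distinct; for
  infinite \<open>'u\<close> a bijection with the square is taken.\<close>

lemma ex_enc: "\<exists>e :: 'u \<times> 'u \<Rightarrow> 'u. \<forall>(V :: ('k, 'u) module) (W :: ('k, 'u) module). module K V \<longrightarrow> module K W \<longrightarrow> inj_on e (carrier V \<times> carrier W)"
proof (cases "finite (UNIV :: 'u set)")
  case True
  have "carrier V = {\<zero>\<^bsub>V\<^esub>}" if "module K V" for V :: "('k, 'u) module"
  proof (rule ccontr)
    interpret K: field K by (rule field_K)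
    interpret V: module K V by fact
    assume "carrier V \<noteq> {\<zero>\<^bsub>V\<^esub>}"
    then obtain x where x: "x \<in> carrier V" "x \<noteq> \<zero>\<^bsub>V\<^esub>" by blast
    have "inj_on (\<lambda>c. c \<odot>\<^bsub>V\<^esub> x) (carrier K)"
    proof (rule inj_onI, rule ccontr)
      fix a b assume ab: "a \<in> carrier K" "b \<in> carrier K" "a \<odot>\<^bsub>V\<^esub> x = b \<odot>\<^bsub>V\<^esub> x" "a \<noteq> b"
      let ?c = "a \<ominus>\<^bsub>K\<^esub> b"
      have c: "?c \<in> carrier K" "?c \<noteq> \<zero>\<^bsub>K\<^esub>" using ab by auto
      have "?c \<odot>\<^bsub>V\<^esub> x = \<zero>\<^bsub>V\<^esub>"
        using ab x by (simp add: a_minus_def V.smult_l_distr V.smult_l_minus V.r_neg)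
      moreover have u: "?c \<in> Units K" using c K.field_Units by simp
      ultimately have "(inv\<^bsub>K\<^esub> ?c \<otimes>\<^bsub>K\<^esub> ?c) \<odot>\<^bsub>V\<^esub> x = \<zero>\<^bsub>V\<^esub>"
        using c(1) x K.Units_inv_closed[OF u] by (simp only: V.smult_assoc1) (simp add: V.smult_r_null)
      thus False using K.Units_l_inv[OF u] x by simp
    qed
    thus False using infinite_K finite_imageD[OF finite_subset[OF subset_UNIV True]] by metis
  qed
  thus ?thesis by (intro exI[of _ undefined]) auto
next
  case infinite: False
  obtain e where "bij_betw e ((UNIV :: 'u set) \<times> (UNIV :: 'u set)) (UNIV :: 'u set)"
    using card_of_Times_same_infinite[OF infinite] card_of_ordIso by blast
  thus ?thesis
    by (intro exI[of _ e] allI impI) (rule inj_on_subset[OF bij_betw_imp_inj_on], auto)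
qed

definition enc :: "'u \<times> 'u \<Rightarrow> 'u" where
  "enc = (SOME e. \<forall>(V :: ('k, 'u) module) (W :: ('k, 'u) module). module K V \<longrightarrow> module K W \<longrightarrow> inj_on e (carrier V \<times> carrier W))"

lemma enc_inj: "module K (V :: ('k, 'u) module) ==> module K (W :: ('k, 'u) module) ==> inj_on enc (carrier V \<times> carrier W)"
  using someI_ex[OF ex_enc] unfolding enc_def by blast

subsection \<open>Mapping cones\<close>

text \<open>Mapping cones in coordinates: \<open>\<rho>\<close> and \<open>\<pi>\<close> are the projections to \<open>N\<close> and \<open>\<Sigma>M\<close>.\<close>

definition cone where
  "cone M N \<phi> C i j \<rho> \<pi> \<longleftrightarrow> ob C \<and> i \<in> hm N C 0 \<and> j \<in> hm M C (- 1) \<and> \<rho> \<in> hm C N 0 \<and> \<pi> \<in> hm C M 1 \<and>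
    (\<forall>p. \<forall>n\<in>elt N p. \<rho> p (i p n) = n \<and> \<pi> p (i p n) = \<zero>[M (p + 1)]) \<and>
    (\<forall>p. \<forall>m\<in>elt M (p + 1). \<rho> p (j (p + 1) m) = \<zero>[N p] \<and> \<pi> p (j (p + 1) m) = m) \<and>
    (\<forall>p. \<forall>c\<in>elt C p. i p (\<rho> p c) \<oplus>[C p] j (p + 1) (\<pi> p c) = c \<and>
       \<rho> (p + 1) (diff C p c) = diff N p (\<rho> p c) \<oplus>[N (p + 1)] \<phi> (p + 1) (\<pi> p c) \<and>
       \<pi> (p + 1) (diff C p c) = \<ominus>[M (p + 2)] diff M (p + 1) (\<pi> p c))"

text \<open>The right action on the summand Sigma M carries no sign: the Leibniz rule there has the
  sign (-1)^p instead of (-1)^(p+1), and this is absorbed by the differential -d.\<close>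

lemma ex_cone:
  assumes M: "ob M" and N: "ob N" and f: "\<phi> \<in> cl M N"
  shows "\<exists>C i j \<rho> \<pi>. cone M N \<phi> C i j \<rho> \<pi>"
proof -
  define S where "S p = dsum enc (gr N p) (gr M (p + 1))" for p
  define dec where "dec p = inv_into (elt N p \<times> elt M (p + 1)) enc" for p
  have inj: "inj_on enc (elt N p \<times> elt M (p + 1))" for p
    using enc_inj ob_module assms by blast
  have dec[simp]: "dec p (enc (n, m)) = (n, m)" if "n \<in> elt N p" "m \<in> elt M (p + 1)" for n m p
    using inj that by (simp add: dec_def)
  define C where "C = \<lparr>gr = S,
     diff = (\<lambda>p x. case dec p x of (n, m) \<Rightarrow>
        enc (diff N p n \<oplus>[N (p + 1)] \<phi> (p + 1) m, \<ominus>[M (p + 2)] diff M (p + 1) m)),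
     ract = (\<lambda>p q x a. case dec p x of (n, m) \<Rightarrow> enc (ract N p q n a, ract M (p + 1) q m a))\<rparr>"
  note [simp] = dsum_simps[OF inj, folded S_def] d_simps[OF M] d_simps[OF N] cl_simps[OF f M N]
    act_simps[OF M] act_simps[OF N] module_smult_simps[OF ob_module[OF M]]  module_smult_simps[OF ob_module[OF N]]
    deg_simps A_diff
  have Smod: "module K (S p)" for p
    unfolding S_def using dsum_module[OF inj] ob_module assms by blast
  have [simp]: "abelian_group (S p)" for p using Smod module_ag by blast
  have [simp]: "gr C = S" by (simp add: C_def)
  have [simp]: "diff C p (enc (n, m)) = enc (diff N p n \<oplus>[N (p + 1)] \<phi> (p + 1) m, \<ominus>[M (p + 2)] diff M (p + 1) m)"
    "ract C p q (enc (n, m)) a = enc (ract N p q n a, ract M (p + 1) q m a)"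
    if "n \<in> elt N p" "m \<in> elt M (p + 1)" for n m p q a
    using that by (simp_all add: C_def)
  have inv[simp]: "\<ominus>\<^bsub>S p\<^esub> enc (n, m) = enc (\<ominus>[N p] n, \<ominus>[M (p + 1)] m)"
    if "n \<in> elt N p" "m \<in> elt M (p + 1)" for n m p
    using that by (intro abelian_group.minus_equality) (auto simp: ag_simps assms)
  have cc: "cochain_complex K C"
    unfolding cochain_complex_def
  proof (intro conjI allI ballI)
    fix p show "module K (gr C p)" by (simp add: Smod)
    show "klinear K (gr C p) (gr C (p + 1)) (diff C p)"
      by (rule klinearI) (auto simp: ag_simps assms)
    show "diff C (p + 1) (diff C p x) = \<zero>[C (p + 2)]" if "x \<in> elt C p" for x
      using that by (auto simp: ag_simps assms)
  qed
  have "ob C"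
    unfolding dg_module_def
  proof (intro conjI allI ballI)
    show "cochain_complex K C" by (rule cc)
    fix p q :: int
    have pq[simp]: "p + 1 + q = p + q + 1" "p + 2 + q = p + q + 2" by linarith+
    have act2[simp]: "ract M (p + 1) q x a \<in> elt M (p + q + 1)" if "x \<in> elt M (p + 1)" "a \<in> elt A q" for x a
      using act_simps(1)[OF M that] by simp
    show "kbilinear K (gr C p) (gr A q) (gr C (p + q)) (ract C p q)"
      unfolding kbilinear_def by (auto intro!: klinearI simp: module_smult_simps[OF A_module] ag_simps assms)
    {
      fix r m a b assume mab: "m \<in> elt C p" "a \<in> elt A q" "b \<in> elt A r"
      thus "ract C (p + q) r (ract C p q m a) b = ract C p (q + r) m (gmult A q r a b)"
        using act_simps(8)[OF M _ mab(2,3), of _ "p + 1"] by auto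
    }
    {
      fix m assume "m \<in> elt C p"
      thus "ract C p 0 m (gone A) = m" using act_simps(9)[OF M, of _ "p + 1"] by auto
    }
    fix m a assume ma: "m \<in> elt C p" "a \<in> elt A q"
    thus "diff C (p + q) (ract C p q m a) =
       ract C (p + 1) q (diff C p m) a \<oplus>[C (p + q + 1)]
       sign_pow (gr C (p + q + 1)) p (ract C p (q + 1) m (diff A q a))"
      using act_simps(10)[OF M _ ma(2), of _ "p + 1"] act_simps(10)[OF N _ ma(2), of _ "p"]
        cl_simps(6)[OF f M N _ ma(2), of _ "p + 1"] act_simps(1)[OF M _ A_diff[OF ma(2)], of _ "p + 1"]
      by (auto simp: ag_simps assms sign_pow_def)
  qed
  moreover have "(\<lambda>p n. enc (n, \<zero>[M (p + 1)])) \<in> hm N C 0"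
  proof (rule hmI)
    fix p q :: int
    have [simp]: "p + 1 + q = p + q + 1" by linarith
    show "enc (ract N p q x a, \<zero>[M (p + q + 1)]) = ract C (p + 0) q (enc (x, \<zero>[M (p + 1)])) a"
      if "x \<in> elt N p" "a \<in> elt A q" for x a
      using that by (simp add: ag_simps assms)
  qed (auto simp: ag_simps assms)
  moreover have "(\<lambda>p m. enc (\<zero>[N (p - 1)], m)) \<in> hm M C (- 1)"
  proof (rule hmI)
    fix p q :: int
    have [simp]: "p - 1 + q = p + q - 1" by linarith
    show "enc (\<zero>[N (p + q - 1)], ract M p q x a) = ract C (p + - 1) q (enc (\<zero>[N (p - 1)], x)) a"
      if "x \<in> elt M p" "a \<in> elt A q" for x a
      using that act_simps(4)[OF N that(2), of "p - 1"] by (simp add: ag_simps assms C_def dec[of _ "p - 1", simplified])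
  qed (auto simp: ag_simps assms)
  moreover have "(\<lambda>p c. fst (dec p c)) \<in> hm C N 0"
    by (rule hmI) (auto simp: ag_simps assms)
  moreover have "(\<lambda>p c. snd (dec p c)) \<in> hm C M 1"
  proof (rule hmI)
    fix p q :: int
    have [simp]: "p + 1 + q = p + q + 1" by linarith
    show "snd (dec (p + q) (ract C p q x a)) = ract M (p + 1) q (snd (dec p x)) a"
      if "x \<in> elt C p" "a \<in> elt A q" for x a
      using that by (auto simp: ag_simps assms)
  qed (auto simp: ag_simps assms)
  ultimately have "cone M N \<phi> C (\<lambda>p n. enc (n, \<zero>[M (p + 1)])) (\<lambda>p m. enc (\<zero>[N (p - 1)], m))
     (\<lambda>p c. fst (dec p c)) (\<lambda>p c. snd (dec p c))"
    unfolding cone_def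
    by (auto simp: ag_simps assms)
  thus ?thesis by blast
qed

end

lemma (in abelian_group) coset_eq_iff:
  assumes "additive_subgroup B G" "x \<in> carrier G" "y \<in> carrier G"
  shows "B +> x = B +> y \<longleftrightarrow> x \<ominus> y \<in> B"
proof -
  interpret B: abelian_subgroup B G
    by (rule abelian_subgroupI3[OF assms(1) ag_group])
  show ?thesis
    using B.a_rcos_module[of y x] B.a_rcos_self[of x] add.repr_independence[folded a_r_coset_def, of x B y]
      assms B.a_subgroup unfolding a_minus_def by metis
qed

context dga
begin

subsection \<open>Quasi-isomorphisms\<close>

abbreviation cy where "cy \<equiv> cocycles"
abbreviation bd where "bd \<equiv> coboundaries"

lemma cyI: "x \<in> elt X p ==> diff X p x = \<zero>[X (p + 1)] ==> x \<in> cy X p"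
  by (simp add: cocycles_def)

lemma cyD: "x \<in> cy X p ==> x \<in> elt X p" "x \<in> cy X p ==> q = p + 1 ==> diff X p x = \<zero>[X q]"
  by (simp_all add: cocycles_def)

lemma bdI: "y \<in> elt X q ==> x = diff X q y ==> p = q + 1 ==> x \<in> bd X p"
  by (simp add: coboundaries_def)

lemma bdE:
  assumes "x \<in> bd X p"
  obtains y where "y \<in> elt X (p - 1)" "x = diff X (p - 1) y"
  using assms by (auto simp: coboundaries_def)

lemma bd_cy: "ob X ==> x \<in> bd X p ==> x \<in> cy X p"
  by (erule bdE) (auto intro!: cyI simp: d_m1)

lemma bd_carrier: "ob X ==> x \<in> bd X p ==> x \<in> elt X p"
  by (rule cyD(1)[OF bd_cy])

lemma bd_simps:
  assumes "ob X"
  shows "\<zero>[X p] \<in> bd X p"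
    "x \<in> bd X p ==> \<ominus>[X p] x \<in> bd X p"
    "x \<in> bd X p ==> y \<in> bd X p ==> x \<oplus>[X p] y \<in> bd X p"
    "x \<in> bd X p ==> y \<in> bd X p ==> x \<ominus>[X p] y \<in> bd X p"
    "c \<in> carrier K ==> x \<in> bd X p ==> c \<odot>[X p] x \<in> bd X p"
proof -
  note [simp] = d_m1[OF assms]
  show "\<zero>[X p] \<in> bd X p"
    by (rule bdI[of "\<zero>[X (p - 1)]" _ "p - 1"]) (auto simp: ag_simps assms)
  show neg: "\<ominus>[X p] x \<in> bd X p" if "x \<in> bd X p" for x
  proof -
    obtain y where "y \<in> elt X (p - 1)" "x = diff X (p - 1) y" by (rule bdE[OF \<open>x \<in> bd X p\<close>])
    thus ?thesis
      by (intro bdI[of "\<ominus>[X (p - 1)] y" _ "p - 1"]) (auto simp: ag_simps assms)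
  qed
  show add: "x \<oplus>[X p] y \<in> bd X p" if "x \<in> bd X p" "y \<in> bd X p" for x y
  proof -
    obtain a where "a \<in> elt X (p - 1)" "x = diff X (p - 1) a" by (rule bdE[OF \<open>x \<in> bd X p\<close>])
    moreover obtain b where "b \<in> elt X (p - 1)" "y = diff X (p - 1) b" by (rule bdE[OF \<open>y \<in> bd X p\<close>])
    ultimately show ?thesis
      by (intro bdI[of "a \<oplus>[X (p - 1)] b" _ "p - 1"]) (auto simp: ag_simps assms)
  qed
  show "x \<ominus>[X p] y \<in> bd X p" if "x \<in> bd X p" "y \<in> bd X p"
    using add[OF that(1) neg[OF that(2)]] by (simp add: abelian_group.minus_def' assms)
  show "c \<odot>[X p] x \<in> bd X p" if "c \<in> carrier K" "x \<in> bd X p"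
  proof -
    obtain y where "y \<in> elt X (p - 1)" "x = diff X (p - 1) y" by (rule bdE[OF \<open>x \<in> bd X p\<close>])
    thus ?thesis using that(1) d_simps(6)[OF assms that(1), of y "p - 1"]
      by (intro bdI[of "c \<odot>[X (p - 1)] y" _ "p - 1"]) (auto simp: module_smult_simps[OF ob_module[OF assms]])
  qed
qed

lemma cy_simps:
  assumes "ob X"
  shows "\<zero>[X p] \<in> cy X p"
    "x \<in> cy X p ==> \<ominus>[X p] x \<in> cy X p"
    "x \<in> cy X p ==> y \<in> cy X p ==> x \<oplus>[X p] y \<in> cy X p"
    "x \<in> cy X p ==> y \<in> cy X p ==> x \<ominus>[X p] y \<in> cy X p"
    "c \<in> carrier K ==> x \<in> cy X p ==> c \<odot>[X p] x \<in> cy X p"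
  using assms by (auto intro!: cyI simp: cyD ag_simps d_simps module_smult_simps[OF ob_module[OF assms]])

lemma cl_cy: "f \<in> cl X Y ==> ob X ==> ob Y ==> x \<in> cy X p ==> f p x \<in> cy Y p"
  by (rule cyI) (auto simp: cl_simps(1,4) cyD cl_d'[symmetric, where q = "p + 1"])

lemma cl_bd: "f \<in> cl X Y ==> ob X ==> ob Y ==> x \<in> bd X p ==> f p x \<in> bd Y p"
  by (erule bdE, rule bdI[of "f (p - 1) y" _ "p - 1" for y]) (auto simp: cl_simps(1) cl_d'[where q = p and p = "p - 1"])

lemma bd_subgroup: "ob X ==> additive_subgroup (bd X p) (gr X p)"
  by (intro additive_subgroupI subgroup.intro)
    (auto simp: bd_carrier bd_simps a_inv_def[symmetric] bd_simps(2)[unfolded a_inv_def])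

lemma coset_eq:
  assumes "ob X" "x \<in> cy X p" "y \<in> cy X p"
  shows "bd X p +>\<^bsub>gr X p\<^esub> x = bd X p +>\<^bsub>gr X p\<^esub> y \<longleftrightarrow> x \<ominus>[X p] y \<in> bd X p"
  using assms by (intro abelian_group.coset_eq_iff bd_subgroup cyD ob_ag)

lemma homology_map_coset:
  assumes "f \<in> cl X Y" "ob X" "ob Y" "x \<in> cy X p"
  shows "hmap Y p f (bd X p +>\<^bsub>gr X p\<^esub> x) = bd Y p +>\<^bsub>gr Y p\<^esub> f p x"
proof -
  note [simp] = cl_simps[OF assms(1-3)] bd_carrier[OF assms(2)] bd_carrier[OF assms(3)] cyD(1)[OF assms(4)]
  have 1: "b \<oplus>[Y p] f p (b' \<oplus>[X p] x) \<in> bd Y p +>\<^bsub>gr Y p\<^esub> f p x" if "b \<in> bd Y p" "b' \<in> bd X p" for b b'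
  proof -
    have "b \<oplus>[Y p] f p (b' \<oplus>[X p] x) = (b \<oplus>[Y p] f p b') \<oplus>[Y p] f p x"
      using that assms by (simp add: ag_facts)
    thus ?thesis
      using bd_simps(3)[OF assms(3) that(1) cl_bd[OF assms(1-3) that(2)]] unfolding a_r_coset_def' by auto
  qed
  have 2: "b \<oplus>[Y p] f p x = b \<oplus>[Y p] f p (\<zero>[X p] \<oplus>[X p] x)" if "b \<in> bd Y p" for b
    using assms by (simp add: ag_facts)
  show ?thesis
  proof
    show "hmap Y p f (bd X p +>\<^bsub>gr X p\<^esub> x) \<subseteq> bd Y p +>\<^bsub>gr Y p\<^esub> f p x"
      using 1 unfolding homology_map_def set_add_def' a_r_coset_def'[of _ "bd X p"] by auto
    show "bd Y p +>\<^bsub>gr Y p\<^esub> f p x \<subseteq> hmap Y p f (bd X p +>\<^bsub>gr X p\<^esub> x)"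
      using 2 bd_simps(1)[OF assms(2), of p] unfolding homology_map_def set_add_def' a_r_coset_def' by blast
  qed
qed

text \<open>The homology class of a cocycle z.\<close>

definition hc where "hc X p z = bd X p +>\<^bsub>gr X p\<^esub> z"

lemma hc_carrier: "hel X p = hc X p ` cy X p"
  by (simp add: homology_def hc_def[abs_def])

lemma hc_zero: "ob X ==> \<zero>\<^bsub>homology X p\<^esub> = hc X p \<zero>[X p]"
  using abelian_group.a_coset_add_zero[OF ob_ag, of X "bd X p" p] bd_carrier by (auto simp: homology_def hc_def)

lemma hc_add:
  assumes "ob X" "z \<in> cy X p" "w \<in> cy X p"
  shows "hc X p z \<oplus>\<^bsub>homology X p\<^esub> hc X p w = hc X p (z \<oplus>[X p] w)"
proof -
  have "abelian_subgroup (bd X p) (gr X p)" by (rule abelian_subgroupI3[OF bd_subgroup ob_ag]) (rule assms)+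
  from abelian_subgroup.a_rcos_sum[OF this, of z w] show ?thesis using assms by (simp add: homology_def hc_def cyD)
qed

lemma hc_smult:
  assumes "ob X" "z \<in> cy X p" "c \<in> carrier K"
  shows "c \<odot>\<^bsub>homology X p\<^esub> hc X p z = hc X p (c \<odot>[X p] z)"
proof -
  note m = module_smult_simps[OF ob_module[OF assms(1)]] and z = cyD(1)[OF assms(2)]
  have e: "b \<oplus>[X p] c \<odot>[X p] (b' \<oplus>[X p] z) = (b \<oplus>[X p] c \<odot>[X p] b') \<oplus>[X p] c \<odot>[X p] z"
    if "b \<in> bd X p" "b' \<in> bd X p" for b b'
    using that m z assms bd_carrier[OF assms(1)] by (simp add: ag_facts)
  have "hc X p (c \<odot>[X p] z) \<subseteq> c \<odot>\<^bsub>homology X p\<^esub> hc X p z"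
  proof
    fix x assume "x \<in> hc X p (c \<odot>[X p] z)"
    then obtain b where b: "b \<in> bd X p" "x = b \<oplus>[X p] c \<odot>[X p] z" by (auto simp: hc_def a_r_coset_def')
    have "x = b \<oplus>[X p] c \<odot>[X p] (\<zero>[X p] \<oplus>[X p] z)" using b z assms by (simp add: ag_facts)
    thus "x \<in> c \<odot>\<^bsub>homology X p\<^esub> hc X p z"
      using b(1) bd_simps(1)[OF assms(1)] by (auto simp: homology_def hc_def a_r_coset_def' set_add_def')
  qed
  moreover have "c \<odot>\<^bsub>homology X p\<^esub> hc X p z \<subseteq> hc X p (c \<odot>[X p] z)"
    using e bd_simps(3,5)[OF assms(1)] assms(3) by (auto simp: homology_def hc_def a_r_coset_def' set_add_def') metis
  ultimately show ?thesis by blast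
qed

lemma hc_eq_iff: "ob X ==> z \<in> cy X p ==> w \<in> cy X p ==> hc X p z = hc X p w \<longleftrightarrow> z \<ominus>[X p] w \<in> bd X p"
  unfolding hc_def by (rule coset_eq)

lemma hc_zero_iff: "ob X ==> z \<in> cy X p ==> hc X p z = \<zero>\<^bsub>homology X p\<^esub> \<longleftrightarrow> z \<in> bd X p"
  using hc_eq_iff[of X z p "\<zero>[X p]"] by (simp add: hc_zero cy_simps a_minus_def ag_simps cyD)

lemma homology_module:
  assumes X: "ob X"
  shows "module K (homology X p)"
proof -
  note m = module_smult_simps[OF ob_module[OF X]] and [simp] = hc_add[OF X] hc_smult[OF X] hc_zero[OF X] cy_simps[OF X] X
  interpret k: cring K by (rule cring_K)
  have "abelian_group (homology X p)"
  proof (rule abelian_groupI)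
    fix x assume "x \<in> hel X p"
    then obtain z where z: "z \<in> cy X p" "x = hc X p z" by (auto simp: hc_carrier)
    show "\<exists>y\<in>hel X p. y \<oplus>\<^bsub>homology X p\<^esub> x = \<zero>\<^bsub>homology X p\<^esub>"
      using z by (intro bexI[of _ "hc X p (\<ominus>[X p] z)"]) (auto simp: hc_carrier ag_simps cyD abelian_group.l_neg)
  qed (auto simp: hc_carrier ag_facts cyD)
  thus ?thesis
    by (rule moduleI[OF cring_K]) (auto simp: hc_carrier m module.smult_one[OF ob_module[OF X]] module.smult_l_distr[OF ob_module[OF X]] module.smult_assoc1[OF ob_module[OF X]] cyD)
qed

lemma homology_ag: "ob X ==> abelian_group (homology X p)"
  by (rule module_ag[OF homology_module])

lemma homology_map_hc: "f \<in> cl X Y ==> ob X ==> ob Y ==> z \<in> cy X p ==> hmap Y p f (hc X p z) = hc Y p (f p z)"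
  unfolding hc_def by (rule homology_map_coset)

lemma homology_map_klinear:
  assumes f: "f \<in> cl X Y" and ob: "ob X" "ob Y"
  shows "klinear K (homology X p) (homology Y p) (hmap Y p f)"
  by (rule klinearI)
    (auto simp: hc_carrier homology_map_hc[OF f ob] cl_cy[OF f ob] hc_add ob hc_smult cy_simps cl_simps[OF f ob] cyD)

lemma homology_map_closed:
  assumes f: "f \<in> cl X Y" and ob: "ob X" "ob Y" and z: "z \<in> hel X p"
  shows "hmap Y p f z \<in> hel Y p"
  using z by (auto simp: hc_carrier homology_map_hc[OF f ob] cl_cy[OF f ob])

lemma homology_map_comp:
  assumes f: "f \<in> cl X Y" and g: "g \<in> cl Y Z" and ob: "ob X" "ob Y" "ob Z" and z: "z \<in> hel X p"
  shows "hmap Z p (gcomp g f) z = hmap Z p g (hmap Y p f z)"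
  using z homology_map_hc[OF cl_comp[OF f g ob] ob(1,3)]
  by (auto simp: hc_carrier homology_map_hc[OF f ob(1,2)] homology_map_hc[OF g ob(2,3)] cl_cy[OF f ob(1,2)] gcomp_def)

lemma homology_map_hty:
  assumes h: "hty X Y f g" and f: "f \<in> cl X Y" and g: "g \<in> cl X Y" and ob: "ob X" "ob Y" and z: "z \<in> hel X p"
  shows "hmap Y p f z = hmap Y p g z"
proof (rule htyE[OF h f g ob], goal_cases)
  case (1 h)
  note [simp] = hm_simps[OF 1(1) ob] cl_simps[OF f ob] cl_simps[OF g ob] d_m1[OF ob(2)]
  obtain x where x: "x \<in> cy X p" "z = hc X p x" using z by (auto simp: hc_carrier)
  have x': "x \<in> elt X p" "diff X p x = \<zero>[X (p + 1)]" using x by (auto simp: cyD)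
  have "f p x \<ominus>[Y p] g p x = diff Y (p - 1) (h p x)"
    using x' ob by (simp add: 1(2) ag_simps)
  hence "f p x \<ominus>[Y p] g p x \<in> bd Y p" using x' by (auto intro!: bdI[of "h p x" _ "p - 1"])
  thus ?case using x hc_eq_iff[OF ob(2) cl_cy[OF f ob x(1)] cl_cy[OF g ob x(1)]]
    by (simp add: homology_map_hc[OF f ob] homology_map_hc[OF g ob])
qed

lemma qi_bij_iff: "f \<in> qi X Y \<longleftrightarrow> f \<in> cl X Y \<and> (\<forall>p. bij_betw (hmap Y p f) (hel X p) (hel Y p))"
  by (simp add: quasi_isos_def)

lemma qi_bij: "f \<in> qi X Y ==> bij_betw (hmap Y p f) (hel X p) (hel Y p)"
  by (simp add: quasi_isos_def)

lemma qi_cl: "f \<in> qi X Y ==> f \<in> cl X Y"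
  by (simp add: quasi_isos_def)

lemma qiD:
  assumes q: "f \<in> qi X Y" and ob: "ob X" "ob Y"
  shows "x \<in> cy X p ==> f p x \<in> bd Y p ==> x \<in> bd X p"
    "y \<in> cy Y p ==> (!!x. x \<in> cy X p ==> y \<ominus>[Y p] f p x \<in> bd Y p ==> thesis) ==> thesis"
proof -
  note f = qi_cl[OF q] and b = qi_bij[OF q, of p]
  note h = homology_map_hc[OF f ob] and c = cl_cy[OF f ob]
  show "x \<in> bd X p" if x: "x \<in> cy X p" "f p x \<in> bd Y p"
  proof -
    let ?z = "\<zero>[X p]"
    have "hc Y p (f p x) = hc Y p (f p ?z)"
      using x c cy_simps(1)[OF ob(1)] hc_zero_iff[OF ob(2) c] cl_simps[OF f ob] bd_simps(1)[OF ob(2)] by (simp add: hc_zero[OF ob(2)])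
    hence "hc X p x = hc X p ?z"
      using x(1) cy_simps(1)[OF ob(1), of p] h inj_onD[OF bij_betw_imp_inj_on[OF b], of "hc X p x" "hc X p ?z"] by (simp add: hc_carrier)
    thus ?thesis using hc_zero_iff[OF ob(1) x(1)] hc_zero[OF ob(1)] by simp
  qed
  show thesis if y: "y \<in> cy Y p" and r: "!!x. x \<in> cy X p ==> y \<ominus>[Y p] f p x \<in> bd Y p ==> thesis"
  proof -
    have "hc Y p y \<in> hmap Y p f ` hc X p ` cy X p" using b y by (simp add: bij_betw_def hc_carrier)
    then obtain x where "x \<in> cy X p" "hc Y p y = hc Y p (f p x)" using h by auto
    thus thesis using r hc_eq_iff[OF ob(2) y c] by blast
  qed
qed

text \<open>Elementwise criterion for bijectivity on homology; by additivity, injectivity need only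
  be tested at the zero class.\<close>

lemma qiI:
  assumes f: "f \<in> cl X Y" and ob: "ob X" "ob Y" and i: "!!x p. x \<in> cy X p ==> f p x \<in> bd Y p ==> x \<in> bd X p"
    and s: "!!y p. y \<in> cy Y p ==> \<exists>x\<in>cy X p. y \<ominus>[Y p] f p x \<in> bd Y p"
  shows "f \<in> qi X Y"
  unfolding qi_bij_iff
proof (intro conjI f allI)
  fix p
  note h = homology_map_hc[OF f ob] and c = cl_cy[OF f ob]
  show "bij_betw (hmap Y p f) (hel X p) (hel Y p)"
    unfolding hc_carrier
  proof (rule bij_betw_imageI[OF inj_onI subset_antisym[OF subsetI subsetI]])
    fix z assume "z \<in> hmap Y p f ` hc X p ` cy X p" thus "z \<in> hc Y p ` cy Y p" using h c by auto
  next
    fix z assume "z \<in> hc Y p ` cy Y p"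
    then obtain y where y: "y \<in> cy Y p" "z = hc Y p y" by blast
    obtain x where x: "x \<in> cy X p" "y \<ominus>[Y p] f p x \<in> bd Y p" using s[OF y(1)] by blast
    hence "z = hmap Y p f (hc X p x)" using hc_eq_iff[OF ob(2) y(1) c[OF x(1)]] y(2) h[OF x(1)] by simp
    thus "z \<in> hmap Y p f ` hc X p ` cy X p" using x(1) by blast
  next
    fix u v assume "u \<in> hc X p ` cy X p" "v \<in> hc X p ` cy X p" and e: "hmap Y p f u = hmap Y p f v"
    then obtain x y where x: "x \<in> cy X p" "u = hc X p x" and y: "y \<in> cy X p" "v = hc X p y" by blast
    have "f p x \<ominus>[Y p] f p y \<in> bd Y p"
      using e h[OF x(1)] h[OF y(1)] hc_eq_iff[OF ob(2) c[OF x(1)] c[OF y(1)]] x(2) y(2) by simp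
    moreover have "f p (x \<ominus>[X p] y) = f p x \<ominus>[Y p] f p y"
      using x(1) y(1) cl_simps[OF f ob] ob by (simp add: cyD a_minus_def ag_simps)
    ultimately show "u = v" using i[OF cy_simps(4)[OF ob(1) x(1) y(1)]] hc_eq_iff[OF ob(1) x(1) y(1)] x(2) y(2) by simp
  qed
qed

lemma id_qi: "ob X ==> id_map \<in> qi X X"
  by (rule qiI[OF id_cl]) (auto simp: id_map_def abelian_group.minus_self cyD bd_simps intro!: bexI)

lemma qi_comp:
  assumes "f \<in> qi X Y" "g \<in> qi Y Z" "ob X" "ob Y" "ob Z"
  shows "gcomp g f \<in> qi X Z"
  unfolding qi_bij_iff
proof (intro conjI allI)
  show "gcomp g f \<in> cl X Z" by (rule cl_comp[OF qi_cl[OF assms(1)] qi_cl[OF assms(2)] assms(3-5)])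
  show "bij_betw (hmap Z p (gcomp g f)) (hel X p) (hel Z p)" for p
    by (rule iffD2[OF bij_betw_cong bij_betw_trans[OF qi_bij[OF assms(1)] qi_bij[OF assms(2)]]])
      (simp add: homology_map_comp[OF qi_cl[OF assms(1)] qi_cl[OF assms(2)] assms(3-5)])
qed

lemma gcomp_bij:
  assumes "gcomp g f \<in> qi X Z" "f \<in> cl X Y" "g \<in> cl Y Z" "ob X" "ob Y" "ob Z"
  shows "bij_betw (hmap Z p g \<circ> hmap Y p f) (hel X p) (hel Z p)"
  by (rule iffD2[OF bij_betw_cong qi_bij[OF assms(1)]]) (simp add: homology_map_comp[OF assms(2-)])

lemma qi_cancel_left:
  assumes "gcomp g f \<in> qi X Z" "g \<in> qi Y Z" "f \<in> cl X Y" "ob X" "ob Y" "ob Z"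
  shows "f \<in> qi X Y"
  unfolding qi_bij_iff
proof (intro conjI allI assms)
  note g = qi_cl[OF assms(2)]
  show "bij_betw (hmap Y p f) (hel X p) (hel Y p)" for p
    by (rule iffD2[OF bij_betw_comp_iff2[OF qi_bij[OF assms(2)]] gcomp_bij[OF assms(1,3) g assms(4-6)]])
      (use homology_map_closed[OF assms(3-5)] in blast)
qed

lemma qi_cancel_right:
  assumes "gcomp g f \<in> qi X Z" "f \<in> qi X Y" "g \<in> cl Y Z" "ob X" "ob Y" "ob Z"
  shows "g \<in> qi Y Z"
  unfolding qi_bij_iff
proof (intro conjI allI assms)
  note f = qi_cl[OF assms(2)]
  show "bij_betw (hmap Z p g) (hel Y p) (hel Z p)" for p
    by (rule iffD2[OF bij_betw_comp_iff[OF qi_bij[OF assms(2)]] gcomp_bij[OF assms(1) f assms(3-6)]])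
qed

lemma qi_hty:
  assumes "hty X Y f g" "f \<in> qi X Y" "g \<in> cl X Y" "ob X" "ob Y"
  shows "g \<in> qi X Y"
  unfolding qi_bij_iff
proof (intro conjI allI assms)
  show "bij_betw (hmap Y p g) (hel X p) (hel Y p)" for p
    by (rule iffD1[OF bij_betw_cong qi_bij[OF assms(2)]]) (rule homology_map_hty[OF assms(1) qi_cl[OF assms(2)] assms(3-5)])
qed

end

section \<open>Shifts of dg modules\<close>

lemma shift_obj_simps [simp]: "gr (Sh n M) p = gr M (p + n)"
  "diff (Sh n M) p x = sign_pow (gr M (p + n + 1)) n (diff M (p + n) x)"
  "ract (Sh n M) p q = ract M (p + n) q"
  by (simp_all add: shift_obj_def)

context dga
begin

lemma shift_ob:
  assumes "ob X"
  shows "ob (Sh n X)"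
proof -
  note [simp] = d_simps[OF assms] act_simps[OF assms] module_smult_simps[OF ob_module[OF assms]] A_diff
  have deg: "p + n + 1 = p + 1 + n" "p + n + 2 = p + 2 + n" for p by linarith+
  have deg1: "p + 1 + n = p + n + 1" "p + 2 + n = p + n + 2" for p by linarith+
  show ?thesis
    unfolding dg_module_def cochain_complex_def
  proof (intro conjI allI ballI)
    fix p q :: int
    have deg2: "p + q + n = p + n + q" "p + n + q + 1 = p + q + 1 + n" for p by linarith+
    note dq = deg1[of "p + q"] deg1[of p]
    show "Module.module K (gr (Sh n X) p)" using ob_module[OF assms] by simp
    show "klinear K (gr (Sh n X) p) (gr (Sh n X) (p + 1)) (diff (Sh n X) p)"
      by (rule klinearI) (auto simp: sign_pow_def ag_simps assms deg1)
    show "diff (Sh n X) (p + 1) (diff (Sh n X) p x) = \<zero>[(Sh n X) (p + 2)]"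
      if "x \<in> elt (Sh n X) p" for x
      using that by (auto simp: sign_pow_def ag_simps assms deg1 deg_simps)
    show "kbilinear K (gr (Sh n X) p) (gr A q) (gr (Sh n X) (p + q)) (ract (Sh n X) p q)"
      using act_klinear[OF assms] by (simp add: kbilinear_def deg2)
    {
      fix r m a b assume "m \<in> elt (Sh n X) p" "a \<in> elt A q" "b \<in> elt A r"
      thus "ract (Sh n X) (p + q) r (ract (Sh n X) p q m a) b =
        ract (Sh n X) p (q + r) m (gmult A q r a b)" by (simp add: deg2)
    }
    {
      fix m assume "m \<in> elt (Sh n X) p"
      thus "ract (Sh n X) p 0 m (gone A) = m" by simp
    }
    fix m a assume ma: "m \<in> elt (Sh n X) p" "a \<in> elt A q"
    have [simp]: "p + n + 1 + q = p + n + q + 1" "p + q + 1 + n = p + n + q + 1" "p + 1 + n = p + n + 1" "p + q + n = p + n + q"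
      "p + n + (q + 1) = p + n + q + 1"
      by linarith+
    have [simp]: "ract X (p + n) (q + 1) m (diff A q a) \<in> elt X (p + n + q + 1)"
       "ract X (p + n + 1) q (diff X (p + n) m) a \<in> elt X (p + n + q + 1)"
      using ma by (simp_all del: add.assoc)
    have e: "\<ominus>[X (p + n + q + 1)] ract X (p + n + 1) q (diff X (p + n) m) a =
       ract X (p + n + 1) q (\<ominus>[X (p + n + 1)] diff X (p + n) m) a"
      using ma act_simps(3)[OF assms, of "diff X (p + n) m" "p + n + 1" a q] by simp
    show "diff (Sh n X) (p + q) (ract (Sh n X) p q m a) =
       ract (Sh n X) (p + 1) q (diff (Sh n X) p m) a \<oplus>[(Sh n X) (p + q + 1)]
       sign_pow (gr (Sh n X) (p + q + 1)) p (ract (Sh n X) p (q + 1) m (diff A q a))"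
      using ma by (auto simp: sign_pow_def ag_simps assms e[symmetric])
  qed
qed

lemma shift_hm_dom:
  assumes "f \<in> hm X Y k" "k' = k + n"
  shows "(\<lambda>p. f (p + n)) \<in> hm (Sh n X) Y k'"
proof -
  have 1: "p + k' = p + n + k" for p using assms(2) by linarith
  have "f (p + q + n) (ract X (p + n) q m a) = ract Y (p + n + k) q (f (p + n) m) a"
    if "m \<in> elt X (p + n)" "a \<in> elt A q" for p q m a
  proof -
    have e: "p + q + n = p + n + q" by linarith
    show ?thesis unfolding e using assms(1) that by (simp add: module_maps_def)
  qed
  thus ?thesis using assms(1) unfolding module_maps_def shift_obj_simps 1 by simp
qed

lemma shift_hm_cod:
  assumes "f \<in> hm X Y k" "k' = k - n"
  shows "f \<in> hm X (Sh n Y) k'"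
proof -
  have "p + k' + n = p + k" for p using assms(2) by linarith
  thus ?thesis using assms(1) unfolding module_maps_def shift_obj_simps by (simp only:)
qed

lemma shift_hm:
  assumes "f \<in> hm X Y k"
  shows "(\<lambda>p. f (p + n)) \<in> hm (Sh n X) (Sh n Y) k"
  by (rule shift_hm_cod[OF shift_hm_dom[OF assms refl]]) simp

lemma bdE':
  assumes "x \<in> bd X q" "q = p + 1"
  obtains y where "y \<in> elt X p" "x = diff X p y"
  using assms(1) by (rule bdE) (use that assms(2) in simp)

lemma sign_pow_simps:
  assumes "abelian_group V" "x \<in> carrier V"
  shows "sign_pow V n x \<in> carrier V" "sign_pow V n (sign_pow V n x) = x" "sign_pow V n \<zero>\<^bsub>V\<^esub> = \<zero>\<^bsub>V\<^esub>"
    "sign_pow V m (sign_pow V n x) = sign_pow V (n + m) x"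
  using assms by (auto simp: sign_pow_def ag_simps)

lemma cy_shift:
  assumes "ob X"
  shows "cy (Sh n X) p = cy X (p + n)"
proof -
  have e: "p + 1 + n = p + n + 1" by simp
  have "sign_pow (gr X (p + n + 1)) n (diff X (p + n) x) = \<zero>[X (p + n + 1)] \<longleftrightarrow> diff X (p + n) x = \<zero>[X (p + n + 1)]"
    if "x \<in> elt X (p + n)" for x
    using sign_pow_simps(2,3)[OF ob_ag[OF assms] d_simps(1)[OF assms that refl], of n]
      sign_pow_simps(3)[OF ob_ag[OF assms] abelian_monoid.zero_closed, of n "p + n + 1"]
      abelian_group.axioms(1)[OF ob_ag[OF assms]] by metis
  thus ?thesis by (auto simp: cocycles_def e)
qed

lemma bd_shift:
  assumes "ob X"
  shows "bd (Sh n X) p = bd X (p + n)"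
proof -
  have e: "p + n - 1 = p - 1 + n" "p - 1 + n + 1 = p + n" by simp_all
  show ?thesis
  proof (intro equalityI subsetI)
    fix x assume "x \<in> bd (Sh n X) p"
    then obtain y where y: "y \<in> elt X (p - 1 + n)" "x = sign_pow (gr X (p + n)) n (diff X (p - 1 + n) y)"
      by (auto simp: coboundaries_def e)
    have "diff X (p - 1 + n) y \<in> bd X (p + n)" using y(1) by (intro bdI[OF _ refl]) auto
    thus "x \<in> bd X (p + n)" using bd_simps(2)[OF assms] y(2) by (auto simp: sign_pow_def)
  next
    fix x assume x: "x \<in> bd X (p + n)"
    hence "sign_pow (gr X (p + n)) n x \<in> bd X (p + n)" using bd_simps(2)[OF assms] by (auto simp: sign_pow_def)
    then obtain y where y: "y \<in> elt X (p - 1 + n)" "sign_pow (gr X (p + n)) n x = diff X (p - 1 + n) y"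
      by (rule bdE'[where p = "p - 1 + n"]) auto
    have "x = sign_pow (gr X (p + n)) n (diff X (p - 1 + n) y)"
      unfolding y(2)[symmetric] using sign_pow_simps(2)[OF ob_ag[OF assms] bd_carrier[OF assms x]] by simp
    thus "x \<in> bd (Sh n X) p"
      using y(1) by (auto simp: coboundaries_def e)
  qed
qed

text \<open>The sign in the shifted differential changes neither cocycles nor coboundaries, so this
  is an equality and not just an isomorphism.\<close>

lemma homology_shift: "ob X ==> homology (Sh n X) p = homology X (p + n)"
  by (simp add: homology_def cy_shift bd_shift)

lemma hc_shift: "ob X ==> hc (Sh n X) p = hc X (p + n)"
  by (simp add: fun_eq_iff hc_def bd_shift)

section \<open>Calculations in the coordinates of a cone\<close>

lemma cone_ob: "cone M N \<phi> C i j \<rho> \<pi> ==> ob C"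
  and cone_hm: "cone M N \<phi> C i j \<rho> \<pi> ==> i \<in> hm N C 0" "cone M N \<phi> C i j \<rho> \<pi> ==> j \<in> hm M C (- 1)"
    "cone M N \<phi> C i j \<rho> \<pi> ==> \<rho> \<in> hm C N 0" "cone M N \<phi> C i j \<rho> \<pi> ==> \<pi> \<in> hm C M 1"
  by (auto simp: cone_def)

lemma cone_simps0:
  assumes "cone M N \<phi> C i j \<rho> \<pi>"
  shows "n \<in> elt N p ==> \<rho> p (i p n) = n" "n \<in> elt N p ==> \<pi> p (i p n) = \<zero>[M (p + 1)]"
   "m \<in> elt M q ==> q = p + 1 ==> \<rho> p (j q m) = \<zero>[N p]"
   "m \<in> elt M q ==> q = p + 1 ==> \<pi> p (j q m) = m"
   "c \<in> elt C p ==> i p (\<rho> p c) \<oplus>[C p] j (p + 1) (\<pi> p c) = c"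
   "c \<in> elt C p ==> q = p + 1 ==> \<rho> q (diff C p c) = diff N p (\<rho> p c) \<oplus>[N (p + 1)] \<phi> (p + 1) (\<pi> p c)"
   "c \<in> elt C p ==> q = p + 1 ==> \<pi> q (diff C p c) = \<ominus>[M (p + 2)] diff M (p + 1) (\<pi> p c)"
  using assms by (auto simp: cone_def)

lemma cone_eqI:
  assumes "cone M N \<phi> C i j \<rho> \<pi>" "c \<in> elt C p" "c' \<in> elt C p"
    "\<rho> p c = \<rho> p c'" "\<pi> p c = \<pi> p c'"
  shows "c = c'"
  using cone_simps0(5)[OF assms(1)] assms(2-) by metis

lemma cone_simps:
  assumes "cone M N \<phi> C i j \<rho> \<pi>" "ob M" "ob N" "\<phi> \<in> cl M N"
  shows "!!p n q. n \<in> elt N p ==> q = p ==> i p n \<in> elt C q"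
   "!!p m q. m \<in> elt M p ==> q = p - 1 ==> j p m \<in> elt C q"
   "!!p c q. c \<in> elt C p ==> q = p ==> \<rho> p c \<in> elt N q"
   "!!p c q. c \<in> elt C p ==> q = p + 1 ==> \<pi> p c \<in> elt M q"
   "!!p n. n \<in> elt N p ==> \<rho> p (i p n) = n" "!!p n. n \<in> elt N p ==> \<pi> p (i p n) = \<zero>[M (p + 1)]"
   "!!p m q. m \<in> elt M q ==> q = p + 1 ==> \<rho> p (j q m) = \<zero>[N p]"
   "!!p m q. m \<in> elt M q ==> q = p + 1 ==> \<pi> p (j q m) = m"
   "!!p c q. c \<in> elt C p ==> q = p + 1 ==> \<rho> q (diff C p c) = diff N p (\<rho> p c) \<oplus>[N (p + 1)] \<phi> (p + 1) (\<pi> p c)"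
   "!!p c q. c \<in> elt C p ==> q = p + 1 ==> \<pi> q (diff C p c) = \<ominus>[M (p + 2)] diff M (p + 1) (\<pi> p c)"
   "!!p n q. n \<in> elt N p ==> q = p ==> diff C q (i p n) = i (p + 1) (diff N p n)"
   "!!p m q. m \<in> elt M p ==> q = p - 1 ==> diff C q (j p m) = i p (\<phi> p m) \<ominus>[C p] j (p + 1) (diff M p m)"
proof -
  note C = cone_ob[OF assms(1)]
  note [simp] = hm_simps[OF cone_hm(1)[OF assms(1)] assms(3) C, simplified]
    hm_simps[OF cone_hm(2)[OF assms(1)] assms(2) C, simplified] hm_simps[OF cone_hm(3)[OF assms(1)] C assms(3), simplified]
    hm_simps[OF cone_hm(4)[OF assms(1)] C assms(2), simplified] cone_simps0[OF assms(1)]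
    d_simps[OF assms(2)] d_simps[OF assms(3)] d_simps[OF C] cl_simps[OF assms(4,2,3)] C
  show "!!p n q. n \<in> elt N p ==> q = p ==> i p n \<in> elt C q"
   "!!p m q. m \<in> elt M p ==> q = p - 1 ==> j p m \<in> elt C q"
   "!!p c q. c \<in> elt C p ==> q = p ==> \<rho> p c \<in> elt N q"
   "!!p c q. c \<in> elt C p ==> q = p + 1 ==> \<pi> p c \<in> elt M q"
   "!!p n. n \<in> elt N p ==> \<rho> p (i p n) = n" "!!p n. n \<in> elt N p ==> \<pi> p (i p n) = \<zero>[M (p + 1)]"
   "!!p m q. m \<in> elt M q ==> q = p + 1 ==> \<rho> p (j q m) = \<zero>[N p]"
   "!!p m q. m \<in> elt M q ==> q = p + 1 ==> \<pi> p (j q m) = m"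
   "!!p c q. c \<in> elt C p ==> q = p + 1 ==> \<rho> q (diff C p c) = diff N p (\<rho> p c) \<oplus>[N (p + 1)] \<phi> (p + 1) (\<pi> p c)"
   "!!p c q. c \<in> elt C p ==> q = p + 1 ==> \<pi> q (diff C p c) = \<ominus>[M (p + 2)] diff M (p + 1) (\<pi> p c)"
    by auto
  show "diff C q (i p n) = i (p + 1) (diff N p n)" if "n \<in> elt N p" "q = p" for p n q
    unfolding \<open>q = p\<close> by (rule cone_eqI[OF assms(1), of _ "p + 1"]) (use that in \<open>auto simp: ag_simps assms deg_simps\<close>)
  show "diff C q (j p m) = i p (\<phi> p m) \<ominus>[C p] j (p + 1) (diff M p m)" if "m \<in> elt M p" "q = p - 1" for p m q
    unfolding \<open>q = p - 1\<close> by (rule cone_eqI[OF assms(1), of _ "p"]) (use that in \<open>auto simp: ag_simps assms deg_simps\<close>)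
qed

lemmas cone_simps' = cone_simps(1-10)

lemma cone_i_cl: "cone M N \<phi> C i j \<rho> \<pi> ==> ob M ==> ob N ==> \<phi> \<in> cl M N ==> i \<in> cl N C"
  by (rule clI[OF cone_hm(1)]) (auto simp: cone_simps(11))

lemma cone_pi_cl:
  assumes "cone M N \<phi> C i j \<rho> \<pi>" "ob M" "ob N" "\<phi> \<in> cl M N"
  shows "\<pi> \<in> cl C (Sh 1 M)"
proof (rule clI)
  show "\<pi> \<in> hm C (Sh 1 M) 0" by (rule shift_hm_cod[OF cone_hm(4)[OF assms(1)]]) simp
qed (use cone_simps'[OF assms] in \<open>simp add: sign_pow_def deg_simps\<close>)

lemma cone_mapping_cone:
  assumes "cone M N \<phi> C i j \<rho> \<pi>" "ob M" "ob N" "\<phi> \<in> cl M N"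
  shows "mapping_cone K A M N \<phi> C i j \<pi>"
proof -
  note C = cone_ob[OF assms(1)]
  note [simp] = hm_simps[OF cone_hm(1)[OF assms(1)] assms(3) C, simplified]
    hm_simps[OF cone_hm(2)[OF assms(1)] assms(2) C, simplified] hm_simps[OF cone_hm(3)[OF assms(1)] C assms(3), simplified]
    hm_simps[OF cone_hm(4)[OF assms(1)] C assms(2), simplified] cone_simps[OF assms]
    d_simps[OF assms(2)] d_simps[OF assms(3)] d_simps[OF C] cl_simps[OF assms(4,2,3)] C
  show ?thesis
    unfolding mapping_cone_def
  proof (intro conjI allI ballI)
    fix p
    show "bij_betw (\<lambda>(n, m). i p n \<oplus>[C p] j (p + 1) m) (elt N p \<times> elt M (p + 1))
          (elt C p)"
      by (rule bij_betw_byWitness[where f' = "\<lambda>c. (\<rho> p c, \<pi> p c)"])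
        (use cone_simps0(5)[OF assms(1)] in \<open>auto simp: ag_simps assms\<close>)
    fix n m assume nm: "n \<in> elt N p" "m \<in> elt M (p + 1)"
    show "diff C p (i p n \<oplus>[C p] j (p + 1) m) =
       i (p + 1) (diff N p n \<oplus>[N (p + 1)] \<phi> (p + 1) m) \<oplus>[C (p + 1)]
       j (p + 2) (\<ominus>[M (p + 2)] diff M (p + 1) m)"
      using nm by (simp add: ag_simps assms deg_simps)
    show "\<pi> p (i p n \<oplus>[C p] j (p + 1) m) = m"
      using nm by (simp add: ag_simps assms deg_simps)
  qed (use assms cone_hm[OF assms(1)] in auto)
qed

text \<open>The missing projection to N is the first coordinate of the inverse of the bijection in
  \<open>mapping_cone\<close>. Compatibility of both projections with the operations is inherited
  from i and j.\<close>

lemma mapping_cone_cone: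
  assumes "mapping_cone K A M N \<phi> C i j \<pi>" "ob M" "ob N" "\<phi> \<in> cl M N"
  shows "\<exists>\<rho>. cone M N \<phi> C i j \<rho> \<pi>"
proof -
  have C: "ob C" and ij: "i \<in> hm N C 0" "j \<in> hm M C (- 1)" using assms(1) by (auto simp: mapping_cone_def)
  note [simp] = hm_simps[OF ij(1) assms(3) C, simplified] hm_simps[OF ij(2) assms(2) C, simplified]
    d_simps[OF assms(2)] d_simps[OF assms(3)] d_simps[OF C] cl_simps[OF assms(4,2,3)] C
    act_simps(1)[OF assms(2)] act_simps(1)[OF assms(3)] act_simps(1)[OF C]
    module_smult_simps(1)[OF ob_module[OF assms(2)]] module_smult_simps(1)[OF ob_module[OF assms(3)]]
    module_smult_simps(1)[OF ob_module[OF C]]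
  let ?s = "\<lambda>p n m. i p n \<oplus>[C p] j (p + 1) m"
  have bij: "bij_betw (\<lambda>(n, m). ?s p n m) (elt N p \<times> elt M (p + 1)) (elt C p)" for p
    using assms(1) by (auto simp: mapping_cone_def)
  define \<rho> where "\<rho> p c = fst (inv_into (elt N p \<times> elt M (p + 1)) (\<lambda>(n, m). ?s p n m) c)" for p c
  have \<rho>: "\<rho> p (?s p n m) = n" if "n \<in> elt N p" "m \<in> elt M (p + 1)" for p n m
    using bij_betw_inv_into_left[OF bij, of "(n, m)" p] that by (simp add: \<rho>_def)
  have \<pi>: "\<pi> p (?s p n m) = m" if "n \<in> elt N p" "m \<in> elt M (p + 1)" for p n m
    using assms(1) that by (auto simp: mapping_cone_def)
  have d: "diff C p (?s p n m) = ?s (p + 1) (diff N p n \<oplus>[N (p + 1)] \<phi> (p + 1) m)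
       (\<ominus>[M (p + 1 + 1)] diff M (p + 1) m)" if "n \<in> elt N p" "m \<in> elt M (p + 1)" for p n m
    using assms(1) that by (auto simp: mapping_cone_def deg_simps)
  have el: "thesis" if "c \<in> elt C p"
     "!!n m. n \<in> elt N p ==> m \<in> elt M (p + 1) ==> c = ?s p n m ==> thesis" for c p thesis
  proof -
    have "c \<in> (\<lambda>(n, m). ?s p n m) ` (elt N p \<times> elt M (p + 1))"
      using that(1) bij_betw_imp_surj_on[OF bij, of p] by simp
    thus thesis using that(2) by auto
  qed
  have sadd: "?s p n m \<oplus>[C p] ?s p n' m' = ?s p (n \<oplus>[N p] n') (m \<oplus>[M (p + 1)] m')"
    and ssmult: "c \<in> carrier K ==> c \<odot>[C p] ?s p n m = ?s p (c \<odot>[N p] n) (c \<odot>[M (p + 1)] m)"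
    if "n \<in> elt N p" "m \<in> elt M (p + 1)" "n' \<in> elt N p" "m' \<in> elt M (p + 1)" for p n m n' m' c
    using that by (simp_all add: ag_simps assms module_smult_simps(2)[OF ob_module[OF C]])
  have sact: "ract C p q (?s p n m) a = ?s (p + q) (ract N p q n a) (ract M (p + 1) q m a)"
    if "n \<in> elt N p" "m \<in> elt M (p + 1)" "a \<in> elt A q" for p q n m a
  proof -
    have [simp]: "p + q + 1 = p + 1 + q" by linarith
    show ?thesis using that hm_simps(6)[OF ij(2) assms(2) C that(2,3)] by (simp add: act_simps(2)[OF C])
  qed
  have actc: "ract M (p + 1) q m a \<in> elt M (p + q + 1)" if "m \<in> elt M (p + 1)" "a \<in> elt A q" for p q m a
    using act_simps(1)[OF assms(2) that, of "p + q + 1"] by simp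
  note clo = ag_facts(1) ob_ag module_smult_simps(1)[OF ob_module] act_simps(1) actc assms(2,3) C
    sadd ssmult sact \<rho> \<pi> klinear_closed[OF hm_klinear[OF ij(1)], simplified]
    klinear_closed[OF hm_klinear[OF ij(2), of "p + 1" for p], simplified] add_0_right
  have r: "\<rho> \<in> hm C N 0"
    by (rule hmI; elim el; simp only: clo)
  have p: "\<pi> \<in> hm C M 1"
  proof (rule hmI)
    fix x a p q assume "x \<in> elt C p" "a \<in> elt A q"
    thus "\<pi> (p + q) (ract C p q x a) = ract M (p + 1) q (\<pi> p x) a"
      by (elim el) (simp only: clo)
  qed (elim el; simp only: clo)+
  have 1: "\<rho> p (i p n) = n" "\<pi> p (i p n) = \<zero>[M (p + 1)]" if "n \<in> elt N p" for p n
    using \<rho>[OF that, of "\<zero>[M (p + 1)]"] \<pi>[OF that, of "\<zero>[M (p + 1)]"] that by (simp_all add: ag_simps assms)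
  have 2: "\<rho> p (j (p + 1) m) = \<zero>[N p]" "\<pi> p (j (p + 1) m) = m" if "m \<in> elt M (p + 1)" for p m
    using \<rho>[OF _ that, of "\<zero>[N p]"] \<pi>[OF _ that, of "\<zero>[N p]"] that by (simp_all add: ag_simps assms)
  have 3: "i p (\<rho> p c) \<oplus>[C p] j (p + 1) (\<pi> p c) = c"
       "\<rho> (p + 1) (diff C p c) = diff N p (\<rho> p c) \<oplus>[N (p + 1)] \<phi> (p + 1) (\<pi> p c)"
       "\<pi> (p + 1) (diff C p c) = \<ominus>[M (p + 2)] diff M (p + 1) (\<pi> p c)" if "c \<in> elt C p" for c p
  proof (atomize(full), rule el[OF that])
    fix n m assume nm: "n \<in> elt N p" "m \<in> elt M (p + 1)" and c: "c = ?s p n m"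
    have k: "diff N p n \<oplus>[N (p + 1)] \<phi> (p + 1) m \<in> elt N (p + 1)"
      "\<ominus>[M (p + 1 + 1)] diff M (p + 1) m \<in> elt M (p + 1 + 1)"
      using nm by (simp_all add: ag_simps assms deg_simps)
    show "i p (\<rho> p c) \<oplus>[C p] j (p + 1) (\<pi> p c) = c \<and>
       \<rho> (p + 1) (diff C p c) = diff N p (\<rho> p c) \<oplus>[N (p + 1)] \<phi> (p + 1) (\<pi> p c) \<and>
       \<pi> (p + 1) (diff C p c) = \<ominus>[M (p + 2)] diff M (p + 1) (\<pi> p c)"
      unfolding c d[OF nm] \<rho>[OF nm] \<pi>[OF nm] \<rho>[OF k] \<pi>[OF k] by (simp add: deg_simps)
  qed
  show ?thesis
    by (rule exI[of _ \<rho>]) (use C ij r p 1 2 3 in \<open>auto simp: cone_def\<close>)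
qed

abbreviation zm where "zm Y \<equiv> (\<lambda>p x. \<zero>[Y p])"

lemma cone_ops:
  assumes "cone M N \<phi> C i j \<rho> \<pi>" "ob M" "ob N" "\<phi> \<in> cl M N"
  shows "!!x y p. x \<in> elt N p ==> y \<in> elt N p ==> i p (x \<oplus>[N p] y) = i p x \<oplus>[C p] i p y"
   "!!x p. x \<in> elt N p ==> i p (\<ominus>[N p] x) = \<ominus>[C p] i p x" "!!p. i p \<zero>[N p] = \<zero>[C p]"
   "!!x y p. x \<in> elt M p ==> y \<in> elt M p ==> j p (x \<oplus>[M p] y) = j p x \<oplus>[C (p - 1)] j p y"
   "!!x p. x \<in> elt M p ==> j p (\<ominus>[M p] x) = \<ominus>[C (p - 1)] j p x" "!!p. j p \<zero>[M p] = \<zero>[C (p - 1)]"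
   "!!x y p. x \<in> elt C p ==> y \<in> elt C p ==> \<rho> p (x \<oplus>[C p] y) = \<rho> p x \<oplus>[N p] \<rho> p y"
   "!!x p. x \<in> elt C p ==> \<rho> p (\<ominus>[C p] x) = \<ominus>[N p] \<rho> p x" "!!p. \<rho> p \<zero>[C p] = \<zero>[N p]"
   "!!x y p. x \<in> elt C p ==> y \<in> elt C p ==> \<pi> p (x \<oplus>[C p] y) = \<pi> p x \<oplus>[M (p + 1)] \<pi> p y"
   "!!x p. x \<in> elt C p ==> \<pi> p (\<ominus>[C p] x) = \<ominus>[M (p + 1)] \<pi> p x" "!!p. \<pi> p \<zero>[C p] = \<zero>[M (p + 1)]"
  using hm_simps[OF cone_hm(1)[OF assms(1)] assms(3) cone_ob[OF assms(1)], simplified]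
    hm_simps[OF cone_hm(2)[OF assms(1)] assms(2) cone_ob[OF assms(1)], simplified]
    hm_simps[OF cone_hm(3)[OF assms(1)] cone_ob[OF assms(1)] assms(3), simplified]
    hm_simps[OF cone_hm(4)[OF assms(1)] cone_ob[OF assms(1)] assms(2), simplified]
  by auto

lemmas cone_rules = cone_ops cone_simps

text \<open>This is the long exact homology sequence, on elements. A cocycle x of C satisfies phi
  (pi x) = - d (rho x), and all preimages can be written down in coordinates.\<close>

lemma cone_exact:
  assumes c: "cone M N \<phi> C i j \<rho> \<pi>" and ob: "ob M" "ob N" and f: "\<phi> \<in> cl M N"
  shows "u \<in> hel C p ==> hmap (Sh 1 M) p \<pi> u = \<zero>\<^bsub>homology M (p + 1)\<^esub> ==>
      \<exists>n\<in>hel N p. u = hmap C p i n"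
    and "n \<in> hel N p ==> hmap C p i n = \<zero>\<^bsub>homology C p\<^esub> ==>
      \<exists>m\<in>hel M p. n = hmap N p \<phi> m"
    and "m \<in> hel M (p + 1) ==> hmap N (p + 1) \<phi> m = \<zero>\<^bsub>homology N (p + 1)\<^esub> ==>
      \<exists>u\<in>hel C p. m = hmap (Sh 1 M) p \<pi> u"
    and "m \<in> hel M p ==> hmap C p i (hmap N p \<phi> m) = \<zero>\<^bsub>homology C p\<^esub>"
    and "u \<in> hel C p ==> hmap N (p + 1) \<phi> (hmap (Sh 1 M) p \<pi> u) = \<zero>\<^bsub>homology N (p + 1)\<^esub>"
proof -
  note C = cone_ob[OF c] and icl = cone_i_cl[OF c ob f] and pcl = cone_pi_cl[OF c ob f] and S = shift_ob[OF ob(1), of 1]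
  note [simp] = cone_rules[OF c ob f] d_simps[OF ob(1)] d_simps[OF ob(2)] d_simps[OF C] d_m1[OF ob(1)] d_m1[OF ob(2)] d_m1[OF C]
    cl_simps[OF f ob] C deg_simps
    homology_map_hc[OF icl ob(2) C] homology_map_hc[OF f ob] homology_map_hc[OF pcl C S, unfolded hc_shift[OF ob(1)]]
  note cy = cl_cy[OF icl ob(2) C] cl_cy[OF f ob] cl_cy[OF pcl C S, unfolded cy_shift[OF ob(1)]]
  have p: "\<rho> p x \<in> elt N p" "\<pi> p x \<in> elt M (p + 1)" "diff M (p + 1) (\<pi> p x) = \<zero>[M (p + 2)]"
    "\<phi> (p + 1) (\<pi> p x) = diff N p (\<ominus>[N p] \<rho> p x)" if x: "x \<in> cy C p" for x p
  proof -
    have x': "x \<in> elt C p" "diff C p x = \<zero>[C (p + 1)]" using x by (auto simp: cyD)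
    thus "\<rho> p x \<in> elt N p" "\<pi> p x \<in> elt M (p + 1)" by simp_all
    show "diff M (p + 1) (\<pi> p x) = \<zero>[M (p + 2)]" using cyD(2)[OF cy(3)[OF x]] by simp
    have "diff N p (\<rho> p x) \<oplus>[N (p + 1)] \<phi> (p + 1) (\<pi> p x) = \<zero>[N (p + 1)]"
      using arg_cong[OF x'(2), of "\<rho> (p + 1)"] x'(1) by simp
    thus "\<phi> (p + 1) (\<pi> p x) = diff N p (\<ominus>[N p] \<rho> p x)"
      using x' abelian_group.minus_equality[of "gr N (p + 1)" "\<phi> (p + 1) (\<pi> p x)" "diff N p (\<rho> p x)"]
        abelian_group.minus_minus[of "gr N (p + 1)"] by (simp add: ag_simps ob)
  qed
  show "\<exists>n\<in>hel N p. u = hmap C p i n"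
    if H: "u \<in> hel C p" "hmap (Sh 1 M) p \<pi> u = \<zero>\<^bsub>homology M (p + 1)\<^esub>"
  proof -
    obtain x where x: "x \<in> cy C p" "u = hc C p x" using H(1) by (auto simp: hc_carrier)
    have x': "x \<in> elt C p" using x(1) by (rule cyD)
    have "\<pi> p x \<in> bd M (p + 1)" using H(2) x cy(3) hc_zero_iff[OF ob(1)] by simp
    then obtain m where m: "m \<in> elt M p" "\<pi> p x = diff M p m" by (rule bdE') auto
    \<comment> \<open>The coordinate d m of x in Sigma M is removed by the boundary of j (-m), at
      the price of phi m in the coordinate of N.\<close>
    let ?n = "\<rho> p x \<oplus>[N p] \<phi> p m"
    have n: "?n \<in> cy N p"
      using p[OF x(1)] m x' cl_d[OF f m(1), of "p + 1"] by (intro cyI) (auto simp: ag_simps ob)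
    have "x \<ominus>[C p] i p ?n = diff C (p - 1) (j p (\<ominus>[M p] m))"
      by (rule cone_eqI[OF c, of _ p]) (use x' m in \<open>auto simp: ag_simps ob\<close>)
    hence "x \<ominus>[C p] i p ?n \<in> bd C p" using m by (intro bdI[of "j p (\<ominus>[M p] m)" _ "p - 1"]) (auto simp: ag_simps ob)
    thus ?thesis using x n hc_eq_iff[OF C x(1) cy(1)[OF n]] by (intro bexI[of _ "hc N p ?n"]) (auto simp: hc_carrier)
  qed
  show "\<exists>m\<in>hel M p. n = hmap N p \<phi> m"
    if H: "n \<in> hel N p" "hmap C p i n = \<zero>\<^bsub>homology C p\<^esub>"
  proof -
    obtain x where x: "x \<in> cy N p" "n = hc N p x" using H(1) by (auto simp: hc_carrier)
    have x': "x \<in> elt N p" using x(1) by (rule cyD)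
    have "i p x \<in> bd C p" using H(2) x cy(1) hc_zero_iff[OF C] by simp
    then obtain s where s: "s \<in> elt C (p - 1)" "i p x = diff C (p - 1) s" by (rule bdE)
    have e: "\<ominus>[M (p + 1)] diff M p (\<pi> (p - 1) s) = \<zero>[M (p + 1)]" using arg_cong[OF s(2), of "\<pi> p"] s(1) x' by simp
    have m: "\<pi> (p - 1) s \<in> cy M p"
      using s(1) arg_cong[OF e, of "\<lambda>x. \<ominus>[M (p + 1)] x"] by (intro cyI) (auto simp: ag_simps ob)
    have "x = diff N (p - 1) (\<rho> (p - 1) s) \<oplus>[N p] \<phi> p (\<pi> (p - 1) s)" using arg_cong[OF s(2), of "\<rho> p"] s(1) x' by simp
    hence "x \<ominus>[N p] \<phi> p (\<pi> (p - 1) s) = diff N (p - 1) (\<rho> (p - 1) s)" using s(1) by (simp add: ag_simps ob)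
    hence "x \<ominus>[N p] \<phi> p (\<pi> (p - 1) s) \<in> bd N p" using s(1) by (intro bdI[of "\<rho> (p - 1) s" _ "p - 1"]) auto
    thus ?thesis using x m hc_eq_iff[OF ob(2) x(1) cy(2)[OF m]] by (intro bexI[of _ "hc M p (\<pi> (p - 1) s)"]) (auto simp: hc_carrier)
  qed
  show "\<exists>u\<in>hel C p. m = hmap (Sh 1 M) p \<pi> u"
    if H: "m \<in> hel M (p + 1)" "hmap N (p + 1) \<phi> m = \<zero>\<^bsub>homology N (p + 1)\<^esub>"
  proof -
    obtain x where x: "x \<in> cy M (p + 1)" "m = hc M (p + 1) x" using H(1) by (auto simp: hc_carrier)
    have x': "x \<in> elt M (p + 1)" "diff M (p + 1) x = \<zero>[M (p + 2)]" using x(1) by (auto simp: cyD)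
    have "\<phi> (p + 1) x \<in> bd N (p + 1)" using H(2) x cy(2) hc_zero_iff[OF ob(2)] by simp
    then obtain n where n: "n \<in> elt N p" "\<phi> (p + 1) x = diff N p n" by (rule bdE') auto
    \<comment> \<open>The boundary of j x is i (phi x) = i (d n), so subtracting i n gives a cocycle
      over x.\<close>
    let ?y = "j (p + 1) x \<ominus>[C p] i p n"
    have "diff C p ?y = \<zero>[C (p + 1)]"
      by (rule cone_eqI[OF c, of _ "p + 1"]) (use x' n in \<open>auto simp: ag_simps ob\<close>)
    hence "?y \<in> cy C p" using x' n by (intro cyI) (auto simp: ag_simps ob)
    moreover have "\<pi> p ?y = x" using x' n by (simp add: ag_simps ob)
    ultimately show ?thesis using x by (intro bexI[of _ "hc C p ?y"]) (auto simp: hc_carrier)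
  qed
  show "hmap C p i (hmap N p \<phi> m) = \<zero>\<^bsub>homology C p\<^esub>" if H: "m \<in> hel M p"
  proof -
    obtain x where x: "x \<in> cy M p" "m = hc M p x" using H by (auto simp: hc_carrier)
    hence x': "x \<in> elt M p" "diff M p x = \<zero>[M (p + 1)]" by (auto simp: cyD)
    have "i p (\<phi> p x) = diff C (p - 1) (j p x)" using x' by (simp add: ag_simps ob)
    hence "i p (\<phi> p x) \<in> bd C p" using x' by (intro bdI[of "j p x" _ "p - 1"]) auto
    thus ?thesis using x hc_zero_iff[OF C cy(1)[OF cy(2)]] cy(2)[OF x(1)] by simp
  qed
  show "hmap N (p + 1) \<phi> (hmap (Sh 1 M) p \<pi> u) = \<zero>\<^bsub>homology N (p + 1)\<^esub>" if H: "u \<in> hel C p"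
  proof -
    obtain x where x: "x \<in> cy C p" "u = hc C p x" using H by (auto simp: hc_carrier)
    have "\<phi> (p + 1) (\<pi> p x) \<in> bd N (p + 1)" by (rule bdI[OF _ p(4)[OF x(1)]]) (use p(1)[OF x(1)] in \<open>auto simp: ag_simps ob\<close>)
    thus ?thesis using x hc_zero_iff[OF ob(2) cy(2)[OF cy(3)]] cy(3)[OF x(1)] by simp
  qed
qed

lemma homology_map_add:
  assumes "f \<in> cl X Y" "ob X" "ob Y"
  shows "u \<in> hel X p ==> v \<in> hel X p ==>
      hmap Y p f (u \<oplus>\<^bsub>homology X p\<^esub> v) = hmap Y p f u \<oplus>\<^bsub>homology Y p\<^esub> hmap Y p f v"
    "u \<in> hel X p ==> hmap Y p f (\<ominus>\<^bsub>homology X p\<^esub> u) = \<ominus>\<^bsub>homology Y p\<^esub> hmap Y p f u"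
    "hmap Y p f \<zero>\<^bsub>homology X p\<^esub> = \<zero>\<^bsub>homology Y p\<^esub>"
  using homology_map_klinear[OF assms, of p] homology_ag[OF assms(2), of p] homology_ag[OF assms(3), of p]
  by (simp_all add: klinear_add klinear_zero klinear_neg)

lemma qi_homologyI:
  assumes f: "f \<in> cl X Y" and ob: "ob X" "ob Y"
    and i: "!!u p. u \<in> hel X p ==> hmap Y p f u = \<zero>\<^bsub>homology Y p\<^esub> ==> u = \<zero>\<^bsub>homology X p\<^esub>"
    and s: "!!v p. v \<in> hel Y p ==> \<exists>u\<in>hel X p. v = hmap Y p f u"
  shows "f \<in> qi X Y"
proof (rule qiI[OF f ob])
  note cy = cl_cy[OF f ob]
  fix x p assume x: "x \<in> cy X p"
  show "x \<in> bd X p" if "f p x \<in> bd Y p"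
    using i[of "hc X p x" p] that x cy[OF x] hc_zero_iff[OF ob(1) x] hc_zero_iff[OF ob(2) cy[OF x]] by (simp add: hc_carrier homology_map_hc[OF f ob])
next
  note cy = cl_cy[OF f ob]
  fix y p assume y: "y \<in> cy Y p"
  then obtain x where "x \<in> cy X p" "hc Y p y = hc Y p (f p x)" using s[of "hc Y p y" p] by (auto simp: hc_carrier homology_map_hc[OF f ob])
  thus "\<exists>x\<in>cy X p. y \<ominus>[Y p] f p x \<in> bd Y p" using hc_eq_iff[OF ob(2) y cy] by blast
qed

section \<open>Acyclic modules, null-homotopies and factorizations\<close>

definition acyclic :: "('k, 'u) dg_mod \<Rightarrow> bool" where
  "acyclic E \<longleftrightarrow> (\<forall>p. hel E p = {\<zero>\<^bsub>homology E p\<^esub>})"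

lemma acyclic_shift: "acyclic E ==> ob E ==> acyclic (Sh n E)"
  by (simp add: acyclic_def homology_shift)

text \<open>In the long exact sequence, injectivity of t on homology makes pi vanish there and
  surjectivity makes i vanish there.\<close>

lemma cone_acyclic:
  assumes c: "cone M N t C i j \<rho> \<pi>" and ob: "ob M" "ob N" and q: "t \<in> qi M N"
  shows "acyclic C"
  unfolding acyclic_def
proof (intro allI equalityI subsetI)
  fix p u assume u: "u \<in> hel C p"
  note ex = cone_exact[OF c ob qi_cl[OF q]] and C = cone_ob[OF c] and S = shift_ob[OF ob(1), of 1]
  have "hmap (Sh 1 M) p \<pi> u = \<zero>\<^bsub>homology M (p + 1)\<^esub>"
    by (rule inj_onD[OF bij_betw_imp_inj_on[OF qi_bij[OF q]] _ _ ag_facts(2)[OF homology_ag[OF ob(1)]]])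
      (use ex(5)[OF u] homology_map_add(3)[OF qi_cl[OF q] ob] homology_map_closed[OF cone_pi_cl[OF c ob qi_cl[OF q]] C S u]
        in \<open>simp_all add: homology_shift ob\<close>)
  then obtain n where n: "n \<in> hel N p" "u = hmap C p i n" using ex(1)[OF u] by blast
  then obtain m where "m \<in> hel M p" "n = hmap N p t m" using bij_betw_imp_surj_on[OF qi_bij[OF q, of p]] by blast
  thus "u \<in> {\<zero>\<^bsub>homology C p\<^esub>}" using ex(4) n by simp
qed (use homology_ag[OF cone_ob[OF c]] in \<open>simp add: ag_facts\<close>)

lemma acyclic_cone_qi:
  assumes c: "cone M N \<phi> C i j \<rho> \<pi>" and ob: "ob M" "ob N" "\<phi> \<in> cl M N" and ac: "acyclic N"
  shows "\<pi> \<in> qi C (Sh 1 M)"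
proof (rule qi_homologyI[OF cone_pi_cl[OF c ob] cone_ob[OF c] shift_ob[OF ob(1)]])
  have z: "n = \<zero>\<^bsub>homology N p\<^esub>" if "n \<in> hel N p" for n p using ac that by (simp add: acyclic_def)
  fix u p
  show "u = \<zero>\<^bsub>homology C p\<^esub>" if "u \<in> hel C p" "hmap (Sh 1 M) p \<pi> u = \<zero>\<^bsub>homology (Sh 1 M) p\<^esub>"
    using cone_exact(1)[OF c ob that[unfolded homology_shift[OF ob(1)]]] z homology_map_add(3)[OF cone_i_cl[OF c ob] ob(2) cone_ob[OF c]] by blast
  show "\<exists>v\<in>hel C p. u = hmap (Sh 1 M) p \<pi> v" if "u \<in> hel (Sh 1 M) p"
    using cone_exact(3)[OF c ob] z homology_map_closed[OF ob(3,1,2)] that homology_shift[OF ob(1)] by simp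
qed

text \<open>R is Sigma^(-1) of the cone of \<psi>, and u its projection to P, a quasi-isomorphism
  because E is acyclic. The composite with \<psi> is null-homotopic through the other
  projection.\<close>

lemma null_cover:
  assumes "ob P" "ob E" "\<psi> \<in> cl P E" "acyclic E"
  shows "\<exists>R u. ob R \<and> u \<in> qi R P \<and> hty R E (gcomp \<psi> u) (zm E)"
proof -
  obtain C i j \<rho> \<pi> where c: "cone P E \<psi> C i j \<rho> \<pi>" using ex_cone[OF assms(1-3)] by blast
  note C = cone_ob[OF c] and hm = cone_hm[OF c]
  let ?R = "Sh (- 1) C" and ?u = "\<lambda>p. \<pi> (p - 1)"
  have R: "ob ?R" by (rule shift_ob[OF C])
  note [simp] = hm_simps[OF hm(1) assms(2) C, simplified]
    hm_simps[OF hm(2) assms(1) C, simplified] hm_simps[OF hm(3) C assms(2), simplified]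
    hm_simps[OF hm(4) C assms(1), simplified] cone_simps[OF c assms(1-3)]
    d_simps[OF assms(1)] d_simps[OF assms(2)] d_simps[OF C] d_m1[OF assms(1)] d_m1[OF assms(2)] d_m1[OF C]
    cl_simps[OF assms(3,1,2)] C sign_pow_def deg_simps
  have uh: "?u \<in> hm ?R P 0" using shift_hm_dom[OF hm(4), of 0 "- 1"] by simp
  have u: "?u \<in> cl ?R P"
    by (rule clI[OF uh]) (auto simp: ag_simps assms)
  have pq: "\<pi> \<in> qi C (Sh 1 P)" by (rule acyclic_cone_qi[OF c assms])
  have q: "?u \<in> qi ?R P"
    unfolding qi_bij_iff
  proof (intro conjI u allI)
    fix p
    have "hmap (Sh 1 P) (p - 1) \<pi> = hmap P p ?u"
      by (simp add: fun_eq_iff homology_map_def bd_shift assms)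
    thus "bij_betw (hmap P p ?u) (hel ?R p) (hel P p)"
      using qi_bij[OF pq, of "p - 1"] by (simp add: homology_shift assms)
  qed
  have h: "(\<lambda>p. \<rho> (p - 1)) \<in> hm ?R E (- 1)" using shift_hm_dom[OF hm(3), of "- 1" "- 1"] by simp
  have "hty ?R E (gcomp \<psi> ?u) (zm E)"
    \<comment> \<open>The homotopy is the projection to E with a minus sign.\<close>
    by (rule htyI[OF hm_neg[OF h R assms(2), of "\<lambda>p. p - 1"]])
     (use cl_comp[OF u assms(3)] cl_zero R assms in \<open>auto simp: gcomp_def ag_simps\<close>)
  thus ?thesis using R q by blast
qed

text \<open>A null-homotopy h of i g has two coordinates: pi h is the closed map v, and rho h is a
  homotopy from g to phi v.\<close>

lemma cone_factor:
  assumes c: "cone M N \<phi> C i j \<rho> \<pi>" and ob: "ob M" "ob N" "\<phi> \<in> cl M N" "ob P"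
    and g: "g \<in> cl P N" and h0: "hty P C (gcomp i g) (zm C)"
  shows "\<exists>v\<in>cl P M. hty P N g (gcomp \<phi> v)"
proof -
  note C = cone_ob[OF c] and hm = cone_hm[OF c]
  note icl = cone_i_cl[OF c ob(1-3)]
  note [simp] = cone_rules[OF c ob(1-3)] d_simps[OF ob(1)] d_simps[OF ob(2)] d_simps[OF C] d_simps[OF ob(4)] d_m1[OF ob(1)] d_m1[OF ob(2)] d_m1[OF C]
    cl_simps[OF ob(3,1,2)] cl_simps[OF g ob(4,2)] C deg_simps
  obtain h where h: "h \<in> hm P C (- 1)" and
    e: "!!p x. x \<in> elt P p ==>
      gcomp i g p x = \<zero>[C p] \<oplus>[C p] (diff C (p - 1) (h p x) \<oplus>[C p] h (p + 1) (diff P p x))"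
    by (rule htyE[OF h0 cl_comp[OF g icl] cl_zero]) (use ob C in auto)
  note [simp] = hm_simps[OF h ob(4) C]
  let ?v = "\<lambda>p x. \<pi> (p - 1) (h p x)"
  have vh: "?v \<in> hm P M 0" using hm_comp[OF h hm(4) ob(4) C ob(1)] by simp
  have v: "?v \<in> cl P M"
  proof (rule clI[OF vh])
    fix p x assume x: "x \<in> elt P p"
    show "\<pi> (p + 1 - 1) (h (p + 1) (diff P p x)) = diff M p (\<pi> (p - 1) (h p x))"
      using arg_cong[OF e[OF x], of "\<pi> p"] x abelian_group.minus_equality[of "gr M (p + 1)" "\<pi> p (h (p + 1) (diff P p x))"
         "\<ominus>[M (p + 1)] diff M p (\<pi> (p - 1) (h p x))"]
      by (simp add: gcomp_def ag_simps ob)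
  qed
  have rh: "(\<lambda>p x. \<rho> (p - 1) (h p x)) \<in> hm P N (- 1)" using hm_comp[OF h hm(3) ob(4) C ob(2)] by simp
  have "hty P N g (gcomp \<phi> ?v)"
  proof (rule htyI[OF rh g cl_comp[OF v ob(3)]])
    fix p x assume x: "x \<in> elt P p"
    show "g p x = gcomp \<phi> ?v p x \<oplus>[N p] (diff N (p - 1) (\<rho> (p - 1) (h p x)) \<oplus>[N p] \<rho> (p + 1 - 1) (h (p + 1) (diff P p x)))"
      using arg_cong[OF e[OF x], of "\<rho> p"] x by (simp add: gcomp_def ag_simps ob)
  qed (use ob in auto)
  thus ?thesis using v by blast
qed

text \<open>Because t f is null-homotopic, f factors through Sigma^(-1) of the cone of t. That
  module is acyclic, so \<open>null_cover\<close> applies to the factor. This becomes the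
  cancellation axiom for fractions.\<close>

lemma qi_factor_null:
  assumes q: "t \<in> qi Y Z" and ob: "ob Y" "ob Z" "ob P" and f: "f \<in> cl P Y" and h0: "hty P Z (gcomp t f) (zm Z)"
  shows "\<exists>R u. ob R \<and> u \<in> qi R P \<and> hty R Y (gcomp f u) (zm Y)"
proof -
  note tcl = qi_cl[OF q]
  obtain C i j \<rho> \<pi> where c: "cone Y Z t C i j \<rho> \<pi>" using ex_cone[OF ob(1,2) tcl] by blast
  note C = cone_ob[OF c] and hm = cone_hm[OF c]
  note [simp] = cone_rules[OF c ob(1,2) tcl] d_simps[OF ob(1)] d_simps[OF ob(2)] d_simps[OF ob(3)] d_simps[OF C] d_m1[OF ob(1)] d_m1[OF ob(2)] d_m1[OF C]
    cl_simps[OF tcl ob(1,2)] cl_simps[OF f ob(3,1)] C deg_simps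
  let ?E = "Sh (- 1) C"
  have E: "ob ?E" by (rule shift_ob[OF C])
  have ac: "acyclic ?E" by (rule acyclic_shift[OF cone_acyclic[OF c ob(1,2) q] C])
  obtain h where h: "h \<in> hm P Z (- 1)" and
    e: "!!p x. x \<in> elt P p ==>
      gcomp t f p x = \<zero>[Z p] \<oplus>[Z p] (diff Z (p - 1) (h p x) \<oplus>[Z p] h (p + 1) (diff P p x))"
    by (rule htyE[OF h0 cl_comp[OF f tcl] cl_zero]) (use ob in auto)
  note [simp] = hm_simps[OF h ob(3,2)]
  \<comment> \<open>The pair (-h, f) is closed precisely because h is a homotopy from t f to 0, and
    projecting to Y gives f back.\<close>
  let ?f = "\<lambda>p x. (\<ominus>[C (p - 1)] i (p - 1) (h p x)) \<oplus>[C (p - 1)] j p (f p x)"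
  have "?f \<in> hm P C (- 1)"
    by (rule hm_add[OF hm_neg[of "\<lambda>p x. i (p - 1) (h p x)" _ _ "-1" "\<lambda>p. p - 1"]])
      (use hm_comp[OF h hm(1) ob(3,2) C, of "- 1"] hm_comp[OF cl_hm[OF f] hm(2) ob(3,1) C, of "- 1"] ob C in auto)
  hence fh: "?f \<in> hm P ?E 0" by (rule shift_hm_cod) simp
  have fcl: "?f \<in> cl P ?E"
  proof (rule clI[OF fh])
    fix p x assume x: "x \<in> elt P p"
    show "\<ominus>[C (p + 1 - 1)] i (p + 1 - 1) (h (p + 1) (diff P p x)) \<oplus>[C (p + 1 - 1)] j (p + 1) (f (p + 1) (diff P p x)) =
       diff (Sh (- 1) C) p (?f p x)"
      by (rule cone_eqI[OF c, of _ p]) (use x e[OF x] in \<open>auto simp: ag_simps ob sign_pow_def gcomp_def\<close>)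
  qed
  obtain R u where R: "ob R" "u \<in> qi R P" "hty R ?E (gcomp ?f u) (zm ?E)"
    using null_cover[OF ob(3) E fcl ac] by blast
  note ucl = qi_cl[OF R(2)]
  have kh: "(\<lambda>p. \<pi> (p - 1)) \<in> hm ?E Y 0" using shift_hm_dom[OF hm(4), of 0 "- 1"] by simp
  have k: "(\<lambda>p. \<pi> (p - 1)) \<in> cl ?E Y"
    by (rule clI[OF kh]) (auto simp: ag_simps ob sign_pow_def)
  have "hty R Y (gcomp (\<lambda>p. \<pi> (p - 1)) (gcomp ?f u)) (gcomp (\<lambda>p. \<pi> (p - 1)) (zm ?E))"
    by (rule hty_comp_left[OF R(3) cl_comp[OF ucl fcl R(1) ob(3) E] cl_zero[OF R(1) E] k R(1) E ob(1)])
  moreover have "hty R Y (gcomp f u) (gcomp (\<lambda>p. \<pi> (p - 1)) (gcomp ?f u))"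
    by (rule hty_eq) (use cl_comp[OF cl_comp[OF ucl fcl] k] cl_comp[OF ucl f] R E ob in \<open>auto simp: gcomp_def ag_simps cl_simps(1)[OF ucl]\<close>)
  moreover have "hty R Y (gcomp (\<lambda>p. \<pi> (p - 1)) (zm ?E)) (zm Y)"
    by (rule hty_eq) (use cl_comp[OF cl_zero k] cl_zero R E ob in \<open>auto simp: gcomp_def\<close>)
  moreover have "gcomp f u \<in> cl R Y" "gcomp (\<lambda>p. \<pi> (p - 1)) (gcomp ?f u) \<in> cl R Y"
    "gcomp (\<lambda>p. \<pi> (p - 1)) (zm ?E) \<in> cl R Y" "zm Y \<in> cl R Y"
    using cl_comp[OF cl_comp[OF ucl fcl] k] cl_comp[OF ucl f] cl_comp[OF cl_zero k] cl_zero R E ob by auto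
  ultimately have "hty R Y (gcomp f u) (zm Y)"
    using hty_trans R(1) ob(1) by meson
  thus ?thesis using R by blast
qed

text \<open>The five lemma, applied to the long exact homology sequences of the two cones.\<close>
lemma cone_map_qi:
  assumes c: "cone M N \<phi> C i j \<rho> \<pi>" and c': "cone M' N' \<phi>' C' i' j' \<rho>' \<pi>'"
    and ob: "ob M" "ob N" "ob M'" "ob N'" and f: "\<phi> \<in> cl M N" and f': "\<phi>' \<in> cl M' N'"
    and qa: "a \<in> qi M M'" and qb: "b \<in> qi N N'" and sq: "hty M N' (gcomp b \<phi>) (gcomp \<phi>' a)" and g: "g \<in> cl C C'"
    and gi: "!!p x. x \<in> elt N p ==> g p (i p x) = i' p (b p x)"
    and gp: "!!p x. x \<in> elt C p ==> \<pi>' p (g p x) = a (p + 1) (\<pi> p x)"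
  shows "g \<in> qi C C'"
proof (rule qi_homologyI[OF g cone_ob[OF c] cone_ob[OF c']])
  note a = qi_cl[OF qa] and b = qi_cl[OF qb]
  note C = cone_ob[OF c] and C' = cone_ob[OF c'] and icl = cone_i_cl[OF c ob(1,2) f] and pcl = cone_pi_cl[OF c ob(1,2) f] and icl' = cone_i_cl[OF c' ob(3,4) f']
    and pcl' = cone_pi_cl[OF c' ob(3,4) f'] and ex = cone_exact[OF c ob(1,2) f] and ex' = cone_exact[OF c' ob(3,4) f']
    and S = shift_ob[OF ob(1), of 1] and S' = shift_ob[OF ob(3), of 1]
  let ?H = hmap
  note cl = homology_map_closed[OF icl ob(2) C] homology_map_closed[OF pcl C S, unfolded homology_shift[OF ob(1)]] homology_map_closed[OF g C C']
     homology_map_closed[OF a ob(1,3)] homology_map_closed[OF b ob(2,4)] homology_map_closed[OF f ob(1,2)] homology_map_closed[OF f' ob(3,4)]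
     homology_map_closed[OF icl' ob(4) C'] homology_map_closed[OF pcl' C' S', unfolded homology_shift[OF ob(3)]]
  note z = homology_map_add(3)[OF a ob(1,3)] homology_map_add(3)[OF b ob(2,4)] homology_map_add(3)[OF icl ob(2) C]
    homology_map_add(3)[OF pcl' C' S', unfolded homology_shift[OF ob(3)]]
  have hgi: "?H C' p g (?H C p i n) = ?H C' p i' (?H N' p b n)" if "n \<in> hel N p" for n p
    using that gi by (auto simp: hc_carrier homology_map_hc[OF icl ob(2) C] homology_map_hc[OF b ob(2,4)] homology_map_hc[OF icl' ob(4) C']
      homology_map_hc[OF g C C'] cl_cy[OF icl ob(2) C] cl_cy[OF b ob(2,4)] cyD)
  have hpg: "?H (Sh 1 M') p \<pi>' (?H C' p g u) = ?H M' (p + 1) a (?H (Sh 1 M) p \<pi> u)" if "u \<in> hel C p" for u p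
    using that gp cl_cy[OF pcl C S, unfolded cy_shift[OF ob(1)]] by (auto simp: hc_carrier homology_map_hc[OF pcl C S] homology_map_hc[OF a ob(1,3)] homology_map_hc[OF pcl' C' S']
      homology_map_hc[OF g C C'] cl_cy[OF g C C'] hc_shift ob cyD)
  have hfa: "?H N' p \<phi>' (?H M' p a m) = ?H N' p b (?H N p \<phi> m)" if "m \<in> hel M p" for m p
    using homology_map_hty[OF sq cl_comp[OF f b] cl_comp[OF a f'] ob(1,4) that] homology_map_comp[OF f b ob(1,2,4) that]
      homology_map_comp[OF a f' ob(1,3,4) that] ob by simp
  have ia: "m = m1" if "m \<in> hel M p" "m1 \<in> hel M p" "?H M' p a m = ?H M' p a m1" for m m1 p
    using inj_onD[OF bij_betw_imp_inj_on[OF qi_bij[OF qa]] that(3,1,2)] .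
  have ib: "n = n1" if "n \<in> hel N p" "n1 \<in> hel N p" "?H N' p b n = ?H N' p b n1" for n n1 p
    using inj_onD[OF bij_betw_imp_inj_on[OF qi_bij[OF qb]] that(3,1,2)] .
  have sa: "\<exists>m\<in>hel M p. m1 = ?H M' p a m" if "m1 \<in> hel M' p" for m1 p
    using that bij_betw_imp_surj_on[OF qi_bij[OF qa, of p]] by blast
  have sb: "\<exists>n\<in>hel N p. n1 = ?H N' p b n" if "n1 \<in> hel N' p" for n1 p
    using that bij_betw_imp_surj_on[OF qi_bij[OF qb, of p]] by blast
  note ag = homology_ag[OF ob(1)] homology_ag[OF ob(2)] homology_ag[OF C] homology_ag[OF C'] homology_ag[OF ob(3)]
  show "u = \<zero>\<^bsub>homology C p\<^esub>" if u: "u \<in> hel C p" "?H C' p g u = \<zero>\<^bsub>homology C' p\<^esub>" for u p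
  proof -
    have "?H (Sh 1 M) p \<pi> u = \<zero>\<^bsub>homology M (p + 1)\<^esub>"
      by (rule ia[OF cl(2)[OF u(1)] ag_facts(2)[OF ag(1)]]) (use hpg[OF u(1)] u(2) z in simp)
    then obtain n where n: "n \<in> hel N p" "u = ?H C p i n" using ex(1)[OF u(1)] by blast
    obtain m1 where m1: "m1 \<in> hel M' p" "?H N' p b n = ?H N' p \<phi>' m1"
      using ex'(2)[OF cl(5)[OF n(1)]] hgi[OF n(1)] n(2) u(2) by auto
    obtain m where m: "m \<in> hel M p" "m1 = ?H M' p a m" using sa[OF m1(1)] by blast
    have "n = ?H N p \<phi> m" by (rule ib[OF n(1) cl(6)[OF m(1)]]) (use m1 m hfa[OF m(1)] in simp)
    thus ?thesis using ex(4)[OF m(1)] n(2) by simp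
  qed
  show "\<exists>u\<in>hel C p. v = ?H C' p g u" if v: "v \<in> hel C' p" for v p
  proof -
    obtain m where m: "m \<in> hel M (p + 1)" "?H (Sh 1 M') p \<pi>' v = ?H M' (p + 1) a m" using sa[OF cl(9)[OF v]] by blast
    have "?H N (p + 1) \<phi> m = \<zero>\<^bsub>homology N (p + 1)\<^esub>"
      by (rule ib[OF cl(6)[OF m(1)] ag_facts(2)[OF ag(2)]]) (use hfa[OF m(1)] ex'(5)[OF v] m(2) z in simp)
    then obtain u where u: "u \<in> hel C p" "m = ?H (Sh 1 M) p \<pi> u" using ex(3)[OF m(1)] by blast
    \<comment> \<open>v and the image of u agree after pi', so their difference comes from
      N'.\<close>
    let ?w = "v \<ominus>\<^bsub>homology C' p\<^esub> ?H C' p g u"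
    have "?H (Sh 1 M') p \<pi>' ?w = \<zero>\<^bsub>homology M' (p + 1)\<^esub>"
      using homology_map_add(1,2)[OF pcl' C' S', unfolded homology_shift[OF ob(3)]] hpg[OF u(1)] u(2) m(2) v cl(3)[OF u(1)] cl(4)[OF m(1)] ag
      by (simp add: ag_simps)
    then obtain n1 where n1: "n1 \<in> hel N' p" "?w = ?H C' p i' n1"
      using ex'(1)[OF abelian_group.minus_closed[OF ag(4) v cl(3)[OF u(1)]]] by blast
    obtain n where n: "n \<in> hel N p" "n1 = ?H N' p b n" using sb[OF n1(1)] by blast
    have w: "?w = ?H C' p g (?H C p i n)" unfolding n1(2) n(2) hgi[OF n(1)] ..
    have "v = ?w \<oplus>\<^bsub>homology C' p\<^esub> ?H C' p g u" using v cl(3)[OF u(1)] ag(4) by (simp add: ag_simps)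
    also have "\<dots> = ?H C' p g (?H C p i n \<oplus>\<^bsub>homology C p\<^esub> u)"
      unfolding w using homology_map_add(1)[OF g C C' cl(1)[OF n(1)] u(1)] by simp
    finally show ?thesis using ag_facts(1)[OF ag(3) cl(1)[OF n(1)] u(1)] by (intro bexI)
  qed
qed

text \<open>The filler is the triangular matrix (b rho + h pi, a pi), where the homotopy h of the
  square makes up for its failure to commute strictly.\<close>

lemma cone_fill:
  assumes c: "cone M N \<phi> C i j \<rho> \<pi>" and c': "cone M' N' \<phi>' C' i' j' \<rho>' \<pi>'"
    and ob: "ob M" "ob N" "ob M'" "ob N'" and f: "\<phi> \<in> cl M N" and f': "\<phi>' \<in> cl M' N'"
    and a: "a \<in> cl M M'" and b: "b \<in> cl N N'" and sq: "hty M N' (gcomp b \<phi>) (gcomp \<phi>' a)"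
  shows "\<exists>g\<in>cl C C'. (\<forall>p. \<forall>x\<in>elt N p. g p (i p x) = i' p (b p x)) \<and>
     (\<forall>p. \<forall>x\<in>elt C p. \<pi>' p (g p x) = a (p + 1) (\<pi> p x)) \<and>
     (a \<in> qi M M' \<longrightarrow> b \<in> qi N N' \<longrightarrow> g \<in> qi C C')"
proof -
  note C = cone_ob[OF c] and hm = cone_hm[OF c] and C' = cone_ob[OF c'] and hm' = cone_hm[OF c']
  obtain h where h: "h \<in> hm M N' (- 1)" and
    e: "!!p x. x \<in> elt M p ==>
      gcomp b \<phi> p x = gcomp \<phi>' a p x \<oplus>[N' p] (diff N' (p - 1) (h p x) \<oplus>[N' p] h (p + 1) (diff M p x))"
    by (rule htyE[OF sq cl_comp[OF f b] cl_comp[OF a f']]) (use ob in auto)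
  note [simp] = cone_rules[OF c ob(1,2) f] cone_rules[OF c' ob(3,4) f'] d_simps[OF ob(1)] d_simps[OF ob(2)] d_simps[OF ob(3)]
    d_simps[OF ob(4)] d_simps[OF C] d_simps[OF C']
    d_m1[OF ob(1)] d_m1[OF ob(2)] d_m1[OF ob(3)] d_m1[OF ob(4)] d_m1[OF C] d_m1[OF C']
    cl_simps[OF f ob(1,2)] cl_simps[OF f' ob(3,4)] cl_simps[OF a ob(1,3)] cl_simps[OF b ob(2,4)] hm_simps[OF h ob(1,4)]
    C C' deg_simps
  let ?n = "\<lambda>p x. b p (\<rho> p x) \<oplus>[N' p] h (p + 1) (\<pi> p x)"
  let ?m = "\<lambda>p x. a (p + 1) (\<pi> p x)"
  let ?g = "\<lambda>p x. i' p (?n p x) \<oplus>[C' p] j' (p + 1) (?m p x)"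
  have n: "?n \<in> hm C N' 0"
    by (rule hm_add) (use hm_comp[OF hm(3) cl_hm[OF b] C ob(2,4)] hm_comp[OF hm(4) h C ob(1,4), of 0] C ob in auto)
  have m: "?m \<in> hm C M' 1"
    using hm_comp[OF hm(4) cl_hm[OF a] C ob(1,3), of 1] by simp
  have g0: "?g \<in> hm C C' 0"
    by (rule hm_add) (use hm_comp[OF n hm'(1) C ob(4) C'] hm_comp[OF m hm'(2) C ob(3) C', of 0] C C' ob in auto)
  have g: "?g \<in> cl C C'"
  proof (rule clI[OF g0])
    fix p x assume x: "x \<in> elt C p"
    have key: "b (p + 1) (diff N p n \<oplus>[N (p + 1)] \<phi> (p + 1) m) \<oplus>[N' (p + 1)] h (p + 2) (\<ominus>[M (p + 2)] diff M (p + 1) m) =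
      diff N' p (b p n \<oplus>[N' p] h (p + 1) m) \<oplus>[N' (p + 1)] \<phi>' (p + 1) (a (p + 1) m)"
      if "n \<in> elt N p" "m \<in> elt M (p + 1)" for n m
      using that e[of m "p + 1"] by (simp add: ag_simps ob gcomp_def)
    show "?g (p + 1) (diff C p x) = diff C' p (?g p x)"
    proof (rule cone_eqI[OF c', of _ "p + 1"])
      show "\<rho>' (p + 1) (?g (p + 1) (diff C p x)) = \<rho>' (p + 1) (diff C' p (?g p x))"
        using x key[of "\<rho> p x" "\<pi> p x"] by (simp add: ag_simps ob)
    qed (use x in \<open>simp_all add: ag_simps ob\<close>)
  qed
  have gi: "?g p (i p x) = i' p (b p x)" if "x \<in> elt N p" for p x
    using that by (simp add: ag_simps ob)
  have gp: "\<pi>' p (?g p x) = a (p + 1) (\<pi> p x)" if "x \<in> elt C p" for p x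
    using that by (simp add: ag_simps ob)
  have gq: "?g \<in> qi C C'" if qa: "a \<in> qi M M'" and qb: "b \<in> qi N N'"
    by (rule cone_map_qi[OF c c' ob f f' qa qb sq g gi gp])
  show ?thesis
    by (intro bexI[OF _ g] conjI ballI allI impI gi gp gq)
qed

text \<open>As a graded module C2 is the sum of N, Sigma M and Sigma N. The projection \<theta> to
  Sigma M is a quasi-isomorphism because N and Sigma N cancel, and the projection to N is the
  homotopy from \<pi>2 to -phi \<theta>.\<close>

lemma cone_rotate:
  assumes c: "cone M N \<phi> C i j \<rho> \<pi>" and ob: "ob M" "ob N" "\<phi> \<in> cl M N"
    and c2: "cone N C i C2 i2 j2 \<rho>2 \<pi>2"
  shows "\<exists>\<theta>\<in>qi C2 (Sh 1 M). (\<forall>p. \<forall>x\<in>elt C p. \<theta> p (i2 p x) = \<pi> p x) \<and>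
     hty C2 (Sh 1 N) \<pi>2 (gcomp (\<lambda>p x. \<ominus>[N (p + 1)] \<phi> (p + 1) x) \<theta>)"
proof -
  note C = cone_ob[OF c] and hm = cone_hm[OF c] and C2 = cone_ob[OF c2] and hm2 = cone_hm[OF c2]
  note icl = cone_i_cl[OF c ob(1-3)]
  note [simp] = cone_rules[OF c ob(1-3)] cone_rules[OF c2 ob(2) C icl] d_simps[OF ob(1)] d_simps[OF ob(2)]
    d_simps[OF C] d_simps[OF C2]
    d_m1[OF ob(1)] d_m1[OF ob(2)] d_m1[OF C] d_m1[OF C2]
    cl_simps[OF ob(3,1,2)] C C2 deg_simps sign_pow_def
  have SM: "ob (Sh 1 M)" "ob (Sh 1 N)" using shift_ob ob by auto
  let ?t = "\<lambda>p x. \<pi> p (\<rho>2 p x)"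
  have t0: "?t \<in> hm C2 (Sh 1 M) 0"
    by (rule shift_hm_cod[of _ _ _ 1]) (use hm_comp[OF hm2(3) hm(4) C2 C ob(1), of 1] in auto)
  have t: "?t \<in> cl C2 (Sh 1 M)"
    by (rule clI[OF t0]) (auto simp: ag_simps ob)
  have q: "?t \<in> qi C2 (Sh 1 M)"
  proof (rule qiI[OF t C2 SM(1)])
    fix x p assume x: "x \<in> cy C2 p" "?t p x \<in> bd (Sh 1 M) p"
    obtain y where y: "y \<in> elt M p" "\<pi> p (\<rho>2 p x) = \<ominus>[M (p + 1)] diff M p y"
      using x(2) by (rule bdE) auto
    have x': "x \<in> elt C2 p" "diff C2 p x = \<zero>[C2 (p + 1)]" using x(1) by (auto simp: cyD)
    \<comment> \<open>This w corrects the coordinate of N, which the lift j y of the coordinate of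
      Sigma M has changed by phi y.\<close>
    define w where "w = \<rho> p (\<rho>2 p x) \<ominus>[N p] \<phi> p y"
    have w: "w \<in> elt N p" using x' y by (simp add: w_def ag_simps ob)
    have r: "\<rho> (p + 1) (diff C p (\<rho>2 p x) \<oplus>[C (p + 1)] i (p + 1) (\<pi>2 p x)) = \<zero>[N (p + 1)]"
      using arg_cong[OF arg_cong[OF x'(2), of "\<rho>2 (p + 1)"], of "\<rho> (p + 1)"] x'(1) by simp
    have "diff N p (\<rho> p (\<rho>2 p x)) \<ominus>[N (p + 1)] \<phi> (p + 1) (diff M p y) \<oplus>[N (p + 1)] \<pi>2 p x = \<zero>[N (p + 1)]"
      using r x'(1) y by (simp add: ag_simps ob)
    hence dw: "\<pi>2 p x = \<ominus>[N (p + 1)] diff N p w"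
      using x'(1) y w abelian_group.minus_equality[of "gr N (p + 1)" "\<pi>2 p x" "diff N p w"]
        abelian_group.minus_equality[of "gr N (p + 1)" "diff N p w" "\<pi>2 p x"]
      by (simp add: w_def ag_simps ob)
    let ?s = "i2 (p - 1) (j p y) \<oplus>[C2 (p - 1)] j2 p w"
    have s: "?s \<in> elt C2 (p - 1)" using y w by (simp add: ag_simps ob)
    have e1: "\<rho>2 p x = \<rho>2 p (diff C2 (p - 1) ?s)"
      by (rule cone_eqI[OF c, of _ p]) (use x' y w in \<open>auto simp: ag_simps ob\<close>, auto simp: w_def ag_simps ob)
    have e2: "\<pi>2 p x = \<pi>2 p (diff C2 (p - 1) ?s)"
      using y(1) w dw by (simp add: ag_simps ob)
    have "x = diff C2 (p - 1) ?s"
      by (rule cone_eqI[OF c2 x'(1) _ e1 e2]) (use s in simp)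
    thus "x \<in> bd C2 p" using s by (intro bdI[of ?s _ "p - 1"]) auto
  next
    fix m p assume "m \<in> cy (Sh 1 M) p"
    hence m: "m \<in> elt M (p + 1)" "\<ominus>[M (p + 2)] diff M (p + 1) m = \<zero>[M (p + 2)]"
      using cyD(1)[of m "Sh 1 M" p] cyD(2)[of m "Sh 1 M" p "p + 1"] by auto
    have m': "diff M (p + 1) m = \<zero>[M (p + 2)]"
      using arg_cong[OF m(2), of "\<lambda>x. \<ominus>[M (p + 2)] x"] m(1) by (simp add: ag_simps ob)
    \<comment> \<open>The second summand cancels i (phi m), the part of the boundary of j m that
      lies in N.\<close>
    let ?x = "i2 p (j (p + 1) m) \<oplus>[C2 p] j2 (p + 1) (\<ominus>[N (p + 1)] \<phi> (p + 1) m)"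
    have x: "?x \<in> elt C2 p" using m by (simp add: ag_simps ob)
    have dx: "diff C2 p ?x = \<zero>[C2 (p + 1)]"
      by (rule cone_eqI[OF c2, of _ "p + 1"]) (use m(1) m' cl_d[OF ob(3) m(1), of "p + 2"] in \<open>auto simp: ag_simps ob\<close>)
    thus "\<exists>x\<in>cy C2 p. m \<ominus>[(Sh 1 M) p] ?t p x \<in> bd (Sh 1 M) p"
      using m x bd_simps(1)[OF SM(1), of p] by (intro bexI[OF _ cyI[OF x dx]]) (simp add: ag_simps ob)
  qed
  have nf: "(\<lambda>p x. \<ominus>[N (p + 1)] \<phi> (p + 1) x) \<in> cl (Sh 1 M) (Sh 1 N)"
    by (rule clI) (use hm_neg[OF shift_hm[OF cl_hm[OF ob(3)], of 1] SM, of "\<lambda>p. p"] ob in \<open>auto simp: ag_simps\<close>)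
  have h: "(\<lambda>p x. \<rho> p (\<rho>2 p x)) \<in> hm C2 (Sh 1 N) (- 1)"
    by (rule shift_hm_cod[of _ _ _ 0]) (use hm_comp[OF hm2(3) hm(3) C2 C ob(2), of 0] in auto)
  have "hty C2 (Sh 1 N) \<pi>2 (gcomp (\<lambda>p x. \<ominus>[N (p + 1)] \<phi> (p + 1) x) ?t)"
    by (rule htyI[OF h cone_pi_cl[OF c2 ob(2) C icl] cl_comp[OF t nf]])
      (use SM ob in \<open>auto simp: ag_simps gcomp_def\<close>)
  thus ?thesis using q by (intro bexI[OF _ q]) simp
qed

lemma cone_octahedral:
  assumes c1: "cone X Y \<phi> C1 i1 j1 \<rho>1 \<pi>1" and c2: "cone Y Z \<psi> C2 i2 j2 \<rho>2 \<pi>2" and c3: "cone X Z (gcomp \<psi> \<phi>) C3 i3 j3 \<rho>3 \<pi>3"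
    and ob: "ob X" "ob Y" "ob Z" and f: "\<phi> \<in> cl X Y" and g: "\<psi> \<in> cl Y Z"
  shows "\<exists>\<alpha>\<in>cl C1 C3. \<forall>C4 i4 j4 \<rho>4 \<pi>4. cone C1 C3 \<alpha> C4 i4 j4 \<rho>4 \<pi>4 \<longrightarrow> (\<exists>\<beta>. \<beta> \<in> qi C2 C4)"
proof -
  note C1 = cone_ob[OF c1] and hm1 = cone_hm[OF c1] and C2 = cone_ob[OF c2] and hm2 = cone_hm[OF c2]
    and C3 = cone_ob[OF c3] and hm3 = cone_hm[OF c3]
  have gf: "gcomp \<psi> \<phi> \<in> cl X Z" using cl_comp[OF f g] ob by simp
  note [simp] = cone_rules[OF c1 ob(1,2) f] cone_rules[OF c2 ob(2,3) g] cone_rules[OF c3 ob(1,3) gf]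
    d_simps[OF ob(1)] d_simps[OF ob(2)] d_simps[OF ob(3)] d_simps[OF C1] d_simps[OF C2] d_simps[OF C3]
    d_m1[OF ob(1)] d_m1[OF ob(2)] d_m1[OF ob(3)] d_m1[OF C1] d_m1[OF C2] d_m1[OF C3]
    cl_simps[OF f ob(1,2)] cl_simps[OF g ob(2,3)] C1 C2 C3 deg_simps gcomp_def
  let ?a = "\<lambda>p x. i3 p (\<psi> p (\<rho>1 p x)) \<oplus>[C3 p] j3 (p + 1) (\<pi>1 p x)"
  have a0: "?a \<in> hm C1 C3 0"
    by (rule hm_add) (use hm_comp[OF hm_comp[OF hm1(3) cl_hm[OF g] C1 ob(2,3), of 0] hm3(1) C1 ob(3) C3, of 0]
        hm_comp[OF hm1(4) hm3(2) C1 ob(1) C3, of 0] C1 C3 in auto)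
  have a: "?a \<in> cl C1 C3"
  proof (rule clI[OF a0])
    fix p x assume x: "x \<in> elt C1 p"
    show "?a (p + 1) (diff C1 p x) = diff C3 p (?a p x)"
      by (rule cone_eqI[OF c3, of _ "p + 1"]) (use x in \<open>simp_all add: ag_simps ob\<close>)
  qed
  have "\<exists>\<beta>. \<beta> \<in> qi C2 C4" if c4: "cone C1 C3 ?a C4 i4 j4 \<rho>4 \<pi>4" for C4 i4 j4 \<rho>4 \<pi>4
  proof -
    note C4 = cone_ob[OF c4] and hm4 = cone_hm[OF c4]
    note [simp] = cone_rules[OF c4 C1 C3 a] d_simps[OF C4] d_m1[OF C4] C4
    let ?b = "\<lambda>p x. i4 p (i3 p (\<rho>2 p x)) \<oplus>[C4 p] j4 (p + 1) (i1 (p + 1) (\<pi>2 p x))"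
    have b0: "?b \<in> hm C2 C4 0"
      by (rule hm_add) (use hm_comp[OF hm_comp[OF hm2(3) hm3(1) C2 ob(3) C3, of 0] hm4(1) C2 C3 C4, of 0]
         hm_comp[OF hm_comp[OF hm2(4) hm1(1) C2 ob(2) C1, of 1] hm4(2) C2 C1 C4, of 0] C2 C4 in auto)
    have b: "?b \<in> cl C2 C4"
    proof (rule clI[OF b0])
      fix p x assume x: "x \<in> elt C2 p"
      have r4: "\<rho>4 (p + 1) (?b (p + 1) (diff C2 p x)) = \<rho>4 (p + 1) (diff C4 p (?b p x))"
        by (rule cone_eqI[OF c3, of _ "p + 1"]) (use x in \<open>simp_all add: ag_simps ob\<close>)
      have p4: "\<pi>4 (p + 1) (?b (p + 1) (diff C2 p x)) = \<pi>4 (p + 1) (diff C4 p (?b p x))"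
        by (rule cone_eqI[OF c1, of _ "p + 2"]) (use x in \<open>simp_all add: ag_simps ob\<close>)
      show "?b (p + 1) (diff C2 p x) = diff C4 p (?b p x)"
        by (rule cone_eqI[OF c4 _ _ r4 p4]) (use x in \<open>simp_all add: ag_simps ob\<close>)
    qed
    have "?b \<in> qi C2 C4"
    proof (rule qiI[OF b C2 C4])
      fix x p assume x: "x \<in> cy C2 p" "?b p x \<in> bd C4 p"
      have x': "x \<in> elt C2 p" "diff C2 p x = \<zero>[C2 (p + 1)]" using x(1) by (auto simp: cyD)
      obtain s where s: "s \<in> elt C4 (p - 1)" "?b p x = diff C4 (p - 1) s" using x(2) by (rule bdE)
      note s3 = arg_cong[OF s(2), of "\<lambda>c. \<rho>3 p (\<rho>4 p c)"] and s4 = arg_cong[OF s(2), of "\<lambda>c. \<pi>3 p (\<rho>4 p c)"]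
        and s1 = arg_cong[OF s(2), of "\<lambda>c. \<rho>1 (p + 1) (\<pi>4 p c)"]
      let ?z = "\<rho>3 (p - 1) (\<rho>4 (p - 1) s)" and ?x = "\<pi>3 (p - 1) (\<rho>4 (p - 1) s)"
        and ?y = "\<rho>1 p (\<pi>4 (p - 1) s)" and ?x' = "\<pi>1 p (\<pi>4 (p - 1) s)"
      \<comment> \<open>This is the image of s under (z, x, y, x') -> (z, y + phi x), a closed
        retraction of \<open>?b\<close>.\<close>
      let ?t = "i2 (p - 1) ?z \<oplus>[C2 (p - 1)] j2 p (?y \<oplus>[Y p] \<phi> p ?x)"
      have t: "?t \<in> elt C2 (p - 1)" using s(1) by (simp add: ag_simps ob)
      have 4: "?x' = diff X p ?x"
        using s4 s(1) x'(1) abelian_group.minus_equality[of "gr X (p + 1)" "?x'" "\<ominus>[X (p + 1)] diff X p ?x"]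
        by (simp add: ag_simps ob)
      have "x = diff C2 (p - 1) ?t"
        by (rule cone_eqI[OF c2, of _ p]) (use x'(1) s(1) s3 s1 4 in \<open>auto simp: ag_simps ob\<close>)
      thus "x \<in> bd C2 p" using t by (intro bdI[of ?t _ "p - 1"]) auto
    next
      fix y p assume y: "y \<in> cy C4 p"
      have y': "y \<in> elt C4 p" "diff C4 p y = \<zero>[C4 (p + 1)]" using y by (auto simp: cyD)
      note s3 = arg_cong[OF y'(2), of "\<lambda>c. \<rho>3 (p + 1) (\<rho>4 (p + 1) c)"] and s4 = arg_cong[OF y'(2), of "\<lambda>c. \<pi>3 (p + 1) (\<rho>4 (p + 1) c)"]
        and s1 = arg_cong[OF y'(2), of "\<lambda>c. \<rho>1 (p + 2) (\<pi>4 (p + 1) c)"]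
      let ?z = "\<rho>3 p (\<rho>4 p y)" and ?x = "\<pi>3 p (\<rho>4 p y)"
        and ?y = "\<rho>1 (p + 1) (\<pi>4 p y)" and ?x' = "\<pi>1 (p + 1) (\<pi>4 p y)"
      have 4: "?x' = diff X (p + 1) ?x"
        using s4 y'(1) abelian_group.minus_equality[of "gr X (p + 2)" "?x'" "\<ominus>[X (p + 2)] diff X (p + 1) ?x"]
        by (simp add: ag_simps ob)
      let ?t = "i2 p ?z \<oplus>[C2 p] j2 (p + 1) (?y \<oplus>[Y (p + 1)] \<phi> (p + 1) ?x)"
      have t: "?t \<in> elt C2 p" using y'(1) by (simp add: ag_simps ob)
      have dt: "diff C2 p ?t = \<zero>[C2 (p + 1)]"
        by (rule cone_eqI[OF c2, of _ "p + 1"]) (use y'(1) s3 s1 4 in \<open>auto simp: ag_simps ob\<close>)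
      \<comment> \<open>The defect left by the retraction is a boundary: x is moved to the
        coordinate of Sigma^2 X, where the differential takes it back to Sigma X.\<close>
      let ?s = "j4 p (j1 (p + 1) ?x)"
      have s: "?s \<in> elt C4 (p - 1)" using y'(1) by (simp add: ag_simps ob)
      have bt: "?b p ?t \<in> elt C4 p" using t by (simp add: ag_simps ob)
      have r4: "\<rho>4 p (y \<ominus>[C4 p] ?b p ?t) = \<rho>4 p (diff C4 (p - 1) ?s)"
        by (rule cone_eqI[OF c3, of _ p]) (use y'(1) s 4 in \<open>auto simp: ag_simps ob\<close>)
      have p4: "\<pi>4 p (y \<ominus>[C4 p] ?b p ?t) = \<pi>4 p (diff C4 (p - 1) ?s)"
        by (rule cone_eqI[OF c1, of _ "p + 1"]) (use y'(1) s 4 in \<open>auto simp: ag_simps ob\<close>)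
      have "y \<ominus>[C4 p] ?b p ?t = diff C4 (p - 1) ?s"
        by (rule cone_eqI[OF c4 _ _ r4 p4]) (use y'(1) s bt in \<open>auto simp: ag_simps ob\<close>)
      thus "\<exists>x\<in>cy C2 p. y \<ominus>[C4 p] ?b p x \<in> bd C4 p"
        using s by (intro bexI[OF _ cyI[OF t dt]] bdI[of ?s _ "p - 1"]) auto
    qed
    thus ?thesis by blast
  qed
  thus ?thesis using a by blast
qed

end

section \<open>Localization by calculus of fractions\<close>

notation gcomp (infixl \<open>\<star>\<close> 75)

text \<open>Composition of raw functions is strictly associative, so simp brings composites into one
  form and only homotopies remain to be argued.\<close>

lemma gcomp_simps [simp]: "(h \<star> g) \<star> f = h \<star> (g \<star> f)" "id_map \<star> f = f" "f \<star> id_map = f"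
  by (simp_all add: gcomp_def id_map_def)

context dga
begin

text \<open>Arrows, weak equivalences and homotopic pairs of arrows, each together with membership
  of its objects, so that the axioms of a calculus of fractions can be used by resolution.\<close>

definition ar where "ar X Y f \<longleftrightarrow> ob X \<and> ob Y \<and> f \<in> cl X Y"
definition we where "we X Y f \<longleftrightarrow> ob X \<and> ob Y \<and> f \<in> qi X Y"
definition heq where "heq X Y f g \<longleftrightarrow> ob X \<and> ob Y \<and> f \<in> cl X Y \<and> g \<in> cl X Y \<and> hty X Y f g"

lemma we_ar: "we X Y f ==> ar X Y f"
  by (simp add: we_def ar_def qi_cl)
lemma arD: "ar X Y f ==> ob X" "ar X Y f ==> ob Y" "ar X Y f ==> f \<in> cl X Y"
  by (simp_all add: ar_def)
lemma weD: "we X Y f ==> ob X" "we X Y f ==> ob Y" "we X Y f ==> f \<in> qi X Y"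
  by (simp_all add: we_def)
lemma heqD: "heq X Y f g ==> ar X Y f" "heq X Y f g ==> ar X Y g" "heq X Y f g ==> hty X Y f g"
  by (simp_all add: heq_def ar_def)
lemma ar_id: "ob X ==> ar X X id_map"
  by (simp add: ar_def)
lemma we_id: "ob X ==> we X X id_map"
  by (simp add: we_def id_qi)
lemma ar_comp: "ar X Y f ==> ar Y Z g ==> ar X Z (g \<star> f)"
  unfolding ar_def using cl_comp by blast
lemma we_comp: "we X Y f ==> we Y Z g ==> we X Z (g \<star> f)"
  unfolding we_def using qi_comp by blast
lemma we_left: "we X Z (g \<star> f) ==> we Y Z g ==> ar X Y f ==> we X Y f"
  unfolding we_def ar_def using qi_cancel_left by blast
lemma we_right: "we X Z (g \<star> f) ==> we X Y f ==> ar Y Z g ==> we Y Z g"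
  unfolding we_def ar_def using qi_cancel_right by blast
lemma heq_refl: "ar X Y f ==> heq X Y f f"
  by (simp add: heq_def ar_def hty_refl)
lemma heq_sym: "heq X Y f g ==> heq X Y g f"
  by (simp add: heq_def hty_sym)
lemma heq_trans [trans]: "heq X Y f g ==> heq X Y g h ==> heq X Y f h"
  unfolding heq_def using hty_trans by blast
lemma heq_left: "heq X Y f g ==> ar Y Z k ==> heq X Z (k \<star> f) (k \<star> g)"
  unfolding heq_def ar_def using hty_comp_left cl_comp by blast
lemma heq_right: "heq X Y f g ==> ar W X k ==> heq W Y (f \<star> k) (g \<star> k)"
  unfolding heq_def ar_def using hty_comp_right cl_comp by blast
lemma we_heq: "heq X Y f g ==> we X Y f ==> we X Y g"
  unfolding heq_def we_def using qi_hty by blast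
text \<open>Maps matter on carriers only; equality there becomes the zero homotopy, so
  representatives are never compared outside.\<close>

lemma heq_eq: "ar X Y f ==> ar X Y g ==> (!!p x. x \<in> elt X p ==> f p x = g p x) ==> heq X Y f g"
  by (simp add: heq_def ar_def hty_eq)

definition plus where "plus Y f g = (\<lambda>p x. f p x \<oplus>[Y p] g p x)"
definition scal where "scal Y c f = (\<lambda>p x. c \<odot>[Y p] f p x)"

lemma ar_plus: "ar X Y f ==> ar X Y g ==> ar X Y (plus Y f g)"
  by (simp add: ar_def cl_add plus_def)
lemma ar_scal: "ar X Y f ==> c \<in> carrier K ==> ar X Y (scal Y c f)"
  by (simp add: ar_def cl_smult scal_def)
lemma ar_zero: "ob X ==> ob Y ==> ar X Y (zm Y)"
  by (simp add: ar_def cl_zero)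
lemma heq_plus: "heq X Y f g ==> heq X Y f' g' ==> heq X Y (plus Y f f') (plus Y g g')"
  by (simp add: heq_def cl_add hty_add plus_def)
lemma heq_scal: "heq X Y f g ==> c \<in> carrier K ==> heq X Y (scal Y c f) (scal Y c g)"
  by (simp add: heq_def cl_smult hty_smult scal_def)
lemma plus_comp [simp]: "plus Y f g \<star> h = plus Y (f \<star> h) (g \<star> h)"
  and scal_comp [simp]: "scal Y c f \<star> h = scal Y c (f \<star> h)"
  and zero_comp [simp]: "zm Y \<star> h = zm Y"
  by (simp_all add: plus_def scal_def gcomp_def)

lemma ar_simps:
  assumes "ar X Y f"
  shows "!!x p. x \<in> elt X p ==> f p x \<in> elt Y p"
   "!!x y p. x \<in> elt X p ==> y \<in> elt X p ==> f p (x \<oplus>[X p] y) = f p x \<oplus>[Y p] f p y"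
   "!!c x p. c \<in> carrier K ==> x \<in> elt X p ==> f p (c \<odot>[X p] x) = c \<odot>[Y p] f p x"
   "!!p. f p \<zero>[X p] = \<zero>[Y p]"
   "!!x p. x \<in> elt X p ==> f p (\<ominus>[X p] x) = \<ominus>[Y p] f p x"
  using cl_simps[OF arD(3,1,2)[OF assms]] by auto

lemma comp_plus:
  assumes "ar X Y f" "ar X Y g" "ar Y Z h"
  shows "heq X Z (h \<star> plus Y f g) (plus Z (h \<star> f) (h \<star> g))"
  by (rule heq_eq[OF ar_comp[OF ar_plus[OF assms(1,2)] assms(3)]
        ar_plus[OF ar_comp[OF assms(1,3)] ar_comp[OF assms(2,3)]]])
    (use ar_simps[OF assms(1)] ar_simps[OF assms(2)] ar_simps[OF assms(3)] in \<open>simp add: gcomp_def plus_def\<close>)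

lemma comp_scal:
  assumes "ar X Y f" "ar Y Z h" "c \<in> carrier K"
  shows "heq X Z (h \<star> scal Y c f) (scal Z c (h \<star> f))"
  by (rule heq_eq[OF ar_comp[OF ar_scal[OF assms(1,3)] assms(2)] ar_scal[OF ar_comp[OF assms(1,2)] assms(3)]])
    (use ar_simps[OF assms(1)] ar_simps[OF assms(2)] assms(3) in \<open>simp add: gcomp_def scal_def\<close>)

text \<open>The composite of f with the inclusion into the acyclic cone of t becomes null-homotopic
  after a cover u; then \<open>cone_factor\<close> factors f u through t.\<close>

lemma ore:
  assumes "ar P Y f" "we Q Y t"
  obtains R u v where "we R P u" "ar R Q v" "heq R Y (f \<star> u) (t \<star> v)"
proof -
  note ob = arD(1,2)[OF assms(1)] weD(1)[OF assms(2)] and f = arD(3)[OF assms(1)] and t = weD(3)[OF assms(2)]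
  note tcl = qi_cl[OF t]
  obtain C i j \<rho> \<pi> where c: "cone Q Y t C i j \<rho> \<pi>" using ex_cone[OF ob(3,2) tcl] by blast
  note C = cone_ob[OF c]
  note icl = cone_i_cl[OF c ob(3,2) tcl]
  obtain R u where R: "ob R" "u \<in> qi R P" "hty R C (i \<star> f \<star> u) (zm C)"
    using null_cover[OF ob(1) C cl_comp[OF f icl ob(1,2) C] cone_acyclic[OF c ob(3,2) t]] by blast
  obtain v where "v \<in> cl R Q" "hty R Y (f \<star> u) (t \<star> v)"
    using cone_factor[OF c ob(3,2) tcl R(1), of "f \<star> u"] R cl_comp[OF qi_cl[OF R(2)] f] ob by auto
  thus thesis
    using R ob f tcl qi_cl[OF R(2)] by (intro that[of R u v]) (auto simp: we_def ar_def heq_def cl_comp)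
qed

text \<open>The difference f - g becomes null-homotopic after t, so a weak equivalence u kills it;
  adding g u gives the claim.\<close>

lemma cancel:
  assumes "we Y Z t" "ar P Y f" "ar P Y g" "heq P Z (t \<star> f) (t \<star> g)"
  obtains R u where "we R P u" "heq R Y (f \<star> u) (g \<star> u)"
proof -
  let ?g = "\<lambda>p x. \<ominus>[Y p] g p x"
  note ob = arD(1,2)[OF assms(2)] weD(2)[OF assms(1)]
  note [simp] = ar_simps[OF assms(2)] ar_simps[OF assms(3)] ar_simps[OF we_ar[OF assms(1)]]
  have g': "ar P Y ?g" using assms(3) by (simp add: ar_def cl_neg)
  have tg: "ar P Z (t \<star> ?g)" by (rule ar_comp[OF g' we_ar[OF assms(1)]])
  have "heq P Z (t \<star> plus Y f ?g) (plus Z (t \<star> f) (t \<star> ?g))"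
    by (rule comp_plus[OF assms(2) g' we_ar[OF assms(1)]])
  also have "heq P Z \<dots> (plus Z (t \<star> g) (t \<star> ?g))"
    by (rule heq_plus[OF assms(4) heq_refl[OF tg]])
  also have "heq P Z \<dots> (zm Z)"
    by (rule heq_eq[OF ar_plus[OF heqD(2)[OF assms(4)] tg] ar_zero[OF ob(1,3)]])
      (auto simp: plus_def gcomp_def ag_simps ob)
  finally have "hty P Z (t \<star> plus Y f ?g) (zm Z)" by (rule heqD)
  then obtain R u where R: "ob R" "u \<in> qi R P" "hty R Y (plus Y f ?g \<star> u) (zm Y)"
    using qi_factor_null[OF weD(3)[OF assms(1)] ob(2,3,1)] arD(3)[OF ar_plus[OF assms(2) g']] by blast
  have u: "we R P u" using R ob by (simp add: we_def)
  note [simp] = ar_simps[OF we_ar[OF u]]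
  note fu = ar_comp[OF we_ar[OF u] assms(2)] and gu = ar_comp[OF we_ar[OF u] assms(3)] and gu' = ar_comp[OF we_ar[OF u] g']
  have 0: "heq R Y (plus Y f ?g \<star> u) (zm Y)" using R ar_comp[OF we_ar[OF u] ar_plus[OF assms(2) g']] ar_zero[OF R(1) ob(2)]
    by (simp add: heq_def ar_def)
  have "heq R Y (f \<star> u) (plus Y (plus Y f ?g \<star> u) (g \<star> u))"
    by (rule heq_eq[OF fu ar_plus[OF ar_comp[OF we_ar[OF u] ar_plus[OF assms(2) g']] gu]])
      (auto simp: plus_def gcomp_def ag_simps ob)
  also have "heq R Y \<dots> (plus Y (zm Y) (g \<star> u))"
    by (rule heq_plus[OF 0 heq_refl[OF gu]])
  also have "heq R Y \<dots> (g \<star> u)"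
    by (rule heq_eq[OF ar_plus[OF ar_zero[OF R(1) ob(2)] gu] gu]) (auto simp: plus_def gcomp_def ag_simps ob)
  finally show thesis using that u by blast
qed

subsection \<open>Fractions\<close>

abbreviation fr where "fr X P Y s f \<equiv> roof_rel G `` {Roof X P Y s f}"

text \<open>\<open>roof_rel\<close> demands only that s u be a quasi-isomorphism. The
  two-out-of-three property passes this on to u and u', which makes the relation symmetric in
  form.\<close>

lemma roof_rel_iff:
  "(Roof X P Y s f, Roof X' P' Y' s' f') \<in> roof_rel G \<longleftrightarrow> X' = X \<and> Y' = Y \<and> we P X s \<and> ar P Y f \<and> we P' X s' \<and> ar P' Y f' \<and>
   (\<exists>Q u u'. we Q P u \<and> we Q P' u' \<and> heq Q X (s \<star> u) (s' \<star> u') \<and> heq Q Y (f \<star> u) (f' \<star> u'))" (is "?L \<longleftrightarrow> ?R")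
proof
  assume ?L
  hence a: "X' = X" "Y' = Y" "we P X s" "ar P Y f" "we P' X s'" "ar P' Y f'"
    by (auto simp: roof_rel_def roofs_def we_def ar_def)
  obtain Q u u' where Q: "ob Q" "u \<in> cl Q P" "u' \<in> cl Q P'" "s \<star> u \<in> qi Q X" "hty Q X (s \<star> u) (s' \<star> u')"
    "hty Q Y (f \<star> u) (f' \<star> u')"
    using \<open>?L\<close> by (auto simp: roof_rel_def)
  note o = weD(1,2)[OF a(3)] arD(2)[OF a(4)] weD(1)[OF a(5)]
  have u: "ar Q P u" "ar Q P' u'" using Q o by (auto simp: ar_def)
  have h: "heq Q X (s \<star> u) (s' \<star> u')" "heq Q Y (f \<star> u) (f' \<star> u')"
    using Q ar_comp[OF u(1) we_ar[OF a(3)]] ar_comp[OF u(2) we_ar[OF a(5)]] ar_comp[OF u(1) a(4)] ar_comp[OF u(2) a(6)]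
    by (auto simp: heq_def ar_def)
  have w: "we Q X (s \<star> u)" using Q o by (simp add: we_def)
  have "we Q P u" "we Q P' u'" using we_left[OF w a(3) u(1)] we_left[OF we_heq[OF h(1) w] a(5) u(2)] .
  thus ?R using a h by blast
next
  assume ?R
  then obtain Q u u' where Q: "we Q P u" "we Q P' u'" "heq Q X (s \<star> u) (s' \<star> u')" "heq Q Y (f \<star> u) (f' \<star> u')"
    and a: "X' = X" "Y' = Y" "we P X s" "ar P Y f" "we P' X s'" "ar P' Y f'" by blast
  thus ?L using we_comp[OF Q(1) a(3)]
    unfolding roof_rel_def roofs_def we_def ar_def heq_def by (auto intro: qi_cl)
qed

lemma roof_relE:
  assumes "(r, r') \<in> roof_rel G"
  obtains X Y P s f P' s' f' where "r = Roof X P Y s f" "r' = Roof X P' Y s' f'"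
  using assms by (auto simp: roof_rel_def)

lemma roof_rel_refl: "we P X s ==> ar P Y f ==> (Roof X P Y s f, Roof X P Y s f) \<in> roof_rel G"
  unfolding roof_rel_iff using we_id heq_refl ar_comp we_ar weD(1) gcomp_simps by metis

lemma roof_rel_sym:
  assumes "(r, r') \<in> roof_rel G"
  shows "(r', r) \<in> roof_rel G"
proof -
  obtain X Y P s f P' s' f' where r: "r = Roof X P Y s f" "r' = Roof X P' Y s' f'" using assms by (rule roof_relE)
  note a = assms[unfolded r roof_rel_iff]
  then obtain Q u u' where "we Q P u" "we Q P' u'" "heq Q X (s \<star> u) (s' \<star> u')" "heq Q Y (f \<star> u) (f' \<star> u')" by blast
  thus ?thesis
    unfolding r roof_rel_iff using a
    by (intro conjI exI[of _ Q] exI[of _ u] exI[of _ u']) (auto intro: heq_sym)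
qed

text \<open>The two comparisons are joined by an Ore square over the middle denominator P'.\<close>

lemma roof_rel_trans:
  assumes "(r, r') \<in> roof_rel G" "(r', r'') \<in> roof_rel G"
  shows "(r, r'') \<in> roof_rel G"
proof -
  obtain X Y P s f P' s' f' where r: "r = Roof X P Y s f" "r' = Roof X P' Y s' f'" using assms(1) by (rule roof_relE)
  obtain P'' s'' f'' where r'': "r'' = Roof X P'' Y s'' f''" using roof_relE[OF assms(2)] r(2) by blast
  note a = assms(1)[unfolded r roof_rel_iff] and b = assms(2)[unfolded r r'' roof_rel_iff]
  obtain Q u u' where Q: "we Q P u" "we Q P' u'" "heq Q X (s \<star> u) (s' \<star> u')" "heq Q Y (f \<star> u) (f' \<star> u')" using a by blast
  obtain Q' v v' where Q': "we Q' P' v" "we Q' P'' v'" "heq Q' X (s' \<star> v) (s'' \<star> v')" "heq Q' Y (f' \<star> v) (f'' \<star> v')" using b by blast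
  obtain R c d where R: "we R Q c" "ar R Q' d" "heq R P' (u' \<star> c) (v \<star> d)" by (rule ore[OF we_ar[OF Q(2)] Q'(1)])
  have d: "we R Q' d" using we_left[OF we_heq[OF R(3) we_comp[OF R(1) Q(2)]] Q'(1) R(2)] .
  have "heq R X (s \<star> (u \<star> c)) (s' \<star> (u' \<star> c))" using heq_right[OF Q(3) we_ar[OF R(1)]] by simp
  also have "heq R X \<dots> (s' \<star> (v \<star> d))" using heq_left[OF R(3) we_ar] a by blast
  also have "heq R X \<dots> (s'' \<star> (v' \<star> d))" using heq_right[OF Q'(3) R(2)] by simp
  finally have 1: "heq R X (s \<star> (u \<star> c)) (s'' \<star> (v' \<star> d))" .
  have "heq R Y (f \<star> (u \<star> c)) (f' \<star> (u' \<star> c))" using heq_right[OF Q(4) we_ar[OF R(1)]] by simp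
  also have "heq R Y \<dots> (f' \<star> (v \<star> d))" using heq_left[OF R(3)] a by blast
  also have "heq R Y \<dots> (f'' \<star> (v' \<star> d))" using heq_right[OF Q'(4) R(2)] by simp
  finally have "heq R Y (f \<star> (u \<star> c)) (f'' \<star> (v' \<star> d))" .
  thus ?thesis
    unfolding r r'' roof_rel_iff using a b 1 we_comp[OF R(1) Q(1)] we_comp[OF d Q'(2)] by blast
qed

lemma fr_eq_iff:
  assumes "we P X s" "ar P Y f"
  shows "fr X P Y s f = fr X' P' Y' s' f' \<longleftrightarrow> (Roof X P Y s f, Roof X' P' Y' s' f') \<in> roof_rel G"
  using roof_rel_refl[OF assms] roof_rel_sym roof_rel_trans by blast

lemma in_fr_iff: "Roof X' P' Y' s' f' \<in> fr X P Y s f \<longleftrightarrow> (Roof X P Y s f, Roof X' P' Y' s' f') \<in> roof_rel G"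
  by blast

lemma in_frD:
  assumes "Roof X' P' Y' s' f' \<in> fr X P Y s f"
  shows "X' = X" "Y' = Y" "we P X s" "ar P Y f" "we P' X s'" "ar P' Y f'" "fr X P Y s f = fr X P' Y s' f'"
  using assms fr_eq_iff unfolding in_fr_iff roof_rel_iff by auto

lemma fr_eqI:
  assumes "we P X s" "ar P Y f" "we P' X s'" "ar P' Y f'"
    "we Q P u" "we Q P' u'" "heq Q X (s \<star> u) (s' \<star> u')" "heq Q Y (f \<star> u) (f' \<star> u')"
  shows "fr X P Y s f = fr X P' Y s' f'"
  unfolding fr_eq_iff[OF assms(1,2)] roof_rel_iff
  by (intro conjI refl assms(1-4) exI[of _ Q] exI[of _ u] exI[of _ u'] assms(5-8))

lemma fr_eqE:
  assumes "fr X P Y s f = fr X P' Y s' f'" "we P X s" "ar P Y f"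
  obtains Q u u' where "we Q P u" "we Q P' u'" "heq Q X (s \<star> u) (s' \<star> u')" "heq Q Y (f \<star> u) (f' \<star> u')"
  using assms(1) unfolding fr_eq_iff[OF assms(2,3)] roof_rel_iff by (elim conjE exE) (rule that)

lemma fr_expand:
  assumes "we P X s" "ar P Y f" "we Q P u"
  shows "fr X P Y s f = fr X Q Y (s \<star> u) (f \<star> u)"
  by (rule fr_eqI[OF assms(1,2) we_comp[OF assms(3,1)] ar_comp[OF we_ar[OF assms(3)] assms(2)] assms(3) we_id[OF weD(1)[OF assms(3)]]])
    (use assms in \<open>auto intro: heq_refl ar_comp we_ar\<close>)

lemma fr_heq:
  assumes "we P X s" "heq P X s s'" "heq P Y f f'"
  shows "fr X P Y s f = fr X P Y s' f'"
  by (rule fr_eqI[OF assms(1) heqD(1)[OF assms(3)] we_heq[OF assms(2,1)] heqD(2)[OF assms(3)] we_id[OF weD(1)[OF assms(1)]] we_id[OF weD(1)[OF assms(1)]]])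
    (use assms in auto)

lemma fr_heq': "we P X s ==> heq P Y f f' ==> fr X P Y s f = fr X P Y s f'"
  by (rule fr_heq) (auto intro: heq_refl we_ar)

text \<open>A comparison may use two different maps u and u'; as s u and s u' are homotopic,
  cancellation of s makes them homotopic after a further cover.\<close>

lemma fr_same_eqE:
  assumes "fr X P Y s f = fr X P Y s g" "we P X s" "ar P Y f" "ar P Y g"
  obtains Q u where "we Q P u" "heq Q Y (f \<star> u) (g \<star> u)"
proof -
  obtain Q u u' where Q: "we Q P u" "we Q P u'" "heq Q X (s \<star> u) (s \<star> u')" "heq Q Y (f \<star> u) (g \<star> u')"
    by (rule fr_eqE[OF assms(1-3)])
  obtain R v where R: "we R Q v" "heq R P (u \<star> v) (u' \<star> v)"
    using cancel[OF assms(2) we_ar[OF Q(1)] we_ar[OF Q(2)] Q(3)] by blast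
  have "heq R Y (f \<star> (u \<star> v)) (g \<star> (u' \<star> v))" using heq_right[OF Q(4) we_ar[OF R(1)]] by simp
  also have "heq R Y \<dots> (g \<star> (u \<star> v))" by (rule heq_left[OF heq_sym[OF R(2)] assms(4)])
  finally show thesis using that[OF we_comp[OF R(1) Q(1)]] by blast
qed

section \<open>Vector space structure on fractions\<close>

abbreviation HD where "HD X Y \<equiv> derived_HOM G X Y"
abbreviation HDc where "HDc X Y \<equiv> carrier (HD X Y)"

lemma HD_iff: "F \<in> HDc X Y \<longleftrightarrow> (\<exists>P s f. we P X s \<and> ar P Y f \<and> F = fr X P Y s f)" if "ob X" "ob Y"
  using that by (auto simp: derived_HOM_def quotient_def roofs_def we_def ar_def)

lemma HD_E:
  assumes "F \<in> HDc X Y" "ob X" "ob Y"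
  obtains P s f where "we P X s" "ar P Y f" "F = fr X P Y s f"
  using assms(1) unfolding HD_iff[OF assms(2,3)] by (elim exE conjE) (rule that)

lemma fr_HD:
  assumes "we P X s" "ar P Y f"
  shows "fr X P Y s f \<in> HDc X Y"
  unfolding HD_iff[OF weD(2)[OF assms(1)] arD(2)[OF assms(2)]]
  by (intro exI[of _ P] exI[of _ s] exI[of _ f] conjI refl assms)

lemma common_denominator:
  assumes "we P X s" "ar P Y f" "we P' X s'" "ar P' Y' f'"
  obtains Q u u' where "we Q P u" "we Q P' u'" "we Q X (s \<star> u)" "fr X P Y s f = fr X Q Y (s \<star> u) (f \<star> u)"
    "fr X P' Y' s' f' = fr X Q Y' (s \<star> u) (f' \<star> u')"
proof -
  obtain Q u u' where Q: "we Q P u" "ar Q P' u'" "heq Q X (s \<star> u) (s' \<star> u')"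
    by (rule ore[OF we_ar[OF assms(1)] assms(3)])
  have w: "we Q X (s \<star> u)" by (rule we_comp[OF Q(1) assms(1)])
  have u': "we Q P' u'" by (rule we_left[OF we_heq[OF Q(3) w] assms(3) Q(2)])
  show thesis
    by (rule that[OF Q(1) u' w fr_expand[OF assms(1,2) Q(1)]],
        simp add: fr_expand[OF assms(3,4) u'],
        rule fr_heq[OF we_comp[OF u' assms(3)] heq_sym[OF Q(3)] heq_refl[OF ar_comp[OF Q(2) assms(4)]]])
qed

lemma HD_E2:
  assumes "F \<in> HDc X Y" "F' \<in> HDc X Y'" "ob X" "ob Y" "ob Y'"
  obtains P s f f' where "we P X s" "ar P Y f" "F = fr X P Y s f" "ar P Y' f'" "F' = fr X P Y' s f'"
proof -
  obtain P s f where 1: "we P X s" "ar P Y f" "F = fr X P Y s f" by (rule HD_E[OF assms(1,3,4)])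
  obtain P' s' f' where 2: "we P' X s'" "ar P' Y' f'" "F' = fr X P' Y' s' f'" by (rule HD_E[OF assms(2,3,5)])
  show thesis
  proof (rule common_denominator[OF 1(1,2) 2(1,2)])
    fix Q u u' assume "we Q P u" "we Q P' u'" "we Q X (s \<star> u)" "fr X P Y s f = fr X Q Y (s \<star> u) (f \<star> u)"
    "fr X P' Y' s' f' = fr X Q Y' (s \<star> u) (f' \<star> u')"
    note a = this
    show thesis
      by (rule that[OF a(3) ar_comp[OF we_ar[OF a(1)] 1(2)] trans[OF 1(3) a(4)] ar_comp[OF we_ar[OF a(2)] 2(2)] trans[OF 2(3) a(5)]])
  qed
qed

lemma HD_E3:
  assumes "F \<in> HDc X Y" "F' \<in> HDc X Y'" "F'' \<in> carrier (HD X Y'')" "ob X" "ob Y" "ob Y'" "ob Y''"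
  obtains P s f f' f'' where "we P X s" "ar P Y f" "F = fr X P Y s f" "ar P Y' f'" "F' = fr X P Y' s f'"
     "ar P Y'' f''" "F'' = fr X P Y'' s f''"
proof -
  obtain P s f f' where 1: "we P X s" "ar P Y f" "F = fr X P Y s f" "ar P Y' f'" "F' = fr X P Y' s f'"
    by (rule HD_E2[OF assms(1,2,4,5,6)])
  obtain P' s' f'' where 2: "we P' X s'" "ar P' Y'' f''" "F'' = fr X P' Y'' s' f''" by (rule HD_E[OF assms(3,4,7)])
  show thesis
  proof (rule common_denominator[OF 1(1,2) 2(1,2)])
    fix Q u u' assume "we Q P u" "we Q P' u'" "we Q X (s \<star> u)" "fr X P Y s f = fr X Q Y (s \<star> u) (f \<star> u)"
    "fr X P' Y'' s' f'' = fr X Q Y'' (s \<star> u) (f'' \<star> u')"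
    note a = this
    show thesis
      by (rule that[OF a(3) ar_comp[OF we_ar[OF a(1)] 1(2)] trans[OF 1(3) a(4)]
            ar_comp[OF we_ar[OF a(1)] 1(4)] trans[OF 1(5) fr_expand[OF 1(1,4) a(1)]]
            ar_comp[OF we_ar[OF a(2)] 2(2)] trans[OF 2(3) a(5)]])
  qed
qed

text \<open>The summands are compared through unrelated roofs R and R'. An Ore square aligns them
  over P only; to align them over Q as well, the denominator t is cancelled.\<close>

lemma plus_well_defined:
  assumes s: "we P X s" "ar P Y f" "ar P Y f'"
    and m: "Roof X Q Y t g \<in> fr X P Y s f" "Roof X Q Y t g' \<in> fr X P Y s f'"
  shows "fr X Q Y t (plus Y g g') = fr X P Y s (plus Y f f')"
proof -
  note m1 = in_frD[OF m(1)] and m2 = in_frD[OF m(2)]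
  obtain R a b where R: "we R P a" "we R Q b" "heq R X (s \<star> a) (t \<star> b)" "heq R Y (f \<star> a) (g \<star> b)"
    by (rule fr_eqE[OF m1(7) s(1,2)])
  obtain R' a' b' where R': "we R' P a'" "we R' Q b'" "heq R' X (s \<star> a') (t \<star> b')" "heq R' Y (f' \<star> a') (g' \<star> b')"
    by (rule fr_eqE[OF m2(7) s(1,3)])
  obtain T c c' where T: "we T R c" "ar T R' c'" "heq T P (a \<star> c) (a' \<star> c')"
    by (rule ore[OF we_ar[OF R(1)] R'(1)])
  have c': "we T R' c'" by (rule we_left[OF we_heq[OF T(3) we_comp[OF T(1) R(1)]] R'(1) T(2)])
  have tb: "ar T Q (b \<star> c)" "ar T Q (b' \<star> c')" using ar_comp we_ar T R R' by blast+
  have "heq T X (t \<star> (b \<star> c)) (s \<star> (a \<star> c))" using heq_right[OF heq_sym[OF R(3)] we_ar[OF T(1)]] by simp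
  also have "heq T X \<dots> (s \<star> (a' \<star> c'))" by (rule heq_left[OF T(3) we_ar[OF s(1)]])
  also have "heq T X \<dots> (t \<star> (b' \<star> c'))" using heq_right[OF R'(3) T(2)] by simp
  finally obtain W e where W: "we W T e" "heq W Q ((b \<star> c) \<star> e) ((b' \<star> c') \<star> e)"
    by (rule cancel[OF m1(5) tb])
  have u: "we W P (a \<star> (c \<star> e))" "we W Q (b \<star> (c \<star> e))"
    using we_comp[OF we_comp[OF W(1) T(1)] R(1)] we_comp[OF we_comp[OF W(1) T(1)] R(2)] by simp_all
  note ce = ar_comp[OF we_ar[OF W(1)] we_ar[OF T(1)]] and ce' = ar_comp[OF we_ar[OF W(1)] T(2)]
  show ?thesis
  proof (rule fr_eqI[OF m1(5) ar_plus[OF m1(6) m2(6)] s(1) ar_plus[OF s(2,3)] u(2,1)])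
    show "heq W X (t \<star> (b \<star> (c \<star> e))) (s \<star> (a \<star> (c \<star> e)))"
      using heq_right[OF heq_sym[OF R(3)] ce] by simp
    have 1: "heq W Y (g \<star> (b \<star> (c \<star> e))) (f \<star> (a \<star> (c \<star> e)))"
      using heq_right[OF heq_sym[OF R(4)] ce] by simp
    have "heq W Y (g' \<star> (b \<star> (c \<star> e))) (g' \<star> (b' \<star> (c' \<star> e)))"
      using heq_left[OF W(2) m2(6)] by simp
    also have "heq W Y \<dots> (f' \<star> (a' \<star> (c' \<star> e)))"
      using heq_right[OF heq_sym[OF R'(4)] ce'] by simp
    also have "heq W Y \<dots> (f' \<star> (a \<star> (c \<star> e)))"
      using heq_left[OF heq_right[OF heq_sym[OF T(3)] we_ar[OF W(1)]] s(3)] by simp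
    finally show "heq W Y (plus Y g g' \<star> (b \<star> (c \<star> e))) (plus Y f f' \<star> (a \<star> (c \<star> e)))"
      using heq_plus[OF 1] by simp
  qed
qed

text \<open>By \<open>plus_well_defined\<close> the union that defines the sum runs over a single
  class.\<close>

lemma add_fr:
  assumes s: "we P X s" "ar P Y f" "ar P Y f'"
  shows "fr X P Y s f \<oplus>\<^bsub>HD X Y\<^esub> fr X P Y s f' = fr X P Y s (plus Y f f')"
proof -
  have "{fr X Q Y t (\<lambda>p x. g p x \<oplus>[Y p] g' p x) | Q t g g'.
     Roof X Q Y t g \<in> fr X P Y s f \<and> Roof X Q Y t g' \<in> fr X P Y s f'} = {fr X P Y s (plus Y f f')}" (is "?S = _")
  proof (intro equalityI subsetI)
    fix F assume "F \<in> ?S"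
    thus "F \<in> {fr X P Y s (plus Y f f')}"
      using plus_well_defined[OF s] unfolding plus_def by blast
  next
    fix F assume "F \<in> {fr X P Y s (plus Y f f')}"
    thus "F \<in> ?S"
      using roof_rel_refl[OF s(1,2)] roof_rel_refl[OF s(1,3)] unfolding plus_def by blast
  qed
  thus ?thesis by (simp add: derived_HOM_def)
qed

lemma smult_fr:
  assumes s: "we P X s" "ar P Y f" "c \<in> carrier K"
  shows "c \<odot>\<^bsub>HD X Y\<^esub> fr X P Y s f = fr X P Y s (scal Y c f)"
proof -
  have wd: "fr X Q Y t (scal Y c g) = fr X P Y s (scal Y c f)" if m: "Roof X Q Y t g \<in> fr X P Y s f" for Q t g
  proof -
    note m1 = in_frD[OF m]
    obtain R a b where R: "we R P a" "we R Q b" "heq R X (s \<star> a) (t \<star> b)" "heq R Y (f \<star> a) (g \<star> b)"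
      by (rule fr_eqE[OF m1(7) s(1,2)])
    show ?thesis
      by (rule fr_eqI[OF m1(5) ar_scal[OF m1(6) s(3)] s(1) ar_scal[OF s(2,3)] R(2,1) heq_sym[OF R(3)]])
        (use heq_scal[OF heq_sym[OF R(4)] s(3)] in simp)
  qed
  have "{fr X Q Y t (\<lambda>p x. c \<odot>[Y p] g p x) | Q t g. Roof X Q Y t g \<in> fr X P Y s f} = {fr X P Y s (scal Y c f)}" (is "?S = _")
  proof (intro equalityI subsetI)
    fix F assume "F \<in> ?S"
    thus "F \<in> {fr X P Y s (scal Y c f)}"
      using wd unfolding scal_def by blast
  next
    fix F assume "F \<in> {fr X P Y s (scal Y c f)}"
    thus "F \<in> ?S"
      using roof_rel_refl[OF s(1,2)] unfolding scal_def by blast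
  qed
  thus ?thesis by (simp add: derived_HOM_def)
qed

lemma zero_fr:
  assumes "we P X s" "ob Y"
  shows "\<zero>\<^bsub>HD X Y\<^esub> = fr X P Y s (zm Y)"
  using fr_expand[OF we_id[OF weD(2)[OF assms(1)]] ar_zero[OF weD(2)[OF assms(1)] assms(2)] assms(1)]
  by (simp add: derived_HOM_def strict_mor_def)

lemma plus_app: "plus Y f g p x = f p x \<oplus>[Y p] g p x" and scal_app: "scal Y c f p x = c \<odot>[Y p] f p x"
  by (simp_all add: plus_def scal_def)

lemma HD_module:
  assumes ob: "ob X" "ob Y"
  shows "module K (HD X Y)"
proof (rule moduleI)
  note E2 = HD_E2[OF _ _ ob(1,2,2)] and E3 = HD_E3[OF _ _ _ ob(1,2,2,2)]
  note [simp] = add_fr smult_fr ar_plus ar_scal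
  have fi: "fr X P Y s f = fr X P Y s g" if "we P X s" "ar P Y f" "ar P Y g" "!!p x. x \<in> elt P p ==> f p x = g p x" for P s f g
    by (rule fr_heq'[OF that(1) heq_eq[OF that(2-4)]])
  note md = ob_module[OF ob(2)]
  note [simp] = ob_ag[OF ob(2)] module_smult_simps[OF md]
  show "cring K" by (rule cring_K)
  show "abelian_group (HD X Y)"
  proof (rule abelian_groupI)
    fix F F' assume a: "F \<in> HDc X Y" "F' \<in> HDc X Y"
    obtain P s f f' where r: "we P X s" "ar P Y f" "F = fr X P Y s f" "ar P Y f'" "F' = fr X P Y s f'" by (rule E2[OF a])
    show "F \<oplus>\<^bsub>HD X Y\<^esub> F' \<in> HDc X Y" using r by (simp add: fr_HD)
    show "F \<oplus>\<^bsub>HD X Y\<^esub> F' = F' \<oplus>\<^bsub>HD X Y\<^esub> F" using r ar_simps[OF r(2)] ar_simps[OF r(4)]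
      by (simp, intro fi) (auto simp: plus_app ag_facts(4))
    fix F'' assume b: "F'' \<in> HDc X Y"
    obtain P s f f' f'' where r: "we P X s" "ar P Y f" "F = fr X P Y s f" "ar P Y f'" "F' = fr X P Y s f'"
      "ar P Y f''" "F'' = fr X P Y s f''" by (rule E3[OF a b])
    show "F \<oplus>\<^bsub>HD X Y\<^esub> F' \<oplus>\<^bsub>HD X Y\<^esub> F'' = F \<oplus>\<^bsub>HD X Y\<^esub> (F' \<oplus>\<^bsub>HD X Y\<^esub> F'')"
      using r ar_simps[OF r(2)] ar_simps[OF r(4)] ar_simps[OF r(6)]
      by (simp, intro fi) (auto simp: plus_app ag_facts(3))
  next
    show "\<zero>\<^bsub>HD X Y\<^esub> \<in> HDc X Y"
      using zero_fr[OF we_id[OF ob(1)] ob(2)] fr_HD[OF we_id[OF ob(1)] ar_zero[OF ob]] by simp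
    fix F assume F: "F \<in> HDc X Y"
    obtain P s f where r: "we P X s" "ar P Y f" "F = fr X P Y s f" by (rule HD_E[OF F ob])
    note z = ar_zero[OF weD(1)[OF r(1)] ob(2)]
    show "\<zero>\<^bsub>HD X Y\<^esub> \<oplus>\<^bsub>HD X Y\<^esub> F = F" using r zero_fr[OF r(1) ob(2)] z ar_simps[OF r(2)]
      by (simp, intro fi) (auto simp: plus_app ag_facts)
    have n: "ar P Y (\<lambda>p x. \<ominus>[Y p] f p x)" using r(2) by (simp add: ar_def cl_neg)
    have "fr X P Y s (\<lambda>p x. \<ominus>[Y p] f p x) \<oplus>\<^bsub>HD X Y\<^esub> F = \<zero>\<^bsub>HD X Y\<^esub>"
      unfolding r(3) add_fr[OF r(1) n r(2)] zero_fr[OF r(1) ob(2)]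
      by (rule fi[OF r(1) ar_plus[OF n r(2)] z]) (use ar_simps[OF r(2)] in \<open>simp add: plus_app ag_simps\<close>)
    thus "\<exists>F'\<in>HDc X Y. F' \<oplus>\<^bsub>HD X Y\<^esub> F = \<zero>\<^bsub>HD X Y\<^esub>"
      using fr_HD[OF r(1) n] by blast
  qed
  {
    fix F assume F: "F \<in> HDc X Y"
    obtain P s f where r: "we P X s" "ar P Y f" "F = fr X P Y s f" by (rule HD_E[OF F ob])
    have k: "\<one>\<^bsub>K\<^esub> \<in> carrier K" using cring_K by (simp add: cring.cring_simprules(6))
    show "\<one>\<^bsub>K\<^esub> \<odot>\<^bsub>HD X Y\<^esub> F = F"
      unfolding r(3) smult_fr[OF r(1,2) k]
      by (rule fi[OF r(1) ar_scal[OF r(2) k] r(2)]) (use ar_simps[OF r(2)] in \<open>simp add: scal_app module.smult_one[OF md]\<close>)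
  }
  fix a F assume a: "a \<in> carrier K" and F: "F \<in> HDc X Y"
  obtain P s f where r: "we P X s" "ar P Y f" "F = fr X P Y s f" by (rule HD_E[OF F ob])
  show "a \<odot>\<^bsub>HD X Y\<^esub> F \<in> HDc X Y" using r a by (simp add: fr_HD)
  { fix b assume b: "b \<in> carrier K"
    have ab: "a \<oplus>\<^bsub>K\<^esub> b \<in> carrier K" "a \<otimes>\<^bsub>K\<^esub> b \<in> carrier K" using a b cring_K by (auto intro: cring.cring_simprules)
    show "(a \<oplus>\<^bsub>K\<^esub> b) \<odot>\<^bsub>HD X Y\<^esub> F = a \<odot>\<^bsub>HD X Y\<^esub> F \<oplus>\<^bsub>HD X Y\<^esub> b \<odot>\<^bsub>HD X Y\<^esub> F"
      using r a b ab ar_simps[OF r(2)]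
      by (simp, intro fi) (auto simp: scal_app plus_app module.smult_l_distr[OF md])
    show "(a \<otimes>\<^bsub>K\<^esub> b) \<odot>\<^bsub>HD X Y\<^esub> F = a \<odot>\<^bsub>HD X Y\<^esub> (b \<odot>\<^bsub>HD X Y\<^esub> F)"
      using r a b ab ar_simps[OF r(2)]
      by (simp, intro fi) (auto simp: scal_app plus_app module.smult_assoc1[OF md])
  }
  fix F' assume F': "F' \<in> HDc X Y"
  obtain P s f f' where r: "we P X s" "ar P Y f" "F = fr X P Y s f" "ar P Y f'" "F' = fr X P Y s f'" by (rule E2[OF F F'])
  show "a \<odot>\<^bsub>HD X Y\<^esub> (F \<oplus>\<^bsub>HD X Y\<^esub> F') = a \<odot>\<^bsub>HD X Y\<^esub> F \<oplus>\<^bsub>HD X Y\<^esub> a \<odot>\<^bsub>HD X Y\<^esub> F'"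
    using r a ar_simps[OF r(2)] ar_simps[OF r(4)]
    by (simp, intro fi) (auto simp: scal_app plus_app)
qed

text \<open>Successive Ore squares map one object to R, R1 and to both comparison roofs. The two
  resulting maps into Q1 agree only after t1, so t1 is cancelled at the end.\<close>

lemma cmp_well_defined:
  assumes F: "fr X P Y s f = fr X P1 Y s1 f1" "we P X s" "ar P Y f" "we P1 X s1" "ar P1 Y f1"
   and H: "fr Y Q Z t g = fr Y Q1 Z t1 g1" "we Q Y t" "ar Q Z g" "we Q1 Y t1" "ar Q1 Z g1"
   and R: "we R P u" "ar R Q v" "heq R Y (f \<star> u) (t \<star> v)"
   and R1: "we R1 P1 u1" "ar R1 Q1 v1" "heq R1 Y (f1 \<star> u1) (t1 \<star> v1)"
 shows "fr X R Z (s \<star> u) (g \<star> v) = fr X R1 Z (s1 \<star> u1) (g1 \<star> v1)"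
proof -
  obtain W a a1 where W: "we W P a" "we W P1 a1" "heq W X (s \<star> a) (s1 \<star> a1)" "heq W Y (f \<star> a) (f1 \<star> a1)"
    by (rule fr_eqE[OF F(1-3)])
  obtain V b b1 where V: "we V Q b" "we V Q1 b1" "heq V Y (t \<star> b) (t1 \<star> b1)" "heq V Z (g \<star> b) (g1 \<star> b1)"
    by (rule fr_eqE[OF H(1-3)])
  obtain T1 c d where T1: "we T1 R c" "ar T1 W d" "heq T1 P (u \<star> c) (a \<star> d)" by (rule ore[OF we_ar[OF R(1)] W(1)])
  obtain T2 e c1 where T2: "we T2 T1 e" "ar T2 R1 c1" "heq T2 P1 ((a1 \<star> d) \<star> e) (u1 \<star> c1)"
    by (rule ore[OF ar_comp[OF T1(2) we_ar[OF W(2)]] R1(1)])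
  have d: "we T1 W d" by (rule we_left[OF we_heq[OF T1(3) we_comp[OF T1(1) R(1)]] W(1) T1(2)])
  have c1: "we T2 R1 c1" by (rule we_left[OF we_heq[OF T2(3) we_comp[OF T2(1) we_comp[OF d W(2)]]] R1(1) T2(2)])
  have ce: "we T2 R (c \<star> e)" by (rule we_comp[OF T2(1) T1(1)])
  have de: "ar T2 W (d \<star> e)" by (rule ar_comp[OF we_ar[OF T2(1)] T1(2)])
  obtain T3 k m where T3: "we T3 T2 k" "ar T3 V m" "heq T3 Q ((v \<star> (c \<star> e)) \<star> k) (b \<star> m)"
    by (rule ore[OF ar_comp[OF we_ar[OF ce] R(2)] V(1)])
  note k = we_ar[OF T3(1)]
  have "heq T3 Y (t1 \<star> (b1 \<star> m)) (t \<star> (b \<star> m))" using heq_right[OF heq_sym[OF V(3)] T3(2)] by simp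
  also have "heq T3 Y \<dots> (t \<star> (v \<star> (c \<star> (e \<star> k))))" using heq_left[OF heq_sym[OF T3(3)] we_ar[OF H(2)]] by simp
  also have "heq T3 Y \<dots> (f \<star> (u \<star> (c \<star> (e \<star> k))))" using heq_right[OF heq_sym[OF R(3)] ar_comp[OF k we_ar[OF ce]]] by simp
  also have "heq T3 Y \<dots> (f \<star> (a \<star> (d \<star> (e \<star> k))))"
    using heq_left[OF heq_right[OF T1(3) ar_comp[OF k we_ar[OF T2(1)]]] F(3)] by simp
  also have "heq T3 Y \<dots> (f1 \<star> (a1 \<star> (d \<star> (e \<star> k))))"
    using heq_right[OF W(4) ar_comp[OF k de]] by simp
  also have "heq T3 Y \<dots> (f1 \<star> (u1 \<star> (c1 \<star> k)))"
    using heq_left[OF heq_right[OF T2(3) k] F(5)] by simp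
  also have "heq T3 Y \<dots> (t1 \<star> (v1 \<star> (c1 \<star> k)))"
    using heq_right[OF R1(3) ar_comp[OF k we_ar[OF c1]]] by simp
  finally obtain T4 n where T4: "we T4 T3 n" "heq T4 Q1 ((b1 \<star> m) \<star> n) ((v1 \<star> (c1 \<star> k)) \<star> n)"
    by (rule cancel[OF H(4) ar_comp[OF T3(2) we_ar[OF V(2)]] ar_comp[OF ar_comp[OF k we_ar[OF c1]] R1(2)]])
  note n = we_ar[OF T4(1)]
  note kn = ar_comp[OF n k]
  note wkn = we_comp[OF T4(1) T3(1)]
  show ?thesis
  proof (rule fr_eqI[OF we_comp[OF R(1) F(2)] ar_comp[OF R(2) H(3)] we_comp[OF R1(1) F(4)] ar_comp[OF R1(2) H(5)]
      we_comp[OF wkn ce] we_comp[OF wkn c1]])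
    have "heq T4 X (s \<star> (u \<star> (c \<star> (e \<star> (k \<star> n))))) (s \<star> (a \<star> (d \<star> (e \<star> (k \<star> n)))))"
      using heq_left[OF heq_right[OF T1(3) ar_comp[OF kn we_ar[OF T2(1)]]] we_ar[OF F(2)]] by simp
    also have "heq T4 X \<dots> (s1 \<star> (a1 \<star> (d \<star> (e \<star> (k \<star> n)))))"
      using heq_right[OF W(3) ar_comp[OF kn de]] by simp
    also have "heq T4 X \<dots> (s1 \<star> (u1 \<star> (c1 \<star> (k \<star> n))))"
      using heq_left[OF heq_right[OF T2(3) kn] we_ar[OF F(4)]] by simp
    finally show "heq T4 X ((s \<star> u) \<star> ((c \<star> e) \<star> (k \<star> n))) ((s1 \<star> u1) \<star> (c1 \<star> (k \<star> n)))" by simp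
    have "heq T4 Z (g \<star> (v \<star> (c \<star> (e \<star> (k \<star> n))))) (g \<star> (b \<star> (m \<star> n)))"
      using heq_left[OF heq_right[OF T3(3) n] H(3)] by simp
    also have "heq T4 Z \<dots> (g1 \<star> (b1 \<star> (m \<star> n)))"
      using heq_right[OF V(4) ar_comp[OF n T3(2)]] by simp
    also have "heq T4 Z \<dots> (g1 \<star> (v1 \<star> (c1 \<star> (k \<star> n))))"
      using heq_left[OF T4(2) H(5)] by simp
    finally show "heq T4 Z ((g \<star> v) \<star> ((c \<star> e) \<star> (k \<star> n))) ((g1 \<star> v1) \<star> (c1 \<star> (k \<star> n)))" by simp
  qed
qed

abbreviation cD (infixl \<open>\<ast>\<close> 70) where "H \<ast> F \<equiv> derived_cmp G H F"

lemma cmp_fr: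
  assumes F: "we P X s" "ar P Y f" and H: "we Q Y t" "ar Q Z g" and R: "we R P u" "ar R Q v" "heq R Y (f \<star> u) (t \<star> v)"
  shows "fr Y Q Z t g \<ast> fr X P Y s f = fr X R Z (s \<star> u) (g \<star> v)"
proof -
  have "{fr X' R' Z' (s' \<star> u') (g' \<star> v') | X' P' Y' Q' Z' s' f' t' g' R' u' v'.
         Roof X' P' Y' s' f' \<in> fr X P Y s f \<and> Roof Y' Q' Z' t' g' \<in> fr Y Q Z t g \<and>
         R' \<in> dg_obj G \<and> u' \<in> qi R' P' \<and> v' \<in> cl R' Q' \<and>
         hty R' Y' (f' \<star> u') (t' \<star> v')} = {fr X R Z (s \<star> u) (g \<star> v)}" (is "?S = _")
  proof (intro equalityI subsetI)
    fix C assume "C \<in> ?S"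
    then obtain X' P' Y' Q' Z' s' f' t' g' R' u' v' where C: "C = fr X' R' Z' (s' \<star> u') (g' \<star> v')"
       "Roof X' P' Y' s' f' \<in> fr X P Y s f" "Roof Y' Q' Z' t' g' \<in> fr Y Q Z t g"
       "R' \<in> dg_obj G" "u' \<in> qi R' P'" "v' \<in> cl R' Q'" "hty R' Y' (f' \<star> u') (t' \<star> v')"
      unfolding mem_Collect_eq by (elim exE conjE) (rule that)
    note m1 = in_frD[OF C(2)] and m2 = in_frD[OF C(3)]
    have 1: "we R' P' u'" "ar R' Q' v'" using C(4-) weD(1)[OF m1(5)] weD(1)[OF m2(5)] by (auto simp: we_def ar_def)
    have 2: "heq R' Y (f' \<star> u') (t' \<star> v')"
      using C(7) ar_comp[OF we_ar[OF 1(1)] m1(6)] ar_comp[OF 1(2) we_ar[OF m2(5)]] m1(2) by (auto simp: heq_def ar_def)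
    have "C = fr X R Z (s \<star> u) (g \<star> v)"
      unfolding C(1) m1(1) m2(2)
      by (rule cmp_well_defined[OF m1(7) F m1(5,6) m2(7) H m2(5,6) R 1 2, symmetric])
    thus "C \<in> {fr X R Z (s \<star> u) (g \<star> v)}" by (simp only: singleton_iff)
  next
    fix C assume "C \<in> {fr X R Z (s \<star> u) (g \<star> v)}"
    hence "C = fr X R Z (s \<star> u) (g \<star> v)" by (rule singletonD)
    moreover have "Roof X P Y s f \<in> fr X P Y s f" "Roof Y Q Z t g \<in> fr Y Q Z t g"
      using roof_rel_refl[OF F] roof_rel_refl[OF H] unfolding in_fr_iff .
    moreover have "R \<in> dg_obj G" "u \<in> qi R P" "v \<in> cl R Q" "hty R Y (f \<star> u) (t \<star> v)"
      using R by (auto simp: we_def ar_def heq_def)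
    ultimately show "C \<in> ?S" by (intro CollectI exI conjI)
  qed
  thus ?thesis unfolding derived_cmp_def by (simp only: cSup_singleton)
qed

abbreviation D where "D \<equiv> DA K A"
abbreviation DT where "DT \<equiv> derived_triangles K A"

lemma D_simps [simp]: "Obj D = Collect ob" "HOM D = HD" "cmp D = derived_cmp G"
  "ident D X = fr X X X id_map id_map" "shift D = shift_obj" "triangles D = DT"
  by (simp_all add: DA_def derived_category_def lin_cat.defs strict_mor_def)

text \<open>After an Ore completion the numerator of F factors through the denominator of H, and the
  composite is read off without further choices.\<close>

lemma fr_compose_rep:
  assumes F: "F \<in> HDc X Y" and H: "H \<in> HDc Y Z" and ob: "ob X" "ob Y" "ob Z"
  obtains R s v Q t g where "we R X s" "ar R Q v" "we Q Y t" "ar Q Z g" "F = fr X R Y s (t \<star> v)" "H = fr Y Q Z t g"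
    "H \<ast> F = fr X R Z s (g \<star> v)"
proof -
  obtain P s f where 1: "we P X s" "ar P Y f" "F = fr X P Y s f" by (rule HD_E[OF F ob(1,2)])
  obtain Q t g where 2: "we Q Y t" "ar Q Z g" "H = fr Y Q Z t g" by (rule HD_E[OF H ob(2,3)])
  obtain R u v where R: "we R P u" "ar R Q v" "heq R Y (f \<star> u) (t \<star> v)" by (rule ore[OF 1(2) 2(1)])
  have "F = fr X R Y (s \<star> u) (t \<star> v)"
    using fr_expand[OF 1(1,2) R(1)] fr_heq'[OF we_comp[OF R(1) 1(1)] R(3)] 1(3) by simp
  thus thesis
    using that[OF we_comp[OF R(1) 1(1)] R(2) 2(1,2) _ 2(3)] cmp_fr[OF 1(1,2) 2(1,2) R] 1(3) 2(3) by simp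
qed

lemma cmp_fr':
  assumes "we R X s" "ar R Q v" "we Q Y t" "ar Q Z g"
  shows "fr Y Q Z t g \<ast> fr X R Y s (t \<star> v) = fr X R Z s (g \<star> v)"
  using cmp_fr[OF assms(1) ar_comp[OF assms(2) we_ar[OF assms(3)]] assms(3,4) we_id[OF weD(1)[OF assms(1)]] assms(2)]
    heq_refl[OF ar_comp[OF assms(2) we_ar[OF assms(3)]]] by simp

lemma cmp_HD:
  assumes "F \<in> HDc X Y" "H \<in> HDc Y Z" "ob X" "ob Y" "ob Z"
  shows "H \<ast> F \<in> HDc X Z"
proof (rule fr_compose_rep[OF assms])
  fix R s v Q t g assume a: "we R X s" "ar R Q v" "ar Q Z g" and e: "H \<ast> F = fr X R Z s (g \<star> v)"
  show ?thesis unfolding e by (rule fr_HD[OF a(1) ar_comp[OF a(2,3)]])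
qed

lemma cmp_left_id:
  assumes "F \<in> HDc X Y" "ob X" "ob Y"
  shows "fr Y Y Y id_map id_map \<ast> F = F"
proof -
  obtain P s f where 1: "we P X s" "ar P Y f" "F = fr X P Y s f" by (rule HD_E[OF assms])
  show ?thesis using cmp_fr'[OF 1(1,2) we_id[OF assms(3)] ar_id[OF assms(3)]] 1(3) by simp
qed

lemma cmp_right_id:
  assumes "F \<in> HDc X Y" "ob X" "ob Y"
  shows "F \<ast> fr X X X id_map id_map = F"
proof -
  obtain P s f where 1: "we P X s" "ar P Y f" "F = fr X P Y s f" by (rule HD_E[OF assms])
  have "fr X X X id_map id_map = fr X P X s s"
    using fr_expand[OF we_id[OF assms(2)] ar_id[OF assms(2)] 1(1)] by simp
  thus ?thesis using cmp_fr'[OF 1(1) ar_id[OF weD(1)[OF 1(1)]] 1(1,2)] 1(3) by simp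
qed

text \<open>Representatives are chosen so that each numerator factors through the next denominator;
  then both bracketings are the same fraction.\<close>

lemma cmp_assoc:
  assumes F: "F \<in> HDc W X" and H: "H \<in> HDc X Y" and L: "L \<in> HDc Y Z"
    and ob: "ob W" "ob X" "ob Y" "ob Z"
  shows "L \<ast> (H \<ast> F) = (L \<ast> H) \<ast> F"
proof -
  obtain Q t v R r l where 1: "we Q X t" "ar Q R v" "we R Y r" "ar R Z l" "H = fr X Q Y t (r \<star> v)" "L = fr Y R Z r l"
    "L \<ast> H = fr X Q Z t (l \<star> v)" by (rule fr_compose_rep[OF H L ob(2-4)])
  obtain P s f where 2: "we P W s" "ar P X f" "F = fr W P X s f" by (rule HD_E[OF F ob(1,2)])
  obtain T u x where T: "we T P u" "ar T Q x" "heq T X (f \<star> u) (t \<star> x)" by (rule ore[OF 2(2) 1(1)])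
  note su = we_comp[OF T(1) 2(1)]
  have F': "F = fr W T X (s \<star> u) (t \<star> x)"
    using fr_expand[OF 2(1,2) T(1)] fr_heq'[OF su T(3)] 2(3) by simp
  have "H \<ast> F = fr W T Y (s \<star> u) (r \<star> (v \<star> x))"
    using cmp_fr'[OF su T(2) 1(1) ar_comp[OF 1(2) we_ar[OF 1(3)]]] by (simp add: F' 1(5))
  hence "L \<ast> (H \<ast> F) = fr W T Z (s \<star> u) (l \<star> (v \<star> x))"
    using cmp_fr'[OF su ar_comp[OF T(2) 1(2)] 1(3,4)] by (simp add: 1(6))
  also have "\<dots> = (L \<ast> H) \<ast> F"
    using cmp_fr'[OF su T(2) 1(1) ar_comp[OF 1(2,4)]] by (simp add: F' 1(7))
  finally show ?thesis .
qed

text \<open>Both summands must factor through t over one common object, which takes two Ore squares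
  in succession.\<close>

lemma cmp_add_right:
  assumes F: "F \<in> HDc X Y" "F' \<in> HDc X Y" and H: "H \<in> HDc Y Z" and ob: "ob X" "ob Y" "ob Z"
  shows "H \<ast> (F \<oplus>\<^bsub>HD X Y\<^esub> F') = (H \<ast> F) \<oplus>\<^bsub>HD X Z\<^esub> (H \<ast> F')"
proof -
  obtain P s f f' where 1: "we P X s" "ar P Y f" "F = fr X P Y s f" "ar P Y f'" "F' = fr X P Y s f'" by (rule HD_E2[OF F ob(1,2,2)])
  obtain Q t g where 2: "we Q Y t" "ar Q Z g" "H = fr Y Q Z t g" by (rule HD_E[OF H ob(2,3)])
  obtain R u v where R: "we R P u" "ar R Q v" "heq R Y (f \<star> u) (t \<star> v)" by (rule ore[OF 1(2) 2(1)])
  obtain S w v' where S: "we S R w" "ar S Q v'" "heq S Y ((f' \<star> u) \<star> w) (t \<star> v')"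
    by (rule ore[OF ar_comp[OF we_ar[OF R(1)] 1(4)] 2(1)])
  note uw = we_comp[OF S(1) R(1)]
  let ?s = "s \<star> (u \<star> w)" and ?v = "v \<star> w"
  note su = we_comp[OF uw 1(1)]
  note v = ar_comp[OF we_ar[OF S(1)] R(2)]
  have "heq S Y (f \<star> (u \<star> w)) (t \<star> ?v)" using heq_right[OF R(3) we_ar[OF S(1)]] by simp
  hence F1: "F = fr X S Y ?s (t \<star> ?v)"
    using fr_expand[OF 1(1,2) uw] fr_heq'[OF su] 1(3) by simp
  have F2: "F' = fr X S Y ?s (t \<star> v')"
    using fr_expand[OF 1(1,4) uw] fr_heq'[OF su] S(3) 1(5) by simp
  have "F \<oplus>\<^bsub>HD X Y\<^esub> F' = fr X S Y ?s (plus Y (t \<star> ?v) (t \<star> v'))"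
    unfolding F1 F2 by (rule add_fr[OF su ar_comp[OF v we_ar[OF 2(1)]] ar_comp[OF S(2) we_ar[OF 2(1)]]])
  also have "\<dots> = fr X S Y ?s (t \<star> plus Q ?v v')"
    by (rule fr_heq'[OF su heq_sym[OF comp_plus[OF v S(2) we_ar[OF 2(1)]]]])
  finally have "H \<ast> (F \<oplus>\<^bsub>HD X Y\<^esub> F') = fr X S Z ?s (g \<star> plus Q ?v v')"
    using cmp_fr'[OF su ar_plus[OF v S(2)] 2(1,2)] 2(3) by simp
  also have "\<dots> = fr X S Z ?s (plus Z (g \<star> ?v) (g \<star> v'))"
    by (rule fr_heq'[OF su comp_plus[OF v S(2) 2(2)]])
  also have "\<dots> = (H \<ast> F) \<oplus>\<^bsub>HD X Z\<^esub> (H \<ast> F')"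
    unfolding F1 F2 2(3) cmp_fr'[OF su v 2(1,2)] cmp_fr'[OF su S(2) 2(1,2)]
    by (rule add_fr[OF su ar_comp[OF v 2(2)] ar_comp[OF S(2) 2(2)], symmetric])
  finally show ?thesis .
qed

lemma cmp_smult_right:
  assumes F: "F \<in> HDc X Y" and H: "H \<in> HDc Y Z" and ob: "ob X" "ob Y" "ob Z" and c: "c \<in> carrier K"
  shows "H \<ast> (c \<odot>\<^bsub>HD X Y\<^esub> F) = c \<odot>\<^bsub>HD X Z\<^esub> (H \<ast> F)"
proof -
  obtain R s v Q t g where 1: "we R X s" "ar R Q v" "we Q Y t" "ar Q Z g" "F = fr X R Y s (t \<star> v)" "H = fr Y Q Z t g"
    "H \<ast> F = fr X R Z s (g \<star> v)" by (rule fr_compose_rep[OF F H ob])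
  have "c \<odot>\<^bsub>HD X Y\<^esub> F = fr X R Y s (t \<star> scal Q c v)"
    unfolding 1(5) smult_fr[OF 1(1) ar_comp[OF 1(2) we_ar[OF 1(3)]] c]
    by (rule fr_heq'[OF 1(1) heq_sym[OF comp_scal[OF 1(2) we_ar[OF 1(3)] c]]])
  hence "H \<ast> (c \<odot>\<^bsub>HD X Y\<^esub> F) = fr X R Z s (g \<star> scal Q c v)"
    using cmp_fr'[OF 1(1) ar_scal[OF 1(2) c] 1(3,4)] 1(6) by simp
  also have "\<dots> = fr X R Z s (scal Z c (g \<star> v))"
    by (rule fr_heq'[OF 1(1) comp_scal[OF 1(2,4) c]])
  finally show ?thesis unfolding 1(7) smult_fr[OF 1(1) ar_comp[OF 1(2,4)] c] .
qed

lemma cmp_add_left: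
  assumes F: "F \<in> HDc X Y" and H: "H \<in> HDc Y Z" "H' \<in> HDc Y Z" and ob: "ob X" "ob Y" "ob Z"
  shows "(H \<oplus>\<^bsub>HD Y Z\<^esub> H') \<ast> F = (H \<ast> F) \<oplus>\<^bsub>HD X Z\<^esub> (H' \<ast> F)"
proof -
  obtain Q t g g' where 1: "we Q Y t" "ar Q Z g" "H = fr Y Q Z t g" "ar Q Z g'" "H' = fr Y Q Z t g'" by (rule HD_E2[OF H ob(2,3,3)])
  obtain P s f where 2: "we P X s" "ar P Y f" "F = fr X P Y s f" by (rule HD_E[OF F ob(1,2)])
  obtain R u v where R: "we R P u" "ar R Q v" "heq R Y (f \<star> u) (t \<star> v)" by (rule ore[OF 2(2) 1(1)])
  note su = we_comp[OF R(1) 2(1)]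
  have F1: "F = fr X R Y (s \<star> u) (t \<star> v)"
    using fr_expand[OF 2(1,2) R(1)] fr_heq'[OF su R(3)] 2(3) by simp
  show ?thesis
    unfolding F1 1(3,5) add_fr[OF 1(1,2,4)] cmp_fr'[OF su R(2) 1(1,2)] cmp_fr'[OF su R(2) 1(1,4)]
      cmp_fr'[OF su R(2) 1(1) ar_plus[OF 1(2,4)]] add_fr[OF su ar_comp[OF R(2) 1(2)] ar_comp[OF R(2) 1(4)]] plus_comp ..
qed

lemma cmp_smult_left:
  assumes F: "F \<in> HDc X Y" and H: "H \<in> HDc Y Z" and ob: "ob X" "ob Y" "ob Z" and c: "c \<in> carrier K"
  shows "(c \<odot>\<^bsub>HD Y Z\<^esub> H) \<ast> F = c \<odot>\<^bsub>HD X Z\<^esub> (H \<ast> F)"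
proof -
  obtain R s v Q t g where 1: "we R X s" "ar R Q v" "we Q Y t" "ar Q Z g" "F = fr X R Y s (t \<star> v)" "H = fr Y Q Z t g"
    "H \<ast> F = fr X R Z s (g \<star> v)" by (rule fr_compose_rep[OF F H ob])
  show ?thesis
    unfolding 1(7) smult_fr[OF 1(1) ar_comp[OF 1(2,4)] c] unfolding 1(5,6) smult_fr[OF 1(3,4) c]
      cmp_fr'[OF 1(1-3) ar_scal[OF 1(4) c]] scal_comp ..
qed

lemma D_linear: "linear_category K D"
  unfolding linear_category_def kbilinear_def D_simps mem_Collect_eq
proof (intro conjI ballI)
  fix X Y Z :: "('k, 'u) dg_mod" and H assume "X \<in> Collect ob" "Y \<in> Collect ob" "Z \<in> Collect ob" "H \<in> HDc Y Z"
  thus "klinear K (HD X Y) (HD X Z) (derived_cmp G H)"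
    by (intro klinearI) (simp_all add: cmp_HD cmp_add_right cmp_smult_right)
next
  fix X Y Z :: "('k, 'u) dg_mod" and F assume "X \<in> Collect ob" "Y \<in> Collect ob" "Z \<in> Collect ob" "F \<in> HDc X Y"
  thus "klinear K (HD Y Z) (HD X Z) (\<lambda>H. derived_cmp G H F)"
    by (intro klinearI) (simp_all add: cmp_HD cmp_add_left cmp_smult_left)
next
  fix W X Y Z :: "('k, 'u) dg_mod" and F H L
  assume o: "W \<in> Collect ob" "X \<in> Collect ob" "Y \<in> Collect ob" "Z \<in> Collect ob"
    and a: "F \<in> HDc W X" "H \<in> HDc X Y" "L \<in> HDc Y Z"
  show "L \<ast> (H \<ast> F) = (L \<ast> H) \<ast> F" by (rule cmp_assoc[OF a o[unfolded mem_Collect_eq]])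
qed (auto simp: HD_module cmp_left_id cmp_right_id intro: fr_HD[OF we_id ar_id])

text \<open>The localization functor on closed maps.\<close>

abbreviation Q where "Q X Y f \<equiv> fr X X Y id_map f"

lemma strict_mor_Q: "strict_mor G X Y f = Q X Y f"
  by (simp add: strict_mor_def)

lemma Q_HD: "ar X Y f ==> Q X Y f \<in> HDc X Y"
  by (rule fr_HD[OF we_id[OF arD(1)]])

lemma Q_cmp_fr: "we P X s ==> ar P Y f ==> ar Y Z g ==> Q Y Z g \<ast> fr X P Y s f = fr X P Z s (g \<star> f)"
  using cmp_fr'[of P X s Y f Y id_map Z g] by (simp add: we_id arD)

lemma Q_cmp: "ar X Y f ==> ar Y Z g ==> Q Y Z g \<ast> Q X Y f = Q X Z (g \<star> f)"
  by (rule Q_cmp_fr[OF we_id[OF arD(1)]])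

lemma Q_heq: "heq X Y f g ==> Q X Y f = Q X Y g"
  by (rule fr_heq'[OF we_id[OF arD(1)[OF heqD(1)]]])

lemma fr_cmp_Q: "we P X s ==> ar P Y f ==> fr X P Y s f \<ast> Q P X s = Q P Y f"
  using cmp_fr'[of P P id_map P id_map X s Y f] by (simp add: we_id ar_id weD)

lemma fr_iso:
  assumes "we P X s" "we P Y f"
  shows "cat_iso D X Y (fr X P Y s f)"
proof -
  have 1: "fr Y P X f s \<ast> fr X P Y s f = fr X X X id_map id_map" if "we P X s" "we P Y f" for X Y s f
    using cmp_fr'[OF that(1) ar_id[OF weD(1)[OF that(1)]] that(2) we_ar[OF that(1)]]
      fr_expand[OF we_id[OF weD(2)[OF that(1)]] ar_id[OF weD(2)[OF that(1)]] that(1)] by simp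
  show ?thesis
    unfolding cat_iso_def
    using 1[OF assms] 1[OF assms(2,1)] fr_HD[OF assms(1) we_ar[OF assms(2)]] fr_HD[OF assms(2) we_ar[OF assms(1)]]
      weD(2)[OF assms(1)] weD(2)[OF assms(2)] by auto
qed

lemma Q_iso: "we X Y f ==> cat_iso D X Y (Q X Y f)"
  by (rule fr_iso[OF we_id[OF weD(1)]])

text \<open>Ore squares for both composites with the inverse give quasi-isomorphisms g v and f v'.
  The first makes f injective on homology, the second makes it surjective.\<close>

lemma iso_fr_we:
  assumes s: "we P X s" "ar P Y f" and i: "cat_iso D X Y (fr X P Y s f)"
  shows "we P Y f"
proof -
  note ob = weD(2)[OF s(1)] arD(2)[OF s(2)]
  obtain H where H: "H \<in> HDc Y X" "H \<ast> fr X P Y s f = fr X X X id_map id_map"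
     "fr X P Y s f \<ast> H = fr Y Y Y id_map id_map"
    using i unfolding cat_iso_def D_simps by blast
  obtain Q t g where Q: "we Q Y t" "ar Q X g" "H = fr Y Q X t g" by (rule HD_E[OF H(1) ob(2,1)])
  have split: "\<exists>R u v. we R P u \<and> ar R Q v \<and> heq R Y (f \<star> u) (t \<star> v) \<and> we R X (g \<star> v)"
    if s: "we P X s" "ar P Y f" and Q: "we Q Y t" "ar Q X g" and e: "fr Y Q X t g \<ast> fr X P Y s f = fr X X X id_map id_map"
    for X Y P Q s f t g
  proof -
    obtain R u v where R: "we R P u" "ar R Q v" "heq R Y (f \<star> u) (t \<star> v)" by (rule ore[OF s(2) Q(1)])
    note su = we_comp[OF R(1) s(1)]
    have "fr X R X (s \<star> u) (g \<star> v) = fr X X X id_map id_map" using e cmp_fr[OF s Q R] by simp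
    then obtain W w w' where W: "we W R w" "we W X w'" "heq W X ((s \<star> u) \<star> w) (id_map \<star> w')" "heq W X ((g \<star> v) \<star> w) (id_map \<star> w')"
      by (rule fr_eqE[OF _ su ar_comp[OF R(2) Q(2)]])
    have "we W X ((g \<star> v) \<star> w)" using we_heq[OF heq_sym[OF W(4)]] W(2) by simp
    hence "we R X (g \<star> v)" using we_right[OF _ W(1) ar_comp[OF R(2) Q(2)]] by simp
    thus ?thesis using R by blast
  qed
  obtain R u v where R: "we R P u" "ar R Q v" "heq R Y (f \<star> u) (t \<star> v)" "we R X (g \<star> v)"
    using split[OF s Q(1,2)] H(2) Q(3) by blast
  obtain S u' v' where S: "we S Q u'" "ar S P v'" "heq S X (g \<star> u') (s \<star> v')" "we S Y (f \<star> v')"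
    using split[OF Q(1,2) s] H(3) Q(3) by blast
  note obj = weD(1)[OF s(1)] weD(1)[OF R(1)] weD(1)[OF S(1)] weD(1)[OF Q(1)]
  show ?thesis unfolding we_def
  proof (intro conjI)
    show "ob P" "ob Y" using obj ob by auto
    show "f \<in> qi P Y"
      unfolding qi_bij_iff bij_betw_def
    proof (intro conjI allI)
      fix p
      note fc = arD(3)[OF s(2)] and vc = arD(3)[OF R(2)] and vc' = arD(3)[OF S(2)] and gc = arD(3)[OF Q(2)]
        and uc = qi_cl[OF weD(3)[OF R(1)]] and tc = qi_cl[OF weD(3)[OF Q(1)]]
      let ?H = "\<lambda>Z f. hmap Z p f"
      show "f \<in> cl P Y" by (rule fc)
      have ft: "?H Y f (?H P u z) = ?H Y t (?H Q v z)" if "z \<in> hel R p" for z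
        using homology_map_hty[OF heqD(3)[OF R(3)] arD(3)[OF heqD(1)[OF R(3)]] arD(3)[OF heqD(2)[OF R(3)]] obj(2) ob(2) that]
          homology_map_comp[OF uc fc obj(2,1) ob(2) that] homology_map_comp[OF vc tc obj(2,4) ob(2) that] by simp
      show "inj_on (?H Y f) (hel P p)"
      proof (rule inj_onI)
        fix x y assume xy: "x \<in> hel P p" "y \<in> hel P p" and e: "?H Y f x = ?H Y f y"
        note su = bij_betw_imp_surj_on[OF qi_bij[OF weD(3)[OF R(1)], of p], symmetric]
        obtain a b where ab: "a \<in> hel R p" "x = ?H P u a" "b \<in> hel R p" "y = ?H P u b"
          using xy unfolding su by (elim imageE) blast
        have "?H Q v a = ?H Q v b"
          by (rule inj_onD[OF bij_betw_imp_inj_on[OF qi_bij[OF weD(3)[OF Q(1)]]] _ homology_map_closed[OF vc obj(2,4) ab(1)]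
            homology_map_closed[OF vc obj(2,4) ab(3)]]) (use e ab ft in simp)
        hence "?H X (g \<star> v) a = ?H X (g \<star> v) b"
          using homology_map_comp[OF vc gc obj(2,4) ob(1)] ab by simp
        thus "x = y" using inj_onD[OF bij_betw_imp_inj_on[OF qi_bij[OF weD(3)[OF R(4)]]] _ ab(1,3)] ab(2,4) by simp
      qed
      show "?H Y f ` hel P p = hel Y p"
      proof (intro equalityI subsetI)
        fix y assume "y \<in> ?H Y f ` hel P p"
        thus "y \<in> hel Y p" using homology_map_closed[OF fc obj(1) ob(2)] by blast
      next
        fix y assume "y \<in> hel Y p"
        then obtain z where z: "z \<in> hel S p" "y = ?H Y (f \<star> v') z"
          unfolding bij_betw_imp_surj_on[OF qi_bij[OF weD(3)[OF S(4)], of p], symmetric] by (elim imageE)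
        thus "y \<in> ?H Y f ` hel P p"
          unfolding z(2) homology_map_comp[OF vc' fc obj(3,1) ob(2) z(1)] by (intro imageI homology_map_closed[OF vc' obj(3,1) z(1)])
      qed
    qed
  qed
qed

subsection \<open>The shift functor\<close>

abbreviation sh :: "int \<Rightarrow> (int \<Rightarrow> 'u \<Rightarrow> 'u) \<Rightarrow> int \<Rightarrow> 'u \<Rightarrow> 'u" where "sh n f \<equiv> (\<lambda>p. f (p + n))"

lemma shift_cl:
  assumes "f \<in> cl X Y" "ob X" "ob Y"
  shows "sh n f \<in> cl (Sh n X) (Sh n Y)"
proof (rule clI[OF shift_hm[OF cl_hm[OF assms(1)]]])
  fix p x assume "x \<in> elt (Sh n X) p"
  hence x: "x \<in> elt X (p + n)" by simp
  have e: "p + 1 + n = p + n + 1" by simp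
  have "f (p + n + 1) (sign_pow (gr X (p + n + 1)) n (diff X (p + n) x)) = sign_pow (gr Y (p + n + 1)) n (diff Y (p + n) (f (p + n) x))"
    using x cl_simps[OF assms] d_simps[OF assms(2)] by (auto simp: sign_pow_def)
  thus "sh n f (p + 1) (diff (Sh n X) p x) = diff (Sh n Y) p (sh n f p x)"
    by (simp add: e)
qed

lemma shift_ar: "ar X Y f ==> ar (Sh n X) (Sh n Y) (sh n f)"
  by (simp add: ar_def shift_cl shift_ob)

lemma shift_we:
  assumes "we X Y f"
  shows "we (Sh n X) (Sh n Y) (sh n f)"
proof -
  note f = weD(3)[OF assms] and ob = weD(1,2)[OF assms]
  have "sh n f \<in> qi (Sh n X) (Sh n Y)"
    by (rule qiI[OF shift_cl[OF qi_cl[OF f] ob] shift_ob[OF ob(1)] shift_ob[OF ob(2)]])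
      (use qiD(1)[OF f ob] qiD(2)[OF f ob] in \<open>auto simp: cy_shift bd_shift ob\<close>, metis)
  thus ?thesis using shift_ob ob by (simp add: we_def)
qed

text \<open>The shifted differentials carry the sign (-1)^n, and so must the homotopy.\<close>

lemma shift_heq:
  assumes "heq X Y f g"
  shows "heq (Sh n X) (Sh n Y) (sh n f) (sh n g)"
proof -
  note f = arD(3)[OF heqD(1)[OF assms]] and g = arD(3)[OF heqD(2)[OF assms]] and ob = arD(1,2)[OF heqD(1)[OF assms]]
  note sob = shift_ob[OF ob(1), of n] shift_ob[OF ob(2), of n]
  obtain h where h: "h \<in> hm X Y (- 1)" and
    e: "!!p x. x \<in> elt X p ==>
      f p x = g p x \<oplus>[Y p] (diff Y (p - 1) (h p x) \<oplus>[Y p] h (p + 1) (diff X p x))"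
    by (rule htyE[OF heqD(3)[OF assms] f g ob]) blast
  note [simp] = hm_simps[OF h ob] d_simps[OF ob(1)] d_simps[OF ob(2)] d_m1[OF ob(2)]
  let ?h = "\<lambda>p x. sign_pow (gr Y (p - 1 + n)) n (sh n h p x)"
  have hh: "?h \<in> hm (Sh n X) (Sh n Y) (- 1)"
  proof (cases "even n")
    case True
    thus ?thesis using shift_hm[OF h, of n] by (simp add: sign_pow_def)
  next
    case False
    thus ?thesis using hm_neg[OF shift_hm[OF h, of n] sob, of "\<lambda>p. p - 1"] by (simp add: sign_pow_def)
  qed
  have "hty (Sh n X) (Sh n Y) (sh n f) (sh n g)"
  proof (rule htyI[OF hh shift_cl[OF f ob] shift_cl[OF g ob] sob])
    fix p x assume "x \<in> elt (Sh n X) p"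
    hence x: "x \<in> elt X (p + n)" by simp
    have d: "p - 1 + n = p + n - 1" "p + n - 1 + 1 = p + n" "p + 1 - 1 + n = p + n" "p + 1 + n = p + n + 1" by simp_all
    show "sh n f p x = sh n g p x \<oplus>[(Sh n Y) p] (diff (Sh n Y) (p - 1) (?h p x) \<oplus>[(Sh n Y) p]
        ?h (p + 1) (diff (Sh n X) p x))"
      unfolding shift_obj_simps d e[OF x] using x by (auto simp: sign_pow_def ag_simps ob)
  qed
  thus ?thesis using shift_cl[OF f ob] shift_cl[OF g ob] sob by (simp add: heq_def)
qed

lemma qi_inverse:
  assumes "f \<in> cl X Y" "g \<in> cl Y X" "ob X" "ob Y"
    "!!p x. x \<in> elt X p ==> g p (f p x) = x" "!!p x. x \<in> elt Y p ==> f p (g p x) = x"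
  shows "f \<in> qi X Y"
proof (rule qiI[OF assms(1,3,4)])
  fix x p assume "x \<in> cy X p" "f p x \<in> bd Y p"
  thus "x \<in> bd X p" using cl_bd[OF assms(2,4,3), of "f p x" p] assms(5)[of x p] by (simp add: cyD(1))
next
  fix y p assume y: "y \<in> cy Y p"
  show "\<exists>x\<in>cy X p. y \<ominus>[Y p] f p x \<in> bd Y p"
    by (rule bexI[OF _ cl_cy[OF assms(2,4,3) y]]) (use y assms(6) bd_simps(1)[OF assms(4)] in \<open>simp add: cyD(1) abelian_group.minus_self assms\<close>)
qed

text \<open>The two modules are not equal as records: a double sign cancels only on the carrier. So
  the identity map serves as an isomorphism between them.\<close>

lemma id_shift_shift:
  assumes "ob X"
  shows "we (Sh m (Sh n X)) (Sh (n + m) X) id_map" "we (Sh (n + m) X) (Sh m (Sh n X)) id_map"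
proof -
  have d: "p + (n + m) = p + m + n" "p + m + 1 + n = p + m + n + 1" "p + q + m + n = p + m + n + q" for p q by simp_all
  note ob = shift_ob[OF shift_ob[OF assms]] shift_ob[OF assms]
  have h: "id_map \<in> hm (Sh m (Sh n X)) (Sh (n + m) X) 0" "id_map \<in> hm (Sh (n + m) X) (Sh m (Sh n X)) 0"
    by (rule hmI; simp add: id_map_def d)+
  have dd: "diff (Sh m (Sh n X)) p x = diff (Sh (n + m) X) p x" if "x \<in> elt X (p + m + n)" for p x
    using sign_pow_simps(4)[OF ob_ag[OF assms] d_simps(1)[OF assms that refl], of m n] by (simp add: d)
  have c: "id_map \<in> cl (Sh m (Sh n X)) (Sh (n + m) X)" "id_map \<in> cl (Sh (n + m) X) (Sh m (Sh n X))"
    by (rule clI[OF h(1)], simp add: id_map_def dd del: shift_obj_simps(2), rule clI[OF h(2)], simp add: id_map_def d dd del: shift_obj_simps(2))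
  show "we (Sh m (Sh n X)) (Sh (n + m) X) id_map" "we (Sh (n + m) X) (Sh m (Sh n X)) id_map"
    using qi_inverse[OF c ob] qi_inverse[OF c(2,1) ob(2,1)] ob by (auto simp: we_def id_map_def)
qed

lemma shift_0 [simp]: "Sh 0 X = X"
  by (simp add: shift_obj_def sign_pow_def)

lemma unshift:
  assumes "ob X"
  shows "we (Sh (- n) (Sh n X)) X id_map" "we (Sh n (Sh (- n) X)) X id_map"
    "we X (Sh n (Sh (- n) X)) id_map"
  using id_shift_shift[OF assms, of "- n" n] id_shift_shift[OF assms, of n "- n"] by simp_all

lemma unshift_ar: "ar Y (Sh n X) f ==> ob X ==> ar (Sh (- n) Y) X (sh (- n) f)"
  using ar_comp[OF shift_ar[of Y "Sh n X" f "- n"] we_ar[OF unshift(1)[of X n]]] by simp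

lemma unshift_we: "we Y (Sh n X) f ==> ob X ==> we (Sh (- n) Y) X (sh (- n) f)"
  using we_comp[OF shift_we[of Y "Sh n X" f "- n"] unshift(1)[of X n]] by simp

lemma unshift_heq: "heq Y (Sh n X) f g ==> ob X ==> heq (Sh (- n) Y) X (sh (- n) f) (sh (- n) g)"
  using heq_left[OF shift_heq[of Y "Sh n X" f g "- n"] we_ar[OF unshift(1)[of X n]]] by simp

lemma sh_comp: "sh n (f \<star> g) = sh n f \<star> sh n g"
  by (simp add: gcomp_def)

abbreviation sm where "sm n \<equiv> shift_mor K A n"

lemma sm_fr:
  assumes s: "we P X s" "ar P Y f"
  shows "sm n (fr X P Y s f) = fr (Sh n X) (Sh n P) (Sh n Y) (sh n s) (sh n f)"
proof -
  have wd: "fr (Sh n X') (Sh n P') (Sh n Y') (sh n s') (sh n f') =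
      fr (Sh n X) (Sh n P) (Sh n Y) (sh n s) (sh n f)"
    if m: "Roof X' P' Y' s' f' \<in> fr X P Y s f" for X' P' Y' s' f'
  proof -
    note m1 = in_frD[OF m]
    obtain R a b where R: "we R P a" "we R P' b" "heq R X (s \<star> a) (s' \<star> b)" "heq R Y (f \<star> a) (f' \<star> b)"
      by (rule fr_eqE[OF m1(7) s(1,2)])
    show ?thesis
      unfolding m1(1,2)
      by (rule fr_eqI[OF shift_we[OF m1(5)] shift_ar[OF m1(6)] shift_we[OF s(1)] shift_ar[OF s(2)] shift_we[OF R(2)] shift_we[OF R(1)]])
       (use shift_heq[OF heq_sym[OF R(3)], of n] shift_heq[OF heq_sym[OF R(4)], of n] in \<open>simp_all add: sh_comp\<close>)
  qed
  have "{fr (Sh n X') (Sh n P') (Sh n Y') (sh n s') (sh n f') | X' P' Y' s' f'. Roof X' P' Y' s' f' \<in> fr X P Y s f} =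
    {fr (Sh n X) (Sh n P) (Sh n Y) (sh n s) (sh n f)}" (is "?S = _")
  proof (intro equalityI subsetI)
    fix F assume "F \<in> ?S"
    thus "F \<in> {fr (Sh n X) (Sh n P) (Sh n Y) (sh n s) (sh n f)}"
      unfolding mem_Collect_eq by (elim exE conjE) (simp only: wd singleton_iff)
  next
    fix F assume F: "F \<in> {fr (Sh n X) (Sh n P) (Sh n Y) (sh n s) (sh n f)}"
    show "F \<in> ?S"
      unfolding mem_Collect_eq
      by (intro exI conjI, rule F[unfolded singleton_iff]) (use roof_rel_refl[OF s(1,2)] in simp)
  qed
  thus ?thesis unfolding shift_mor_def by (simp only: cSup_singleton)
qed

lemma sm_HD: "F \<in> HDc X Y ==> ob X ==> ob Y ==> sm n F \<in> carrier (HD (Sh n X) (Sh n Y))"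
  by (rule HD_E, assumption+) (simp only: sm_fr fr_HD shift_we shift_ar)

lemma sm_cmp:
  assumes "F \<in> HDc X Y" "H \<in> HDc Y Z" "ob X" "ob Y" "ob Z"
  shows "sm n (H \<ast> F) = sm n H \<ast> sm n F"
proof -
  obtain R s v Q t g where 1: "we R X s" "ar R Q v" "we Q Y t" "ar Q Z g" "F = fr X R Y s (t \<star> v)" "H = fr Y Q Z t g"
    "H \<ast> F = fr X R Z s (g \<star> v)" by (rule fr_compose_rep[OF assms])
  show ?thesis
    unfolding 1(7) sm_fr[OF 1(1) ar_comp[OF 1(2,4)]] unfolding 1(5,6) sm_fr[OF 1(3,4)] sm_fr[OF 1(1) ar_comp[OF 1(2) we_ar[OF 1(3)]]]
    unfolding sh_comp cmp_fr'[OF shift_we[OF 1(1)] shift_ar[OF 1(2)] shift_we[OF 1(3)] shift_ar[OF 1(4)]] ..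
qed

lemma sm_id:
  assumes "ob X"
  shows "sm n (fr X X X id_map id_map) = fr (Sh n X) (Sh n X) (Sh n X) id_map id_map"
  unfolding sm_fr[OF we_id[OF assms] ar_id[OF assms]] by (simp add: id_map_def)

lemma sm_add:
  assumes "F \<in> HDc X Y" "F' \<in> HDc X Y" "ob X" "ob Y"
  shows "sm n (F \<oplus>\<^bsub>HD X Y\<^esub> F') = sm n F \<oplus>\<^bsub>HD (Sh n X) (Sh n Y)\<^esub> sm n F'"
proof -
  obtain P s f f' where 1: "we P X s" "ar P Y f" "F = fr X P Y s f" "ar P Y f'" "F' = fr X P Y s f'" by (rule HD_E2[OF assms(1-4,4)])
  have e: "sh n (plus Y f f') = plus (Sh n Y) (sh n f) (sh n f')" by (simp add: plus_def)
  show ?thesis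
    unfolding 1(3,5) add_fr[OF 1(1,2,4)] sm_fr[OF 1(1,2)] sm_fr[OF 1(1,4)] sm_fr[OF 1(1) ar_plus[OF 1(2,4)]] e
      add_fr[OF shift_we[OF 1(1)] shift_ar[OF 1(2)] shift_ar[OF 1(4)]] ..
qed

text \<open>Equality of the shifted fractions is a homotopy after a cover of Sigma^n P, and this
  cover can be shifted back.\<close>

lemma sm_inj:
  assumes "F \<in> HDc X Y" "F' \<in> HDc X Y" "ob X" "ob Y" "sm n F = sm n F'"
  shows "F = F'"
proof -
  obtain P s f f' where 1: "we P X s" "ar P Y f" "F = fr X P Y s f" "ar P Y f'" "F' = fr X P Y s f'" by (rule HD_E2[OF assms(1-4,4)])
  obtain R u where R: "we R (Sh n P) u" "heq R (Sh n Y) (sh n f \<star> u) (sh n f' \<star> u)"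
    by (rule fr_same_eqE[OF assms(5)[unfolded 1(3,5) sm_fr[OF 1(1,2)] sm_fr[OF 1(1,4)]] shift_we[OF 1(1)] shift_ar[OF 1(2)] shift_ar[OF 1(4)]])
  note u = unshift_we[OF R(1) weD(1)[OF 1(1)]]
  have "heq (Sh (- n) R) Y (f \<star> sh (- n) u) (f' \<star> sh (- n) u)"
    using unshift_heq[OF R(2) assms(4)] by (simp add: gcomp_def)
  thus ?thesis
    unfolding 1(3,5) using fr_expand[OF 1(1,2) u] fr_expand[OF 1(1,4) u] fr_heq'[OF we_comp[OF u 1(1)]] by simp
qed

lemma sm_surj:
  assumes F: "F \<in> carrier (HD (Sh n X) (Sh n Y))" and ob: "ob X" "ob Y"
  shows "\<exists>F'\<in>HDc X Y. sm n F' = F"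
proof -
  obtain P s f where 1: "we P (Sh n X) s" "ar P (Sh n Y) f" "F = fr (Sh n X) P (Sh n Y) s f"
    by (rule HD_E[OF F shift_ob[OF ob(1)] shift_ob[OF ob(2)]])
  note s = unshift_we[OF 1(1) ob(1)] and f = unshift_ar[OF 1(2) ob(2)]
  have "sm n (fr X (Sh (- n) P) Y (sh (- n) s) (sh (- n) f)) =
      fr (Sh n X) (Sh n (Sh (- n) P)) (Sh n Y) s f"
    unfolding sm_fr[OF s f] by simp
  also have "\<dots> = F"
    using fr_expand[OF 1(1,2) unshift(2)[OF weD(1)[OF 1(1)]]] 1(3) by simp
  finally show ?thesis using fr_HD[OF s f] by blast
qed

lemma shift_shift_iso: "ob X ==> isomorphic D (Sh m (Sh n X)) (Sh (n + m) X)"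
  unfolding isomorphic_def using Q_iso[OF id_shift_shift(1)] by blast

subsection \<open>Triangles of the derived category\<close>

sublocale Dl: lincat K "DA K A"
  by unfold_locales (rule D_linear)

lemma Dmor_iff: "Dl.mor X Y F \<longleftrightarrow> ob X \<and> ob Y \<and> F \<in> HDc X Y"
  by (simp add: Dl.mor_def)

lemma Dmor_fr: "we P X s ==> ar P Y f ==> Dl.mor X Y (fr X P Y s f)"
  by (simp add: Dmor_iff fr_HD weD arD)

lemma Dmor_Q: "ar X Y f ==> Dl.mor X Y (Q X Y f)"
  by (simp add: Dmor_iff Q_HD arD)

lemma Dmor_sm: "Dl.mor X Y F ==> Dl.mor (Sh n X) (Sh n Y) (sm n F)"
  by (simp add: Dmor_iff sm_HD shift_ob)

lemma sm_Q: "ar X Y f ==> sm n (Q X Y f) = Q (Sh n X) (Sh n Y) (sh n f)"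
  using sm_fr[OF we_id[OF arD(1)], of X Y f Y f n] by (simp add: id_map_def)

lemma sm_iso:
  assumes "cat_iso D X Y F"
  shows "cat_iso D (Sh n X) (Sh n Y) (sm n F)"
proof -
  obtain H where H: "Dl.mor X Y F" "Dl.mor Y X H" "H \<ast> F = ident D X" "F \<ast> H = ident D Y"
    using assms by (auto elim: Dl.isoE)
  show ?thesis
  proof (rule Dl.isoI[OF Dmor_sm[OF H(1)] Dmor_sm[OF H(2)]])
    show "cmp D (sm n H) (sm n F) = ident D (Sh n X)"
      using H sm_cmp[of F X Y H X n] sm_id[of X n] by (simp add: Dmor_iff)
    show "cmp D (sm n F) (sm n H) = ident D (Sh n Y)"
      using H sm_cmp[of H Y X F Y n] sm_id[of Y n] by (simp add: Dmor_iff)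
  qed
qed

lemma Q_neg:
  assumes "ar X Y f"
  shows "\<ominus>\<^bsub>HD X Y\<^esub> Q X Y f = Q X Y (\<lambda>p x. \<ominus>[Y p] f p x)"
proof -
  note ob = arD(1,2)[OF assms]
  have n: "ar X Y (\<lambda>p x. \<ominus>[Y p] f p x)" using assms by (simp add: ar_def cl_neg)
  have "Q X Y (\<lambda>p x. \<ominus>[Y p] f p x) \<oplus>\<^bsub>HD X Y\<^esub> Q X Y f = Q X Y (zm Y)"
    unfolding add_fr[OF we_id[OF ob(1)] n assms]
    by (rule Q_heq[OF heq_eq[OF ar_plus[OF n assms] ar_zero[OF ob]]]) (use ar_simps[OF assms] ob in \<open>simp add: plus_app ag_simps\<close>)
  hence "Q X Y (\<lambda>p x. \<ominus>[Y p] f p x) \<oplus>\<^bsub>HD X Y\<^esub> Q X Y f = \<zero>\<^bsub>HD X Y\<^esub>"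
    using zero_fr[OF we_id[OF ob(1)] ob(2)] by simp
  thus ?thesis
    using abelian_group.minus_equality[OF module_ag[OF HD_module[OF ob]]] Q_HD[OF n] Q_HD[OF assms] by blast
qed

text \<open>By \<open>null_cover\<close>, the identity of E becomes null-homotopic after a
  quasi-isomorphism, so its fraction is zero.\<close>

lemma acyclic_zero:
  assumes "ob E" "acyclic E"
  shows "zero_object D E"
proof -
  obtain R u where R: "ob R" "u \<in> qi R E" "hty R E (id_map \<star> u) (zm E)"
    using null_cover[OF assms(1,1) id_cl[OF assms(1)] assms(2)] by blast
  have u: "we R E u" using R assms by (simp add: we_def)
  have h: "heq R E u (zm E)" using R assms qi_cl[OF R(2)] cl_zero by (simp add: heq_def)
  have "Q E E id_map = fr E R E u u" using fr_expand[OF we_id[OF assms(1)] ar_id[OF assms(1)] u] by simp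
  also have "\<dots> = fr E R E u (zm E)" by (rule fr_heq'[OF u h])
  also have "\<dots> = \<zero>\<^bsub>HD E E\<^esub>" using zero_fr[OF u assms(1)] by simp
  finally show ?thesis using assms by (simp add: zero_object_def)
qed

lemma D_tri_iff:
  "(X, Y, Z, F, H, L) \<in> DT \<longleftrightarrow> Dl.mor X Y F \<and> Dl.mor Y Z H \<and> Dl.mor Z (Sh 1 X) L \<and>
    (\<exists>M N \<phi> C i j \<rho> \<pi> a b c. ar M N \<phi> \<and> cone M N \<phi> C i j \<rho> \<pi> \<and> cat_iso D X M a \<and> cat_iso D Y N b \<and> cat_iso D Z C c \<and>
      b \<ast> F = Q M N \<phi> \<ast> a \<and> c \<ast> H = Q N C i \<ast> b \<and> sm 1 a \<ast> L = Q C (Sh 1 M) \<pi> \<ast> c)"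
proof -
  have iso: "cat_iso (derived_category G) = cat_iso D"
    by (simp add: fun_eq_iff cat_iso_def derived_category_def strict_mor_Q)
  have dc: "Obj (derived_category G) = Collect ob" "HOM (derived_category G) = HD" "cmp (derived_category G) = derived_cmp G"
    by (simp_all add: derived_category_def)
  have mc: "(\<exists>j. mapping_cone K A M N \<phi> C i j \<pi> \<and> P) \<longleftrightarrow> (\<exists>j \<rho>. cone M N \<phi> C i j \<rho> \<pi> \<and> P)"
    if "ob M" "ob N" "\<phi> \<in> cl M N" for M N \<phi> C i \<pi> P
    using cone_mapping_cone[OF _ that] mapping_cone_cone[OF _ that] by blast
  have "(\<exists>M\<in>dg_obj G. \<exists>N\<in>dg_obj G. \<exists>\<phi>\<in>cl M N. \<exists>C i j \<pi>. mapping_cone K A M N \<phi> C i j \<pi> \<and> P M N \<phi> C i \<pi>) \<longleftrightarrow>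
     (\<exists>M N \<phi> C i j \<rho> \<pi>. ar M N \<phi> \<and> cone M N \<phi> C i j \<rho> \<pi> \<and> P M N \<phi> C i \<pi>)" for P
  proof
    assume "\<exists>M\<in>dg_obj G. \<exists>N\<in>dg_obj G. \<exists>\<phi>\<in>cl M N. \<exists>C i j \<pi>. mapping_cone K A M N \<phi> C i j \<pi> \<and> P M N \<phi> C i \<pi>"
    then obtain M N \<phi> C i j \<pi> where 1: "ob M" "ob N" "\<phi> \<in> cl M N" "mapping_cone K A M N \<phi> C i j \<pi>" "P M N \<phi> C i \<pi>" by auto
    then obtain \<rho> where "cone M N \<phi> C i j \<rho> \<pi>" using mapping_cone_cone by blast
    thus "\<exists>M N \<phi> C i j \<rho> \<pi>. ar M N \<phi> \<and> cone M N \<phi> C i j \<rho> \<pi> \<and> P M N \<phi> C i \<pi>" using 1 unfolding ar_def by blast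
  next
    assume "\<exists>M N \<phi> C i j \<rho> \<pi>. ar M N \<phi> \<and> cone M N \<phi> C i j \<rho> \<pi> \<and> P M N \<phi> C i \<pi>"
    then obtain M N \<phi> C i j \<rho> \<pi> where 1: "ob M" "ob N" "\<phi> \<in> cl M N" "cone M N \<phi> C i j \<rho> \<pi>" "P M N \<phi> C i \<pi>" unfolding ar_def by auto
    have "mapping_cone K A M N \<phi> C i j \<pi>" by (rule cone_mapping_cone[OF 1(4,1,2,3)])
    thus "\<exists>M\<in>dg_obj G. \<exists>N\<in>dg_obj G. \<exists>\<phi>\<in>cl M N. \<exists>C i j \<pi>. mapping_cone K A M N \<phi> C i j \<pi> \<and> P M N \<phi> C i \<pi>"
      unfolding G_simps using 1 by blast
  qed
  note * = this[of "\<lambda>M N \<phi> C i \<pi>. \<exists>a b c. cat_iso D X M a \<and> cat_iso D Y N b \<and> cat_iso D Z C c \<and>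
      b \<ast> F = Q M N \<phi> \<ast> a \<and> c \<ast> H = Q N C i \<ast> b \<and> sm 1 a \<ast> L = Q C (Sh 1 M) \<pi> \<ast> c"]
  show ?thesis
    unfolding derived_triangles_def Let_def mem_Collect_eq prod.case iso dc strict_mor_Q * Dmor_iff
    by (rule iffI; elim conjE; intro conjI; (assumption | (simp add: shift_ob; fail)))
qed

lemmas D_asc = Dl.asc[unfolded D_simps(3)] and D_idl = Dl.idl[unfolded D_simps(3,4)] and D_idr = Dl.idr[unfolded D_simps(3,4)]
  and D_mc = Dl.mc[unfolded D_simps(3)] and D_iscr = Dl.iso_cancel_right[unfolded D_simps(3)] and D_isoE = Dl.isoE[unfolded D_simps(3)]
  and D_paste = Dl.paste[unfolded D_simps(3)] and D_flip = Dl.flip[unfolded D_simps(3)] and D_conj = Dl.conjugate[unfolded D_simps(3)]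

lemma sm_comp: "Dl.mor U V F ==> Dl.mor V W H ==> sm n (H \<ast> F) = sm n H \<ast> sm n F"
  using sm_cmp[of F U V H W n] by (simp add: Dmor_iff)

lemma sm_inverse: "Dl.mor U V F ==> Dl.mor V U H ==> H \<ast> F = ident D U ==> sm n H \<ast> sm n F = ident D (Sh n U)"
  using sm_comp[of U V F U H n] sm_id[of U n] by (simp add: Dmor_iff)

lemma cone_ar:
  assumes "cone M N \<phi> C i j \<rho> \<pi>" "ar M N \<phi>"
  shows "ar N C i" "ar C (Sh 1 M) \<pi>"
  using cone_i_cl[OF assms(1) arD[OF assms(2)]] cone_pi_cl[OF assms(1) arD[OF assms(2)]]
    arD(1,2)[OF assms(2)] cone_ob[OF assms(1)] shift_ob by (auto simp: ar_def)

lemma D_std_mor: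
  assumes "cone M N \<phi> C i j \<rho> \<pi>" "ar M N \<phi>"
  shows "Dl.mor M N (Q M N \<phi>)" "Dl.mor N C (Q N C i)" "Dl.mor C (Sh 1 M) (Q C (Sh 1 M) \<pi>)"
  using Dmor_Q[OF assms(2)] Dmor_Q[OF cone_ar(1)[OF assms]] Dmor_Q[OF cone_ar(2)[OF assms]] .

text \<open>The squares are recorded in both directions, so that morphisms can be carried to the
  standard cones and the fillers back again.\<close>

lemma D_tri_std_isos:
  assumes t: "(X, Y, Z, f, g, h) \<in> DT"
  obtains M N \<phi> C i j \<rho> \<pi> a b c a' b' c' where "ar M N \<phi>" "cone M N \<phi> C i j \<rho> \<pi>"
    "cat_iso D X M a" "cat_iso D Y N b" "cat_iso D Z C c" "cat_iso D M X a'" "cat_iso D N Y b'" "cat_iso D C Z c'"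
    "b \<ast> f = Q M N \<phi> \<ast> a" "c \<ast> g = Q N C i \<ast> b" "sm 1 a \<ast> h = Q C (Sh 1 M) \<pi> \<ast> c"
    "b' \<ast> Q M N \<phi> = f \<ast> a'" "c' \<ast> Q N C i = g \<ast> b'" "sm 1 a' \<ast> Q C (Sh 1 M) \<pi> = h \<ast> c'"
    "a' \<ast> a = ident D X" "a \<ast> a' = ident D M" "b' \<ast> b = ident D Y" "b \<ast> b' = ident D N"
proof -
  obtain M N \<phi> C i j \<rho> \<pi> a b c where 1: "ar M N \<phi>" "cone M N \<phi> C i j \<rho> \<pi>" "cat_iso D X M a" "cat_iso D Y N b" "cat_iso D Z C c"
      "b \<ast> f = Q M N \<phi> \<ast> a" "c \<ast> g = Q N C i \<ast> b" "sm 1 a \<ast> h = Q C (Sh 1 M) \<pi> \<ast> c"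
    and tm: "Dl.mor X Y f" "Dl.mor Y Z g" "Dl.mor Z (Sh 1 X) h"
    using t unfolding D_tri_iff by blast
  note s = D_std_mor[OF 1(2,1)]
  obtain a' where a: "Dl.mor X M a" "Dl.mor M X a'" "a' \<ast> a = ident D X" "a \<ast> a' = ident D M" "cat_iso D M X a'" using 1(3) by (rule D_isoE)
  obtain b' where b: "Dl.mor Y N b" "Dl.mor N Y b'" "b' \<ast> b = ident D Y" "b \<ast> b' = ident D N" "cat_iso D N Y b'" using 1(4) by (rule D_isoE)
  obtain c' where c: "Dl.mor Z C c" "Dl.mor C Z c'" "c' \<ast> c = ident D Z" "c \<ast> c' = ident D C" "cat_iso D C Z c'" using 1(5) by (rule D_isoE)
  show thesis
    by (rule that[OF 1(1-5) a(5) b(5) c(5) 1(6-8) D_flip[OF tm(1) s(1) a(1,2,4) b(1-3) 1(6)] D_flip[OF tm(2) s(2) b(1,2,4) c(1-3) 1(7)]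
      D_flip[OF tm(3) s(3) c(1,2,4) Dmor_sm[OF a(1)] Dmor_sm[OF a(2)] sm_inverse[OF a(1-3)] 1(8)] a(3,4) b(3,4)])
qed

lemma D_tri_iso:
  assumes t: "(X, Y, Z, f, g, h) \<in> DT" and a: "cat_iso D X X' a" and b: "cat_iso D Y Y' b" and c: "cat_iso D Z Z' c"
    and m: "Dl.mor X' Y' f'" "Dl.mor Y' Z' g'" "Dl.mor Z' (Sh 1 X') h'"
    and e: "f' \<ast> a = b \<ast> f" "g' \<ast> b = c \<ast> g" "h' \<ast> c = sm 1 a \<ast> h"
  shows "(X', Y', Z', f', g', h') \<in> DT"
proof -
  obtain M N \<phi> C i j \<rho> \<pi> a0 b0 c0 where 1: "ar M N \<phi>" "cone M N \<phi> C i j \<rho> \<pi>" "cat_iso D X M a0" "cat_iso D Y N b0" "cat_iso D Z C c0"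
      "b0 \<ast> f = Q M N \<phi> \<ast> a0" "c0 \<ast> g = Q N C i \<ast> b0" "sm 1 a0 \<ast> h = Q C (Sh 1 M) \<pi> \<ast> c0"
    and tm: "Dl.mor X Y f" "Dl.mor Y Z g" "Dl.mor Z (Sh 1 X) h"
    using t unfolding D_tri_iff by blast
  note s = D_std_mor[OF 1(2,1)] and m0 = 1(3-5)[THEN Dl.iso_mor]
  obtain a' where a': "Dl.mor X X' a" "Dl.mor X' X a'" "a' \<ast> a = ident D X" "a \<ast> a' = ident D X'" "cat_iso D X' X a'" using a by (rule D_isoE)
  obtain b' where b': "Dl.mor Y Y' b" "Dl.mor Y' Y b'" "b' \<ast> b = ident D Y" "b \<ast> b' = ident D Y'" "cat_iso D Y' Y b'" using b by (rule D_isoE)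
  obtain c' where c': "Dl.mor Z Z' c" "Dl.mor Z' Z c'" "c' \<ast> c = ident D Z" "c \<ast> c' = ident D Z'" "cat_iso D Z' Z c'" using c by (rule D_isoE)
  note sa = Dmor_sm[OF a'(1), of 1] and sa' = Dmor_sm[OF a'(2), of 1] and s0 = Dmor_sm[OF m0(1), of 1]
  note f1 = D_flip[OF tm(1) m(1) a'(1,2,4) b'(1-3) e(1)[symmetric]] and g1 = D_flip[OF tm(2) m(2) b'(1,2,4) c'(1-3) e(2)[symmetric]]
    and h1 = D_flip[OF tm(3) m(3) c'(1,2,4) sa sa' sm_inverse[OF a'(1-3)] e(3)[symmetric]]
  show ?thesis
    unfolding D_tri_iff
    by (intro conjI m exI, rule 1(1), rule 1(2),
      rule Dl.iso_comp[OF a'(5) 1(3), unfolded D_simps(3)], rule Dl.iso_comp[OF b'(5) 1(4), unfolded D_simps(3)],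
      rule Dl.iso_comp[OF c'(5) 1(5), unfolded D_simps(3)],
      rule D_paste[OF m(1) tm(1) s(1) a'(2) m0(1) b'(2) m0(2) f1 1(6)], rule D_paste[OF m(2) tm(2) s(2) b'(2) m0(2) c'(2) m0(3) g1 1(7)])
     (unfold sm_comp[OF a'(2) m0(1)], rule D_paste[OF m(3) tm(3) s(3) c'(2) m0(3) sa' s0 h1 1(8)])
qed

lemma D_tri_std:
  assumes "cone M N \<phi> C i j \<rho> \<pi>" "ar M N \<phi>"
  shows "(M, N, C, Q M N \<phi>, Q N C i, Q C (Sh 1 M) \<pi>) \<in> DT"
proof -
  note ob = arD(1,2)[OF assms(2)] and C = cone_ob[OF assms(1)] and ia = cone_ar[OF assms]
  note idr = D_idr and idl = D_idl
  note mQ = Dmor_Q[OF assms(2)] and mi = Dmor_Q[OF ia(1)] and mp = Dmor_Q[OF ia(2)]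
  have 1: "cat_iso D X X (Q X X id_map)" if "ob X" for X using Q_iso[OF we_id[OF that]] .
  show ?thesis
    unfolding D_tri_iff
    by (intro conjI mQ mi mp exI, rule assms(2), rule assms(1), rule 1[OF ob(1)], rule 1[OF ob(2)], rule 1[OF C])
      (simp_all add: idr[OF mQ] idl[OF mQ] idr[OF mi] idl[OF mi] idr[OF mp] sm_id[OF ob(1)] idl[OF mp])
qed

lemma D_one_iso: "ob X ==> cat_iso D X X (Q X X id_map)"
  using Q_iso[OF we_id] .

text \<open>Used for a fraction F whose triangle is the standard one of a numerator: a and b move
  the first two vertices while the third one stays.\<close>

lemma D_tri_transport:
  assumes t: "(M, N, Z, f, g, h) \<in> DT" and a: "cat_iso D M X a" and b: "cat_iso D N Y b"
    and F: "Dl.mor X Y F" and e: "F \<ast> a = b \<ast> f" and m: "Dl.mor M N f" "Dl.mor N Z g" "Dl.mor Z (Sh 1 M) h"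
  obtains g' where "(X, Y, Z, F, g', sm 1 a \<ast> h) \<in> DT" "g' \<ast> b = g"
proof -
  obtain b' where b': "Dl.mor N Y b" "Dl.mor Y N b'" "b' \<ast> b = ident D N" using b by (rule Dl.isoE) auto
  note a' = Dl.iso_mor[OF a]
  note Z = Dl.morD(2)[OF m(2), unfolded D_simps mem_Collect_eq]
  have e2: "(g \<ast> b') \<ast> b = g"
    using D_asc[OF b'(1,2) m(2)] b'(3) D_idr[OF m(2)] by simp
  have "(X, Y, Z, F, g \<ast> b', sm 1 a \<ast> h) \<in> DT"
    by (rule D_tri_iso[OF t a b D_one_iso[OF Z] F D_mc[OF b'(2) m(2)] D_mc[OF m(3) Dmor_sm[OF a']] e])
      (use e2 D_idl[OF m(2)] D_idr[OF D_mc[OF m(3) Dmor_sm[OF a']]] in simp_all)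
  thus thesis using that e2 by blast
qed

text \<open>With F = f s^(-1), the cone of the numerator f is transported along s.\<close>

lemma D_tri_cone:
  assumes "Dl.mor X Y F"
  shows "\<exists>Z g h. (X, Y, Z, F, g, h) \<in> DT"
proof -
  have ob: "ob X" "ob Y" and F: "F \<in> HDc X Y" using assms by (auto simp: Dmor_iff)
  obtain P s f where 1: "we P X s" "ar P Y f" "F = fr X P Y s f" by (rule HD_E[OF F ob])
  obtain C i j \<rho> \<pi> where c: "cone P Y f C i j \<rho> \<pi>" using ex_cone arD[OF 1(2)] by blast
  have "F \<ast> Q P X s = Q Y Y id_map \<ast> Q P Y f"
    using fr_cmp_Q[OF 1(1,2)] D_idl[OF Dmor_Q[OF 1(2)]] 1(3) by simp
  thus ?thesis
    using D_tri_transport[OF D_tri_std[OF c 1(2)] Q_iso[OF 1(1)] D_one_iso[OF ob(2)] assms _ D_std_mor[OF c 1(2)]] by metis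
qed

text \<open>A as a right module over itself supplies an object; the cone of its identity is then a
  zero object.\<close>

lemma ob_A: "ob \<lparr>gr = gr A, diff = diff A, ract = gmult A\<rparr>"
  using dg_A unfolding dg_module_def dg_algebra_def cochain_complex_def kbilinear_def by simp

lemma D_tri_one:
  assumes "ob X"
  shows "\<exists>Z g h. zero_object D Z \<and> (X, X, Z, Q X X id_map, g, h) \<in> DT"
proof -
  obtain C i j \<rho> \<pi> where c: "cone X X id_map C i j \<rho> \<pi>" using ex_cone[OF assms assms id_cl[OF assms]] by blast
  have "zero_object D C" by (rule acyclic_zero[OF cone_ob[OF c] cone_acyclic[OF c assms assms id_qi[OF assms]]])
  thus ?thesis using D_tri_std[OF c ar_id[OF assms]] by blast
qed

lemma D_tri_rot:
  assumes t: "(X, Y, Z, f, g, h) \<in> DT"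
  shows "(Y, Z, Sh 1 X, g, h, \<ominus>\<^bsub>HD (Sh 1 X) (Sh 1 Y)\<^esub> sm 1 f) \<in> DT"
proof -
  obtain M N \<phi> C i j \<rho> \<pi> a b c where 1: "ar M N \<phi>" "cone M N \<phi> C i j \<rho> \<pi>"
    "cat_iso D M X a" "cat_iso D N Y b" "cat_iso D C Z c" "f \<ast> a = b \<ast> Q M N \<phi>" "g \<ast> b = c \<ast> Q N C i"
    "h \<ast> c = sm 1 a \<ast> Q C (Sh 1 M) \<pi>" by (rule D_tri_std_isos[OF t], rule that) (assumption | rule sym)+
  have tm: "Dl.mor X Y f" "Dl.mor Y Z g" "Dl.mor Z (Sh 1 X) h" using t unfolding D_tri_iff by blast+
  note ob = arD(1,2)[OF 1(1)] and C = cone_ob[OF 1(2)] and ia = cone_ar[OF 1(2,1)]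
  note am = Dl.iso_mor[OF 1(3)] and bm = Dl.iso_mor[OF 1(4)]
  obtain C2 i2 j2 \<rho>2 \<pi>2 where c2: "cone N C i C2 i2 j2 \<rho>2 \<pi>2" using ex_cone arD[OF ia(1)] by blast
  note ia2 = cone_ar[OF c2 ia(1)]
  let ?nf = "\<lambda>p x. \<ominus>[N (p + 1)] \<phi> (p + 1) x"
  obtain \<theta> where th: "\<theta> \<in> qi C2 (Sh 1 M)" "!!p x. x \<in> elt C p ==> \<theta> p (i2 p x) = \<pi> p x"
     "hty C2 (Sh 1 N) \<pi>2 (?nf \<star> \<theta>)"
    using cone_rotate[OF 1(2) ob arD(3)[OF 1(1)] c2] by blast
  have thw: "we C2 (Sh 1 M) \<theta>" using th cone_ob[OF c2] shift_ob[OF ob(1)] by (simp add: we_def)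
  note phi = shift_ar[OF 1(1), of 1]
  have nf: "ar (Sh 1 M) (Sh 1 N) ?nf" using phi cl_neg[OF arD(3)[OF phi] arD(1,2)[OF phi]] by (simp add: ar_def)
  \<comment> \<open>The closed map -phi realizes the sign that the rotation axiom
    prescribes.\<close>
  have Qnf: "\<ominus>\<^bsub>HD (Sh 1 M) (Sh 1 N)\<^esub> sm 1 (Q M N \<phi>) = Q (Sh 1 M) (Sh 1 N) ?nf"
    unfolding sm_Q[OF 1(1)] Q_neg[OF phi] by simp
  have e1: "Q C2 (Sh 1 M) \<theta> \<ast> Q C C2 i2 = Q C (Sh 1 M) \<pi>"
    unfolding Q_cmp[OF ia2(1) we_ar[OF thw]]
    by (rule Q_heq[OF heq_eq[OF ar_comp[OF ia2(1) we_ar[OF thw]] ia(2)]]) (use th(2) in \<open>simp add: gcomp_def\<close>)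
  have e2: "Q (Sh 1 M) (Sh 1 N) ?nf \<ast> Q C2 (Sh 1 M) \<theta> = Q C2 (Sh 1 N) \<pi>2"
    unfolding Q_cmp[OF we_ar[OF thw] nf]
    by (rule Q_heq[OF heq_sym]) (use th(3) ia2(2) ar_comp[OF we_ar[OF thw] nf] in \<open>simp add: heq_def ar_def\<close>)
  have std: "(N, C, Sh 1 M, Q N C i, Q C (Sh 1 M) \<pi>, Q (Sh 1 M) (Sh 1 N) ?nf) \<in> DT"
    by (rule D_tri_iso[OF D_tri_std[OF c2 ia(1)] D_one_iso[OF ob(2)] D_one_iso[OF C] Q_iso[OF thw] Dmor_Q[OF ia(1)] Dmor_Q[OF ia(2)] Dmor_Q[OF nf]])
      (simp_all add: D_idl[OF Dmor_Q[OF ia(1)]] D_idr[OF Dmor_Q[OF ia(1)]] D_idr[OF Dmor_Q[OF ia(2)]] e1 e2 sm_id[OF ob(2)] D_idl[OF Dmor_Q[OF ia2(2)]])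
  note sf = Dmor_sm[OF tm(1), of 1] and sa = Dmor_sm[OF am, of 1] and sb = Dmor_sm[OF bm, of 1] and sp = Dmor_sm[OF Dmor_Q[OF 1(1)], of 1]
  note cn = Dl.cn[unfolded D_simps] and nc = Dl.nc[unfolded D_simps] and mn = Dl.mn[unfolded D_simps]
  have "(\<ominus>\<^bsub>HD (Sh 1 X) (Sh 1 Y)\<^esub> sm 1 f) \<ast> sm 1 a = \<ominus>\<^bsub>HD (Sh 1 M) (Sh 1 Y)\<^esub> sm 1 (f \<ast> a)"
    unfolding nc[OF sa sf] sm_comp[OF am tm(1)] ..
  also have "\<dots> = sm 1 b \<ast> Q (Sh 1 M) (Sh 1 N) ?nf"
    unfolding Qnf[symmetric] cn[OF sp sb] sm_comp[OF Dmor_Q[OF 1(1)] bm, symmetric] 1(6) ..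
  finally show ?thesis
    by (intro D_tri_iso[OF std 1(4,5) sm_iso[OF 1(3)] tm(2,3) mn[OF sf] 1(7,8)])
qed

text \<open>F = a s^(-1) and H = b t^(-1) are represented over one honest map \<open>?p\<close> such
  that both squares commute up to homotopy. Its cone maps to C by a quasi-isomorphism g1 and to C'
  by g2, and the filler is g2 g1^(-1).\<close>

lemma D_fill_std:
  assumes c: "cone M N \<phi> C i j \<rho> \<pi>" and c': "cone M' N' \<phi>' C' i' j' \<rho>' \<pi>'" and f: "ar M N \<phi>" and f': "ar M' N' \<phi>'"
    and A: "Dl.mor M M' F" and B: "Dl.mor N N' H" and e: "H \<ast> Q M N \<phi> = Q M' N' \<phi>' \<ast> F"
  shows "\<exists>L. Dl.mor C C' L \<and> L \<ast> Q N C i = Q N' C' i' \<ast> H \<and> Q C' (Sh 1 M') \<pi>' \<ast> L = sm 1 F \<ast> Q C (Sh 1 M) \<pi>"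
proof -
  note ob = arD(1,2)[OF f] and ob' = arD(1,2)[OF f'] and ia = cone_ar[OF c f] and ia' = cone_ar[OF c' f']
  obtain P s a where 1: "we P M s" "ar P M' a" "F = fr M P M' s a" using A HD_E unfolding Dmor_iff by blast
  obtain R t b where 2: "we R N t" "ar R N' b" "H = fr N R N' t b" using B HD_E unfolding Dmor_iff by blast
  \<comment> \<open>This aligns phi s with the denominator t of H.\<close>
  obtain P1 u v where P1: "we P1 P u" "ar P1 R v" "heq P1 N ((\<phi> \<star> s) \<star> u) (t \<star> v)"
    by (rule ore[OF ar_comp[OF we_ar[OF 1(1)] f] 2(1)])
  note su = we_comp[OF P1(1) 1(1)] and au = ar_comp[OF we_ar[OF P1(1)] 1(2)]
  have F1: "F = fr M P1 M' (s \<star> u) (a \<star> u)" unfolding 1(3) by (rule fr_expand[OF 1(1,2) P1(1)])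
  have "H \<ast> Q M N \<phi> = fr M P1 N' (s \<star> u) (b \<star> v)"
    unfolding 2(3) using cmp_fr[OF we_id[OF ob(1)] f 2(1,2) su P1(2)] P1(3) by simp
  moreover have "Q M' N' \<phi>' \<ast> F = fr M P1 N' (s \<star> u) (\<phi>' \<star> (a \<star> u))"
    unfolding F1 by (rule Q_cmp_fr[OF su au f'])
  ultimately have "fr M P1 N' (s \<star> u) (b \<star> v) = fr M P1 N' (s \<star> u) (\<phi>' \<star> (a \<star> u))" using e by simp
  \<comment> \<open>The hypothesis is an equality of fractions with the same denominator, so over P2
    the second square commutes up to homotopy.\<close>
  then obtain P2 w where P2: "we P2 P1 w" "heq P2 N' ((b \<star> v) \<star> w) ((\<phi>' \<star> (a \<star> u)) \<star> w)"
    by (rule fr_same_eqE[OF _ su ar_comp[OF P1(2) 2(2)] ar_comp[OF au f']])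
  let ?s = "s \<star> (u \<star> w)" and ?a = "a \<star> (u \<star> w)" and ?p = "v \<star> w"
  note uw = we_comp[OF P2(1) P1(1)]
  note s2 = we_comp[OF uw 1(1)] and a2 = ar_comp[OF we_ar[OF uw] 1(2)] and p2 = ar_comp[OF we_ar[OF P2(1)] P1(2)]
  have F2: "F = fr M P2 M' ?s ?a" unfolding 1(3) by (rule fr_expand[OF 1(1,2) uw])
  have sq1: "heq P2 N (t \<star> ?p) (\<phi> \<star> ?s)" using heq_sym[OF heq_right[OF P1(3) we_ar[OF P2(1)]]] by simp
  have sq2: "heq P2 N' (b \<star> ?p) (\<phi>' \<star> ?a)" using P2(2) by simp
  obtain C2 i2 j2 \<rho>2 \<pi>2 where c2: "cone P2 R ?p C2 i2 j2 \<rho>2 \<pi>2" using ex_cone arD[OF p2] by blast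
  note ia2 = cone_ar[OF c2 p2]
  obtain g1 where g1: "g1 \<in> cl C2 C" "!!p x. x \<in> elt R p ==> g1 p (i2 p x) = i p (t p x)"
     "!!p x. x \<in> elt C2 p ==> \<pi> p (g1 p x) = ?s (p + 1) (\<pi>2 p x)" "g1 \<in> qi C2 C"
    using cone_fill[OF c2 c arD(1,2)[OF p2] ob arD(3)[OF p2] arD(3)[OF f] arD(3)[OF we_ar[OF s2]] arD(3)[OF we_ar[OF 2(1)]] heqD(3)[OF sq1]]
      weD(3)[OF s2] weD(3)[OF 2(1)] by blast
  obtain g2 where g2: "g2 \<in> cl C2 C'" "!!p x. x \<in> elt R p ==> g2 p (i2 p x) = i' p (b p x)"
     "!!p x. x \<in> elt C2 p ==> \<pi>' p (g2 p x) = ?a (p + 1) (\<pi>2 p x)"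
    using cone_fill[OF c2 c' arD(1,2)[OF p2] ob' arD(3)[OF p2] arD(3)[OF f'] arD(3)[OF a2] arD(3)[OF 2(2)] heqD(3)[OF sq2]] by blast
  note obC = cone_ob[OF c] cone_ob[OF c'] cone_ob[OF c2]
  have w1: "we C2 C g1" and r2: "ar C2 C' g2" using g1 g2 obC by (auto simp: we_def ar_def)
  let ?L = "fr C C2 C' g1 g2"
  have L: "Dl.mor C C' ?L" by (rule Dmor_fr[OF w1 r2])
  note LQ = fr_cmp_Q[OF w1 r2]
  have eq1: "g1 \<star> i2 = g1 \<star> i2" ..
  have hi1: "heq R C (g1 \<star> i2) (i \<star> t)"
    by (rule heq_eq[OF ar_comp[OF ia2(1) we_ar[OF w1]] ar_comp[OF we_ar[OF 2(1)] ia(1)]]) (simp add: gcomp_def g1)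
  have hi2: "heq R C' (g2 \<star> i2) (i' \<star> b)"
    by (rule heq_eq[OF ar_comp[OF ia2(1) r2] ar_comp[OF 2(2) ia'(1)]]) (simp add: gcomp_def g2)
  have hp1: "heq C2 (Sh 1 M) (\<pi> \<star> g1) (sh 1 ?s \<star> \<pi>2)"
    by (rule heq_eq[OF ar_comp[OF we_ar[OF w1] ia(2)] ar_comp[OF ia2(2) shift_ar[OF we_ar[OF s2]]]])
      (use g1(3) in \<open>simp add: gcomp_def\<close>)
  have hp2: "heq C2 (Sh 1 M') (\<pi>' \<star> g2) (sh 1 ?a \<star> \<pi>2)"
    by (rule heq_eq[OF ar_comp[OF r2 ia'(2)] ar_comp[OF ia2(2) shift_ar[OF a2]]])
      (use g2(3) in \<open>simp add: gcomp_def\<close>)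
  have 3: "?L \<ast> Q N C i = Q N' C' i' \<ast> H"
  proof (rule D_iscr[OF Q_iso[OF 2(1)] D_mc[OF Dmor_Q[OF ia(1)] L] D_mc[OF B Dmor_Q[OF ia'(1)]]])
    have "(?L \<ast> Q N C i) \<ast> Q R N t = ?L \<ast> Q R C (g1 \<star> i2)"
      unfolding D_asc[OF Dmor_Q[OF we_ar[OF 2(1)]] Dmor_Q[OF ia(1)] L, symmetric] Q_cmp[OF we_ar[OF 2(1)] ia(1)] Q_heq[OF hi1] ..
    also have "\<dots> = Q R C' (g2 \<star> i2)"
      unfolding Q_cmp[OF ia2(1) we_ar[OF w1], symmetric] D_asc[OF Dmor_Q[OF ia2(1)] Dmor_Q[OF we_ar[OF w1]] L] LQ Q_cmp[OF ia2(1) r2] ..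
    also have "\<dots> = Q N' C' i' \<ast> (H \<ast> Q R N t)"
      unfolding Q_heq[OF hi2] 2(3) fr_cmp_Q[OF 2(1,2)] Q_cmp[OF 2(2) ia'(1)] ..
    also have "\<dots> = (Q N' C' i' \<ast> H) \<ast> Q R N t"
      by (rule D_asc[OF Dmor_Q[OF we_ar[OF 2(1)]] B Dmor_Q[OF ia'(1)]])
    finally show "(?L \<ast> Q N C i) \<ast> Q R N t = (Q N' C' i' \<ast> H) \<ast> Q R N t" .
  qed
  note sF = Dmor_sm[OF A, of 1] and ss = Dmor_sm[OF Dmor_Q[OF we_ar[OF s2]], of 1]
  have 4: "Q C' (Sh 1 M') \<pi>' \<ast> ?L = sm 1 F \<ast> Q C (Sh 1 M) \<pi>"
  proof (rule D_iscr[OF Q_iso[OF w1] D_mc[OF L Dmor_Q[OF ia'(2)]] D_mc[OF Dmor_Q[OF ia(2)] sF]])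
    have "(sm 1 F \<ast> Q C (Sh 1 M) \<pi>) \<ast> Q C2 C g1 = sm 1 F \<ast> Q C2 (Sh 1 M) (sh 1 ?s \<star> \<pi>2)"
      unfolding D_asc[OF Dmor_Q[OF we_ar[OF w1]] Dmor_Q[OF ia(2)] sF, symmetric] Q_cmp[OF we_ar[OF w1] ia(2)] Q_heq[OF hp1] ..
    also have "\<dots> = (sm 1 F \<ast> sm 1 (Q P2 M ?s)) \<ast> Q C2 (Sh 1 P2) \<pi>2"
      unfolding Q_cmp[OF ia2(2) shift_ar[OF we_ar[OF s2]], symmetric] sm_Q[OF we_ar[OF s2], symmetric]
      by (rule D_asc[OF Dmor_Q[OF ia2(2)] ss sF])
    also have "sm 1 F \<ast> sm 1 (Q P2 M ?s) = sm 1 (Q P2 M' ?a)"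
      using sm_cmp[of "Q P2 M ?s" P2 M F M' 1] Q_HD[OF we_ar[OF s2]] A weD(1)[OF s2] fr_cmp_Q[OF s2 a2] by (simp add: F2 Dmor_iff)
    also have "\<dots> \<ast> Q C2 (Sh 1 P2) \<pi>2 = Q C2 (Sh 1 M') (\<pi>' \<star> g2)"
      unfolding sm_Q[OF a2] Q_cmp[OF ia2(2) shift_ar[OF a2]] Q_heq[OF hp2] ..
    also have "\<dots> = Q C' (Sh 1 M') \<pi>' \<ast> (?L \<ast> Q C2 C g1)"
      unfolding LQ Q_cmp[OF r2 ia'(2)] ..
    also have "\<dots> = (Q C' (Sh 1 M') \<pi>' \<ast> ?L) \<ast> Q C2 C g1"
      by (rule D_asc[OF Dmor_Q[OF we_ar[OF w1]] L Dmor_Q[OF ia'(2)]])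
    finally show "(Q C' (Sh 1 M') \<pi>' \<ast> ?L) \<ast> Q C2 C g1 = (sm 1 F \<ast> Q C (Sh 1 M) \<pi>) \<ast> Q C2 C g1" ..
  qed
  show ?thesis using L 3 4 by blast
qed

text \<open>F and H are conjugated to the standard cones, filled there by \<open>D_fill_std\<close>,
  and the filler is conjugated back.\<close>

lemma D_tri_fill:
  assumes t: "(X, Y, Z, f, g, h) \<in> DT" and t': "(X', Y', Z', f', g', h') \<in> DT"
    and F: "Dl.mor X X' F" and H: "Dl.mor Y Y' H" and e: "H \<ast> f = f' \<ast> F"
  shows "\<exists>L. Dl.mor Z Z' L \<and> L \<ast> g = g' \<ast> H \<and> h' \<ast> L = sm 1 F \<ast> h"
proof (rule D_tri_std_isos[OF t], rule D_tri_std_isos[OF t'], goal_cases)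
  case (1 M N \<phi> C i j \<rho> \<pi> a b c a' b' c' M1 N1 \<phi>1 C1 i1 j1 \<rho>1 \<pi>1 a1 b1 c1 a1' b1' c1')
  note s = D_std_mor[OF 1(2,1)] and s1 = D_std_mor[OF 1(20,19)]
  note m = 1(3-8)[THEN Dl.iso_mor] and m1 = 1(21-26)[THEN Dl.iso_mor]
  have tm: "Dl.mor X Y f" "Dl.mor Y Z g" "Dl.mor Z (Sh 1 X) h" using t unfolding D_tri_iff by blast+
  have tm': "Dl.mor X' Y' f'" "Dl.mor Y' Z' g'" "Dl.mor Z' (Sh 1 X') h'" using t' unfolding D_tri_iff by blast+
  let ?F = "a1 \<ast> (F \<ast> a')" and ?H = "b1 \<ast> (H \<ast> b')"
  note Fa = D_mc[OF m(4) F] and Hb = D_mc[OF m(5) H]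
  note mF = D_mc[OF Fa m1(1)] and mH = D_mc[OF Hb m1(2)]
  have "?H \<ast> Q M N \<phi> = Q M1 N1 \<phi>1 \<ast> ?F"
    by (rule D_paste[OF s(1) tm'(1) s1(1) Fa m1(1) Hb m1(2) D_paste[OF s(1) tm(1) tm'(1) m(4) F m(5) H 1(12) e] 1(27)])
  then obtain L where L: "Dl.mor C C1 L" "L \<ast> Q N C i = Q N1 C1 i1 \<ast> ?H" "Q C1 (Sh 1 M1) \<pi>1 \<ast> L = sm 1 ?F \<ast> Q C (Sh 1 M) \<pi>"
    using D_fill_std[OF 1(2) 1(20) 1(1) 1(19) mF mH] by blast
  note Lc = D_mc[OF m(3) L(1)] and Hb2 = D_mc[OF m(2) mH] and Fa2 = D_mc[OF m(1) mF]
  note sm = Dmor_sm[OF m(1), of 1] Dmor_sm[OF mF, of 1] Dmor_sm[OF m1(4), of 1]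
  show ?thesis
  proof (intro exI conjI)
    show "Dl.mor Z Z' (c1' \<ast> (L \<ast> c))" by (rule D_mc[OF Lc m1(6)])
    have "(c1' \<ast> (L \<ast> c)) \<ast> g = g' \<ast> (b1' \<ast> (?H \<ast> b))"
      by (rule D_paste[OF tm(2) s1(2) tm'(2) Hb2 m1(5) Lc m1(6) D_paste[OF tm(2) s(2) s1(2) m(2) mH m(3) L(1) 1(10) L(2)] 1(31)])
    thus "(c1' \<ast> (L \<ast> c)) \<ast> g = g' \<ast> H" using D_conj[OF H m(2,5) 1(17) m1(2,5) 1(35)] by simp
    have "(sm 1 a1' \<ast> (sm 1 ?F \<ast> sm 1 a)) \<ast> h = h' \<ast> (c1' \<ast> (L \<ast> c))"
      by (rule D_paste[OF tm(3) s1(3) tm'(3) Lc m1(6) D_mc[OF sm(1,2)] sm(3) D_paste[OF tm(3) s(3) s1(3) m(3) L(1) sm(1,2) 1(11) L(3)[symmetric]] 1(32)])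
    thus "h' \<ast> (c1' \<ast> (L \<ast> c)) = sm 1 F \<ast> h"
      using D_conj[OF F m(1,4) 1(15) m1(1,4) 1(33)] sm_comp[OF m(1) mF, of 1] sm_comp[OF Fa2 m1(4), of 1] by simp
  qed
qed

text \<open>Writing F = t v s^(-1) and H = g t^(-1), the composite is (g v) s^(-1). The octahedron
  of v and g is then transported along s and t.\<close>

lemma D_tri_oct:
  assumes F: "Dl.mor X Y F" and H: "Dl.mor Y Z H"
  shows "\<exists>Z' X' Y' f1 f2 g1 g2 h1 h2 k1 k2 k3.
      (X, Y, Z', F, f1, f2) \<in> DT \<and> (Y, Z, X', H, g1, g2) \<in> DT \<and>
      (X, Z, Y', H \<ast> F, h1, h2) \<in> DT \<and> (Z', Y', X', k1, k2, k3) \<in> DT"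
proof -
  have ob: "ob X" "ob Y" "ob Z" and FH: "F \<in> HDc X Y" "H \<in> HDc Y Z" using F H by (auto simp: Dmor_iff)
  obtain P s v R t g where 1: "we P X s" "ar P R v" "we R Y t" "ar R Z g" "F = fr X P Y s (t \<star> v)" "H = fr Y R Z t g"
    "H \<ast> F = fr X P Z s (g \<star> v)" by (rule fr_compose_rep[OF FH ob])
  note gv = ar_comp[OF 1(2,4)]
  obtain C1 i1 j1 \<rho>1 \<pi>1 where c1: "cone P R v C1 i1 j1 \<rho>1 \<pi>1" using ex_cone arD[OF 1(2)] by blast
  obtain C2 i2 j2 \<rho>2 \<pi>2 where c2: "cone R Z g C2 i2 j2 \<rho>2 \<pi>2" using ex_cone arD[OF 1(4)] by blast
  obtain C3 i3 j3 \<rho>3 \<pi>3 where c3: "cone P Z (g \<star> v) C3 i3 j3 \<rho>3 \<pi>3" using ex_cone arD[OF gv] by blast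
  obtain \<alpha> where al: "\<alpha> \<in> cl C1 C3" "!!C4 i4 j4 \<rho>4 \<pi>4. cone C1 C3 \<alpha> C4 i4 j4 \<rho>4 \<pi>4 ==> \<exists>\<beta>. \<beta> \<in> qi C2 C4"
    using cone_octahedral[OF c1 c2 c3 arD(1,2)[OF 1(2)] arD(2)[OF 1(4)] arD(3)[OF 1(2)] arD(3)[OF 1(4)]] by blast
  have ala: "ar C1 C3 \<alpha>" using al(1) cone_ob[OF c1] cone_ob[OF c3] by (simp add: ar_def)
  obtain C4 i4 j4 \<rho>4 \<pi>4 where c4: "cone C1 C3 \<alpha> C4 i4 j4 \<rho>4 \<pi>4" using ex_cone arD[OF ala] by blast
  obtain \<beta> where "\<beta> \<in> qi C2 C4" using al(2)[OF c4] by blast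
  hence be: "we C2 C4 \<beta>" using cone_ob[OF c2] cone_ob[OF c4] by (simp add: we_def)
  obtain b where b: "Dl.mor C2 C4 (Q C2 C4 \<beta>)" "Dl.mor C4 C2 b" "b \<ast> Q C2 C4 \<beta> = ident D C2" "Q C2 C4 \<beta> \<ast> b = ident D C4" "cat_iso D C4 C2 b"
    using Q_iso[OF be] by (rule Dl.isoE) auto
  have eF: "F \<ast> Q P X s = Q R Y t \<ast> Q P R v"
    unfolding 1(5) fr_cmp_Q[OF 1(1) ar_comp[OF 1(2) we_ar[OF 1(3)]]] Q_cmp[OF 1(2) we_ar[OF 1(3)]] ..
  have eH: "H \<ast> Q R Y t = Q Z Z id_map \<ast> Q R Z g"
    unfolding 1(6) fr_cmp_Q[OF 1(3,4)] Q_cmp[OF 1(4) ar_id[OF ob(3)]] by simp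
  have eHF: "(H \<ast> F) \<ast> Q P X s = Q Z Z id_map \<ast> Q P Z (g \<star> v)"
    unfolding 1(7) fr_cmp_Q[OF 1(1) gv] Q_cmp[OF gv ar_id[OF ob(3)]] by simp
  obtain f1 where t1: "(X, Y, C1, F, f1, sm 1 (Q P X s) \<ast> Q C1 (Sh 1 P) \<pi>1) \<in> DT"
    by (rule D_tri_transport[OF D_tri_std[OF c1 1(2)] Q_iso[OF 1(1)] Q_iso[OF 1(3)] F eF D_std_mor[OF c1 1(2)]])
  obtain g1 where t2: "(Y, Z, C2, H, g1, sm 1 (Q R Y t) \<ast> Q C2 (Sh 1 R) \<pi>2) \<in> DT"
    by (rule D_tri_transport[OF D_tri_std[OF c2 1(4)] Q_iso[OF 1(3)] D_one_iso[OF ob(3)] H eH D_std_mor[OF c2 1(4)]])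
  obtain h1 where t3: "(X, Z, C3, H \<ast> F, h1, sm 1 (Q P X s) \<ast> Q C3 (Sh 1 P) \<pi>3) \<in> DT"
    by (rule D_tri_transport[OF D_tri_std[OF c3 gv] Q_iso[OF 1(1)] D_one_iso[OF ob(3)] D_mc[OF F H] eHF D_std_mor[OF c3 gv]])
  note s4 = D_std_mor[OF c4 ala]
  have t4: "(C1, C3, C2, Q C1 C3 \<alpha>, b \<ast> Q C3 C4 i4, Q C4 (Sh 1 C1) \<pi>4 \<ast> Q C2 C4 \<beta>) \<in> DT"
  proof (rule D_tri_iso[OF D_tri_std[OF c4 ala] D_one_iso[OF cone_ob[OF c1]] D_one_iso[OF cone_ob[OF c3]] b(5) s4(1) D_mc[OF s4(2) b(2)] D_mc[OF b(1) s4(3)]])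
    show "Q C1 C3 \<alpha> \<ast> Q C1 C1 id_map = Q C3 C3 id_map \<ast> Q C1 C3 \<alpha>"
      using D_idl[OF s4(1)] D_idr[OF s4(1)] by simp
    show "b \<ast> Q C3 C4 i4 \<ast> Q C3 C3 id_map = b \<ast> Q C3 C4 i4"
      using D_idr[OF D_mc[OF s4(2) b(2)]] by simp
    show "Q C4 (Sh 1 C1) \<pi>4 \<ast> Q C2 C4 \<beta> \<ast> b = sm 1 (Q C1 C1 id_map) \<ast> Q C4 (Sh 1 C1) \<pi>4"
      using D_asc[OF b(2,1) s4(3)] b(4) D_idr[OF s4(3)] D_idl[OF s4(3)] sm_id[OF cone_ob[OF c1], of 1] by simp
  qed
  show ?thesis using t1 t2 t3 t4 by blast
qed

sublocale Dt: tricat K "DA K A" "shift_mor K A 1"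
proof (unfold_locales, goal_cases)
  case (3 X m n) thus ?case by (simp add: shift_shift_iso)
next
  case (5 X Y f Z g) thus ?case using sm_cmp[of f X Y g Z 1] by (simp add: Dmor_iff)
next
  case (8 X Y f g) thus ?case using sm_inj[of f X Y g 1] by (simp add: Dmor_iff)
next
  case (9 X Y h) thus ?case using sm_surj[of h 1 X Y] by (auto simp: Dmor_iff)
next
  case (10 X Y Z f g h) thus ?case by (simp add: D_tri_iff)
next
  case (11 X Y Z f g h X' a Y' b Z' c f' g' h')
  show ?case unfolding D_simps by (rule D_tri_iso[OF 11[unfolded D_simps]])
next
  case 12
  show ?case using D_tri_one[OF ob_A] by blast
next
  case (13 X Y f) thus ?case using D_tri_cone by simp
next
  case (14 X) thus ?case using D_tri_one by simp
next
  case (15 X Y Z f g h) thus ?case using D_tri_rot by simp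
next
  case (16 X Y Z f g h X' Y' Z' f' g' h' a b)
  show ?case unfolding D_simps by (rule D_tri_fill[OF 16[unfolded D_simps]])
next
  case (17 X Y f Z g)
  show ?case unfolding D_simps by (rule D_tri_oct[OF 17])
qed (auto simp: shift_ob Dmor_iff sm_HD sm_id sm_add)

end

section \<open>Objects with finite-dimensional homology\<close>

context dga
begin

abbreviation fd where "fd \<equiv> fd_objects K A"

lemma fd_exact:
  assumes f: "f \<in> cl X Y" and g: "g \<in> cl Y Z" and Y: "ob Y" and fd: "X \<in> fd" "Z \<in> fd"
    and ex: "!!p v. v \<in> hel Y p ==> hmap Z p g v = \<zero>\<^bsub>homology Z p\<^esub> ==>
      \<exists>u\<in>hel X p. v = hmap Y p f u"
  shows "Y \<in> fd"
proof -
  have ob: "ob X" "ob Z" using fd by (simp_all add: fd_objects_def)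
  have "zero_space (homology Y p)" if z: "zero_space (homology X p)" "zero_space (homology Z p)" for p
  proof -
    have "v = \<zero>\<^bsub>homology Y p\<^esub>" if v: "v \<in> hel Y p" for v
      using ex[OF v] homology_map_closed[OF g Y ob(2) v] z homology_map_add(3)[OF f ob(1) Y] by (auto simp: zero_space_def)
    thus ?thesis using ag_facts(2)[OF homology_ag[OF Y]] by (auto simp: zero_space_def)
  qed
  hence "{p. \<not> zero_space (homology Y p)} \<subseteq> {p. \<not> zero_space (homology X p)} \<union> {p. \<not> zero_space (homology Z p)}" by blast
  hence "finite {p. \<not> zero_space (homology Y p)}" using fd finite_subset unfolding fd_objects_def by blast
  moreover have "finite_dim K (homology Y p)" for p
    by (rule exact_finite_dim[OF field_K homology_module[OF ob(1)] homology_module[OF Y] homology_module[OF ob(2)]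
          homology_map_klinear[OF f ob(1) Y] homology_map_klinear[OF g Y ob(2)]]) (use fd in \<open>auto simp: fd_objects_def dest!: ex\<close>)
  ultimately show ?thesis using Y by (simp add: fd_objects_def)
qed

lemma fd_ob: "X \<in> fd ==> ob X"
  by (simp add: fd_objects_def)

text \<open>Both directions are instances of \<open>fd_exact\<close> with a zero map on one side:
  exactness is surjectivity in one case and injectivity in the other.\<close>

lemma fd_we:
  assumes f: "we X Y f"
  shows "X \<in> fd \<longleftrightarrow> Y \<in> fd"
proof
  note ob = weD(1,2)[OF f] and q = weD(3)[OF f]
  show "Y \<in> fd" if "X \<in> fd"
    by (rule fd_exact[OF qi_cl[OF q] cl_zero[OF ob(2,1)] ob(2) that that]) (use bij_betw_imp_surj_on[OF qi_bij[OF q]] in blast)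
  show "X \<in> fd" if "Y \<in> fd"
  proof (rule fd_exact[OF cl_zero[OF ob(2,1)] qi_cl[OF q] ob(1) that that])
    fix p v assume "v \<in> hel X p" "hmap Y p f v = \<zero>\<^bsub>homology Y p\<^esub>"
    hence v: "v = \<zero>\<^bsub>homology X p\<^esub>"
      using inj_onD[OF bij_betw_imp_inj_on[OF qi_bij[OF q, of p]] _ _ ag_facts(2)[OF homology_ag[OF ob(1)]]] homology_map_add(3)[OF qi_cl[OF q] ob] by simp
    show "\<exists>u\<in>hel Y p. v = hmap X p (zm X) u"
      unfolding v using homology_map_add(3)[OF cl_zero[OF ob(2,1)] ob(2,1), symmetric, of p] ag_facts(2)[OF homology_ag[OF ob(2)]] by (rule bexI)
  qed
qed

text \<open>Both legs of a fraction that represents an isomorphism are quasi-isomorphisms.\<close>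

lemma fd_isomorphic: "isomorphic D X Y ==> X \<in> fd ==> Y \<in> fd"
proof -
  assume "isomorphic D X Y" and X: "X \<in> fd"
  then obtain F where F: "cat_iso D X Y F" by (auto simp: isomorphic_def)
  hence ob: "ob X" "ob Y" "F \<in> HDc X Y" by (auto simp: cat_iso_def)
  obtain P s f where P: "we P X s" "ar P Y f" "F = fr X P Y s f" by (rule HD_E[OF ob(3,1,2)])
  show "Y \<in> fd" using fd_we[OF P(1)] fd_we[OF iso_fr_we[OF P(1,2)]] F P(3) X by simp
qed

lemma fd_shift: "X \<in> fd ==> Sh n X \<in> fd"
proof -
  assume X: "X \<in> fd"
  have "{p. \<not> zero_space (homology X (p + n))} \<subseteq> (\<lambda>p. p - n) ` {p. \<not> zero_space (homology X p)}" by force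
  thus ?thesis using X finite_surj by (auto simp: fd_objects_def homology_shift shift_ob)
qed

lemma fd_cone:
  assumes c: "cone M N \<phi> C i j \<rho> \<pi>" and f: "ar M N \<phi>" and fd: "M \<in> fd" "N \<in> fd"
  shows "C \<in> fd"
proof -
  note ob = arD(1,2)[OF f] and fcl = arD(3)[OF f]
  show ?thesis
    by (rule fd_exact[OF cone_i_cl[OF c ob fcl] cone_pi_cl[OF c ob fcl] cone_ob[OF c] fd(2) fd_shift[OF fd(1)]])
      (use cone_exact(1)[OF c ob fcl] in \<open>simp add: homology_shift ob\<close>)
qed

text \<open>Over a zero object the zero map represents an isomorphism and so is a quasi-isomorphism;
  hence all homology vanishes.\<close>

lemma fd_zero:
  assumes "zero_object D X"
  shows "X \<in> fd"
proof -
  have X: "ob X" and e: "Q X X id_map = \<zero>\<^bsub>HD X X\<^esub>" using assms by (auto simp: zero_object_def)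
  have "Q X X (zm X) = Q X X id_map" using e zero_fr[OF we_id[OF X] X] by simp
  hence "we X X (zm X)" using iso_fr_we[OF we_id[OF X] ar_zero[OF X X]] D_one_iso[OF X] by simp
  hence q: "zm X \<in> qi X X" by (rule weD)
  have z: "hel X p = {\<zero>\<^bsub>homology X p\<^esub>}" for p
  proof -
    have "z \<in> bd X p" if "z \<in> cy X p" for z using qiD(1)[OF q X X that bd_simps(1)[OF X]] .
    hence "hc X p ` cy X p \<subseteq> {\<zero>\<^bsub>homology X p\<^esub>}" using hc_zero_iff[OF X] by blast
    thus ?thesis using cy_simps(1)[OF X, of p] unfolding hc_carrier by blast
  qed
  interpret h: module K "homology X p" for p by (rule homology_module[OF X])
  have "finite_dim K (homology X p)" for p
    unfolding finite_dim_def using z by (intro exI[of _ "{}"]) auto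
  thus ?thesis using z X by (simp add: fd_objects_def zero_space_def)
qed

lemma fd_subcat: "triangulated_subcat D fd"
  unfolding triangulated_subcat_def
proof (intro conjI allI ballI impI)
  show "fd \<subseteq> Obj D" using fd_ob by auto
  show "X \<in> fd" if "zero_object D X" for X using fd_zero[OF that] .
  show "Y \<in> fd" if "X \<in> fd" "isomorphic D X Y" for X Y using fd_isomorphic[OF that(2,1)] .
  show "shift D 1 X \<in> fd" "shift D (- 1) X \<in> fd" if "X \<in> fd" for X using fd_shift[OF that] by simp_all
  show "Z \<in> fd" if fd: "X \<in> fd" "Y \<in> fd" and t: "(X, Y, Z, f, g, h) \<in> triangles D" for X Y Z f g h
  proof (rule D_tri_std_isos[OF t[unfolded D_simps]])
    fix M N \<phi> C i j \<rho> \<pi> a b c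
    assume c: "cone M N \<phi> C i j \<rho> \<pi>" "ar M N \<phi>" and "cat_iso D M X a" "cat_iso D N Y b" "cat_iso D C Z c"
    hence i: "isomorphic D M X" "isomorphic D N Y" "isomorphic D C Z" by (auto simp: isomorphic_def)
    have "M \<in> fd" "N \<in> fd" using fd fd_isomorphic[OF Dl.isomorphic_sym[OF i(1)]] fd_isomorphic[OF Dl.isomorphic_sym[OF i(2)]] by auto
    thus "Z \<in> fd" using fd_isomorphic[OF i(3) fd_cone[OF c]] by blast
  qed
qed

text \<open>Schur's lemma over an algebraically closed field: an eigenvector of an endomorphism on the homology shows that a suitable translate of
  the endomorphism by a scalar is not invertible.\<close>
lemma scalar_endomorphisms:
  assumes ac: "algebraically_closed K" and S: "S \<in> fd" "\<not> zero_object D S"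
    and div: "!!F. Dl.mor S S F ==> F \<noteq> zero_mor D S S ==> cat_iso D S S F"
  shows "Hom D S S = {c \<odot>\<^bsub>HOM D S S\<^esub> ident D S | c. c \<in> carrier K}"
proof (intro equalityI subsetI)
  have oS: "ob S" using fd_ob[OF S(1)] .
  note one = Dl.m1[of S, unfolded D_simps]
  fix F assume "F \<in> Hom D S S"
  hence F: "F \<in> HDc S S" by simp
  obtain P s f where P: "we P S s" "ar P S f" "F = fr S P S s f" by (rule HD_E[OF F oS oS])
  note ob = weD(1)[OF P(1)] and scl = qi_cl[OF weD(3)[OF P(1)]] and fcl = arD(3)[OF P(2)]
  obtain p where p: "\<not> zero_space (homology S p)" using acyclic_zero[OF oS] S(2) unfolding acyclic_def zero_space_def by blast
  let ?V = "homology S p" and ?W = "homology P p" and ?s = "hmap S p s" and ?f = "hmap S p f"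
  note mV = homology_module[OF oS, of p] and mW = homology_module[OF ob, of p]
  interpret V: vspace K ?V by (rule vspaceI[OF field_K mV])
  interpret W: vspace K ?W by (rule vspaceI[OF field_K mW])
  have bij: "bij_betw ?s (carrier ?W) (carrier ?V)" using weD(3)[OF P(1)] by (simp add: quasi_isos_def)
  define t where "t = inv_into (carrier ?W) ?s"
  have t: "t v \<in> carrier ?W" "?s (t v) = v" if "v \<in> carrier ?V" for v
    using that inv_into_into[of v ?s "carrier ?W"] f_inv_into_f[of v ?s "carrier ?W"] bij_betw_imp_surj_on[OF bij] unfolding t_def by simp_all
  have st: "t (?s w) = w" if "w \<in> carrier ?W" for w
    using that bij unfolding t_def by (simp add: bij_betw_def)
  note ks = homology_map_klinear[OF scl ob oS, of p] and kf = homology_map_klinear[OF fcl ob oS, of p]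
  have "klinear K ?V ?W t"
  proof (rule klinearI)
    show "t (x \<oplus>\<^bsub>?V\<^esub> y) = t x \<oplus>\<^bsub>?W\<^esub> t y" if "x \<in> carrier ?V" "y \<in> carrier ?V" for x y
      using st[of "t x \<oplus>\<^bsub>?W\<^esub> t y"] klinear_add[OF ks t(1)[OF that(1)] t(1)[OF that(2)]] t that by simp
    show "t (c \<odot>\<^bsub>?V\<^esub> x) = c \<odot>\<^bsub>?W\<^esub> t x" if "c \<in> carrier K" "x \<in> carrier ?V" for c x
      using st[of "c \<odot>\<^bsub>?W\<^esub> t x"] klinear_smult[OF ks that(1) t(1)[OF that(2)]] t that by simp
  qed (rule t)
  hence kT: "klinear K ?V ?V (\<lambda>v. ?f (t v))" by (rule klinear_comp[OF _ kf])
  have fdV: "finite_dim K ?V" using S(1) by (simp add: fd_objects_def)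
  obtain v where v: "v \<in> carrier ?V" "v \<noteq> \<zero>\<^bsub>?V\<^esub>" using p unfolding zero_space_def by auto
  obtain c u where c: "c \<in> carrier K" "u \<in> carrier ?V" "u \<noteq> \<zero>\<^bsub>?V\<^esub>" "?f (t u) = c \<odot>\<^bsub>?V\<^esub> u"
    by (rule V.ex_eigenvector[OF ac kT fdV v])
  obtain z where z: "z \<in> cy P p" "t u = hc P p z" using t(1)[OF c(2)] by (auto simp: hc_carrier)
  have cs: "ar P S (scal S (\<ominus>\<^bsub>K\<^esub> c) s)" using ar_scal[OF we_ar[OF P(1)], of "\<ominus>\<^bsub>K\<^esub> c"] c(1) by simp
  \<comment> \<open>The numerator of F - c, over the same denominator s.\<close>
  let ?g = "plus S f (scal S (\<ominus>\<^bsub>K\<^esub> c) s)"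
  have g: "ar P S ?g" by (rule ar_plus[OF P(2) cs])
  note gcl = arD(3)[OF g]
  have zS: "f p z \<in> cy S p" "s p z \<in> cy S p" using cl_cy[OF fcl ob oS z(1)] cl_cy[OF scl ob oS z(1)] .
  have su: "hc S p (s p z) = u" using t(2)[OF c(2)] z homology_map_hc[OF scl ob oS z(1)] by simp
  have fu: "hc S p (f p z) = c \<odot>\<^bsub>?V\<^esub> u" using c(4) z homology_map_hc[OF fcl ob oS z(1)] by simp
  have "hc S p (?g p z) = c \<odot>\<^bsub>?V\<^esub> u \<oplus>\<^bsub>?V\<^esub> (\<ominus>\<^bsub>K\<^esub> c) \<odot>\<^bsub>?V\<^esub> u"
    using zS c(1) by (simp add: plus_app scal_app hc_add[OF oS, symmetric] hc_smult[OF oS, symmetric] cy_simps[OF oS] fu su)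
  also have "\<dots> = \<zero>\<^bsub>?V\<^esub>" using c by (simp add: V.smult_l_minus V.M.r_neg)
  finally have "?g p z \<in> bd S p" using hc_zero_iff[OF oS cl_cy[OF gcl ob oS z(1)]] by simp
  \<comment> \<open>A non-bounding cocycle with bounding image shows that \<open>?g\<close> is no
    quasi-isomorphism.\<close>
  moreover have "z \<notin> bd P p"
  proof
    assume "z \<in> bd P p"
    hence "t u = \<zero>\<^bsub>?W\<^esub>" using z hc_zero_iff[OF ob z(1)] by simp
    thus False using t(2)[OF c(2)] c(3) klinear_zero[OF ks mW[THEN module_ag] mV[THEN module_ag]] by simp
  qed
  ultimately have "\<not> we P S ?g" using qiD(1)[OF weD(3)[of P S ?g] ob oS z(1)] by blast
  hence "\<not> cat_iso D S S (fr S P S s ?g)" using iso_fr_we[OF P(1) g] by blast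
  hence "fr S P S s ?g = \<zero>\<^bsub>HD S S\<^esub>" using div[OF Dmor_fr[OF P(1) g]] by auto
  moreover have "fr S P S s (scal S (\<ominus>\<^bsub>K\<^esub> c) s) = (\<ominus>\<^bsub>K\<^esub> c) \<odot>\<^bsub>HD S S\<^esub> Q S S id_map"
  proof -
    have "Q S S id_map = fr S P S s s" using fr_expand[OF we_id[OF oS] ar_id[OF oS] P(1)] by simp
    thus ?thesis using smult_fr[OF P(1) we_ar[OF P(1)], of "\<ominus>\<^bsub>K\<^esub> c"] c(1) by simp
  qed
  moreover have "fr S P S s ?g = F \<oplus>\<^bsub>HD S S\<^esub> fr S P S s (scal S (\<ominus>\<^bsub>K\<^esub> c) s)"
    using add_fr[OF P(1,2) cs] P(3) by simp
  ultimately have e: "F \<oplus>\<^bsub>HD S S\<^esub> (\<ominus>\<^bsub>K\<^esub> c) \<odot>\<^bsub>HD S S\<^esub> Q S S id_map = \<zero>\<^bsub>HD S S\<^esub>" by simp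
  interpret E: module K "HD S S" by (rule HD_module[OF oS oS])
  have i: "Q S S id_map \<in> HDc S S" using Q_HD[OF ar_id[OF oS]] .
  have "F = c \<odot>\<^bsub>HD S S\<^esub> Q S S id_map"
    using e E.M.minus_equality[of F "\<ominus>\<^bsub>HD S S\<^esub> (c \<odot>\<^bsub>HD S S\<^esub> Q S S id_map)"] F c(1) i by (simp add: E.smult_l_minus)
  thus "F \<in> {c \<odot>\<^bsub>HOM D S S\<^esub> ident D S | c. c \<in> carrier K}" using c(1) by auto
next
  fix F assume "F \<in> {c \<odot>\<^bsub>HOM D S S\<^esub> ident D S | c. c \<in> carrier K}"
  thus "F \<in> Hom D S S" using Dl.ms[OF Dl.m1] fd_ob[OF S(1)] by (auto simp: Dl.mor_def)
qed

end

section \<open>The bijection\<close>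

theorem corollary9p5:
  fixes K :: "'k ring" and A :: "('k, 'u) dg_alg"
  assumes "algebraically_closed K"
    and "dg_algebra K A"
    and "!!p. finite_dim K (homology A p)"
    and "\<exists>N. \<forall>p>N. zero_space (homology A p)"
    and "homologically_smooth K A"
  shows "(\<forall>t\<in>length_t_structures K A. \<forall>Ss.
            simple_representatives (heart (Dfd K A) t) Ss \<longrightarrow> simple_minded K A Ss) \<and>
         bij_betw
           (\<lambda>t. simple_minded_equiv K A `` {Ss. simple_representatives (heart (Dfd K A) t) Ss})
           (length_t_structures K A)
           ({Ss. simple_minded K A Ss} // simple_minded_equiv K A)"
proof -
  interpret ac: algebraically_closed K by fact
  interpret d: dga K A by unfold_locales (rule ac.field_axioms ac.infinite_carrier assms(2))+
  interpret s: tri_sub K "DA K A" "shift_mor K A 1" "fd_objects K A" by unfold_locales (rule d.fd_subcat)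
  let ?D = "DA K A" and ?cl = "\<lambda>Ss. extension_closure (Dfd K A) (set Ss)"
  let ?E = "simple_minded_equiv K A" and ?T = "length_t_structures K A"
  let ?rep = "\<lambda>t. simple_representatives (heart (Dfd K A) t)"
  have Hz: "d.Dt.Hz X Y \<longleftrightarrow> Hom ?D X Y = {zero_mor ?D X Y}" if "X \<in> fd_objects K A" "Y \<in> fd_objects K A" for X Y
    using d.Dt.Hz_iff s.E_Obj that by blast
  have sh: "shift ?D n X \<in> fd_objects K A" if "X \<in> fd_objects K A" for n X using d.fd_shift[OF that] by simp
  \<comment> \<open>The abstract category gives everything except that endomorphisms are scalars;
    this is where the eigenvector argument enters.\<close>
  have A: "simple_minded K A Ss" "?cl Ss = U \<inter> V" if t: "(U, V) \<in> ?T" and r: "?rep (U, V) Ss" for U V Ss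
  proof -
    have b: "bounded_t_structure s.S (U, V)" and l: "length_category K (heart s.S (U, V))"
      using t by (simp_all add: length_t_structures_def Dfd_def)
    note * = s.simples_of_t_structure[OF b l r[unfolded Dfd_def]]
    have S: "S \<in> fd_objects K A" if "S \<in> set Ss" for S using *(1) that by blast
    have "Hom ?D S S = {c \<odot>\<^bsub>HOM ?D S S\<^esub> ident ?D S | c. c \<in> carrier K}" if "S \<in> set Ss" for S
      by (rule d.scalar_endomorphisms[OF assms(1) S[OF that] *(3)[OF that]]) (rule *(4)[OF that])
    moreover have "ident ?D S \<noteq> zero_mor ?D S S" if "S \<in> set Ss" for S
      using *(3)[OF that] S[OF that] s.E_Obj by (auto simp: zero_object_def)
    moreover have "Hom ?D (Ss ! i) (Ss ! j) = {zero_mor ?D (Ss ! i) (Ss ! j)}" if "i < length Ss" "j < length Ss" "i \<noteq> j" for i j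
      using *(2)[OF that] that by (simp add: Hz S)
    moreover have "Hom ?D S (shift ?D n S') = {zero_mor ?D S (shift ?D n S')}" if "S \<in> set Ss" "S' \<in> set Ss" "n < 0" for S S' n
      using *(5)[OF that] unfolding Hz[OF S[OF that(1)] sh[OF S[OF that(2)]]] .
    ultimately show "simple_minded K A Ss" using *(1,6) unfolding simple_minded_def by (intro conjI allI ballI impI) simp_all
    show "?cl Ss = U \<inter> V" using *(7) by (simp add: Dfd_def)
  qed
  have ex: "\<exists>Ss. ?rep (U, V) Ss" if t: "(U, V) \<in> ?T" for U V
  proof -
    interpret h: lincat K "heart (Dfd K A) (U, V)"
      by unfold_locales (use t in \<open>simp add: length_t_structures_def length_category_def abelian_category_def\<close>)
    show ?thesis using h.finite_isoclasses_iff t by (simp add: length_t_structures_def)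
  qed
  have B: "\<exists>U V. (U, V) \<in> ?T \<and> ?rep (U, V) Ss" if m: "simple_minded K A Ss" for Ss
  proof -
    have S: "set Ss \<subseteq> fd_objects K A" and hull: "triangulated_hull ?D (set Ss) = fd_objects K A"
      and m1: "!!i j. i < length Ss ==> j < length Ss ==> i \<noteq> j ==> Hom ?D (Ss ! i) (Ss ! j) = {zero_mor ?D (Ss ! i) (Ss ! j)}"
      and m2: "!!S. S \<in> set Ss ==> ident ?D S \<noteq> zero_mor ?D S S"
      and m3: "!!S. S \<in> set Ss ==> Hom ?D S S = {c \<odot>\<^bsub>HOM ?D S S\<^esub> ident ?D S | c. c \<in> carrier K}"
      and m4: "!!S S' n. S \<in> set Ss ==> S' \<in> set Ss ==> n < 0 ==> Hom ?D S (shift ?D n S') = {zero_mor ?D S (shift ?D n S')}"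
      using m unfolding simple_minded_def by simp_all
    have o: "S \<in> Obj ?D" if "S \<in> set Ss" for S using S s.E_Obj that by blast
    \<comment> \<open>A nonzero multiple c of the identity is inverted by the multiple with c^(-1),
      so one-dimensionality gives the division property of \<open>smf\<close>.\<close>
    have div: "cat_iso ?D S S f" if S: "S \<in> set Ss" and f: "d.Dl.mor S S f" "f \<noteq> zero_mor ?D S S" for S f
    proof -
      obtain c where c: "c \<in> carrier K" "f = c \<odot>\<^bsub>HOM ?D S S\<^esub> ident ?D S"
        using d.Dl.morD(3)[OF f(1)] unfolding m3[OF S] by (elim CollectE exE conjE) (rule that)
      interpret H: module K "HOM ?D S S" using d.Dl.Hom_module[OF o[OF S] o[OF S]] .
      note one = d.Dl.m1[OF o[OF S]]
      note oc = d.Dl.morD(3)[OF one]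
      have c0: "c \<noteq> \<zero>\<^bsub>K\<^esub>" using f(2) c H.smult_l_null[OF oc] by auto
      hence i: "inv\<^bsub>K\<^esub> c \<in> carrier K" "inv\<^bsub>K\<^esub> c \<otimes>\<^bsub>K\<^esub> c = \<one>\<^bsub>K\<^esub>" "c \<otimes>\<^bsub>K\<^esub> inv\<^bsub>K\<^esub> c = \<one>\<^bsub>K\<^esub>" using c(1) ac.field_Units by auto
      let ?g = "inv\<^bsub>K\<^esub> c \<odot>\<^bsub>HOM ?D S S\<^esub> ident ?D S"
      have "cmp ?D ?g f = ident ?D S" "cmp ?D f ?g = ident ?D S"
        using c i d.Dl.cs[OF d.Dl.ms[OF one] d.Dl.ms[OF one]] d.Dl.cs[OF one d.Dl.ms[OF one]] d.Dl.sc[OF one one] d.Dl.idl[OF one]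
          H.smult_assoc1[OF _ _ oc, symmetric] H.smult_one[OF oc] by simp_all
      thus ?thesis using d.Dl.isoI[OF f(1) d.Dl.ms[OF one i(1)]] by blast
    qed
    obtain U V where UV: "bounded_t_structure s.S (U, V)" "length_category K (heart s.S (U, V))" "simple_representatives (heart s.S (U, V)) Ss"
    proof (rule s.t_structure_of_simples[of Ss, OF S])
      show "d.Dt.Hz (Ss ! i) (Ss ! j)" if "i < length Ss" "j < length Ss" "i \<noteq> j" for i j
        using m1[OF that] that Hz[of "Ss ! i" "Ss ! j"] S by (simp add: subset_iff)
      show "\<not> zero_object ?D S" if "S \<in> set Ss" for S
        using m2[OF that] by (simp add: zero_object_def)
      show "d.Dt.Hz s (shift ?D n s')" if "s \<in> set Ss" "s' \<in> set Ss" "n < 0" for s s' n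
        using m4[OF that] Hz[OF subsetD[OF S that(1)] sh[OF subsetD[OF S that(2)]]] by blast
      show "triangulated_hull ?D (set Ss) = fd_objects K A" by (rule hull)
    qed (use div in blast)+
    interpret h: lincat K "heart s.S (U, V)"
      by unfold_locales (use UV(2) in \<open>simp add: length_category_def abelian_category_def\<close>)
    show ?thesis using UV h.finite_isoclasses_iff unfolding length_t_structures_def Dfd_def by blast
  qed
  have cls: "?E `` {Ss} = {Ts. simple_minded K A Ts \<and> ?cl Ts = ?cl Ss}" if "simple_minded K A Ss" for Ss
    using that by (auto simp: simple_minded_equiv_def)
  \<comment> \<open>All families of representatives for one t-structure have the heart as extension
    closure, so the class attached to it is recovered from the heart alone.\<close>
  have F: "?E `` {Ss. ?rep (U, V) Ss} = {Ts. simple_minded K A Ts \<and> ?cl Ts = U \<inter> V}"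
    if "(U, V) \<in> ?T" for U V
    using A[OF that] ex[OF that] by (auto simp: simple_minded_equiv_def)
  \<comment> \<open>The class contains a family, whose closure is the heart of either t-structure; a
    bounded t-structure is determined by its heart.\<close>
  have inj: "(U, V) = (U', V')" if t: "(U, V) \<in> ?T" "(U', V') \<in> ?T"
    and e: "?E `` {Ss. ?rep (U, V) Ss} = ?E `` {Ss. ?rep (U', V') Ss}" for U V U' V'
  proof -
    obtain Ss where "?rep (U, V) Ss" using ex[OF t(1)] by blast
    hence "simple_minded K A Ss" "?cl Ss = U \<inter> V" using A[OF t(1)] by blast+
    hence "U \<inter> V = U' \<inter> V'" using e unfolding F[OF t(1)] F[OF t(2)] by blast
    thus ?thesis by (intro s.heart_bounded_determines) (use t in \<open>simp_all add: length_t_structures_def Dfd_def\<close>)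
  qed
  have "bij_betw (\<lambda>t. ?E `` {Ss. ?rep t Ss}) (?T)
    ({Ss. simple_minded K A Ss} // ?E)"
    unfolding bij_betw_def
  proof (intro conjI inj_onI equalityI subsetI)
    show "t = t'" if "t \<in> ?T" "t' \<in> ?T"
      "?E `` {Ss. ?rep t Ss} = ?E `` {Ss. ?rep t' Ss}" for t t'
      using that inj by (cases t, cases t') blast
    fix c assume "c \<in> (\<lambda>t. ?E `` {Ss. ?rep t Ss}) ` ?T"
    then obtain U V where t: "(U, V) \<in> ?T" "c = ?E `` {Ss. ?rep (U, V) Ss}" by auto
    obtain Ss where "?rep (U, V) Ss" using ex[OF t(1)] by blast
    hence "simple_minded K A Ss" "?cl Ss = U \<inter> V" using A[OF t(1)] by blast+
    hence "c = ?E `` {Ss}" using t(2) F[OF t(1)] cls by simp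
    thus "c \<in> {Ss. simple_minded K A Ss} // ?E"
      using \<open>simple_minded K A Ss\<close> unfolding quotient_def by blast
  next
    fix c assume "c \<in> {Ss. simple_minded K A Ss} // ?E"
    then obtain Ss where Ss: "simple_minded K A Ss" "c = ?E `` {Ss}" unfolding quotient_def by blast
    obtain U V where t: "(U, V) \<in> ?T" "?rep (U, V) Ss" using B[OF Ss(1)] by blast
    have "c = ?E `` {Ss. ?rep (U, V) Ss}" using Ss cls F[OF t(1)] A(2)[OF t] by simp
    thus "c \<in> (\<lambda>t. ?E `` {Ss. ?rep t Ss}) ` ?T" using t(1) by blast
  qed
  moreover have "\<forall>t\<in>?T. \<forall>Ss. ?rep t Ss \<longrightarrow> simple_minded K A Ss" using A(1) by auto
  ultimately show ?thesis by blast
qed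

end
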